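(* Let $n\ge1$ and let $\lambda$ be a partition with at most $n$ parts. Then $$K_{\lambda,0}^{C_n}(t)=\sum_{T\in K_{C_n}^{0}(\lambda)}t^{\mathrm{ch}_{C_n}(L(T))},\qquad\text{where}\qquad \mathrm{ch}_{C_n}(L(T))=\sum_{i=1}^{2n-1}(2n-i)\left\lceil\frac{\varepsilon_i(L(T))}{2}\right\rceil.$$
   Context: Generalized exponent: for $\mathfrak{sp}_{2n}$ (type $C_n$) with positive roots $R_+$, Weyl group $W$, length $\ell$, half-sum $\rho$ of positive roots, let $\prod_{\alpha\in R_+}\frac1{1-te^\alpha}=\sum_\beta P_t(\beta)e^\beta$, and $K^{C_n}_{\lambda,0}(t)=\sum_{w\in W}(-1)^{\ell(w)}P_t(w(\lambda+\rho)-\rho)$, where $\lambda=\sum_i\lambda_i\varepsilon_i$ is viewed as a dominant weight. King tableaux: $K^0_{C_n}(\lambda)$ is the set of semistandard tableaux of shape $\lambda$ in the alphabet $\{1<\overline1<2<\overline2<\cdots<n<\overline n\}$ such that the entries in each row $i$ are greater than or equal to $i$, and of weight $0$ (for each $k$, the numbers of entries $k$ and $\overline k$ are equal). For a semistandard tableau $b$ with entries in $\{1,\dots,2n\}$ and $1\le i\le2n-1$: read $b$ by columns from right to left, each from top to bottom; keep only letters $i$ (written $+$) and $i+1$ (written $-$); recursively delete adjacent factors $+-$; the result is $-^p+^q$, and $\varepsilon_i(b)=p$, $\varphi_i(b)=q$. The map $L$: given $T\in K^0_{C_n}(\lambda)$, replace each entry $k$ by $2k-1$ and each $\overline k$ by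 $2k$; then $L(T)$ is the lowest weight element of the component of the resulting tableau for the $U_q(\mathfrak{sl}_2\oplus\cdots\oplus\mathfrak{sl}_2)$-crystal structure given by the crystal operators with odd indices $1,3,\dots,2n-1$. Concretely, for each $k=1,\dots,n$, all letters $2k-1$ whose symbols $+$ survive the deletion procedure for $i=2k-1$ are changed to $2k$. *)

theory Defs
  imports Complex_Main "HOL-Library.Poly_Mapping"
    "HOL-Computational_Algebra.Formal_Power_Series"
begin

section \<open>The root system of type C and generalized exponents\<close>

text \<open>
  A weight is an integral linear combination of \<open>\<epsilon>\<^sub>1, \<epsilon>\<^sub>2, \<dots>\<close>, and \<open>\<epsilon>\<^sub>i\<close> is \<open>coord i\<close>; in rank \<open>n\<close> only
  the indices \<open>1, \<dots>, n\<close> are moved by the Weyl group.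
\<close>

type_synonym weight = "nat \<Rightarrow>\<^sub>0 int"

definition coord :: "nat \<Rightarrow> weight" where
  "coord i = Poly_Mapping.single i 1"

definition pos_roots :: "nat \<Rightarrow> weight set" where
  "pos_roots n =
     {coord i - coord j | i j. 1 \<le> i \<and> i < j \<and> j \<le> n} \<union>
     {coord i + coord j | i j. 1 \<le> i \<and> i < j \<and> j \<le> n} \<union>
     {frag_cmul 2 (coord i) | i. 1 \<le> i \<and> i \<le> n}"

definition simple_roots :: "nat \<Rightarrow> weight set" where
  "simple_roots n =
     {coord i - coord (i + 1) | i. 1 \<le> i \<and> i < n} \<union> {frag_cmul 2 (coord n)}"

text \<open>The sum of the positive roots has even coordinates, so the division is exact.\<close>

definition rho :: "nat \<Rightarrow> weight" where
  "rho n = Poly_Mapping.map (\<lambda>x. x div 2) (\<Sum>\<alpha>\<in>pos_roots n. \<alpha>)"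

definition ip :: "weight \<Rightarrow> weight \<Rightarrow> int" where
  "ip v w = (\<Sum>i\<in>Poly_Mapping.keys v. Poly_Mapping.lookup v i * Poly_Mapping.lookup w i)"

text \<open>For a root \<open>\<alpha>\<close> of type C the quotient \<open>2(v,\<alpha>)/(\<alpha>,\<alpha>)\<close> is an integer for every weight \<open>v\<close>.\<close>

definition reflection :: "weight \<Rightarrow> weight \<Rightarrow> weight" where
  "reflection \<alpha> v = v - frag_cmul (2 * ip v \<alpha> div ip \<alpha> \<alpha>) \<alpha>"

inductive_set weyl_group :: "nat \<Rightarrow> (weight \<Rightarrow> weight) set" for n where
  weyl_id: "id \<in> weyl_group n"
| weyl_reflection:
    "\<alpha> \<in> pos_roots n \<Longrightarrow> w \<in> weyl_group n \<Longrightarrow> reflection \<alpha> \<circ> w \<in> weyl_group n"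

definition weyl_length :: "nat \<Rightarrow> (weight \<Rightarrow> weight) \<Rightarrow> nat" where
  "weyl_length n w =
     (LEAST k. \<exists>\<alpha>s. length \<alpha>s = k \<and> set \<alpha>s \<subseteq> simple_roots n \<and>
                  w = foldr (\<lambda>\<alpha> f. reflection \<alpha> \<circ> f) \<alpha>s id)"

text \<open>
  \<open>weight \<Rightarrow>\<^sub>0 int\<close> is the group ring of the weight lattice, with \<open>e\<^sup>\<alpha>\<close> being \<open>Poly_Mapping.single \<alpha> 1\<close>.
  The product of the \<open>1/(1 - t e\<^sup>\<alpha>)\<close> is a power series in \<open>t\<close> over this ring; the library's inverse
  of a power series over a commutative ring takes the inverse of the constant term, here \<open>1\<close>,
  as its second argument.
\<close>

definition kostant_series :: "nat \<Rightarrow> (weight \<Rightarrow>\<^sub>0 int) fps" where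
  "kostant_series n =
     (\<Prod>\<alpha>\<in>pos_roots n.
        fps_left_inverse (1 - fps_const (Poly_Mapping.single \<alpha> 1) * fps_X) 1)"

definition kostant_t :: "nat \<Rightarrow> weight \<Rightarrow> int fps" where
  "kostant_t n \<beta> = Abs_fps (\<lambda>k. Poly_Mapping.lookup (fps_nth (kostant_series n) k) \<beta>)"

definition is_partition :: "nat list \<Rightarrow> bool" where
  "is_partition lam \<longleftrightarrow> sorted_wrt (\<ge>) lam \<and> 0 \<notin> set lam"

definition partition_weight :: "nat list \<Rightarrow> weight" where
  "partition_weight lam = (\<Sum>i<length lam. frag_cmul (int (lam ! i)) (coord (i + 1)))"

text \<open>A polynomial in \<open>t\<close>, regarded as a power series.\<close>

definition generalized_exponent :: "nat \<Rightarrow> nat list \<Rightarrow> int fps" where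
  "generalized_exponent n lam =
     (\<Sum>w\<in>weyl_group n. (-1) ^ weyl_length n w *
        kostant_t n (w (partition_weight lam + rho n) - rho n))"

section \<open>King tableaux\<close>

text \<open>
  Tableaux are lists of rows (English convention); rows and columns of cells are counted from \<open>0\<close>.
\<close>

definition semistandard :: "nat list \<Rightarrow> 'a::linorder list list \<Rightarrow> bool" where
  "semistandard lam T \<longleftrightarrow>
     map length T = lam \<and>
     (\<forall>row\<in>set T. sorted row) \<and>
     (\<forall>r c. Suc r < length T \<and> c < length (T ! Suc r) \<longrightarrow> T ! r ! c < T ! Suc r ! c)"

text \<open>The alphabet \<open>1 < 1\<close>-bar \<open>< 2 < 2\<close>-bar \<open>< \<dots>\<close>\<close>

datatype letter = Plain (idx: nat) | is_Bar: Bar (idx: nat)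

instantiation letter :: linorder
begin

definition less_eq_letter :: "letter \<Rightarrow> letter \<Rightarrow> bool" where
  "a \<le> b \<longleftrightarrow> idx a < idx b \<or> idx a = idx b \<and> (is_Bar a \<longrightarrow> is_Bar b)"

definition less_letter :: "letter \<Rightarrow> letter \<Rightarrow> bool" where
  "a < b \<longleftrightarrow> idx a < idx b \<or> idx a = idx b \<and> \<not> is_Bar a \<and> is_Bar b"

instance
  by standard (auto simp: less_eq_letter_def less_letter_def intro: letter.expand)

end

definition king_tableaux0 :: "nat \<Rightarrow> nat list \<Rightarrow> letter list list set" where
  "king_tableaux0 n lam =
     {T. semistandard lam T \<and>
         (\<forall>row\<in>set T. \<forall>x\<in>set row. 1 \<le> idx x \<and> idx x \<le> n) \<and>
         (\<forall>r<length T. \<forall>x\<in>set (T ! r). Plain (r + 1) \<le> x) \<and>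
         (\<forall>k. count_list (concat T) (Plain k) = count_list (concat T) (Bar k))}"

fun code :: "letter \<Rightarrow> nat" where
  "code (Plain k) = 2 * k - 1"
| "code (Bar k) = 2 * k"

section \<open>Signatures, the map L and the charge\<close>

datatype sign = Plus | Minus

text \<open>
  The letters of a signature carry a label (later: the cell they come from), so that one can tell
  which of them survive. \<open>reduce\<close> computes the result of deleting adjacent factors \<open>+-\<close>, in any
  order, as long as there are any; this is what the four lemmas below say.
\<close>

fun reduce :: "('a \<times> sign) list \<Rightarrow> ('a \<times> sign) list" where
  "reduce [] = []"
| "reduce (x # w) =
     (case (snd x, reduce w) of
        (Plus, (_, Minus) # w') \<Rightarrow> w'
      | _ \<Rightarrow> x # reduce w)"

inductive deletion :: "('a \<times> sign) list \<Rightarrow> ('a \<times> sign) list \<Rightarrow> bool" where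
  "deletion (u @ (p, Plus) # (q, Minus) # v) (u @ v)"

lemma deletion_reduce: "deletion\<^sup>*\<^sup>* w (reduce w)"
proof (induction w)
  case Nil
  then show ?case by simp
next
  case (Cons x w)
  have lift: "deletion (x # a) (x # b)" if "deletion a b" for a b
    using that
  proof cases
    case (1 u p q v)
    then show ?thesis
      using deletion.intros[of "x # u" p q v] by simp
  qed
  have step: "deletion\<^sup>*\<^sup>* (x # w) (x # reduce w)"
    using Cons.IH by (induction rule: rtranclp_induct) (auto intro: rtranclp.rtrancl_into_rtrancl lift)
  show ?case
  proof (cases "\<exists>p q v. x = (p, Plus) \<and> reduce w = (q, Minus) # v")
    case True
    then obtain p q v where *: "x = (p, Plus)" "reduce w = (q, Minus) # v" by blast
    have "deletion (x # reduce w) v"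
      using deletion.intros[of "[]" p q v] * by simp
    with step have "deletion\<^sup>*\<^sup>* (x # w) v" by (rule rtranclp.rtrancl_into_rtrancl)
    with * show ?thesis by simp
  next
    case False
    then have "reduce (x # w) = x # reduce w"
      by (cases x) (auto split: sign.splits list.splits prod.splits)
    with step show ?thesis by simp
  qed
qed

lemma reduce_shape: "\<exists>p q. map snd (reduce w) = replicate p Minus @ replicate q Plus"
proof (induction w)
  case Nil
  then show ?case by simp
next
  case (Cons x w)
  then obtain p q where pq: "map snd (reduce w) = replicate p Minus @ replicate q Plus" by blast
  show ?case
  proof (cases "snd x")
    case Minus
    then have "map snd (reduce (x # w)) = replicate (Suc p) Minus @ replicate q Plus"
      using pq by simp
    then show ?thesis by blast
  next
    case Plus
    show ?thesis
    proof (cases p)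
      case 0
      then have "map snd (reduce (x # w)) = replicate 0 Minus @ replicate (Suc q) Plus"
        using pq Plus by (cases q) (auto split: list.splits sign.splits)
      then show ?thesis by blast
    next
      case (Suc p')
      then have "map snd (reduce (x # w)) = replicate p' Minus @ replicate q Plus"
        using pq Plus by (auto split: list.splits sign.splits)
      then show ?thesis by blast
    qed
  qed
qed

lemma reduce_deletion: "deletion w w' \<Longrightarrow> reduce w = reduce w'"
proof (induction rule: deletion.induct)
  case (1 u p q v)
  show ?case by (induction u) (auto split: sign.splits list.splits)
qed

lemma reduce_unique:
  assumes "deletion\<^sup>*\<^sup>* w w'" and "map snd w' = replicate p Minus @ replicate q Plus"
  shows "w' = reduce w"
proof -
  have "reduce w = reduce w'"
    using assms(1) by (induction rule: rtranclp_induct) (auto dest: reduce_deletion)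
  moreover have "reduce w' = w'"
    using assms(2)
  proof (induction w' arbitrary: p q)
    case Nil
    then show ?case by simp
  next
    case (Cons x v)
    show ?case
    proof (cases p)
      case (Suc p')
      with Cons show ?thesis by auto
    next
      case 0
      with Cons.prems obtain q' where q: "q = Suc q'" by (cases q) auto
      with Cons.prems 0 have v: "map snd v = replicate q' Plus" and x: "snd x = Plus" by auto
      then have "reduce v = v" using Cons.IH[of 0 q'] by simp
      with v x show ?thesis by (cases q') (auto split: list.splits sign.splits)
    qed
  qed
  ultimately show ?thesis by simp
qed

text \<open>Columns from right to left, each from top to bottom; the first row is the longest one.\<close>

definition reading_cells :: "'a list list \<Rightarrow> (nat \<times> nat) list" where
  "reading_cells b =
     [(r, c). c \<leftarrow> rev [0..<(if b = [] then 0 else length (hd b))],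
              r \<leftarrow> [0..<length b], c < length (b ! r)]"

definition signature :: "nat \<Rightarrow> nat list list \<Rightarrow> ((nat \<times> nat) \<times> sign) list" where
  "signature i b =
     [((r, c), if b ! r ! c = i then Plus else Minus).
        (r, c) \<leftarrow> reading_cells b, b ! r ! c = i \<or> b ! r ! c = i + 1]"

definition crystal_eps :: "nat \<Rightarrow> nat list list \<Rightarrow> nat" where
  "crystal_eps i b = length (filter (\<lambda>x. snd x = Minus) (reduce (signature i b)))"

definition surviving_plus :: "nat \<Rightarrow> nat list list \<Rightarrow> (nat \<times> nat) set" where
  "surviving_plus i b = {p. (p, Plus) \<in> set (reduce (signature i b))}"

text \<open>
  A cell in \<open>surviving_plus (2 * k - 1) b\<close> contains \<open>2 * k - 1\<close>, so adding \<open>1\<close> changes it to \<open>2 * k\<close>.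
  Different \<open>k\<close> involve disjoint sets of letters, so the changes can be made simultaneously.
\<close>

definition king_L :: "nat \<Rightarrow> letter list list \<Rightarrow> nat list list" where
  "king_L n T =
     (let b = map (map code) T in
      map (\<lambda>r. map (\<lambda>c. if \<exists>k\<in>{1..n}. (r, c) \<in> surviving_plus (2 * k - 1) b
                         then b ! r ! c + 1 else b ! r ! c)
                   [0..<length (b ! r)])
          [0..<length b])"

definition charge_C :: "nat \<Rightarrow> nat list list \<Rightarrow> nat" where
  "charge_C n b = (\<Sum>i = 1..2 * n - 1. (2 * n - i) * nat \<lceil>real (crystal_eps i b) / 2\<rceil>)"

end

theory Submission
  imports Defs "Jordan_Normal_Form.Determinant"
begin

text \<open>
  Let \<open>H\<close> be the product of the \<open>1/(1 - t x\<^sub>i x\<^sub>j)\<close> over \<open>i \<le> j < 2 n\<close>, the graded character of the symmetric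
  algebra of the symmetric square of the natural representation, which is the adjoint representation.
  Substituting \<open>e\<close> to the power \<open>\<plusminus> \<epsilon>\<^sub>k\<close> for the variables, the product that defines \<open>P\<^sub>t\<close> becomes \<open>H\<close> times a
  factor whose exponents, shifted by \<open>\<rho>\<close>, lie in the cube \<open>[- n, n]\<close>; a weight in this cube is either fixed
  by a reflection or conjugate to \<open>\<rho>\<close>. Since \<open>H\<close> is invariant, \<open>K\<^sub>\<lambda>\<close> is, up to a factor that does not
  depend on \<open>\<lambda>\<close>, the alternating sum over the Weyl group of the coefficients of \<open>H\<close> at \<open>w (\<lambda> + \<rho>) - \<rho>\<close>.

  This alternating sum is the pairing of \<open>H\<close> with the determinant of the \<open>g (l - r) - g (l + r)\<close>, where
  \<open>g k\<close> is the sum of the \<open>h\<^sub>a h\<^sub>b\<close> with \<open>b - a = k\<close>. For this pairing the determinant agrees with the product of a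
  flagged determinant of complete symmetric polynomials, whose expansion into monomials runs over the King
  tableaux of shape \<open>\<lambda>\<close> (as Gelfand-Tsetlin patterns), and a sum over the partitions \<open>\<mu>\<close> whose
  rows come in equal pairs. By Littlewood, \<open>H\<close> is the sum of the Schur functions of partitions with even
  rows. A Bender-Knuth involution therefore leaves the pairs of a tableau \<open>K\<close> and a partition \<open>\<mu>\<close> for which \<open>\<mu>\<close>
  dominates all signatures of \<open>K\<close> and \<open>\<mu> + wt K\<close> has even parts. The tableaux that occur are those with \<open>\<phi>\<^sub>i = 0\<close> and even
  \<open>\<epsilon>\<^sub>i\<close> for odd \<open>i\<close>; the least \<open>\<mu>\<close> for such a \<open>K\<close> produces the charge, with the rounded \<open>\<epsilon>\<^sub>i/2\<close>, and the remaining
  freedom in \<open>\<mu>\<close> is a factor that does not depend on \<open>\<lambda>\<close>. All these factors cancel because \<open>K\<^sub>\<lambda> = 1\<close> for empty \<open>\<lambda>\<close>.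

  Finally, \<open>L\<close> is a bijection of the King tableaux of weight \<open>0\<close> onto these tableaux: in terms of the walk that
  goes up at each uncancelled \<open>i\<close> and down at each uncancelled \<open>i + 1\<close>, it reverses the record steps.
\<close>

section \<open>The group ring of the weight lattice\<close>

text \<open>Two symmetries have to be reconciled: the Weyl group of type C, which defines the
  alternating sum, and the symmetric group on all 2 n variables, which drives the cancellation of
  tableaux. The pairing with \<open>H\<close> mediates. A product of complete symmetric polynomials
  pairs to a single monomial coefficient of \<open>H\<close>, whereas the pairing of a monomial
  changes only by a sign under the dot action; hence symmetric factors may be traded for factors in
  fewer variables. This flag is the origin of the King condition: column j of the determinant sees
  only the variables below 2 (n - j), and letter i is the variable 2 n - i, so row s (from 0)
  contains no letter up to 2 s. The ceiling comes from parity. Since the rows of \<mu> come in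
  pairs, \<mu> has no gap at odd i; at even i its gap must be at least phi_i = tot_i + eps_i, and
  congruent to tot_i modulo 2 because all parts are even. The least such gap is tot_i + 2 ceil
  (eps_i / 2). Summation by parts with the weights 2 n - i then shows that the least \<mu> satisfies
  |\<mu>| + |\<lambda>| = twice the charge.\<close>

type_synonym laurent = "weight \<Rightarrow>\<^sub>0 int"

abbreviation lookup where "lookup \<equiv> Poly_Mapping.lookup"
abbreviation keys where "keys \<equiv> Poly_Mapping.keys"
abbreviation single where "single \<equiv> Poly_Mapping.single"

lemma frag_of_mult: "frag_of a * frag_of b = frag_of (a + b :: weight)"
  by (simp add: mult_single)

lemma frag_of_0: "frag_of (0 :: weight) = 1"
  by simp

lemma lookup_frag_of_mult: "lookup (frag_of a * f) b = lookup f (b - a :: weight)"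
  using subset_UNIV
proof (induction f rule: frag_induction)
  case (one x)
  then show ?case by (simp add: frag_of_mult lookup_single when_def algebra_simps)
qed (simp_all add: right_diff_distrib lookup_minus)

text \<open>A functional on the group ring given by its values on the basis; multiplying the
  argument by a fixed element then becomes an operation on these values
  (\<open>pr_mult\<close>).\<close>

definition pr :: "(weight \<Rightarrow> int) \<Rightarrow> laurent \<Rightarrow> int" where
  "pr D f = (\<Sum>a\<in>keys f. lookup f a * D a)"

lemma pr_frag_extend: "pr D f = lookup (frag_extend (\<lambda>a. frag_cmul (D a) (frag_of ())) f) ()"
  by (simp add: pr_def frag_extend_def lookup_sum)

lemma pr_0 [simp]: "pr D 0 = 0"
  by (simp add: pr_def)

lemma pr_frag_of [simp]: "pr D (frag_of a) = D a"
  by (simp add: pr_frag_extend)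

lemma pr_1 [simp]: "pr D 1 = D 0"
  using pr_frag_of[of D 0] by simp

lemma pr_add: "pr D (f + g) = pr D f + pr D g"
  by (simp add: pr_frag_extend frag_extend_add lookup_add)

lemma pr_diff: "pr D (f - g) = pr D f - pr D g"
  by (simp add: pr_frag_extend frag_extend_diff lookup_minus)

lemma pr_uminus: "pr D (- f) = - pr D f"
  using pr_diff[of D 0 f] by simp

lemma pr_sum: "pr D (\<Sum>i\<in>I. f i) = (\<Sum>i\<in>I. pr D (f i))"
  by (induction I rule: infinite_finite_induct) (simp_all add: pr_add)

lemma pr_fun_diff: "pr (\<lambda>a. D a - E a) f = pr D f - pr E f"
  by (simp add: pr_def right_diff_distrib sum_subtractf)

lemma pr_fun_uminus: "pr (\<lambda>a. - D a) f = - pr D f"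
  by (simp add: pr_def sum_negf)

lemma pr_fun_sum: "pr (\<lambda>a. \<Sum>i\<in>I. D i a) f = (\<Sum>i\<in>I. pr (D i) f)"
  unfolding pr_def sum_distrib_left by (rule sum.swap)

lemma pr_fun_cmul: "pr (\<lambda>a. c * D a) f = c * pr D f"
  by (simp add: pr_def sum_distrib_left ac_simps)

lemma pr_cong: "(\<And>a. a \<in> keys f \<Longrightarrow> D a = E a) \<Longrightarrow> pr D f = pr E f"
  by (simp add: pr_def)

lemma pr_delta: "pr (\<lambda>a. if a = b then 1 else 0) f = lookup f b"
proof -
  have "pr (\<lambda>a. if a = b then 1 else 0) f = (\<Sum>a\<in>keys f. if a = b then lookup f a else 0)"
    unfolding pr_def by (rule sum.cong) auto
  then show ?thesis by (simp add: in_keys_iff)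
qed

lemma pr_mult: "pr D (f * g) = pr (\<lambda>a. pr (\<lambda>b. D (a + b)) g) f"
  using subset_UNIV
proof (induction f rule: frag_induction)
  case (one a)
  have "pr D (frag_of a * g) = pr (\<lambda>b. D (a + b)) g"
    using subset_UNIV
    by (induction g rule: frag_induction) (simp_all add: frag_of_mult pr_diff right_diff_distrib)
  then show ?case by simp
qed (simp_all add: pr_diff left_diff_distrib)

lemma pr_frag_of_mult: "pr D (frag_of a * g) = pr (\<lambda>b. D (a + b)) g"
  by (simp add: pr_mult)

section \<open>Push-forward along maps of the weight lattice\<close>

definition pmh :: "(weight \<Rightarrow> weight) \<Rightarrow> laurent \<Rightarrow> laurent" where
  "pmh h f = frag_extend (\<lambda>a. frag_of (h a)) f"

lemma pmh_0 [simp]: "pmh h 0 = 0"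
  by (simp add: pmh_def)

lemma pmh_frag_of [simp]: "pmh h (frag_of a) = frag_of (h a)"
  by (simp add: pmh_def)

lemma pmh_add: "pmh h (f + g) = pmh h f + pmh h g"
  by (simp add: pmh_def frag_extend_add)

lemma pmh_diff: "pmh h (f - g) = pmh h f - pmh h g"
  by (simp add: pmh_def frag_extend_diff)

lemma pmh_uminus: "pmh h (- f) = - pmh h f"
  by (simp add: pmh_def frag_extend_minus)

lemma pmh_sum: "pmh h (\<Sum>i\<in>I. f i) = (\<Sum>i\<in>I. pmh h (f i))"
  by (induction I rule: infinite_finite_induct) (simp_all add: pmh_add)

lemma pr_pmh: "pr D (pmh h f) = pr (D \<circ> h) f"
  using subset_UNIV by (induction f rule: frag_induction) (simp_all add: pr_diff pmh_diff)

lemma lookup_pmh: "lookup (pmh h f) b = pr (\<lambda>a. if h a = b then 1 else 0) f"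
  using pr_pmh[of "\<lambda>a. if a = b then 1 else 0" h f] by (simp add: pr_delta o_def)

lemma pmh_inj_lookup:
  assumes "inj h"
  shows "lookup (pmh h f) (h a) = lookup f a"
  using assms by (simp add: lookup_pmh inj_eq pr_delta)

locale lattice_hom =
  fixes h :: "weight \<Rightarrow> weight"
  assumes add: "h (a + b) = h a + h b"
begin

lemma zero [simp]: "h 0 = 0"
  using add[of 0 0] by simp

lemma uminus: "h (- a) = - h a"
  using add[of "- a" a] by (metis add.left_inverse add_eq_0_iff2 zero)

lemma diff: "h (a - b) = h a - h b"
  using add[of a "- b"] by (simp add: uminus)

lemma pmh_1 [simp]: "pmh h 1 = 1"
  using pmh_frag_of[of h 0] by simp

lemma pmh_mult: "pmh h (f * g) = pmh h f * pmh h g"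
  using subset_UNIV
proof (induction f rule: frag_induction)
  case (one a)
  show ?case
    using subset_UNIV
    by (induction g rule: frag_induction) (simp_all add: frag_of_mult add pmh_diff right_diff_distrib)
qed (simp_all add: pmh_diff left_diff_distrib)

lemma pmh_prod: "pmh h (\<Prod>i\<in>I. f i) = (\<Prod>i\<in>I. pmh h (f i))"
  by (induction I rule: infinite_finite_induct) (simp_all add: pmh_mult)

lemma pmh_power: "pmh h (f ^ k) = pmh h f ^ k"
  by (induction k) (simp_all add: pmh_mult)

end

section \<open>Power series in t over the group ring\<close>

definition fmap_coeffs :: "('a \<Rightarrow> 'b) \<Rightarrow> 'a::zero fps \<Rightarrow> 'b::zero fps" where
  "fmap_coeffs h F = Abs_fps (\<lambda>n. h (fps_nth F n))"

lemma fmap_coeffs_nth [simp]: "fps_nth (fmap_coeffs h F) n = h (fps_nth F n)"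
  by (simp add: fmap_coeffs_def)

context lattice_hom
begin

lemma fmap_mult: "fmap_coeffs (pmh h) (F * G) = fmap_coeffs (pmh h) F * fmap_coeffs (pmh h) G"
  by (rule fps_ext) (simp add: fps_mult_nth pmh_sum pmh_mult)

lemma fmap_1: "fmap_coeffs (pmh h) 1 = 1"
  by (rule fps_ext) simp

lemma fmap_prod: "fmap_coeffs (pmh h) (\<Prod>i\<in>I. F i) = (\<Prod>i\<in>I. fmap_coeffs (pmh h) (F i))"
  by (induction I rule: infinite_finite_induct) (simp_all add: fmap_mult fmap_1)

end

definition geo :: "'a::comm_ring_1 \<Rightarrow> 'a fps" where
  "geo a = Abs_fps (\<lambda>k. a ^ k)"

lemma geo_nth [simp]: "fps_nth (geo a) k = a ^ k"
  by (simp add: geo_def)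

lemma geo_mult: "geo a * (1 - fps_const a * fps_X) = 1"
proof (rule fps_ext)
  fix n
  show "fps_nth (geo a * (1 - fps_const a * fps_X)) n = fps_nth 1 n"
    by (cases n) (simp_all add: right_diff_distrib mult.left_commute[of "geo a"] flip: mult.assoc)
qed

text \<open>A left inverse is unique in a commutative ring, so the inverse that defines
  \<open>kostant_series\<close> is the geometric series.\<close>

lemma geo_left_inverse: "fps_left_inverse (1 - fps_const a * fps_X) 1 = geo (a :: 'a :: comm_ring_1)"
proof -
  let ?f = "1 - fps_const a * fps_X"
  have "fps_left_inverse ?f 1 * ?f = 1"
    by (rule fps_left_inverse) simp
  then have "fps_left_inverse ?f 1 * (?f * geo a) = geo a"
    by (metis mult.assoc mult_1)
  then show ?thesis
    by (metis geo_mult mult.commute mult_1_right)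
qed

lemma (in lattice_hom) fmap_geo: "fmap_coeffs (pmh h) (geo a) = geo (pmh h a)"
  by (rule fps_ext) (simp add: pmh_power)

section \<open>Alternating functionals and symmetric elements\<close>

definition xv :: "nat \<Rightarrow> laurent" where
  "xv i = frag_of (coord i)"

definition pw :: "(nat \<Rightarrow> nat) \<Rightarrow> weight \<Rightarrow> weight" where
  "pw p a = Poly_Mapping.map_key p a"

lemma lookup_coord: "lookup (coord i) j = (if i = j then 1 else 0)"
  by (simp add: coord_def lookup_single when_def)

lemma lookup_pw: "inj p \<Longrightarrow> lookup (pw p a) i = lookup a (p i)"
  by (simp add: pw_def map_key.rep_eq)

lemma lattice_hom_pw: "inj p \<Longrightarrow> lattice_hom (pw p)"
  by unfold_locales (simp add: pw_def map_key_plus)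

lemma pw_coord: "bij p \<Longrightarrow> pw p (coord i) = coord (Hilbert_Choice.inv p i)"
  by (rule poly_mapping_eqI) (auto simp: lookup_pw lookup_coord bij_is_inj bij_is_surj surj_f_inv_f inv_f_f)

lemma pmh_pw_xv: "bij p \<Longrightarrow> pmh (pw p) (xv i) = xv (Hilbert_Choice.inv p i)"
  by (simp add: xv_def pw_coord)

abbreviation swp :: "nat \<Rightarrow> nat \<Rightarrow> nat" where
  "swp i \<equiv> transpose i (Suc i)"

lemma lookup_pw_swp [simp]: "lookup (pw (swp i) a) j = lookup a (swp i j)"
  by (simp add: lookup_pw)

lemma lattice_hom_swp: "lattice_hom (pw (swp i))"
  by (simp add: lattice_hom_pw)

lemma pw_swp_swp [simp]: "pw (swp i) (pw (swp i) a) = a"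
  by (rule poly_mapping_eqI) simp

text \<open>
  The dot action of the adjacent transpositions, \<open>w (a + \<rho>) - \<rho>\<close> with \<open>\<rho> = (\<dots>, 2, 1, 0)\<close>.
\<close>

definition sdot :: "nat \<Rightarrow> weight \<Rightarrow> weight" where
  "sdot i a = pw (swp i) a - coord i + coord (Suc i)"

lemma lookup_sdot: "lookup (sdot i a) j =
    (if j = i then lookup a (Suc i) - 1 else if j = Suc i then lookup a i + 1 else lookup a j)"
  by (simp add: sdot_def lookup_add lookup_minus lookup_coord transpose_def)

lemma sdot_add: "sdot i (a + b) = sdot i a + pw (swp i) b"
  by (simp add: sdot_def lattice_hom.add[OF lattice_hom_swp])

definition alternating :: "nat \<Rightarrow> (weight \<Rightarrow> int) \<Rightarrow> bool" where
  "alternating m D \<longleftrightarrow> (\<forall>i a. Suc i < m \<longrightarrow> D (sdot i a) = - D a)"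

lemma alternatingD: "alternating m D \<Longrightarrow> Suc i < m \<Longrightarrow> D (sdot i a) = - D a"
  by (simp add: alternating_def)

lemma alternating_mono: "alternating m D \<Longrightarrow> m' \<le> m \<Longrightarrow> alternating m' D"
  by (auto simp: alternating_def)

text \<open>The equation between neighbouring exponents says that \<open>a\<close> is fixed by
  \<open>sdot i\<close>, so \<open>D a\<close> is its own negative.\<close>

lemma alternating_fixed:
  assumes "alternating m D" "Suc i < m" "lookup a (Suc i) = lookup a i + 1"
  shows "D a = 0"
proof -
  have "sdot i a = a"
    by (rule poly_mapping_eqI) (simp add: lookup_sdot assms(3))
  with alternatingD[OF assms(1,2), of a] show ?thesis by simp
qed

definition symm :: "nat \<Rightarrow> laurent \<Rightarrow> bool" where
  "symm m f \<longleftrightarrow> (\<forall>i. Suc i < m \<longrightarrow> pmh (pw (swp i)) f = f)"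

lemma symm_0 [simp]: "symm m 0"
  by (simp add: symm_def)

lemma symm_1 [simp]: "symm m 1"
  by (simp add: symm_def lattice_hom.pmh_1[OF lattice_hom_swp])

lemma symm_add: "symm m f \<Longrightarrow> symm m g \<Longrightarrow> symm m (f + g)"
  by (simp add: symm_def pmh_add)

lemma symm_uminus: "symm m f \<Longrightarrow> symm m (- f)"
  by (simp add: symm_def pmh_uminus)

lemma symm_diff: "symm m f \<Longrightarrow> symm m g \<Longrightarrow> symm m (f - g)"
  by (simp add: symm_def pmh_diff)

lemma symm_mult: "symm m f \<Longrightarrow> symm m g \<Longrightarrow> symm m (f * g)"
  by (simp add: symm_def lattice_hom.pmh_mult[OF lattice_hom_swp])

lemma symm_power: "symm m f \<Longrightarrow> symm m (f ^ k)"
  by (induction k) (simp_all add: symm_mult)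

text \<open>In \<open>sdot i (a + b)\<close> the dot action affects only \<open>a\<close>, while
  \<open>b\<close> is permuted in the ordinary way (\<open>sdot_add\<close>); the invariance of
  \<open>s\<close> absorbs that permutation. This makes \<open>peqv\<close> compatible with
  multiplication by symmetric elements.\<close>

lemma alternating_mult:
  assumes "alternating m D" "symm m s"
  shows "alternating m (\<lambda>a. pr (\<lambda>b. D (a + b)) s)"
  unfolding alternating_def
proof (intro allI impI)
  fix i a assume i: "Suc i < m"
  have "pr (\<lambda>b. D (sdot i a + b)) s = pr (\<lambda>b. D (sdot i a + b)) (pmh (pw (swp i)) s)"
    using assms(2) i by (simp add: symm_def)
  also have "\<dots> = pr (\<lambda>b. - D (a + b)) s"
    using assms(1) i by (simp add: pr_pmh o_def alternatingD flip: sdot_add)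
  finally show "pr (\<lambda>b. D (sdot i a + b)) s = - pr (\<lambda>b. D (a + b)) s"
    by (simp add: pr_fun_uminus)
qed

text \<open>
  The relation \<open>peqv m f g\<close> says that \<open>f\<close> and \<open>g\<close> have the same image under the Demazure operator of the
  longest permutation of the variables \<open>0, \<dots>, m - 1\<close>. Testing with alternating functionals
  avoids the operator and the sum over permutations that defines it.
\<close>

definition peqv :: "nat \<Rightarrow> laurent \<Rightarrow> laurent \<Rightarrow> bool" where
  "peqv m f g \<longleftrightarrow> (\<forall>D. alternating m D \<longrightarrow> pr D f = pr D g)"

lemma peqvD: "peqv m f g \<Longrightarrow> alternating m D \<Longrightarrow> pr D f = pr D g"
  by (simp add: peqv_def)

lemma peqv_refl [simp]: "peqv m f f"
  by (simp add: peqv_def)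

lemma peqv_sym: "peqv m f g \<Longrightarrow> peqv m g f"
  by (simp add: peqv_def)

lemma peqv_trans [trans]: "peqv m f g \<Longrightarrow> peqv m g k \<Longrightarrow> peqv m f k"
  by (simp add: peqv_def)

lemma peqv_sum: "(\<And>i. i \<in> I \<Longrightarrow> peqv m (f i) (g i)) \<Longrightarrow> peqv m (\<Sum>i\<in>I. f i) (\<Sum>i\<in>I. g i)"
  by (simp add: peqv_def pr_sum)

lemma peqv_mono: "peqv m f g \<Longrightarrow> m \<le> m' \<Longrightarrow> peqv m' f g"
  using alternating_mono by (auto simp: peqv_def)

lemma peqv_mult:
  assumes "symm m s" "peqv m f g"
  shows "peqv m (s * f) (s * g)"
  unfolding peqv_def
proof (intro allI impI)
  fix D assume "alternating m D"
  then show "pr D (s * f) = pr D (s * g)"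
    using peqvD[OF assms(2) alternating_mult[OF _ assms(1)]]
    by (metis (no_types, lifting) mult.commute pr_mult)
qed

section \<open>Powers of the last variable under alternating functionals\<close>

lemma xv_power: "xv i ^ k = frag_of (single i (int k))"
proof (induction k)
  case (Suc k)
  have "single i (1 + int k) = single i 1 + single i (int k)"
    by (rule single_add)
  with Suc show ?case
    by (simp add: xv_def coord_def frag_of_mult)
qed simp

text \<open>One dot reflection turns the exponents (0, k) of two neighbours into (k - 1, 1): the
  power moves to the variable before it, loses one, and leaves a 1 behind.\<close>

lemma alternating_power:
  assumes D: "alternating m D" and "j < m"
  shows "t \<le> j \<Longrightarrow> D (single j k) =
           (-1) ^ t * D (single (j - t) (k - int t) + (\<Sum>i\<in>{j - t<..j}. coord i))"
proof (induction t)
  case (Suc t)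
  let ?a = "single (j - t) (k - int t) + (\<Sum>i\<in>{j - t<..j}. coord i)"
  have l: "lookup (\<Sum>i\<in>{u<..j}. coord i) v = (if u < v \<and> v \<le> j then 1 else 0)" for u v
    by (simp add: lookup_sum lookup_coord)
  have "sdot (j - Suc t) ?a =
      single (j - Suc t) (k - int (Suc t)) + (\<Sum>i\<in>{j - Suc t<..j}. coord i)"
    using Suc.prems by (intro poly_mapping_eqI) (auto simp: lookup_sdot lookup_add l lookup_single when_def)
  moreover have "Suc (j - Suc t) < m" using assms(2) Suc.prems by simp
  ultimately have "D (single (j - Suc t) (k - int (Suc t)) + (\<Sum>i\<in>{j - Suc t<..j}. coord i)) = - D ?a"
    using alternatingD[OF D] by metis
  with Suc show ?case by simp
qed simp

text \<open>After \<open>k - 1\<close> moves the power has exponent 1 and its left neighbour has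
  exponent 0, a fixed point of the dot action. The bound \<open>k \<le> m\<close> guarantees that
  this neighbour exists.\<close>

lemma peqv_power_0:
  assumes "0 < k" "k \<le> m"
  shows "peqv (Suc m) (xv m ^ k) 0"
  unfolding peqv_def
proof (intro allI impI)
  fix D assume D: "alternating (Suc m) D"
  define a where "a = single (m - (k - 1)) (int k - int (k - 1)) + (\<Sum>i\<in>{m - (k - 1)<..m}. coord i)"
  have "D a = 0"
  proof (rule alternating_fixed[OF D, of "m - k"])
    show "Suc (m - k) < Suc m" using assms by simp
    show "lookup a (Suc (m - k)) = lookup a (m - k) + 1"
      using assms by (auto simp: a_def lookup_add lookup_sum lookup_coord lookup_single when_def)
  qed
  moreover have "k - 1 \<le> m" using assms by simp
  ultimately show "pr D (xv m ^ k) = pr D 0"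
    using alternating_power[OF D lessI, of "k - 1" "int k"] by (simp add: xv_power a_def)
qed

text \<open>The \<open>m\<close> moves run through all variables and leave the exponent 1
  everywhere; this is the first positive power for which no fixed point is met.\<close>

lemma peqv_power_top: "peqv (Suc m) (xv m ^ Suc m) ((-1) ^ m * (\<Prod>i<Suc m. xv i))"
  unfolding peqv_def
proof (intro allI impI)
  fix D assume D: "alternating (Suc m) D"
  have *: "(\<Prod>i<n. xv i) = frag_of (\<Sum>i<n. coord i)" for n
    by (induction n) (simp_all add: xv_def frag_of_mult add.commute)
  have "single 0 1 + (\<Sum>i\<in>{0<..m}. coord i) = (\<Sum>i<Suc m. coord i)"
    by (rule poly_mapping_eqI) (auto simp: lookup_add lookup_sum lookup_coord lookup_single lookup_one when_def)
  then have "D (single m (int (Suc m))) = (-1) ^ m * D (\<Sum>i<Suc m. coord i)"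
    using alternating_power[OF D lessI, of m "int (Suc m)"] by simp
  moreover have "pr D ((-1) ^ m * f) = (-1) ^ m * pr D f" for f
    by (cases "even m") (simp_all add: pr_uminus)
  ultimately show "pr D (xv m ^ Suc m) = pr D ((-1) ^ m * (\<Prod>i<Suc m. xv i))"
    by (simp only: xv_power * pr_frag_of)
qed

section \<open>Complete and elementary symmetric polynomials\<close>

definition hS :: "nat set \<Rightarrow> nat \<Rightarrow> laurent" where
  "hS S k = fps_nth (\<Prod>i\<in>S. geo (xv i)) k"

definition hZ :: "nat set \<Rightarrow> int \<Rightarrow> laurent" where
  "hZ S k = (if k < 0 then 0 else hS S (nat k))"

text \<open>The elementary symmetric polynomial, with the sign \<open>(-1) ^ k\<close>.\<close>

definition eS :: "nat set \<Rightarrow> nat \<Rightarrow> laurent" where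
  "eS S k = fps_nth (\<Prod>i\<in>S. 1 - fps_const (xv i) * fps_X) k"

lemma hS_0 [simp]: "hS S 0 = 1"
  by (induction S rule: infinite_finite_induct) (simp_all add: hS_def fps_mult_nth)

lemma eS_0 [simp]: "eS S 0 = 1"
  by (induction S rule: infinite_finite_induct) (simp_all add: eS_def fps_mult_nth)

lemma hS_empty: "hS {} k = (if k = 0 then 1 else 0)"
  by (simp add: hS_def)

lemma hZ_empty: "hZ {} k = (if k = 0 then 1 else 0)"
  by (simp add: hZ_def hS_empty)

lemma hZ_neg [simp]: "k < 0 \<Longrightarrow> hZ S k = 0"
  by (simp add: hZ_def)

lemma hZ_0 [simp]: "hZ S 0 = 1"
  by (simp add: hZ_def)

lemma hZ_of_nat [simp]: "hZ S (int k) = hS S k"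
  by (simp add: hZ_def)

lemma hS_insert_expand:
  assumes "finite S" "i \<notin> S"
  shows "hS (insert i S) k = (\<Sum>b\<le>k. xv i ^ b * hS S (k - b))"
  using assms by (simp add: hS_def fps_mult_nth atMost_atLeast0)

lemma hZ_insert_expand:
  assumes "finite S" "i \<notin> S" "k \<le> int B"
  shows "hZ (insert i S) k = (\<Sum>b\<le>B. xv i ^ b * hZ S (k - int b))"
proof (cases "k < 0")
  case False
  then obtain j where k: "k = int j" by (metis linorder_not_less zero_le_imp_eq_int)
  have "(\<Sum>b\<le>B. xv i ^ b * hZ S (k - int b)) = (\<Sum>b\<le>j. xv i ^ b * hZ S (k - int b))"
    using k assms by (intro sum.mono_neutral_right) auto
  also have "\<dots> = (\<Sum>b\<le>j. xv i ^ b * hS S (j - b))"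
    using k by (intro sum.cong) (auto simp flip: of_nat_diff)
  finally show ?thesis
    by (simp add: k hS_insert_expand[OF assms(1,2)])
qed simp

lemma hZ_remove:
  assumes "finite S" "i \<notin> S"
  shows "hZ S k = hZ (insert i S) k - xv i * hZ (insert i S) (k - 1)"
proof (cases "k \<le> 0")
  case True
  then show ?thesis by (cases "k = 0") auto
next
  case False
  then obtain j where j: "k = int (Suc j)"
    by (metis Suc_pred' of_nat_0_less_iff linorder_not_less zero_less_imp_eq_int)
  let ?P = "\<Prod>i\<in>insert i S. geo (xv i)"
  have "(\<Prod>i\<in>S. geo (xv i)) = ?P * (1 - fps_const (xv i) * fps_X)"
    using assms geo_mult[of "xv i"] by (simp add: mult.commute mult.left_commute)
  also have "\<dots> = ?P - fps_const (xv i) * (?P * fps_X)"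
    by (simp only: right_diff_distrib mult_1_right mult.left_commute)
  finally have "hS S (Suc j) = hS (insert i S) (Suc j) - xv i * hS (insert i S) j"
    unfolding hS_def by (simp del: prod.insert)
  then show ?thesis using hZ_of_nat[of S "Suc j"] hZ_of_nat[of "insert i S" "Suc j"] by (simp add: j)
qed

lemma eS_insert:
  assumes "finite S" "i \<notin> S"
  shows "eS (insert i S) k = eS S k - (if k = 0 then 0 else xv i * eS S (k - 1))"
  using assms
  by (cases k) (simp_all add: eS_def left_diff_distrib mult.assoc fps_mult_nth_0)

lemma eS_eq_0: "finite S \<Longrightarrow> card S < k \<Longrightarrow> eS S k = 0"
proof (induction S arbitrary: k rule: finite_induct)
  case empty
  then show ?case by (simp add: eS_def)
next
  case (insert i S)
  then show ?case by (simp add: eS_insert)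
qed

lemma eS_top: "finite S \<Longrightarrow> eS S (card S) = (-1) ^ card S * (\<Prod>i\<in>S. xv i)"
  by (induction S rule: finite_induct) (simp_all add: eS_insert eS_eq_0 mult.left_commute)

lemma eS_hS: "finite S \<Longrightarrow> (\<Sum>l\<le>k. eS S l * hS S (k - l)) = (if k = 0 then 1 else 0)"
proof -
  assume "finite S"
  have "(\<Prod>i\<in>S. geo (xv i)) * (\<Prod>i\<in>S. 1 - fps_const (xv i) * fps_X) = 1"
    by (simp add: geo_mult flip: prod.distrib)
  then have "fps_nth ((\<Prod>i\<in>S. 1 - fps_const (xv i) * fps_X) * (\<Prod>i\<in>S. geo (xv i))) k = fps_nth 1 k"
    by (simp add: mult.commute)
  then show ?thesis
    by (simp add: fps_mult_nth eS_def hS_def atMost_atLeast0)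
qed

lemma eS_hZ:
  assumes "finite S" "card S \<le> L"
  shows "(\<Sum>l\<le>L. eS S l * hZ S (k - int l)) = (if k = 0 then 1 else 0)"
proof (cases "k < 0")
  case False
  then obtain j where k: "k = int j" by (metis linorder_not_less zero_le_imp_eq_int)
  have "(\<Sum>l\<le>L. eS S l * hZ S (k - int l)) = (\<Sum>l\<le>max L j. eS S l * hZ S (k - int l))"
    using assms by (intro sum.mono_neutral_left) (auto simp: eS_eq_0)
  also have "\<dots> = (\<Sum>l\<le>j. eS S l * hZ S (k - int l))"
    using k by (intro sum.mono_neutral_right) auto
  also have "\<dots> = (\<Sum>l\<le>j. eS S l * hS S (j - l))"
    using k by (intro sum.cong) (auto simp flip: of_nat_diff)
  finally show ?thesis
    by (simp add: k eS_hS[OF assms(1)])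
qed auto

lemma fmap_perm_prod:
  assumes "bij p" "p ` S = S" and F: "\<And>a. fmap_coeffs (pmh (pw p)) (F a) = F (pmh (pw p) a)"
  shows "fmap_coeffs (pmh (pw p)) (\<Prod>i\<in>S. F (xv i)) = (\<Prod>i\<in>S. F (xv i))"
proof -
  interpret lattice_hom "pw p"
    using assms(1) by (intro lattice_hom_pw) (rule bij_is_inj)
  have inj: "inj_on (Hilbert_Choice.inv p) S"
    using assms(1) by (meson bij_imp_bij_inv bij_is_inj inj_on_subset subset_UNIV)
  have im: "Hilbert_Choice.inv p ` S = S"
    using assms(1,2) by (metis bij_is_inj image_inv_f_f)
  have "fmap_coeffs (pmh (pw p)) (\<Prod>i\<in>S. F (xv i)) = (\<Prod>i\<in>S. F (xv (Hilbert_Choice.inv p i)))"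
    by (simp add: fmap_prod F pmh_pw_xv assms(1))
  also have "\<dots> = (\<Prod>i\<in>S. F (xv i))"
    using prod.reindex[OF inj, of "\<lambda>i. F (xv i)"] im by simp
  finally show ?thesis .
qed

lemma swp_image: "Suc i < m \<Longrightarrow> swp i ` {..<m} = {..<m}"
  by (rule permutes_image) (rule permutes_swap_id, auto)

lemma symm_hS: "symm m (hS {..<m} k)"
  unfolding symm_def
proof (intro allI impI)
  fix i assume i: "Suc i < m"
  have "fmap_coeffs (pmh (pw (swp i))) (\<Prod>i<m. geo (xv i)) = (\<Prod>i<m. geo (xv i))"
    by (rule fmap_perm_prod[where F = geo, OF bij_transpose swp_image[OF i] lattice_hom.fmap_geo[OF lattice_hom_swp]])
  then show "pmh (pw (swp i)) (hS {..<m} k) = hS {..<m} k"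
    unfolding hS_def by (rule fmap_coeffs_nth[symmetric, THEN trans, OF arg_cong[where f = "\<lambda>F. fps_nth F k"]])
qed

lemma symm_eS: "symm m (eS {..<m} k)"
  unfolding symm_def
proof (intro allI impI)
  fix i assume i: "Suc i < m"
  interpret lattice_hom "pw (swp i)" by (rule lattice_hom_swp)
  define F where "F a = 1 - fps_const a * fps_X" for a :: laurent
  have F: "fmap_coeffs (pmh (pw (swp i))) (F a) = F (pmh (pw (swp i)) a)" for a
  proof (rule fps_ext)
    fix n
    show "fps_nth (fmap_coeffs (pmh (pw (swp i))) (F a)) n = fps_nth (F (pmh (pw (swp i)) a)) n"
      by (cases "n = 0"; cases "n = 1") (simp_all add: F_def pmh_uminus)
  qed
  have "fmap_coeffs (pmh (pw (swp i))) (\<Prod>i<m. F (xv i)) = (\<Prod>i<m. F (xv i))"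
    by (rule fmap_perm_prod[where F = F, OF bij_transpose swp_image[OF i] F])
  from arg_cong[where f = "\<lambda>F. fps_nth F k", OF this]
  show "pmh (pw (swp i)) (eS {..<m} k) = eS {..<m} k"
    unfolding eS_def F_def by (simp only: fmap_coeffs_nth)
qed

lemma symm_hZ: "symm m (hZ {..<m} k)"
  by (simp add: hZ_def symm_hS)

text \<open>
  \<open>hgen r F\<close> holds for the linear combinations \<open>F\<close> of products of \<open>r\<close> complete symmetric polynomials,
  as functions of the set of variables.
\<close>

definition hgen :: "nat \<Rightarrow> (nat set \<Rightarrow> laurent) \<Rightarrow> bool" where
  "hgen r F \<longleftrightarrow> (\<forall>m. \<exists>s. s 0 = F {..<Suc m} \<and> (\<forall>k. symm (Suc m) (s k)) \<and>
      F {..<m} = (\<Sum>k\<le>r. xv m ^ k * s k))"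

lemma hgenE:
  assumes "hgen r F"
  obtains s where "s 0 = F {..<Suc m}" "\<And>k. symm (Suc m) (s k)" "F {..<m} = (\<Sum>k\<le>r. xv m ^ k * s k)"
  using assms unfolding hgen_def by blast

lemma hgen_0 [simp]: "hgen r (\<lambda>S. 0)"
  unfolding hgen_def by (auto intro!: exI[of _ "\<lambda>k. 0"])

lemma hgen_1 [simp]: "hgen 0 (\<lambda>S. 1)"
  unfolding hgen_def by (auto intro!: exI[of _ "\<lambda>k. 1"])

lemma hgen_add:
  assumes "hgen r F" "hgen r G"
  shows "hgen r (\<lambda>S. F S + G S)"
  unfolding hgen_def
proof
  fix m
  obtain s where
    "s 0 = F {..<Suc m}" "\<And>k. symm (Suc m) (s k)" "F {..<m} = (\<Sum>k\<le>r. xv m ^ k * s k)"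
    using assms(1) by (rule hgenE[where m = m]) blast
  moreover obtain t where
    "t 0 = G {..<Suc m}" "\<And>k. symm (Suc m) (t k)" "G {..<m} = (\<Sum>k\<le>r. xv m ^ k * t k)"
    using assms(2) by (rule hgenE[where m = m]) blast
  ultimately show "\<exists>s. s 0 = F {..<Suc m} + G {..<Suc m} \<and> (\<forall>k. symm (Suc m) (s k)) \<and>
      F {..<m} + G {..<m} = (\<Sum>k\<le>r. xv m ^ k * s k)"
    by (intro exI[of _ "\<lambda>k. s k + t k"]) (simp add: symm_add distrib_left sum.distrib)
qed

lemma hgen_uminus:
  assumes "hgen r F"
  shows "hgen r (\<lambda>S. - F S)"
  unfolding hgen_def
proof
  fix m
  obtain s where
    "s 0 = F {..<Suc m}" "\<And>k. symm (Suc m) (s k)" "F {..<m} = (\<Sum>k\<le>r. xv m ^ k * s k)"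
    using assms by (rule hgenE[where m = m]) blast
  then show "\<exists>s. s 0 = - F {..<Suc m} \<and> (\<forall>k. symm (Suc m) (s k)) \<and>
      - F {..<m} = (\<Sum>k\<le>r. xv m ^ k * s k)"
    by (intro exI[of _ "\<lambda>k. - s k"]) (simp add: symm_uminus sum_negf)
qed

lemma hgen_diff: "hgen r F \<Longrightarrow> hgen r G \<Longrightarrow> hgen r (\<lambda>S. F S - G S)"
  using hgen_add[of r F "\<lambda>S. - G S"] by (simp add: hgen_uminus)

lemma hgen_sum: "(\<And>i. i \<in> I \<Longrightarrow> hgen r (F i)) \<Longrightarrow> hgen r (\<lambda>S. \<Sum>i\<in>I. F i S)"
  by (induction I rule: infinite_finite_induct) (simp_all add: hgen_add)

text \<open>By \<open>hZ_remove\<close>, taking the variable \<open>m\<close> out of one complete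
  symmetric polynomial costs at most one power of it. The number of factors therefore bounds the
  degree in \<open>xv m\<close>.\<close>

lemma hgen_hZ:
  assumes "hgen r F"
  shows "hgen (Suc r) (\<lambda>S. F S * hZ S j)"
  unfolding hgen_def
proof
  fix m
  obtain s where s:
    "s 0 = F {..<Suc m}" "\<And>k. symm (Suc m) (s k)" "F {..<m} = (\<Sum>k\<le>r. xv m ^ k * s k)"
    using assms(1) by (rule hgenE[where m = m]) blast
  let ?h = "hZ {..<Suc m}"
  have h: "hZ {..<m} j = ?h j - xv m * ?h (j - 1)"
    using hZ_remove[of "{..<m}" m j] by (simp add: lessThan_Suc)
  define t where "t k = (if k \<le> r then s k * ?h j else 0) - (if k = 0 then 0 else s (k - 1) * ?h (j - 1))" for k
  have "F {..<m} * hZ {..<m} j =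
      (\<Sum>k\<le>r. xv m ^ k * (s k * ?h j)) - (\<Sum>k\<le>r. xv m ^ Suc k * (s k * ?h (j - 1)))"
    by (simp add: s(3) h right_diff_distrib sum_distrib_left sum_distrib_right ac_simps)
  also have "(\<Sum>k\<le>r. xv m ^ k * (s k * ?h j)) = (\<Sum>k\<le>Suc r. xv m ^ k * (if k \<le> r then s k * ?h j else 0))"
    by simp
  also have "(\<Sum>k\<le>r. xv m ^ Suc k * (s k * ?h (j - 1))) =
      (\<Sum>k\<le>Suc r. xv m ^ k * (if k = 0 then 0 else s (k - 1) * ?h (j - 1)))"
    unfolding sum.atMost_Suc_shift by simp
  finally have "F {..<m} * hZ {..<m} j = (\<Sum>k\<le>Suc r. xv m ^ k * t k)"
    by (simp add: t_def right_diff_distrib sum_subtractf)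
  moreover have "symm (Suc m) (t k)" for k
    unfolding t_def by (auto intro!: symm_diff symm_uminus symm_mult s(2) symm_hZ)
  moreover have "t 0 = F {..<Suc m} * ?h j" by (simp add: t_def s(1))
  ultimately show "\<exists>s. s 0 = F {..<Suc m} * ?h j \<and> (\<forall>k. symm (Suc m) (s k)) \<and>
      F {..<m} * hZ {..<m} j = (\<Sum>k\<le>Suc r. xv m ^ k * s k)"
    by blast
qed

text \<open>Only the powers of \<open>xv m\<close> up to \<open>r \<le> m\<close> occur, and the
  positive ones among them are equivalent to 0. The coefficient of the power 0 is \<open>F\<close>
  in one more variable.\<close>

lemma hgen_peqv_Suc:
  assumes "hgen r F" "r \<le> m"
  shows "peqv (Suc m) (F {..<m}) (F {..<Suc m})"
proof -
  obtain s where s: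
    "s 0 = F {..<Suc m}" "\<And>k. symm (Suc m) (s k)" "F {..<m} = (\<Sum>k\<le>r. xv m ^ k * s k)"
    using assms(1) by (rule hgenE[where m = m]) blast
  have "peqv (Suc m) (\<Sum>k\<le>r. xv m ^ k * s k) (\<Sum>k\<le>r. if k = 0 then s 0 else 0)"
  proof (rule peqv_sum)
    fix k assume "k \<in> {..r}"
    then show "peqv (Suc m) (xv m ^ k * s k) (if k = 0 then s 0 else 0)"
      using peqv_mult[OF s(2)[of k] peqv_power_0[of k m]] assms(2)
      by (auto simp: mult.commute)
  qed
  then show ?thesis by (simp add: s(1,3))
qed

lemma hgen_peqv:
  assumes "hgen r F" "r \<le> m" "m \<le> m'"
  shows "peqv m' (F {..<m}) (F {..<m'})"
  using assms(3)
proof (induction m' rule: dec_induct)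
  case (step k)
  have "peqv (Suc k) (F {..<m}) (F {..<k})"
    using step.IH by (rule peqv_mono) simp
  also have "peqv (Suc k) (F {..<k}) (F {..<Suc k})"
    by (rule hgen_peqv_Suc[OF assms(1)]) (use assms(2) step.hyps in simp)
  finally show ?case .
qed simp

lemma hgen_prod: "hgen r (\<lambda>S. \<Prod>j<r. hZ S (b j))"
  by (induction r) (simp_all add: hgen_hZ)

text \<open>The last factor is symmetric in all the variables and is carried along; the
  \<open>m\<close> factors that remain are few enough to lose the last variable, and induction
  applies to them.\<close>

lemma peqv_flagged: "peqv m (\<Prod>j<m. hZ {..<m} (b j)) (\<Prod>j<m. hZ {..<Suc j} (b j))"
proof (induction m)
  case (Suc m)
  have "peqv (Suc m) (\<Prod>j<m. hZ {..<Suc m} (b j)) (\<Prod>j<m. hZ {..<m} (b j))"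
    by (rule peqv_sym, rule hgen_peqv_Suc[OF hgen_prod]) simp
  also have "peqv (Suc m) (\<Prod>j<m. hZ {..<m} (b j)) (\<Prod>j<m. hZ {..<Suc j} (b j))"
    using Suc.IH by (rule peqv_mono) simp
  finally have "peqv (Suc m) (\<Prod>j<m. hZ {..<Suc m} (b j)) (\<Prod>j<m. hZ {..<Suc j} (b j))" .
  from peqv_mult[OF symm_hZ[of "Suc m" "b m"] this] show ?case
    by (simp add: mult.commute)
qed simp

section \<open>A determinant of products of complete symmetric polynomials\<close>

text \<open>Matrices are given by their entries as functions of the indices, so that minors are
  compositions with \<open>skip\<close>.\<close>

definition cdet :: "nat \<Rightarrow> (nat \<Rightarrow> nat \<Rightarrow> 'a::comm_ring_1) \<Rightarrow> 'a" where
  "cdet n F = det (mat n n (\<lambda>(i, j). F i j))"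

lemma cdet_leibniz:
  "cdet n F = (\<Sum>p | p permutes {0..<n}. of_int (sign p) * (\<Prod>i = 0..<n. F i (p i)))"
  unfolding cdet_def det_def
  by (auto intro!: sum.cong prod.cong dest: permutes_in_image)

lemma cdet_cong: "(\<And>i j. i < n \<Longrightarrow> j < n \<Longrightarrow> F i j = G i j) \<Longrightarrow> cdet n F = cdet n G"
  unfolding cdet_def by (rule arg_cong[of _ _ det]) (auto intro!: eq_matI)

lemma cdet_0 [simp]: "cdet 0 F = 1"
  by (simp add: cdet_def)

abbreviation skip :: "nat \<Rightarrow> nat \<Rightarrow> nat" where
  "skip i k \<equiv> (if k < i then k else Suc k)"

lemma cdet_expand_col:
  assumes "j < Suc n"
  shows "cdet (Suc n) F = (\<Sum>i<Suc n. (-1) ^ (i + j) * F i j * cdet n (\<lambda>i' j'. F (skip i i') (skip j j')))"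
proof -
  have "cofactor (mat (Suc n) (Suc n) (\<lambda>(i, j). F i j)) i j =
      (-1) ^ (i + j) * cdet n (\<lambda>i' j'. F (skip i i') (skip j j'))" if "i < Suc n" for i
    using that assms unfolding cofactor_def mat_delete_def cdet_def
    by (auto intro!: arg_cong[where f = "\<lambda>x. (-1) ^ (i + j) * det x"] eq_matI)
  then show ?thesis
    using laplace_expansion_column[OF _ assms, of "mat (Suc n) (Suc n) (\<lambda>(i, j). F i j)"] assms
    by (simp add: cdet_def ac_simps)
qed

lemma cdet_expand:
  "cdet (Suc n) F = (\<Sum>i<Suc n. (-1) ^ i * F i 0 * cdet n (\<lambda>i' j'. F (skip i i') (Suc j')))"
  by (simp add: cdet_expand_col[of 0])

lemma cdet_same_cols:
  assumes "j < n" "k < n" "j \<noteq> k" "\<And>i. i < n \<Longrightarrow> F i j = F i k"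
  shows "cdet n F = 0"
  unfolding cdet_def
  by (rule det_identical_columns[OF _ assms(3,1,2)]) (use assms in auto)

lemma cdet_swap_rows:
  assumes "Suc k < n"
  shows "cdet n (\<lambda>i. F (swp k i)) = - cdet n F"
proof -
  have p: "swp k permutes {0..<n}"
    using assms by (intro permutes_swap_id) auto
  have "mat n n (\<lambda>(i, j). mat n n (\<lambda>(i, j). F i j) $$ (swp k i, j)) = mat n n (\<lambda>(i, j). F (swp k i) j)"
    using permutes_in_image[OF p] by (intro eq_matI) auto
  then show ?thesis
    using det_permute_rows[OF _ p, of "mat n n (\<lambda>(i, j). F i j)"]
    by (simp add: cdet_def sign_swap_id)
qed

text \<open>By linearity in column 0, each of the other columns in the combination contributes a
  determinant with two equal columns.\<close>

lemma cdet_comb_col: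
  assumes "0 < n" "\<And>i. i < n \<Longrightarrow> b i = (\<Sum>r<n. c r * F i r)"
  shows "cdet n (\<lambda>i j. if j = 0 then b i else F i j) = c 0 * cdet n F"
proof -
  obtain m where n: "n = Suc m" using assms(1) by (cases n) auto
  define C where "C i = (-1) ^ i * cdet m (\<lambda>i' j'. F (skip i i') (Suc j'))" for i
  have col: "cdet n (\<lambda>i j. if j = 0 then a i else F i j) = (\<Sum>i<n. a i * C i)" for a
    unfolding n cdet_expand by (simp add: C_def ac_simps)
  have F: "cdet n (\<lambda>i j. if j = 0 then F i r else F i j) = (if r = 0 then cdet n F else 0)" if "r < n" for r
  proof (cases "r = 0")
    case True
    then show ?thesis by (auto intro: cdet_cong)
  next
    case False
    then show ?thesis
      using that by (auto intro: cdet_same_cols[of 0 n r])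
  qed
  have "cdet n (\<lambda>i j. if j = 0 then b i else F i j) = (\<Sum>i<n. (\<Sum>r<n. c r * F i r) * C i)"
    unfolding col by (rule sum.cong) (simp_all add: assms(2))
  also have "\<dots> = (\<Sum>r<n. c r * (\<Sum>i<n. F i r * C i))"
    by (simp add: sum_distrib_left sum_distrib_right mult.assoc) (rule sum.swap)
  also have "\<dots> = (\<Sum>r<n. if r = 0 then c r * cdet n F else 0)"
    by (rule sum.cong) (simp_all add: F flip: col)
  finally show ?thesis using assms(1) by simp
qed

section \<open>The symplectic determinant and its flagged form\<close>

definition hq :: "nat set \<Rightarrow> int \<Rightarrow> laurent fps" where
  "hq S k = fps_const (hZ S k) * fps_X ^ nat k"

definition eX :: "nat set \<Rightarrow> nat \<Rightarrow> laurent fps" where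
  "eX S k = fps_const (eS S k) * fps_X ^ k"

text \<open>
  The sum of \<open>h\<^sub>a h\<^sub>b\<close> over \<open>b - a = k\<close>; the exponent of the series variable records the degree.
\<close>

definition gq :: "nat set \<Rightarrow> int \<Rightarrow> laurent fps" where
  "gq S k = Abs_fps (\<lambda>N. if even (int N - k)
     then hZ S ((int N - k) div 2) * hZ S ((int N + k) div 2) else 0)"

lemma hq_nth: "fps_nth (hq S k) N = (if int N = k then hZ S k else 0)"
  by (auto simp: hq_def fps_X_power_nth)

lemma hq_neg [simp]: "k < 0 \<Longrightarrow> hq S k = 0"
  by (simp add: hq_def)

lemma eX_mult_nth: "fps_nth (eX S k * F) N = (if k \<le> N then eS S k * fps_nth F (N - k) else 0)"
  by (simp add: eX_def mult.assoc fps_X_power_mult_nth)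

lemma gq_uminus: "gq S (- k) = gq S k"
  by (rule fps_ext) (auto simp: gq_def mult.commute)

text \<open>In degree \<open>N\<close> the summand of index i contains \<open>h_a h_b\<close> with a
  = (N - k) / 2, independent of i, and b = (N + k) / 2 - i. The relation between elementary and
  complete polynomials sums the second factor to 0 unless N = - k, and then \<open>h_a\<close> with
  a = - k is left.\<close>

lemma eX_gq:
  assumes S: "finite S" "card S \<le> L"
  shows "(\<Sum>i\<le>L. eX S i * gq S (k - int i)) = hq S (- k)"
proof (rule fps_ext)
  fix N
  let ?a = "(int N - k) div 2" and ?b = "(int N + k) div 2"
  show "fps_nth (\<Sum>i\<le>L. eX S i * gq S (k - int i)) N = fps_nth (hq S (- k)) N"
  proof (cases "even (int N - k)")
    case True
    have "fps_nth (eX S i * gq S (k - int i)) N = eS S i * (hZ S ?a * hZ S (?b - int i))" for i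
    proof (cases "i \<le> N")
      case i: True
      have 1: "int (N - i) - (k - int i) = int N - k"
        and 2: "int (N - i) + (k - int i) = (int N + k) - 2 * int i"
        using i by auto
      have 3: "((int N + k) - 2 * int i) div 2 = ?b - int i" by presburger
      show ?thesis
        using i True by (simp add: eX_mult_nth gq_def 1 2 3)
    next
      case False
      then have "?a < 0 \<or> ?b - int i < 0" by linarith
      then show ?thesis using False by (auto simp: eX_mult_nth)
    qed
    then have "fps_nth (\<Sum>i\<le>L. eX S i * gq S (k - int i)) N =
        hZ S ?a * (\<Sum>i\<le>L. eS S i * hZ S (?b - int i))"
      by (simp add: fps_sum_nth sum_distrib_left ac_simps)
    also have "\<dots> = (if ?b = 0 then hZ S ?a else 0)"
      by (simp add: eS_hZ[OF S])
    also have "\<dots> = (if int N = - k then hZ S (- k) else 0)"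
    proof -
      have "?b = 0 \<longleftrightarrow> int N = - k" using True by presburger
      moreover have "int N = - k \<Longrightarrow> ?a = - k" by presburger
      ultimately show ?thesis by auto
    qed
    finally show ?thesis by (simp add: hq_nth)
  next
    case False
    then have "int N \<noteq> - k" by presburger
    moreover have "fps_nth (eX S i * gq S (k - int i)) N = 0" for i
      using False by (auto simp: eX_mult_nth gq_def)
    ultimately show ?thesis by (simp add: fps_sum_nth hq_nth)
  qed
qed

definition fg :: "nat set \<Rightarrow> nat \<Rightarrow> int \<Rightarrow> laurent fps" where
  "fg S r l = gq S (l - int r) - gq S (l + int r)"

text \<open>The relation \<open>eX_gq\<close> is used twice, with the coefficients in their order
  and reversed. As \<open>gq\<close> is even, the reversed sum is \<open>hq S (- l - n)\<close>,
  which is 0 by the bound on \<open>l\<close>. The coefficients of the difference are antisymmetric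
  under i -> 2 n - i: the middle term drops out and the others pair up to values of
  \<open>fg\<close>.\<close>

lemma eX_fg:
  assumes S: "finite S" "card S = 2 * n" and l: "l > - int n"
  shows "hq S (l - int n) = (\<Sum>j<n. (eX S j - eX S (2 * n - j)) * fg S (n - j) l)"
proof -
  let ?k = "int n - l"
  let ?g = "\<lambda>i. gq S (?k - int i)"
  have 1: "(\<Sum>i\<le>2 * n. eX S i * ?g i) = hq S (l - int n)"
    using eX_gq[OF S(1), of "2 * n" ?k] S(2) by simp
  have "(\<Sum>i\<le>2 * n. eX S i * gq S (2 * int n - ?k - int i)) = hq S (- l - int n)"
  proof -
    have *: "- (2 * int n - ?k) = - l - int n" by simp
    show ?thesis
      using eX_gq[OF S(1), of "2 * n" "2 * int n - ?k"] S(2) unfolding * by simp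
  qed
  also have "(\<Sum>i\<le>2 * n. eX S i * gq S (2 * int n - ?k - int i)) = (\<Sum>i\<le>2 * n. eX S (2 * n - i) * ?g i)"
  proof -
    have "(\<Sum>i\<le>2 * n. eX S i * gq S (2 * int n - ?k - int i)) =
        (\<Sum>i\<le>2 * n. eX S (2 * n - i) * gq S (2 * int n - ?k - int (2 * n - i)))"
      by (rule sum.reindex_bij_witness[of _ "\<lambda>i. 2 * n - i" "\<lambda>i. 2 * n - i"]) auto
    also have "\<dots> = (\<Sum>i\<le>2 * n. eX S (2 * n - i) * ?g i)"
    proof (rule sum.cong[OF refl])
      fix i assume "i \<in> {..2 * n}"
      then have "2 * int n - ?k - int (2 * n - i) = - (?k - int i)" by (simp add: of_nat_diff)
      then show "eX S (2 * n - i) * gq S (2 * int n - ?k - int (2 * n - i)) = eX S (2 * n - i) * ?g i"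
        by (simp only: gq_uminus)
    qed
    finally show ?thesis .
  qed
  finally have 2: "(\<Sum>i\<le>2 * n. eX S (2 * n - i) * ?g i) = 0"
    using l by simp
  let ?t = "\<lambda>i. (eX S i - eX S (2 * n - i)) * ?g i"
  have "hq S (l - int n) = (\<Sum>i\<le>2 * n. ?t i)"
    using 1 2 by (simp add: left_diff_distrib sum_subtractf)
  also have "\<dots> = (\<Sum>i<n. ?t i) + (\<Sum>i\<in>{n..2 * n}. ?t i)"
  proof -
    have "{..2 * n} = {..<n} \<union> {n..2 * n}" by auto
    then show ?thesis by (simp add: sum.union_disjoint ivl_disj_int)
  qed
  also have "(\<Sum>i\<in>{n..2 * n}. ?t i) = (\<Sum>i\<in>{n<..2 * n}. ?t i)"
    by (rule sum.mono_neutral_right) (auto simp: not_less le_less)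
  also have "\<dots> = (\<Sum>i<n. ?t (2 * n - i))"
    by (rule sum.reindex_bij_witness[of _ "\<lambda>i. 2 * n - i" "\<lambda>i. 2 * n - i"]) auto
  also have "(\<Sum>i<n. ?t i) + (\<Sum>i<n. ?t (2 * n - i)) = (\<Sum>i<n. (eX S i - eX S (2 * n - i)) * fg S (n - i) l)"
  proof -
    have "?t i + ?t (2 * n - i) = (eX S i - eX S (2 * n - i)) * fg S (n - i) l" if "i < n" for i
    proof -
      have "?g i = gq S (l - int (n - i))" "?g (2 * n - i) = gq S (l + int (n - i))"
        using that gq_uminus[of S "l - int (n - i)"] gq_uminus[of S "l + int (n - i)"]
        by (simp_all add: of_nat_diff algebra_simps)
      then show ?thesis using that by (simp add: fg_def algebra_simps)
    qed
    then show ?thesis by (simp flip: sum.distrib)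
  qed
  finally show ?thesis .
qed

text \<open>The numbers \<open>l i\<close> will be the coordinates of \<lambda> + \<rho>, and
  \<open>n - j\<close> are those of \<rho>. The two summands of \<open>fg\<close> supply the sign
  changes, so the Leibniz expansion runs over the signed permutations.\<close>

definition Mdet :: "nat \<Rightarrow> (nat \<Rightarrow> int) \<Rightarrow> nat set \<Rightarrow> laurent fps" where
  "Mdet n l S = cdet n (\<lambda>i j. fg S (n - j) (l i))"

text \<open>A flagged Jacobi-Trudi determinant. Deleting column 0 gives the same kind of determinant
  for \<open>n - 1\<close>, in two variables fewer.\<close>

definition KSdet :: "nat \<Rightarrow> (nat \<Rightarrow> int) \<Rightarrow> laurent fps" where
  "KSdet n l = cdet n (\<lambda>i j. hq {..<2 * (n - j)} (l i - int (n - j)))"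

text \<open>Column 0 is replaced by the combination of all columns from \<open>eX_fg\<close>; its
  own coefficient there is the factor on the left.\<close>

lemma Mdet_Suc:
  assumes S: "finite S" "card S = 2 * Suc n" and l: "\<And>i. i < Suc n \<Longrightarrow> l i > - int (Suc n)"
  shows "(1 - eX S (2 * Suc n)) * Mdet (Suc n) l S =
    (\<Sum>i<Suc n. (-1) ^ i * hq S (l i - int (Suc n)) * Mdet n (l \<circ> skip i) S)"
proof -
  let ?F = "\<lambda>i j. fg S (Suc n - j) (l i)"
  have "(\<Sum>i<Suc n. (-1) ^ i * hq S (l i - int (Suc n)) * Mdet n (l \<circ> skip i) S) =
      cdet (Suc n) (\<lambda>i j. if j = 0 then hq S (l i - int (Suc n)) else ?F i j)"
    unfolding cdet_expand Mdet_def by simp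
  also have "\<dots> = (eX S 0 - eX S (2 * Suc n - 0)) * cdet (Suc n) ?F"
    by (rule cdet_comb_col) (use eX_fg[OF S l] in auto)
  finally show ?thesis by (simp add: Mdet_def eX_def)
qed

lemma KSdet_Suc:
  "KSdet (Suc n) l = (\<Sum>i<Suc n. (-1) ^ i * hq {..<2 * Suc n} (l i - int (Suc n)) * KSdet n (l \<circ> skip i))"
  unfolding KSdet_def cdet_expand by simp

section \<open>Coefficientwise extension to power series in t\<close>

definition feqv :: "nat \<Rightarrow> laurent fps \<Rightarrow> laurent fps \<Rightarrow> bool" where
  "feqv m F G \<longleftrightarrow> (\<forall>N. peqv m (fps_nth F N) (fps_nth G N))"

definition fsymm :: "nat \<Rightarrow> laurent fps \<Rightarrow> bool" where
  "fsymm m F \<longleftrightarrow> (\<forall>N. symm m (fps_nth F N))"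

definition fhgen :: "nat \<Rightarrow> (nat set \<Rightarrow> laurent fps) \<Rightarrow> bool" where
  "fhgen r F \<longleftrightarrow> (\<forall>N. hgen r (\<lambda>S. fps_nth (F S) N))"

lemma feqv_refl [simp]: "feqv m F F"
  by (simp add: feqv_def)

lemma feqv_trans [trans]: "feqv m F G \<Longrightarrow> feqv m G H \<Longrightarrow> feqv m F H"
  using peqv_trans unfolding feqv_def by blast

lemma feqv_sum: "(\<And>i. i \<in> I \<Longrightarrow> feqv m (F i) (G i)) \<Longrightarrow> feqv m (\<Sum>i\<in>I. F i) (\<Sum>i\<in>I. G i)"
  by (simp add: feqv_def fps_sum_nth peqv_sum)

lemma feqv_mono: "feqv m F G \<Longrightarrow> m \<le> m' \<Longrightarrow> feqv m' F G"
  using peqv_mono unfolding feqv_def by blast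

lemma feqv_mult: "fsymm m S \<Longrightarrow> feqv m F G \<Longrightarrow> feqv m (S * F) (S * G)"
  unfolding feqv_def fsymm_def fps_mult_nth by (auto intro!: peqv_sum peqv_mult)

lemma fsymm_hq: "fsymm m (hq {..<m} k)"
  by (simp add: fsymm_def hq_nth symm_hZ)

lemma fsymm_minus_one_power: "fsymm m F \<Longrightarrow> fsymm m ((-1) ^ i * F)"
  by (cases "even i") (simp_all add: fsymm_def symm_uminus)

lemma fhgen_1 [simp]: "fhgen 0 (\<lambda>S. 1)"
  by (simp add: fhgen_def)

lemma fhgen_diff: "fhgen r F \<Longrightarrow> fhgen r G \<Longrightarrow> fhgen r (\<lambda>S. F S - G S)"
  by (simp add: fhgen_def hgen_diff)

lemma fhgen_sum: "(\<And>i. i \<in> I \<Longrightarrow> fhgen r (F i)) \<Longrightarrow> fhgen r (\<lambda>S. \<Sum>i\<in>I. F i S)"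
  by (simp add: fhgen_def fps_sum_nth hgen_sum)

lemma fhgen_minus_one_power: "fhgen r F \<Longrightarrow> fhgen r (\<lambda>S. (-1) ^ i * F S)"
  by (cases "even i") (simp_all add: fhgen_def hgen_uminus)

lemma fhgen_gq:
  assumes "fhgen r F"
  shows "fhgen (Suc (Suc r)) (\<lambda>S. gq S k * F S)"
proof -
  have "hgen (Suc (Suc r)) (\<lambda>S. fps_nth (F S) i * fps_nth (gq S k) j)" for i j
  proof -
    have "hgen (Suc (Suc r)) (\<lambda>S. fps_nth (F S) i * hZ S a * hZ S b)" for a b
      using assms by (intro hgen_hZ) (simp add: fhgen_def)
    then show ?thesis by (cases "even (int j - k)") (simp_all add: gq_def mult.assoc)
  qed
  then show ?thesis
    unfolding fhgen_def by (subst mult.commute) (simp add: fps_mult_nth hgen_sum)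
qed

text \<open>Every entry is built from products of two complete symmetric polynomials, so the
  determinant has \<open>2 * n\<close> of them in each term. This is just the number needed to add
  variables beyond the first \<open>2 * n\<close>.\<close>

lemma fhgen_Mdet: "fhgen (2 * n) (Mdet n l)"
proof (induction n arbitrary: l)
  case 0
  then show ?case by (simp add: Mdet_def[abs_def])
next
  case (Suc n)
  have "Mdet (Suc n) l = (\<lambda>S. \<Sum>i<Suc n. (-1) ^ i *
      (gq S (l i - int (Suc n)) * Mdet n (l \<circ> skip i) S - gq S (l i + int (Suc n)) * Mdet n (l \<circ> skip i) S))"
    by (rule ext) (simp add: Mdet_def cdet_expand fg_def left_diff_distrib mult.assoc del: sum.lessThan_Suc)
  moreover have "fhgen (Suc (Suc (2 * n))) \<dots>"
    using Suc.IH by (intro fhgen_sum fhgen_minus_one_power fhgen_diff fhgen_gq)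
  ultimately show ?case by simp
qed

lemma Mdet_feqv: "2 * n \<le> m \<Longrightarrow> feqv m (Mdet n l {..<2 * n}) (Mdet n l {..<m})"
  using fhgen_Mdet[of n l] by (auto simp: feqv_def fhgen_def intro: hgen_peqv)

section \<open>Partitions whose rows come in equal pairs\<close>

text \<open>The partitions with equal rows \<open>2 k - 1\<close> and \<open>2 k\<close> for all \<open>k\<close>, given by the multiplicities of their columns.\<close>

definition U :: "nat \<Rightarrow> nat \<Rightarrow> (nat \<Rightarrow> nat) set" where
  "U n N = {m. (\<forall>k. k \<notin> {1..n} \<longrightarrow> m k = 0) \<and> (\<Sum>k=1..n. 2 * k * m k) = N}"

definition muw :: "nat \<Rightarrow> (nat \<Rightarrow> nat) \<Rightarrow> weight" where
  "muw n m = (\<Sum>k=1..n. frag_cmul (int (m k)) (\<Sum>i<2 * k. coord i))"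

text \<open>The product over k = 1, ..., n of the geometric series in t^(2 k) times the product of
  the first 2 k variables; \<open>Psi_Suc\<close> removes the last of them.\<close>

definition Psi :: "nat \<Rightarrow> laurent fps" where
  "Psi n = Abs_fps (\<lambda>N. \<Sum>m\<in>U n N. frag_of (muw n m))"

lemma U_0: "U 0 N = (if N = 0 then {\<lambda>k. 0} else {})"
  by (auto simp: U_def)

lemma U_Suc: "U (Suc n) N = U n N \<union>
    (if 2 * Suc n \<le> N then (\<lambda>m. m(Suc n := Suc (m (Suc n)))) ` U (Suc n) (N - 2 * Suc n) else {})"
  (is "_ = _ \<union> ?R")
proof (intro equalityI subsetI)
  fix m assume m: "m \<in> U (Suc n) N"
  show "m \<in> U n N \<union> ?R"
  proof (cases "m (Suc n)")
    case 0
    with m have "m k = 0" if "k \<notin> {1..n}" for k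
      using that by (cases "k = Suc n") (auto simp: U_def)
    with m 0 show ?thesis by (auto simp: U_def)
  next
    case (Suc j)
    let ?m = "m(Suc n := j)"
    have "(\<Sum>k=1..n. 2 * k * ?m k) = (\<Sum>k=1..n. 2 * k * m k)"
      by (rule sum.cong) auto
    with m Suc have "2 * Suc n \<le> N" "?m \<in> U (Suc n) (N - 2 * Suc n)"
      by (auto simp: U_def)
    moreover have "m = ?m(Suc n := Suc (?m (Suc n)))"
      using Suc by auto
    ultimately have "m \<in> (\<lambda>m. m(Suc n := Suc (m (Suc n)))) ` U (Suc n) (N - 2 * Suc n)"
      by (intro image_eqI[of _ _ ?m])
    with \<open>2 * Suc n \<le> N\<close> show ?thesis by simp
  qed
next
  fix m assume "m \<in> U n N \<union> ?R"
  then show "m \<in> U (Suc n) N"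
  proof
    assume "m \<in> ?R"
    then obtain m' where N: "2 * Suc n \<le> N" and m': "m' \<in> U (Suc n) (N - 2 * Suc n)"
      and m: "m = m'(Suc n := Suc (m' (Suc n)))"
      by (auto split: if_splits)
    have "(\<Sum>k=1..n. 2 * k * m k) = (\<Sum>k=1..n. 2 * k * m' k)"
      unfolding m by (rule sum.cong) auto
    with N m' show ?thesis by (auto simp: U_def m)
  qed (auto simp: U_def)
qed

lemma finite_U: "finite (U n N)"
proof (induction n arbitrary: N)
  case 0
  then show ?case by (simp add: U_0)
next
  case (Suc n)
  show ?case
    by (induction N rule: less_induct) (subst U_Suc, auto simp: Suc)
qed

lemma U_sum_Suc:
  "(\<Sum>m\<in>U (Suc n) N. f m) = (\<Sum>m\<in>U n N. f m) + (if 2 * Suc n \<le> N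
     then \<Sum>m\<in>U (Suc n) (N - 2 * Suc n). f (m(Suc n := Suc (m (Suc n)))) else 0)"
proof (cases "2 * Suc n \<le> N")
  case True
  let ?s = "\<lambda>m. m(Suc n := Suc (m (Suc n)))"
  have inj: "inj_on ?s A" for A
    by (rule inj_onI) (metis Suc_inject fun_upd_eqD fun_upd_triv fun_upd_upd)
  have "m (Suc n) = 0" if "m \<in> U n N" for m
    using that by (simp add: U_def)
  then have "U n N \<inter> ?s ` U (Suc n) (N - 2 * Suc n) = {}"
    by fastforce
  then have "(\<Sum>m\<in>U (Suc n) N. f m) = (\<Sum>m\<in>U n N. f m) + (\<Sum>m\<in>?s ` U (Suc n) (N - 2 * Suc n). f m)"
    using True by (subst U_Suc) (simp add: sum.union_disjoint finite_U)
  then show ?thesis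
    using True by (simp add: sum.reindex[OF inj])
next
  case False
  then show ?thesis by (subst U_Suc) simp
qed

lemma muw_step: "muw (Suc n) (m(Suc n := Suc (m (Suc n)))) = (\<Sum>i<2 * Suc n. coord i) + muw (Suc n) m"
proof -
  have "(\<Sum>k=1..n. frag_cmul (int ((m(Suc n := Suc (m (Suc n)))) k)) (\<Sum>i<2 * k. coord i)) = muw n m"
    unfolding muw_def by (rule sum.cong) auto
  then show ?thesis
    by (simp add: muw_def frag_cmul_distrib del: sum.lessThan_Suc)
qed

lemma prod_xv: "(\<Prod>i<n. xv i) = frag_of (\<Sum>i<n. coord i)"
  by (induction n) (simp_all add: xv_def frag_of_mult add.commute)

lemma Psi_Suc: "(1 - eX {..<2 * Suc n} (2 * Suc n)) * Psi (Suc n) = Psi n"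
proof (rule fps_ext)
  fix N
  have e: "eS {..<2 * Suc n} (2 * Suc n) = frag_of (\<Sum>i<2 * Suc n. coord i)"
    using eS_top[of "{..<2 * Suc n}"] by (simp add: prod_xv del: prod.lessThan_Suc sum.lessThan_Suc mult_Suc_right)
  have "muw (Suc n) m = muw n m" if "m \<in> U n N" for m N
    using that by (simp add: muw_def U_def)
  then show "fps_nth ((1 - eX {..<2 * Suc n} (2 * Suc n)) * Psi (Suc n)) N = fps_nth (Psi n) N"
    by (simp add: left_diff_distrib eX_mult_nth e Psi_def U_sum_Suc[of _ n N] muw_step sum_distrib_left
        del: sum.lessThan_Suc mult_Suc_right flip: frag_of_mult)
qed

lemma geo_power:
  assumes "0 < d"
  shows "Abs_fps (\<lambda>N. if d dvd N then c ^ (N div d) else 0) * (1 - fps_const c * fps_X ^ d) = (1 :: 'a::comm_ring_1 fps)"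
    (is "?E * _ = 1")
proof (rule fps_ext)
  fix N
  have "?E * (1 - fps_const c * fps_X ^ d) = ?E - fps_const c * (fps_X ^ d * ?E)"
    by (simp add: algebra_simps)
  then have *: "fps_nth (?E * (1 - fps_const c * fps_X ^ d)) N =
      fps_nth ?E N - (if d \<le> N then c * fps_nth ?E (N - d) else 0)"
    by (simp add: fps_X_power_mult_nth)
  show "fps_nth (?E * (1 - fps_const c * fps_X ^ d)) N = fps_nth 1 N"
  proof (cases "d \<le> N")
    case True
    then obtain M where "N = d + M" by (metis le_Suc_ex)
    then show ?thesis unfolding * using assms by auto
  next
    case False
    then show ?thesis unfolding * using assms by (cases "N = 0") (auto dest: dvd_imp_le)
  qed
qed

text \<open>After multiplication by \<open>1 - eX ?X ?d\<close> both sides have the same expansion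
  along the first column: on the left the factor cancels the last series in \<open>Psi\<close>, on
  the right it is the factor of \<open>Mdet_Suc\<close>. The minors agree in two variables fewer by
  induction, and \<open>Mdet_feqv\<close> restores these two.\<close>

theorem KSdet_Psi_feqv:
  assumes "\<And>i. i < n \<Longrightarrow> l i > 0"
  shows "feqv (2 * n) (KSdet n l * Psi n) (Mdet n l {..<2 * n})"
  using assms
proof (induction n arbitrary: l)
  case 0
  have "Psi 0 = 1"
    by (rule fps_ext) (simp add: Psi_def U_0 muw_def)
  then show ?case by (simp add: KSdet_def Mdet_def)
next
  case (Suc n)
  let ?d = "2 * Suc n" and ?X = "{..<2 * Suc n}"
  let ?E = "Abs_fps (\<lambda>N. if ?d dvd N then eS ?X ?d ^ (N div ?d) else 0)"
  have E: "?E * (1 - eX ?X ?d) = 1"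
    unfolding eX_def by (rule geo_power) simp
  have fE: "fsymm ?d ?E"
    by (simp add: fsymm_def symm_power symm_eS del: mult_Suc_right)
  let ?c = "\<lambda>i. (-1) ^ i * hq ?X (l i - int (Suc n))"
  have "feqv ?d ((1 - eX ?X ?d) * (KSdet (Suc n) l * Psi (Suc n))) ((1 - eX ?X ?d) * Mdet (Suc n) l ?X)"
  proof -
    have "(1 - eX ?X ?d) * (KSdet (Suc n) l * Psi (Suc n)) = KSdet (Suc n) l * Psi n"
      by (simp only: mult.left_commute[of _ "KSdet (Suc n) l"] Psi_Suc)
    also have "\<dots> = (\<Sum>i<Suc n. ?c i * (KSdet n (l \<circ> skip i) * Psi n))"
      by (simp only: KSdet_Suc sum_distrib_right mult.assoc)
    finally have 1: "(1 - eX ?X ?d) * (KSdet (Suc n) l * Psi (Suc n)) =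
        (\<Sum>i<Suc n. ?c i * (KSdet n (l \<circ> skip i) * Psi n))" .
    have 2: "feqv ?d (\<Sum>i<Suc n. ?c i * (KSdet n (l \<circ> skip i) * Psi n)) (\<Sum>i<Suc n. ?c i * Mdet n (l \<circ> skip i) ?X)"
    proof (intro feqv_sum feqv_mult fsymm_minus_one_power fsymm_hq)
      fix i
      have "feqv (2 * n) (KSdet n (l \<circ> skip i) * Psi n) (Mdet n (l \<circ> skip i) {..<2 * n})"
        using Suc.prems by (intro Suc.IH) auto
      then have "feqv ?d (KSdet n (l \<circ> skip i) * Psi n) (Mdet n (l \<circ> skip i) {..<2 * n})"
        by (rule feqv_mono) simp
      also have "feqv ?d (Mdet n (l \<circ> skip i) {..<2 * n}) (Mdet n (l \<circ> skip i) ?X)"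
        by (rule Mdet_feqv) simp
      finally show "feqv ?d (KSdet n (l \<circ> skip i) * Psi n) (Mdet n (l \<circ> skip i) ?X)" .
    qed
    have 3: "(\<Sum>i<Suc n. ?c i * Mdet n (l \<circ> skip i) ?X) = (1 - eX ?X ?d) * Mdet (Suc n) l ?X"
    proof (rule Mdet_Suc[where n = n and l = l and S = ?X, symmetric])
      fix i assume "i < Suc n"
      then show "- int (Suc n) < l i" using Suc.prems[of i] by linarith
    qed auto
    show ?thesis unfolding 1 3[symmetric] by (rule 2)
  qed
  \<comment> \<open>The inverse \<open>?E\<close> is symmetric as well, so the common factor may be
    cancelled within the equivalence.\<close>
  from feqv_mult[OF fE this] show ?case
    unfolding mult.assoc[symmetric] E by simp
qed

section \<open>Coefficient extraction\<close>

lemma keys_diff_sub: "keys f \<subseteq> A \<Longrightarrow> keys g \<subseteq> A \<Longrightarrow> keys (f - g) \<subseteq> A"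
  using keys_diff[of f g] by blast

lemma keys_sum_sub: "(\<And>i. i \<in> I \<Longrightarrow> keys (f i) \<subseteq> A) \<Longrightarrow> keys (\<Sum>i\<in>I. f i) \<subseteq> A"
  using keys_sum[of f I] by blast

lemma keys_mult_sub:
  "keys f \<subseteq> A \<Longrightarrow> keys g \<subseteq> B \<Longrightarrow> (\<And>a b. a \<in> A \<Longrightarrow> b \<in> B \<Longrightarrow> a + b \<in> C) \<Longrightarrow> keys (f * g) \<subseteq> C"
  using keys_mult[of f g] by blast

locale submonoid =
  fixes A :: "weight set"
  assumes zero: "0 \<in> A" and add: "a \<in> A \<Longrightarrow> b \<in> A \<Longrightarrow> a + b \<in> A"
begin

lemma keys_1: "keys (1 :: laurent) \<subseteq> A"
  using zero by simp

lemma keys_mult: "keys f \<subseteq> A \<Longrightarrow> keys g \<subseteq> A \<Longrightarrow> keys (f * g) \<subseteq> A"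
  by (rule keys_mult_sub[where A = A and B = A and C = A]) (auto intro: add)

lemma keys_prod: "(\<And>i. i \<in> I \<Longrightarrow> keys (f i) \<subseteq> A) \<Longrightarrow> keys (\<Prod>i\<in>I. f i :: laurent) \<subseteq> A"
proof (induction I rule: infinite_finite_induct)
  case (insert i I)
  then have "keys (f i * prod f I) \<subseteq> A"
    by (intro keys_mult) auto
  then show ?case using insert.hyps by simp
qed (simp_all add: zero)

lemma keys_power: "keys f \<subseteq> A \<Longrightarrow> keys (f ^ k :: laurent) \<subseteq> A"
  by (induction k) (simp_all add: zero keys_mult)

lemma keys_fps_mult:
  "(\<And>N. keys (fps_nth F N) \<subseteq> A) \<Longrightarrow> (\<And>N. keys (fps_nth G N) \<subseteq> A) \<Longrightarrow> keys (fps_nth (F * G) N) \<subseteq> A"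
  unfolding fps_mult_nth by (intro keys_sum_sub keys_mult)

lemma keys_fps_prod:
  "(\<And>i N. i \<in> I \<Longrightarrow> keys (fps_nth (F i) N) \<subseteq> A) \<Longrightarrow> keys (fps_nth (\<Prod>i\<in>I. F i :: laurent fps) N) \<subseteq> A"
proof (induction I arbitrary: N rule: infinite_finite_induct)
  case (insert i I)
  then have "keys (fps_nth (F i * prod F I) N) \<subseteq> A"
    by (intro keys_fps_mult) auto
  then show ?case using insert.hyps by simp
qed (simp_all add: zero)

lemma keys_hZ:
  assumes "\<And>i. i \<in> S \<Longrightarrow> coord i \<in> A"
  shows "keys (hZ S k) \<subseteq> A"
proof -
  have "keys (hS S j) \<subseteq> A" for j
    unfolding hS_def by (rule keys_fps_prod) (simp add: keys_power xv_def assms)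
  then show ?thesis by (simp add: hZ_def)
qed

end

section \<open>The Vandermonde product and Schur coefficients\<close>

definition rhox :: "nat \<Rightarrow> weight" where
  "rhox m = (\<Sum>i<m. single i (int (m - 1 - i)))"

lemma lookup_rhox: "lookup (rhox m) i = (if i < m then int (m - 1 - i) else 0)"
  by (simp add: rhox_def lookup_sum lookup_single when_def)

lemma rhox_Suc: "rhox (Suc m) = rhox m + (\<Sum>i<m. coord i)"
  by (rule poly_mapping_eqI) (auto simp: lookup_rhox lookup_add lookup_sum lookup_coord)

lemma sdot_rhox: "Suc i < m \<Longrightarrow> sdot i a + rhox m = pw (swp i) (a + rhox m)"
  by (rule poly_mapping_eqI) (auto simp: lookup_sdot lookup_add lookup_rhox transpose_def)

definition Vd :: "nat \<Rightarrow> laurent" where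
  "Vd m = (\<Prod>j<m. \<Prod>i<j. xv i - xv j)"

lemma pmh_swp_xv: "pmh (pw (swp i)) (xv j) = xv (swp i j)"
  by (simp add: pmh_pw_xv inv_transpose_eq)

lemma prod_swp: "Suc k < m \<Longrightarrow> (\<Prod>i<m. f (swp k i)) = (\<Prod>i<m. f i)"
  by (rule prod.reindex_bij_betw) (simp add: bij_betw_def swp_image inj_on_subset[OF bij_is_inj[OF bij_transpose] subset_UNIV])

lemma Vd_swp: "Suc k < m \<Longrightarrow> pmh (pw (swp k)) (Vd m) = - Vd m"
proof (induction m)
  case (Suc m)
  interpret lattice_hom "pw (swp k)" by (rule lattice_hom_swp)
  show ?case
  proof (cases "Suc k < m")
    case True
    have "pmh (pw (swp k)) (Vd (Suc m)) = - Vd m * (\<Prod>i<m. xv (swp k i) - xv m)"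
      using Suc.IH[OF True] True by (simp add: Vd_def pmh_mult pmh_prod pmh_diff pmh_swp_xv)
    then show ?thesis
      using prod_swp[OF True, of "\<lambda>i. xv i - xv m"] by (simp add: Vd_def)
  next
    case False
    then have m: "m = Suc k" using Suc.prems by simp
    have Vk: "pmh (pw (swp k)) (Vd k) = Vd k"
      by (simp add: Vd_def pmh_prod pmh_diff pmh_swp_xv)
    have V: "Vd (Suc m) = Vd k * (\<Prod>i<k. xv i - xv k) * ((\<Prod>i<k. xv i - xv (Suc k)) * (xv k - xv (Suc k)))"
      by (simp add: Vd_def m)
    show ?thesis
      unfolding V by (simp add: Vk pmh_mult pmh_prod pmh_diff pmh_swp_xv algebra_simps)
  qed
qed simp

text \<open>By the bialternant formula this is, for symmetric \<open>G\<close> and a partition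
  \<open>a\<close>, the coefficient of the Schur polynomial of \<open>a\<close> in
  \<open>G\<close>.\<close>

definition DV :: "nat \<Rightarrow> laurent \<Rightarrow> weight \<Rightarrow> int" where
  "DV m G a = lookup (Vd m * G) (a + rhox m)"

lemma inj_pw_swp: "inj (pw (swp i))"
  by (metis injI pw_swp_swp)

lemma alternating_DV: "symm m G \<Longrightarrow> alternating m (DV m G)"
  unfolding alternating_def
proof (intro allI impI)
  fix i a assume G: "symm m G" and i: "Suc i < m"
  let ?s = "pw (swp i)"
  interpret lattice_hom ?s by (rule lattice_hom_swp)
  have "lookup (Vd m * G) (?s (a + rhox m)) = - lookup (pmh ?s (Vd m * G)) (?s (a + rhox m))"
    using G i by (simp add: pmh_mult Vd_swp symm_def)
  also have "\<dots> = - lookup (Vd m * G) (a + rhox m)"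
    by (simp add: pmh_inj_lookup[OF inj_pw_swp])
  finally show "DV m G (sdot i a) = - DV m G a"
    by (simp add: DV_def sdot_rhox[OF i])
qed

lemma pr_fun_0 [simp]: "pr (\<lambda>a. 0) f = 0"
  by (simp add: pr_def)

text \<open>The adjoint of multiplication: a factor inside the coefficient moves to the argument
  with its exponents negated.\<close>

lemma pr_lookup_mult:
  "pr (\<lambda>a. lookup (u * F) (a + r)) f = pr (\<lambda>a. lookup F (a + r)) (pmh uminus u * f)"
  using subset_UNIV
proof (induction u rule: frag_induction)
  case (one x)
  then show ?case
    by (simp add: lookup_frag_of_mult pr_frag_of_mult diff_add_eq)
qed (simp_all add: pr_diff pmh_diff left_diff_distrib lookup_minus pr_fun_diff)

text \<open>Modulo the terms with a negative exponent of \<open>x\<^sub>y\<close>, multiplication by the product removes the other variables.\<close>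

lemma hZ_quotient:
  assumes "finite S" "y \<notin> S"
  shows "keys (hZ (insert y S) k * (\<Prod>i\<in>S. 1 - xv i * frag_of (- coord y)) - hZ {y} k) \<subseteq> {a. lookup a y < 0}"
  using assms
proof (induction S rule: finite_induct)
  case (insert x S)
  let ?P = "\<Prod>i\<in>S. 1 - xv i * frag_of (- coord y)" and ?q = "xv x * frag_of (- coord y)"
  let ?h = "hZ (insert y (insert x S))"
  have xy: "xv y * frag_of (- coord y) = 1"
    by (simp add: xv_def frag_of_mult)
  have 1: "hZ (insert y S) k = ?h k - xv x * ?h (k - 1)"
    using hZ_remove[of "insert y S" x k] insert by (simp add: insert_commute)
  have 2: "hZ (insert x S) k = ?h k - xv y * ?h (k - 1)"
    using hZ_remove[of "insert x S" y k] insert by simp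
  have "?h k * (1 - ?q) = hZ (insert y S) k - ?q * hZ (insert x S) k"
  proof -
    have "?q * (xv y * ?h (k - 1)) = xv x * (xv y * frag_of (- coord y)) * ?h (k - 1)"
      by (simp only: ac_simps)
    then show ?thesis unfolding 1 2 xy by (simp add: algebra_simps)
  qed
  then have 3: "?h k * ((1 - ?q) * ?P) - hZ {y} k = (hZ (insert y S) k * ?P - hZ {y} k) - ?q * hZ (insert x S) k * ?P"
    unfolding mult.assoc[of "?h k", symmetric] by (simp add: left_diff_distrib)
  have 4: "keys (?q * hZ (insert x S) k * ?P) \<subseteq> {a. lookup a y < 0}"
  proof (rule keys_mult_sub)
    interpret Z: submonoid "{a. lookup a y = 0}"
      by unfold_locales (simp_all add: lookup_add)
    interpret N: submonoid "{a. lookup a y \<le> 0}"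
      by unfold_locales (simp_all add: lookup_add)
    show "keys (?q * hZ (insert x S) k) \<subseteq> {a. lookup a y < 0}"
    proof (rule keys_mult_sub)
      show "keys ?q \<subseteq> {a. lookup a y < 0}"
        using insert by (auto simp: xv_def frag_of_mult lookup_add lookup_minus lookup_coord)
      show "keys (hZ (insert x S) k) \<subseteq> {a. lookup a y = 0}"
        using insert by (intro Z.keys_hZ) (auto simp: lookup_coord)
    qed (simp add: lookup_add)
    show "keys ?P \<subseteq> {a. lookup a y \<le> 0}"
      using insert
      by (intro N.keys_prod keys_diff_sub N.keys_1) (auto simp: xv_def frag_of_mult lookup_add lookup_minus lookup_coord)
  qed (simp add: lookup_add)
  have "y \<notin> S" using insert.prems by simp
  then have "keys (?h k * ((1 - ?q) * ?P) - hZ {y} k) \<subseteq> {a. lookup a y < 0}"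
    unfolding 3 by (intro keys_diff_sub insert.IH 4)
  then show ?case
    by (simp only: prod.insert[OF insert.hyps])
qed simp

lemma pr_eq_0: "(\<And>a. a \<in> keys f \<Longrightarrow> D a = 0) \<Longrightarrow> pr D f = 0"
  by (simp add: pr_def)

lemma hZ_single:
  assumes "0 \<le> k"
  shows "hZ {y} k = frag_of (single y k)"
proof -
  obtain j where "k = int j" using assms by (metis zero_le_imp_eq_int)
  then show ?thesis
    using hZ_insert_expand[of "{}" y k j] by (simp add: hZ_empty xv_power if_distrib cong: if_cong)
qed

text \<open>Induction on the number of variables. The part of the Vandermonde product that contains
  the last variable is moved to the argument, where it turns the last complete polynomial into a
  pure power, up to terms with a negative exponent (\<open>hZ_quotient\<close>). Such terms pair to
  0, since neither \<open>Vd m\<close> nor \<open>G\<close> has negative exponents. The monomial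
  \<open>d\<close> collects the powers split off so far.\<close>

lemma pr_DV_flagged:
  assumes "\<And>a i. a \<in> keys G \<Longrightarrow> i < m \<Longrightarrow> 0 \<le> lookup a i"
    and "\<And>i. i < m \<Longrightarrow> lookup d i = 0" and "\<And>j. j < m \<Longrightarrow> 0 \<le> b j"
  shows "pr (DV m G) ((\<Prod>j<m. hZ {..<Suc j} (b j)) * frag_of d) = lookup G ((\<Sum>j<m. single j (b j)) + d)"
  using assms
proof (induction m arbitrary: d)
  case 0
  then show ?case by (simp add: DV_def Vd_def rhox_def)
next
  case (Suc m)
  let ?f = "\<Prod>j<m. hZ {..<Suc j} (b j)"
  let ?Q = "hZ {..<Suc m} (b m) * (\<Prod>i<m. 1 - xv i * frag_of (- coord m))"
  let ?one = "\<Sum>i<m. coord i"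
  interpret uminus: lattice_hom "uminus :: weight \<Rightarrow> weight"
    by unfold_locales simp
  \<comment> \<open>The monomial pulled out here is the difference between
    \<open>rhox (Suc m)\<close> and \<open>rhox m\<close>, so the next functional is again of the
    form \<open>DV\<close>.\<close>
  have star: "pmh uminus (\<Prod>i<m. xv i - xv m) = frag_of (- ?one) * (\<Prod>i<m. 1 - xv i * frag_of (- coord m))"
  proof -
    have "pmh uminus (\<Prod>i<m. xv i - xv m) = (\<Prod>i<m. frag_of (- coord i) * (1 - xv i * frag_of (- coord m)))"
      by (simp add: uminus.pmh_prod pmh_diff xv_def right_diff_distrib frag_of_mult)
    also have "\<dots> = (\<Prod>i<m. frag_of (- coord i)) * (\<Prod>i<m. 1 - xv i * frag_of (- coord m))"
      by (rule prod.distrib)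
    also have "(\<Prod>i<m. frag_of (- coord i)) = frag_of (- (\<Sum>i<m. coord i))" for m
      by (induction m) (simp_all add: frag_of_mult)
    finally show ?thesis .
  qed
  have "pr (DV (Suc m) G) ((\<Prod>j<Suc m. hZ {..<Suc j} (b j)) * frag_of d) =
      pr (\<lambda>a. lookup ((\<Prod>i<m. xv i - xv m) * (Vd m * G)) (a + rhox (Suc m))) (?f * hZ {..<Suc m} (b m) * frag_of d)"
    by (simp add: DV_def[abs_def] Vd_def ac_simps)
  also have "\<dots> = pr (\<lambda>a. lookup (Vd m * G) (a + rhox (Suc m))) (frag_of (- ?one) * (?Q * ?f * frag_of d))"
    unfolding pr_lookup_mult star by (simp only: ac_simps)
  also have "\<dots> = pr (DV m G) (?Q * ?f * frag_of d)"
    unfolding pr_frag_of_mult DV_def[abs_def] rhox_Suc by (simp add: algebra_simps)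
  also have "\<dots> = pr (DV m G) ((?Q - hZ {m} (b m)) * (?f * frag_of d)) + pr (DV m G) (?f * frag_of (single m (b m) + d))"
  proof -
    have "?Q * ?f * frag_of d = (?Q - hZ {m} (b m)) * (?f * frag_of d) + ?f * (hZ {m} (b m) * frag_of d)"
      by (simp only: left_diff_distrib) (simp add: ac_simps)
    also have "hZ {m} (b m) * frag_of d = frag_of (single m (b m) + d)"
      using Suc.prems(3)[of m] by (simp add: hZ_single frag_of_mult)
    finally show ?thesis by (simp only: pr_add)
  qed
  also have "pr (DV m G) ((?Q - hZ {m} (b m)) * (?f * frag_of d)) = 0"
  proof (rule pr_eq_0)
    fix a assume a: "a \<in> keys ((?Q - hZ {m} (b m)) * (?f * frag_of d))"
    interpret Z: submonoid "{a. lookup a m = 0}"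
      by unfold_locales (simp_all add: lookup_add)
    interpret P: submonoid "{a. 0 \<le> lookup a m}"
      by unfold_locales (simp_all add: lookup_add)
    have 1: "keys (?f * frag_of d) \<subseteq> {a. lookup a m = 0}"
      using Suc.prems(2)[of m] by (intro Z.keys_mult Z.keys_prod Z.keys_hZ) (auto simp: lookup_coord)
    have 2: "keys (?Q - hZ {m} (b m)) \<subseteq> {a. lookup a m < 0}"
      using hZ_quotient[of "{..<m}" m "b m"] by (simp add: lessThan_Suc)
    have "keys ((?Q - hZ {m} (b m)) * (?f * frag_of d)) \<subseteq> {a. lookup a m < 0}"
      by (rule keys_mult_sub[OF 2 1]) (simp add: lookup_add)
    with a have "lookup a m < 0" by blast
    moreover have "keys (Vd m) \<subseteq> {a. 0 \<le> lookup a m}"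
      unfolding Vd_def by (intro P.keys_prod keys_diff_sub) (auto simp: xv_def lookup_coord)
    then have "keys (Vd m * G) \<subseteq> {a. 0 \<le> lookup a m}"
      using Suc.prems(1) by (intro P.keys_mult) auto
    ultimately have "a + rhox m \<notin> keys (Vd m * G)"
      by (auto simp: lookup_add lookup_rhox)
    then show "DV m G a = 0"
      by (simp add: DV_def in_keys_iff)
  qed
  also have "pr (DV m G) (?f * frag_of (single m (b m) + d)) = lookup G ((\<Sum>j<m. single j (b j)) + (single m (b m) + d))"
    using Suc.prems by (intro Suc.IH) (auto simp: lookup_add lookup_single when_def)
  finally show ?case by (simp add: add.assoc)
qed

text \<open>The duality of complete and monomial symmetric functions under the Hall pairing;
  \<open>peqv_flagged\<close> reduces it to the flagged product.\<close>

theorem pr_DV_complete: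
  assumes "symm m G" "\<And>a i. a \<in> keys G \<Longrightarrow> i < m \<Longrightarrow> 0 \<le> lookup a i" "\<And>j. j < m \<Longrightarrow> 0 \<le> b j"
  shows "pr (DV m G) (\<Prod>j<m. hZ {..<m} (b j)) = lookup G (\<Sum>j<m. single j (b j))"
proof -
  have "pr (DV m G) ((\<Prod>j<m. hZ {..<Suc j} (b j)) * frag_of 0) = lookup G ((\<Sum>j<m. single j (b j)) + 0)"
    by (rule pr_DV_flagged) (use assms in auto)
  then show ?thesis
    using peqvD[OF peqv_flagged alternating_DV[OF assms(1)], of b] by simp
qed

text \<open>The transposition of \<open>a\<close> and \<open>Suc b\<close> is the one of
  \<open>a\<close> and \<open>b\<close> conjugated by \<open>swp b\<close>, so adjacent
  transpositions suffice.\<close>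

lemma permutes_adjacent_induct [consumes 1, case_names id swap]:
  assumes "p permutes {..<m}" and "P id"
    and step: "\<And>i p. Suc i < m \<Longrightarrow> p permutes {..<m} \<Longrightarrow> P p \<Longrightarrow> P (swp i \<circ> p)"
  shows "P p"
proof -
  have swp: "swp i permutes {..<m}" if "Suc i < m" for i
    by (rule permutes_swap_id) (use that in auto)
  have tr: "P (transpose a b \<circ> p)" if "a < b" "b < m" "p permutes {..<m}" "P p" for a b p
    using that
  proof (induction b arbitrary: p)
    case (Suc b)
    show ?case
    proof (cases "a = b")
      case True
      have "P (swp b \<circ> p)" using Suc.prems by (intro step) auto
      with True show ?thesis by (simp only:)
    next
      case False
      then have ab: "a < b" using Suc.prems by simp
      have "P (swp b \<circ> (transpose a b \<circ> (swp b \<circ> p)))"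
        using Suc.prems ab
        by (intro step Suc.IH permutes_compose swp permutes_swap_id) auto
      also have "swp b \<circ> (transpose a b \<circ> (swp b \<circ> p)) = transpose a (Suc b) \<circ> p"
        using ab by (auto simp: fun_eq_iff transpose_def)
      finally show ?thesis .
    qed
  qed simp
  have "P p" if "p permutes {..<k}" "k \<le> m" for k
    using that
  proof (induction k arbitrary: p)
    case 0
    then have "p = id" by simp
    then show ?case by (simp only: assms(2))
  next
    case (Suc k)
    then have "p \<in> {p. p permutes insert k {..<k}}" by (simp add: lessThan_Suc)
    then obtain b q where b: "b \<in> insert k {..<k}" and q: "q permutes {..<k}" and p: "p = transpose k b \<circ> q"
      unfolding permutes_insert by auto
    have Pq: "P q" using Suc.IH[OF q] Suc.prems by simp
    have qm: "q permutes {..<m}" using q by (rule permutes_subset) (use Suc.prems in auto)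
    show ?case
    proof (cases "b = k")
      case True
      with p Pq show ?thesis by simp
    next
      case False
      with b Pq qm Suc.prems have "P (transpose b k \<circ> q)"
        by (intro tr) auto
      then show ?thesis unfolding p by (simp only: transpose_commute)
    qed
  qed
  with assms(1) show ?thesis by blast
qed

lemma pw_comp: "inj p \<Longrightarrow> inj q \<Longrightarrow> pw (p \<circ> q) a = pw q (pw p a)"
  by (simp add: pw_def map_key_compose)

lemma pw_id: "pw id = id"
  by (rule ext, rule poly_mapping_eqI) (simp add: lookup_pw)

lemma pmh_id: "pmh id f = f"
  using subset_UNIV by (induction f rule: frag_induction) (simp_all add: pmh_diff)

lemma pmh_pmh: "pmh h (pmh g f) = pmh (\<lambda>a. h (g a)) f"
  using subset_UNIV by (induction f rule: frag_induction) (simp_all add: pmh_diff)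

lemma pmh_pw_swp_comp:
  assumes "inj p"
  shows "pmh (pw (swp i \<circ> p)) f = pmh (pw p) (pmh (pw (swp i)) f)"
proof -
  have "pw (swp i \<circ> p) = (\<lambda>a. pw p (pw (swp i) a))"
    by (rule ext) (simp add: pw_comp assms)
  then show ?thesis by (simp only: pmh_pmh)
qed

lemma inj_pw: "bij p \<Longrightarrow> inj (pw p)"
proof (rule injI)
  fix a b assume p: "bij p" "pw p a = pw p b"
  have "lookup a i = lookup b i" for i
    using p lookup_pw[OF bij_is_inj, of p _ "Hilbert_Choice.inv p i"]
    by (metis bij_inv_eq_iff)
  then show "a = b" by (rule poly_mapping_eqI)
qed

lemma symm_perm: "p permutes {..<m} \<Longrightarrow> symm m f \<Longrightarrow> pmh (pw p) f = f"
proof (induction rule: permutes_adjacent_induct)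
  case id
  then show ?case by (simp only: pw_id pmh_id sign_id of_int_1 mult_1) 
next
  case (swap i p)
  then show ?case
    unfolding pmh_pw_swp_comp[OF permutes_inj[OF swap.hyps(2)]] by (simp add: symm_def)
qed

lemma symm_lookup_perm: "p permutes {..<m} \<Longrightarrow> symm m f \<Longrightarrow> lookup f (pw p a) = lookup f a"
  using pmh_inj_lookup[OF inj_pw[OF permutes_bij], of p "{..<m}" f a] by (simp add: symm_perm)

lemma sign_swp_comp:
  assumes "p permutes {..<m}"
  shows "sign (swp i \<circ> p) = - sign p" "sign (p \<circ> swp i) = - sign p"
  using sign_compose[OF permutation_swap_id permutes_imp_permutation[OF finite_lessThan assms], of i "Suc i"]
    sign_compose[OF permutes_imp_permutation[OF finite_lessThan assms] permutation_swap_id, of i "Suc i"]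
  by (simp_all only: sign_swap_id) simp_all

lemma Vd_perm: "p permutes {..<m} \<Longrightarrow> pmh (pw p) (Vd m) = of_int (sign p) * Vd m"
proof (induction rule: permutes_adjacent_induct)
  case id
  then show ?case by (simp only: pw_id pmh_id sign_id of_int_1 mult_1) 
next
  case (swap i p)
  then show ?case
    unfolding pmh_pw_swp_comp[OF permutes_inj[OF swap.hyps(2)]] sign_swp_comp[OF swap.hyps(2)]
    by (simp add: Vd_swp pmh_uminus)
qed

lemma lookup_Vd_perm: "p permutes {..<m} \<Longrightarrow> lookup (Vd m) (pw p v) = sign p * lookup (Vd m) v"
  using pmh_inj_lookup[OF inj_pw[OF permutes_bij], of p "{..<m}" "Vd m" v]
  by (cases p rule: sign_cases) (simp_all add: Vd_perm)

lemma keys_prod_bound: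
  assumes "\<And>i a. i \<in> I \<Longrightarrow> a \<in> keys (f i) \<Longrightarrow> L i \<le> lookup a j \<and> lookup a j \<le> (B i :: int)"
    and "a \<in> keys (\<Prod>i\<in>I. f i)"
  shows "(\<Sum>i\<in>I. L i) \<le> lookup a j \<and> lookup a j \<le> (\<Sum>i\<in>I. B i)"
  using assms
proof (induction I arbitrary: a rule: infinite_finite_induct)
  case (insert i I)
  then have "a \<in> keys (f i * prod f I)" by simp
  then obtain b c where "a = b + c" "b \<in> keys (f i)" "c \<in> keys (prod f I)"
    using keys_mult by blast
  with insert show ?case by (force simp: lookup_add)
qed simp_all

lemma keys_Vd: "a \<in> keys (Vd m) \<Longrightarrow> 0 \<le> lookup a j \<and> lookup a j \<le> (if j < m then int m - 1 else 0)"
proof (induction m arbitrary: a)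
  case 0
  then show ?case by (simp add: Vd_def)
next
  case (Suc m)
  then have "a \<in> keys (Vd m * (\<Prod>i<m. xv i - xv m))" by (simp add: Vd_def)
  then obtain b c where a: "a = b + c" and b: "b \<in> keys (Vd m)" and c: "c \<in> keys (\<Prod>i<m. xv i - xv m)"
    using keys_mult by blast
  have "(\<Sum>i<m. 0) \<le> lookup c j \<and> lookup c j \<le> (\<Sum>i<m. if j = i \<or> j = m then 1 else 0)"
  proof (rule keys_prod_bound[OF _ c])
    fix i a assume "a \<in> keys (xv i - xv m)"
    then have "a = coord i \<or> a = coord m" using keys_diff[of "xv i" "xv m"] by (auto simp: xv_def)
    then show "0 \<le> lookup a j \<and> lookup a j \<le> (if j = i \<or> j = m then 1 else 0)"
      by (auto simp: lookup_coord)
  qed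
  moreover have "(\<Sum>i<m. if j = i \<or> j = m then 1 else 0 :: int) = (if j < m then 1 else if j = m then int m else 0)"
    by auto
  ultimately show ?case using Suc.IH[OF b] by (auto simp: a lookup_add split: if_splits)
qed

text \<open>Two equal exponents would make the coefficient its own negative. The exponents are
  therefore \<open>m\<close> distinct numbers from 0 to m - 1, and the permutation can be read
  off.\<close>

lemma keys_Vd_perm:
  assumes "v \<in> keys (Vd m)"
  shows "\<exists>p. p permutes {..<m} \<and> v = pw p (rhox m)"
proof -
  have inj: "lookup v a \<noteq> lookup v b" if "a < m" "b < m" "a \<noteq> b" for a b
  proof
    assume eq: "lookup v a = lookup v b"
    have p: "transpose a b permutes {..<m}" using that by (intro permutes_swap_id) auto
    have "pw (transpose a b) v = v"
      by (rule poly_mapping_eqI) (simp add: lookup_pw eq transpose_def)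
    then have "lookup (Vd m) v = 0"
      using lookup_Vd_perm[OF p, of v] that by (simp add: sign_swap_id)
    with assms show False by (simp add: in_keys_iff)
  qed
  define p where "p i = (if i < m then m - 1 - nat (lookup v i) else i)" for i
  have bd: "0 \<le> lookup v i" "lookup v i \<le> int m - 1" if "i < m" for i
    using keys_Vd[OF assms, of i] that by auto
  have "inj_on p {..<m}"
  proof (rule inj_onI)
    fix a b assume ab: "a \<in> {..<m}" "b \<in> {..<m}" "p a = p b"
    then have "lookup v a = lookup v b"
      using bd[of a] bd[of b] by (simp add: p_def)
    with ab inj show "a = b" by auto
  qed
  moreover have "p ` {..<m} \<subseteq> {..<m}" by (auto simp: p_def)
  ultimately have "bij_betw p {..<m} {..<m}"
    by (simp add: bij_betw_def endo_inj_surj)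
  then have p: "p permutes {..<m}"
    by (rule bij_imp_permutes) (simp add: p_def)
  moreover have "v = pw p (rhox m)"
  proof (rule poly_mapping_eqI)
    fix i
    show "lookup v i = lookup (pw p (rhox m)) i"
      using bd[of i] keys_Vd[OF assms, of i] by (auto simp: lookup_pw permutes_inj[OF p] lookup_rhox p_def of_nat_diff)
  qed
  ultimately show ?thesis by blast
qed

lemma lookup_mult_pr: "lookup (f * g) c = pr (\<lambda>a. lookup g (c - a)) f"
  using subset_UNIV
  by (induction f rule: frag_induction) (simp_all add: left_diff_distrib lookup_minus pr_diff lookup_frag_of_mult)

lemma pw_rhox_inj:
  assumes p: "p permutes {..<m}" and q: "q permutes {..<m}" and "pw p (rhox m) = pw q (rhox m)"
  shows "p = q"
proof
  fix i
  have "lookup (rhox m) (p i) = lookup (rhox m) (q i)"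
    using assms(3) lookup_pw[OF permutes_inj[OF p], of "rhox m" i] lookup_pw[OF permutes_inj[OF q], of "rhox m" i] by simp
  moreover have "p i < m \<longleftrightarrow> i < m" "q i < m \<longleftrightarrow> i < m"
    using permutes_in_image[OF p] permutes_in_image[OF q] by auto
  ultimately show "p i = q i"
    using permutes_not_in[OF p, of i] permutes_not_in[OF q, of i]
    by (cases "i < m") (auto simp: lookup_rhox)
qed

text \<open>Applied to a symmetric element, it extracts the same Schur coefficient as
  \<open>DV\<close>, but it is alternating in the exponent \<open>b\<close> of that element.
  \<open>DV_eq_delta\<close> exchanges the two roles, so that \<open>peqv\<close> can be applied to
  \<open>Hm\<close> itself.\<close>

definition delta :: "nat \<Rightarrow> weight \<Rightarrow> weight \<Rightarrow> int" where
  "delta m a b = (\<Sum>p | p permutes {..<m}. sign p * (if b = pw p (a + rhox m) - rhox m then 1 else 0))"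

lemma pr_delta_perm:
  "pr (delta m a) G = (\<Sum>p | p permutes {..<m}. sign p * lookup G (pw p (a + rhox m) - rhox m))"
  by (simp add: delta_def[abs_def] pr_fun_sum pr_fun_cmul pr_delta)

lemma alternating_delta: "alternating m (delta m a)"
  unfolding alternating_def
proof (intro allI impI)
  fix i b assume i: "Suc i < m"
  have s: "swp i permutes {..<m}" using i by (intro permutes_swap_id) auto
  have "delta m a (sdot i b) =
      (\<Sum>p | p permutes {..<m}. sign (p \<circ> swp i) *
        (if sdot i b = pw (p \<circ> swp i) (a + rhox m) - rhox m then 1 else 0))"
    unfolding delta_def by (rule sum_permutations_compose_right[OF s])
  also have "\<dots> = (\<Sum>p | p permutes {..<m}. - (sign p * (if b = pw p (a + rhox m) - rhox m then 1 else 0)))"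
  proof (rule sum.cong[OF refl])
    fix p assume "p \<in> {p. p permutes {..<m}}"
    then have p: "p permutes {..<m}" by simp
    have "sign (p \<circ> swp i) = - sign p"
      by (rule sign_swp_comp[OF p])
    moreover have "sdot i b = pw (p \<circ> swp i) (a + rhox m) - rhox m \<longleftrightarrow> b = pw p (a + rhox m) - rhox m"
    proof -
      have "sdot i b = pw (p \<circ> swp i) (a + rhox m) - rhox m \<longleftrightarrow>
          pw (swp i) (b + rhox m) = pw (swp i) (pw p (a + rhox m))"
        by (simp add: pw_comp permutes_inj[OF p] eq_diff_eq sdot_rhox[OF i])
      also have "\<dots> \<longleftrightarrow> b = pw p (a + rhox m) - rhox m"
        by (simp add: inj_eq[OF inj_pw_swp] eq_diff_eq)
      finally show ?thesis .
    qed
    ultimately show "sign (p \<circ> swp i) * (if sdot i b = pw (p \<circ> swp i) (a + rhox m) - rhox m then 1 else 0) =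
        - (sign p * (if b = pw p (a + rhox m) - rhox m then 1 else 0))"
      by simp
  qed
  finally show "delta m a (sdot i b) = - delta m a b"
    by (simp add: delta_def sum_negf)
qed

text \<open>The constant is \<open>1\<close>, but its value does not matter.\<close>

lemma DV_eq_delta:
  assumes "symm m G"
  shows "DV m G a = lookup (Vd m) (rhox m) * pr (delta m a) G"
proof -
  let ?P = "{p. p permutes {..<m}}" and ?c = "lookup (Vd m) (rhox m)" and ?g = "a + rhox m"
  have fin: "finite ?P" by (rule finite_permutations) simp
  have "DV m G a = (\<Sum>v\<in>keys (Vd m). lookup (Vd m) v * lookup G (?g - v))"
    by (simp add: DV_def lookup_mult_pr pr_def)
  also have "\<dots> = (\<Sum>v\<in>(\<lambda>p. pw p (rhox m)) ` ?P. lookup (Vd m) v * lookup G (?g - v))"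
    using keys_Vd_perm fin by (intro sum.mono_neutral_left) (auto simp: in_keys_iff)
  also have "\<dots> = (\<Sum>p\<in>?P. lookup (Vd m) (pw p (rhox m)) * lookup G (?g - pw p (rhox m)))"
    by (subst sum.reindex) (auto intro!: inj_onI pw_rhox_inj)
  also have "\<dots> = (\<Sum>p\<in>?P. ?c * (sign p * lookup G (?g - pw p (rhox m))))"
    by (rule sum.cong) (auto simp: lookup_Vd_perm)
  \<comment> \<open>With the inverse permutation acting on \<rho>, the invariance of
    \<open>G\<close> carries \<open>p\<close> over to \<open>a + rhox m\<close>.\<close>
  also have "\<dots> = (\<Sum>p\<in>?P. ?c * (sign (Hilbert_Choice.inv p) * lookup G (?g - pw (Hilbert_Choice.inv p) (rhox m))))"
    by (rule sum_permutations_inverse)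
  also have "\<dots> = (\<Sum>p\<in>?P. ?c * (sign p * lookup G (pw p ?g - rhox m)))"
  proof (rule sum.cong[OF refl])
    fix p assume "p \<in> ?P"
    then have p: "p permutes {..<m}" by simp
    let ?q = "Hilbert_Choice.inv p"
    have q: "?q permutes {..<m}" using p by (rule permutes_inv)
    interpret lattice_hom "pw p" using permutes_inj[OF p] by (rule lattice_hom_pw)
    have "pw p (?g - pw ?q (rhox m)) = pw p ?g - rhox m"
      using pw_comp[OF permutes_inj[OF q] permutes_inj[OF p], of "rhox m"]
      by (simp only: diff permutes_inv_o[OF p] pw_id id_apply)
    then have "lookup G (?g - pw ?q (rhox m)) = lookup G (pw p ?g - rhox m)"
      using symm_lookup_perm[OF p assms] by metis
    moreover have "sign ?q = sign p"
      using p by (simp add: sign_inverse permutes_imp_permutation[of "{..<m}"])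
    ultimately show "?c * (sign ?q * lookup G (?g - pw ?q (rhox m))) = ?c * (sign p * lookup G (pw p ?g - rhox m))"
      by simp
  qed
  finally show ?thesis by (simp add: pr_delta_perm sum_distrib_left)
qed

section \<open>The identity of Littlewood\<close>

text \<open>The graded character of the symmetric algebra of the symmetric square.\<close>

definition Hm :: "nat \<Rightarrow> laurent fps" where
  "Hm m = (\<Prod>j<m. \<Prod>i\<le>j. geo (xv i * xv j))"

lemma Hm_Suc: "Hm (Suc m) = Hm m * (\<Prod>i\<le>m. geo (xv i * xv m))"
  by (simp add: Hm_def)

lemma fmap_swp_Hm: "Suc k < m \<Longrightarrow> fmap_coeffs (pmh (pw (swp k))) (Hm m) = Hm m"
proof (induction m)
  case (Suc m)
  interpret lattice_hom "pw (swp k)" by (rule lattice_hom_swp)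
  let ?f = "fmap_coeffs (pmh (pw (swp k)))"
  have f: "?f (geo (xv i * xv j)) = geo (xv (swp k i) * xv (swp k j))" for i j
    by (simp add: fmap_geo pmh_mult pmh_swp_xv)
  show ?case
  proof (cases "Suc k < m")
    case True
    have "?f (\<Prod>i\<le>m. geo (xv i * xv m)) = (\<Prod>i<m. geo (xv (swp k i) * xv m)) * geo (xv m * xv m)"
      using True by (simp add: fmap_prod fmap_mult f flip: lessThan_Suc_atMost)
    also have "\<dots> = (\<Prod>i\<le>m. geo (xv i * xv m))"
      using prod_swp[OF True, of "\<lambda>i. geo (xv i * xv m)"] by (simp flip: lessThan_Suc_atMost)
    finally show ?thesis
      using Suc.IH[OF True] by (simp add: Hm_Suc fmap_mult)
  next
    case False
    then have m: "m = Suc k" using Suc.prems by simp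
    have "?f (Hm k) = Hm k"
      by (simp add: Hm_def fmap_prod f)
    moreover have "Hm (Suc m) = Hm k * ((\<Prod>i<k. geo (xv i * xv k)) * geo (xv k * xv k)) *
        (((\<Prod>i<k. geo (xv i * xv (Suc k))) * geo (xv k * xv (Suc k))) * geo (xv (Suc k) * xv (Suc k)))"
      by (simp add: Hm_Suc m flip: lessThan_Suc_atMost)
    ultimately show ?thesis
      by (simp add: fmap_mult fmap_prod f mult.commute[of "xv (Suc k)" "xv k"] ac_simps)
  qed
qed simp

lemma symm_Hm: "symm m (fps_nth (Hm m) d)"
  unfolding symm_def
proof (intro allI impI)
  fix i assume "Suc i < m"
  from arg_cong[OF fmap_swp_Hm[OF this], of "\<lambda>F. fps_nth F d"]
  show "pmh (pw (swp i)) (fps_nth (Hm m) d) = fps_nth (Hm m) d" by (simp only: fmap_coeffs_nth)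
qed

lemma keys_Hm:
  assumes "a \<in> keys (fps_nth (Hm m) d)"
  shows "0 \<le> lookup a i" "m \<le> i \<Longrightarrow> lookup a i = 0"
proof -
  interpret submonoid "{a. (\<forall>i. 0 \<le> lookup a i) \<and> (\<forall>i\<ge>m. lookup a i = 0)}"
    by unfold_locales (simp_all add: lookup_add)
  have "keys (fps_nth (Hm m) d) \<subseteq> {a. (\<forall>i. 0 \<le> lookup a i) \<and> (\<forall>i\<ge>m. lookup a i = 0)}"
    unfolding Hm_def
  proof (intro keys_fps_prod)
    fix j i N assume "j \<in> {..<m}" "i \<in> {..j}"
    then have "keys (xv i * xv j) \<subseteq> {a. (\<forall>i. 0 \<le> lookup a i) \<and> (\<forall>i\<ge>m. lookup a i = 0)}"
      by (auto simp: xv_def frag_of_mult lookup_add lookup_coord)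
    then show "keys (fps_nth (geo (xv i * xv j)) N) \<subseteq> {a. (\<forall>i. 0 \<le> lookup a i) \<and> (\<forall>i\<ge>m. lookup a i = 0)}"
      unfolding geo_nth by (rule keys_power)
  qed
  with assms show "0 \<le> lookup a i" "m \<le> i \<Longrightarrow> lookup a i = 0" by blast+
qed

text \<open>The substitution of \<open>c * t\<close> for t; with \<open>c = xv m\<close> it produces
  the factors 1 - t x_i x_m from the generating function of the elementary polynomials.\<close>

definition fscale :: "'a::comm_ring_1 \<Rightarrow> 'a fps \<Rightarrow> 'a fps" where
  "fscale c F = Abs_fps (\<lambda>k. c ^ k * fps_nth F k)"

lemma fscale_mult: "fscale c (F * G) = fscale c F * fscale c G"
proof (rule fps_ext)
  fix n
  have "c ^ n * (fps_nth F i * fps_nth G (n - i)) = (c ^ i * fps_nth F i) * (c ^ (n - i) * fps_nth G (n - i))"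
    if "i \<le> n" for i
  proof -
    have "c ^ n = c ^ i * c ^ (n - i)" using that by (simp flip: power_add)
    then show ?thesis by (simp add: ac_simps)
  qed
  then show "fps_nth (fscale c (F * G)) n = fps_nth (fscale c F * fscale c G) n"
    by (simp add: fscale_def fps_mult_nth sum_distrib_left)
qed

lemma fscale_1: "fscale c 1 = 1"
  by (rule fps_ext) (simp add: fscale_def)

lemma fscale_prod: "fscale c (\<Prod>i\<in>I. F i) = (\<Prod>i\<in>I. fscale c (F i))"
  by (induction I rule: infinite_finite_induct) (simp_all add: fscale_1 fscale_mult)

lemma fscale_linear: "fscale c (1 - fps_const a * fps_X) = 1 - fps_const (a * c) * fps_X"
  by (rule fps_ext) (simp add: fscale_def mult.commute)

text \<open>The factors that lead from \<open>m\<close> to \<open>m + 1\<close> variables are moved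
  to the other side, where they form the elementary generating function at
  \<open>xv m * t\<close>.\<close>

lemma Hm_expand:
  "fps_nth (Hm m) d = (\<Sum>k\<le>d. xv m ^ k * (eS {..<Suc m} k * fps_nth (Hm (Suc m)) (d - k)))"
proof -
  have "(\<Prod>i\<le>m. geo (xv i * xv m)) * (\<Prod>i\<le>m. 1 - fps_const (xv i * xv m) * fps_X) = 1"
    by (simp add: geo_mult flip: prod.distrib)
  then have "Hm m = fscale (xv m) (\<Prod>i<Suc m. 1 - fps_const (xv i) * fps_X) * Hm (Suc m)"
    unfolding fscale_prod fscale_linear Hm_Suc lessThan_Suc_atMost
    by (simp only: mult.left_commute[of _ "Hm m"]) (simp add: mult.commute)
  then show ?thesis
    by (subst \<open>Hm m = _\<close>)
      (simp add: fscale_def fps_mult_nth eS_def mult.assoc atMost_atLeast0 del: prod.lessThan_Suc)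
qed

text \<open>Of the powers of \<open>xv m\<close> in \<open>Hm_expand\<close> only the exponents 0
  and m + 1 survive, and beyond these the elementary polynomials vanish. For m + 1 the product of
  all variables occurs twice, and the two signs multiply to -1.\<close>

lemma Hm_peqv:
  "peqv (Suc m) (fps_nth (Hm m) d) (fps_nth (Hm (Suc m)) d -
     (if Suc m \<le> d then fps_nth (Hm (Suc m)) (d - Suc m) * frag_of (\<Sum>i<Suc m. coord i) ^ 2 else 0))"
proof -
  let ?s = "\<lambda>k. eS {..<Suc m} k * fps_nth (Hm (Suc m)) (d - k)"
  let ?t = "\<lambda>k. if k = 0 then ?s 0 else if k = Suc m then (-1) ^ m * (\<Prod>i<Suc m. xv i) * ?s k else 0"
  have "peqv (Suc m) (\<Sum>k\<le>d. xv m ^ k * ?s k) (\<Sum>k\<le>d. ?t k)"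
  proof (rule peqv_sum)
    fix k
    have s: "symm (Suc m) (?s k)" by (intro symm_mult symm_eS symm_Hm)
    consider "k = 0" | "0 < k" "k \<le> m" | "k = Suc m" | "Suc m < k" by linarith
    then show "peqv (Suc m) (xv m ^ k * ?s k) (?t k)"
    proof cases
      case 2
      with peqv_mult[OF s peqv_power_0[OF 2]] show ?thesis by (simp add: mult.commute)
    next
      case 3
      with peqv_mult[OF s peqv_power_top] show ?thesis
        by (simp add: mult.commute del: power_Suc prod.lessThan_Suc)
    next
      case 4
      then show ?thesis by (simp add: eS_eq_0)
    qed simp
  qed
  moreover have "(\<Sum>k\<le>d. ?t k) = fps_nth (Hm (Suc m)) d -
     (if Suc m \<le> d then fps_nth (Hm (Suc m)) (d - Suc m) * frag_of (\<Sum>i<Suc m. coord i) ^ 2 else 0)"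
  proof -
    have "(\<Sum>k\<le>d. ?t k) = (\<Sum>k\<le>d. if k = 0 then ?s 0 else 0) +
        (\<Sum>k\<le>d. if k = Suc m then (-1) ^ m * (\<Prod>i<Suc m. xv i) * ?s (Suc m) else 0)"
      unfolding sum.distrib[symmetric] by (rule sum.cong) auto
    moreover have "(-1) ^ m * (\<Prod>i<Suc m. xv i) * ?s (Suc m) =
        - (fps_nth (Hm (Suc m)) (d - Suc m) * frag_of (\<Sum>i<Suc m. coord i) ^ 2)"
    proof -
      have "(-1) ^ m * p * ((-1) ^ Suc m * p * H) = - (H * p ^ 2)" for p H :: laurent
        by (cases "even m") (simp_all add: power2_eq_square ac_simps)
      then show ?thesis
        using eS_top[of "{..<Suc m}"] by (simp add: prod_xv del: prod.lessThan_Suc sum.lessThan_Suc power_Suc)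
    qed
    ultimately show ?thesis by simp
  qed
  ultimately show ?thesis unfolding Hm_expand[of m d] by (simp only:)
qed


definition even_partition :: "nat \<Rightarrow> weight \<Rightarrow> bool" where
  "even_partition m a \<longleftrightarrow> (\<forall>i<m. even (lookup a i))"

definition partition_like :: "nat \<Rightarrow> weight \<Rightarrow> bool" where
  "partition_like m a \<longleftrightarrow> (\<forall>i<m. 0 \<le> lookup a i) \<and> (\<forall>i\<ge>m. lookup a i = 0) \<and>
     (\<forall>i. Suc i < m \<longrightarrow> lookup a (Suc i) \<le> lookup a i)"

lemma partition_like_antimono:
  assumes "partition_like m a" "i \<le> j" "j < m"
  shows "lookup a j \<le> lookup a i"
  using assms(2,3)
proof (induction j rule: dec_induct)
  case (step k)
  then have "lookup a (Suc k) \<le> lookup a k"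
    using assms(1) by (simp add: partition_like_def)
  with step show ?case by simp
qed simp

lemma delta_nonzeroE:
  assumes "delta m a b \<noteq> 0"
  obtains p where "p permutes {..<m}" "\<And>i. lookup b i + lookup (rhox m) i = lookup a (p i) + lookup (rhox m) (p i)"
proof -
  from assms[unfolded delta_def] obtain p where
    "p \<in> {p. p permutes {..<m}}" "sign p * (if b = pw p (a + rhox m) - rhox m then 1 else 0) \<noteq> 0"
    by (rule sum.not_neutral_contains_not_neutral)
  then have p: "p permutes {..<m}" and b: "b = pw p (a + rhox m) - rhox m"
    by (auto split: if_splits)
  have "lookup b i + lookup (rhox m) i = lookup a (p i) + lookup (rhox m) (p i)" for i
    by (simp add: b lookup_minus lookup_add lookup_pw permutes_inj[OF p])
  with p show thesis by (rule that)
qed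

text \<open>The last entry of \<open>rhox (Suc m)\<close> is 0, so \<open>a + rhox (Suc m)\<close>
  has a negative entry, and no permutation of it is \<open>b + rhox (Suc m)\<close> with
  \<open>b\<close> nonnegative.\<close>

lemma pr_delta_neg:
  assumes "lookup a m < 0" "\<And>b i. b \<in> keys f \<Longrightarrow> 0 \<le> lookup b i"
  shows "pr (delta (Suc m) a) f = 0"
proof (rule pr_eq_0, rule ccontr)
  fix b assume b: "b \<in> keys f" and nz: "delta (Suc m) a b \<noteq> 0"
  obtain p where p: "p permutes {..<Suc m}"
    and *: "\<And>i. lookup b i + lookup (rhox (Suc m)) i = lookup a (p i) + lookup (rhox (Suc m)) (p i)"
    by (rule delta_nonzeroE[OF nz]) blast
  let ?i = "Hilbert_Choice.inv p m"
  have "p ?i = m" using permutes_inverses[OF p] by simp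
  then have "lookup b ?i + lookup (rhox (Suc m)) ?i < 0"
    using *[of ?i] assms(1) by (simp add: lookup_rhox)
  then show False
    using assms(2)[OF b, of ?i] by (simp add: lookup_rhox split: if_splits)
qed

lemma delta_shift:
  "delta m a (b + frag_cmul c (\<Sum>i<m. coord i)) = delta m (a - frag_cmul c (\<Sum>i<m. coord i)) b"
proof -
  let ?c = "frag_cmul c (\<Sum>i<m. coord i)"
  have "b + ?c = pw p (a + rhox m) - rhox m \<longleftrightarrow> b = pw p (a - ?c + rhox m) - rhox m"
    if p: "p permutes {..<m}" for p
  proof -
    interpret lattice_hom "pw p" using permutes_inj[OF p] by (rule lattice_hom_pw)
    have "pw p ?c = ?c"
      using permutes_in_image[OF p]
      by (intro poly_mapping_eqI) (simp add: lookup_pw permutes_inj[OF p] lookup_sum lookup_coord)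
    moreover have "pw p (a - ?c + rhox m) = pw p (a + rhox m) - pw p ?c"
      by (simp add: add diff)
    ultimately have *: "pw p (a - ?c + rhox m) - rhox m = pw p (a + rhox m) - rhox m - ?c"
      by (simp add: diff_right_commute)
    show ?thesis unfolding * by (simp only: eq_diff_eq)
  qed
  then show ?thesis unfolding delta_def by (intro sum.cong) auto
qed

text \<open>The last entry 0 of \<open>b + rhox (Suc m)\<close> can only come from the last entry of
  \<open>a + rhox (Suc m)\<close>, as all the others are positive. So the contributing permutations
  fix \<open>m\<close>.\<close>

lemma delta_Suc_0:
  assumes "lookup a m = 0" "lookup b m = 0" "\<And>i. i < m \<Longrightarrow> 0 \<le> lookup a i"
  shows "delta (Suc m) a b = delta m a b"
proof -
  let ?f = "\<lambda>n p. sign p * (if b = pw p (a + rhox n) - rhox n then 1 else 0)"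
  have sub: "{p. p permutes {..<m}} \<subseteq> {p. p permutes {..<Suc m}}"
    using permutes_subset[of _ "{..<m}" "{..<Suc m}"] by auto
  have "delta (Suc m) a b = (\<Sum>p | p permutes {..<m}. ?f (Suc m) p)"
    unfolding delta_def
  proof (rule sum.mono_neutral_right[OF _ sub])
    show "\<forall>p\<in>{p. p permutes {..<Suc m}} - {p. p permutes {..<m}}. ?f (Suc m) p = 0"
    proof (intro ballI, rule ccontr)
      fix p assume p: "p \<in> {p. p permutes {..<Suc m}} - {p. p permutes {..<m}}" and "?f (Suc m) p \<noteq> 0"
      then have b: "b = pw p (a + rhox (Suc m)) - rhox (Suc m)" by (auto split: if_splits)
      have pm: "p permutes {..<Suc m}" using p by simp
      have "lookup a (p m) + lookup (rhox (Suc m)) (p m) = 0"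
        using assms(2) by (simp add: b lookup_minus lookup_add lookup_pw permutes_inj[OF pm] lookup_rhox)
      moreover have "p m < Suc m" using permutes_in_image[OF pm, of m] by simp
      ultimately have "p m = m"
        using assms(3)[of "p m"] by (cases "p m = m") (auto simp: lookup_rhox)
      then have "p permutes {..<m}"
        by (intro permutes_superset[OF pm]) (auto simp: less_Suc_eq)
      with p show False by simp
    qed
  qed (simp add: finite_permutations)
  also have "\<dots> = delta m a b"
    unfolding delta_def
  proof (rule sum.cong[OF refl])
    fix p assume "p \<in> {p. p permutes {..<m}}"
    then have p: "p permutes {..<m}" by simp
    interpret lattice_hom "pw p" using permutes_inj[OF p] by (rule lattice_hom_pw)
    have "pw p (\<Sum>i<m. coord i) = (\<Sum>i<m. coord i)"
      using permutes_in_image[OF p]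
      by (intro poly_mapping_eqI) (simp add: lookup_pw permutes_inj[OF p] lookup_sum lookup_coord)
    then have "pw p (a + rhox (Suc m)) - rhox (Suc m) = pw p (a + rhox m) - rhox m"
      by (simp add: rhox_Suc add)
    then show "?f (Suc m) p = ?f m p" by simp
  qed
  finally show ?thesis .
qed

text \<open>Under \<open>delta\<close>, \<open>Hm_peqv\<close> becomes a recursion that removes two
  full columns. It ends with a last part 0, which leads to one variable fewer, or with a last part
  1, where the removal makes the part negative and the coefficient vanishes.\<close>

theorem pr_delta_Hm:
  assumes "partition_like m a"
  shows "pr (delta m a) (fps_nth (Hm m) d) =
    (if even_partition m a \<and> (\<Sum>i<m. lookup a i) = 2 * int d then 1 else 0)"
  using assms
proof (induction m arbitrary: a d)
  case 0
  then have "a = 0" by (intro poly_mapping_eqI) (simp add: partition_like_def)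
  then show ?case
    by (simp add: Hm_def delta_def rhox_def pw_id even_partition_def)
next
  case (Suc m)
  note IH = Suc.IH
  let ?one = "\<Sum>i<Suc m. coord i"
  let ?L = "\<lambda>a d. pr (delta (Suc m) a) (fps_nth (Hm (Suc m)) d)"
  have rec: "pr (delta (Suc m) a) (fps_nth (Hm m) d) =
      ?L a d - (if Suc m \<le> d then ?L (a - frag_cmul 2 ?one) (d - Suc m) else 0)" for a d
  proof -
    have "pr (delta (Suc m) a) (f * frag_of ?one ^ 2) = pr (delta (Suc m) (a - frag_cmul 2 ?one)) f" for f
    proof -
      have "frag_of ?one ^ 2 = frag_of (frag_cmul 2 ?one)"
        using frag_cmul_distrib[of 1 1 ?one] by (simp add: power2_eq_square frag_of_mult del: sum.lessThan_Suc)
      then have *: "f * frag_of ?one ^ 2 = frag_of (frag_cmul 2 ?one) * f" by (simp only: mult.commute)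
      show ?thesis
        unfolding * pr_frag_of_mult by (simp only: add.commute[of "frag_cmul 2 ?one"] delta_shift)
    qed
    then show ?thesis
      using peqvD[OF Hm_peqv[of m d] alternating_delta[of _ a]] by (simp add: pr_diff del: sum.lessThan_Suc)
  qed
  have neg: "?L a d = 0" if "lookup a m < 0" for a d
    using that keys_Hm by (intro pr_delta_neg) auto
  have lk: "lookup (a - frag_cmul 2 ?one) i = lookup a i - (if i < Suc m then 2 else 0)" for a i
    by (simp add: lookup_minus lookup_sum lookup_coord del: sum.lessThan_Suc)
  show ?case
    using Suc.prems
  proof (induction "nat (lookup a m)" arbitrary: a d rule: less_induct)
    case less
    have nonneg: "0 \<le> lookup a m" using less.prems by (simp add: partition_like_def)
    have sum2: "(\<Sum>i<Suc m. lookup (a - frag_cmul 2 ?one) i) = (\<Sum>i<Suc m. lookup a i) - 2 * int (Suc m)"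
      unfolding lk by (simp add: sum_subtractf)
    show ?case
    proof (cases "lookup a m = 0")
      case True
      have "?L a d = pr (delta (Suc m) a) (fps_nth (Hm m) d)"
        using rec[of a d] neg[of "a - frag_cmul 2 ?one"] True by (simp add: lk del: sum.lessThan_Suc)
      also have "\<dots> = pr (delta m a) (fps_nth (Hm m) d)"
        using True less.prems keys_Hm(2)[of _ m d m]
        by (intro pr_cong delta_Suc_0) (auto simp: partition_like_def)
      also have "\<dots> = (if even_partition m a \<and> (\<Sum>i<m. lookup a i) = 2 * int d then 1 else 0)"
        using less.prems True by (intro IH) (auto simp: partition_like_def le_Suc_eq, metis Suc_leI antisym_conv2)
      finally show ?thesis
        using True by (simp add: even_partition_def All_less_Suc)
    next
      case False
      \<comment> \<open>A partition with \<open>m + 1\<close> nonzero parts does not occur in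
        \<open>m\<close> variables.\<close>
      have "pr (delta (Suc m) a) (fps_nth (Hm m) d) = 0"
      proof (rule pr_eq_0, rule ccontr)
        fix b assume b: "b \<in> keys (fps_nth (Hm m) d)" and nz: "delta (Suc m) a b \<noteq> 0"
        obtain p where p: "p permutes {..<Suc m}"
          and *: "\<And>i. lookup b i + lookup (rhox (Suc m)) i = lookup a (p i) + lookup (rhox (Suc m)) (p i)"
          by (rule delta_nonzeroE[OF nz]) blast
        have "p m < Suc m" using permutes_in_image[OF p, of m] by simp
        then have "0 < lookup a (p m)"
          using partition_like_antimono[OF less.prems, of "p m" m] nonneg False by simp
        moreover have "0 \<le> lookup (rhox (Suc m)) (p m)" by (simp add: lookup_rhox)
        ultimately show False
          using *[of m] keys_Hm(2)[OF b, of m] by (simp add: lookup_rhox)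
      qed
      then have L: "?L a d = (if Suc m \<le> d then ?L (a - frag_cmul 2 ?one) (d - Suc m) else 0)"
        using rec[of a d] by simp
      show ?thesis
      proof (cases "lookup a m = 1")
        case True
        then have "?L a d = 0"
          unfolding L using neg[of "a - frag_cmul 2 ?one"] by (simp add: lk del: sum.lessThan_Suc)
        moreover have "\<not> even_partition (Suc m) a"
          using True by (auto simp: even_partition_def)
        ultimately show ?thesis by simp
      next
        case False
        with nonneg \<open>lookup a m \<noteq> 0\<close> have ge2: "2 \<le> lookup a m" by linarith
        have pl: "partition_like (Suc m) (a - frag_cmul 2 ?one)"
          using less.prems ge2 partition_like_antimono[OF less.prems, of _ m]
          unfolding partition_like_def lk by (auto simp: less_Suc_eq_le) (smt (verit) order.trans)
        have ev: "even_partition (Suc m) (a - frag_cmul 2 ?one) \<longleftrightarrow> even_partition (Suc m) a"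
          unfolding even_partition_def lk by auto
        show ?thesis
        proof (cases "Suc m \<le> d")
          case True
          have "?L (a - frag_cmul 2 ?one) (d - Suc m) =
              (if even_partition (Suc m) a \<and> (\<Sum>i<Suc m. lookup a i) - 2 * int (Suc m) = 2 * int (d - Suc m) then 1 else 0)"
            using less.hyps[OF _ pl] ge2 unfolding ev sum2 by (simp add: lk del: sum.lessThan_Suc)
          then show ?thesis
            unfolding L using True by (simp add: of_nat_diff del: sum.lessThan_Suc)
        next
          case False
          have "2 * int (Suc m) \<le> (\<Sum>i<Suc m. lookup a i)"
          proof -
            have "2 \<le> lookup a i" if "i \<in> {..<Suc m}" for i
              using partition_like_antimono[OF less.prems, of i m] ge2 that by simp
            then show ?thesis
              using sum_mono[of "{..<Suc m}" "\<lambda>_. 2" "lookup a"] by simp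
          qed
          then show ?thesis
            unfolding L using False by auto
        qed
      qed
    qed
  qed
qed

section \<open>Adding one variable to a determinant of complete polynomials\<close>

lemma sum_involution_zero:
  fixes f :: "'a \<Rightarrow> 'b::linordered_ab_group_add"
  assumes "\<And>x. x \<in> S \<Longrightarrow> g x \<in> S \<and> g (g x) = x \<and> f (g x) = - f x"
  shows "sum f S = 0"
proof -
  have "sum f S = (\<Sum>x\<in>S. f (g x))"
    by (rule sum.reindex_bij_witness[of _ g g]) (use assms in auto)
  also have "\<dots> = - sum f S"
    using assms by (simp add: sum_negf)
  finally show ?thesis by simp
qed

text \<open>Every entry is expanded in powers of the new variable. Below the limit
  \<open>1 - int N\<close> all entries of a row vanish, so one range of indices serves all columns
  and the product over the rows can be exchanged with the sums.\<close>

lemma cdet_hZ_insert: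
  fixes x :: nat and l :: "nat \<Rightarrow> int"
  assumes B: "\<And>j. j < N \<Longrightarrow> finite (B j) \<and> x \<notin> B j"
  shows "cdet N (\<lambda>i j. hZ (insert x (B j)) (l i + int j)) =
    (\<Sum>l'\<in>PiE {..<N} (\<lambda>i. {1 - int N..l i}).
       (\<Prod>i<N. xv x ^ nat (l i - l' i)) * cdet N (\<lambda>i j. hZ (B j) (l' i + int j)))"
proof -
  have expand: "hZ (insert x (B j)) (k + int j) = (\<Sum>k'\<in>{1 - int N..k}. xv x ^ nat (k - k') * hZ (B j) (k' + int j))"
    if "j < N" for j k
  proof -
    let ?M = "nat (k + int j)"
    have "hZ (insert x (B j)) (k + int j) = (\<Sum>b\<le>?M. xv x ^ b * hZ (B j) (k - int b + int j))"
      using B[OF that] hZ_insert_expand[of "B j" x "k + int j" ?M] by (simp add: algebra_simps)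
    also have "\<dots> = (\<Sum>b\<in>{b. 1 - int N \<le> k - int b}. xv x ^ b * hZ (B j) (k - int b + int j))"
    proof (rule sum.mono_neutral_cong)
      have "{b. 1 - int N \<le> k - int b} \<subseteq> {..nat (k + int N)}" by auto
      then show "finite {b. 1 - int N \<le> k - int b}" by (rule finite_subset) simp
    qed (use that in auto)
    also have "\<dots> = (\<Sum>k'\<in>{1 - int N..k}. xv x ^ nat (k - k') * hZ (B j) (k' + int j))"
      by (rule sum.reindex_bij_witness[of _ "\<lambda>k'. nat (k - k')" "\<lambda>b. k - int b"]) auto
    finally show ?thesis .
  qed
  let ?P = "{p. p permutes {0..<N}}" and ?I = "PiE {..<N} (\<lambda>i. {1 - int N..l i})"
  have "cdet N (\<lambda>i j. hZ (insert x (B j)) (l i + int j)) =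
      (\<Sum>p\<in>?P. of_int (sign p) * (\<Prod>i<N. \<Sum>k\<in>{1 - int N..l i}. xv x ^ nat (l i - k) * hZ (B (p i)) (k + int (p i))))"
    unfolding cdet_leibniz
    by (rule sum.cong[OF refl], rule arg_cong2[where f = "(*)", OF refl])
      (auto intro!: prod.cong expand dest: permutes_in_image simp: atLeast0LessThan)
  also have "\<dots> = (\<Sum>p\<in>?P. of_int (sign p) * (\<Sum>l'\<in>?I. \<Prod>i<N. xv x ^ nat (l i - l' i) * hZ (B (p i)) (l' i + int (p i))))"
    by (subst prod_sum_PiE) auto
  also have "\<dots> = (\<Sum>l'\<in>?I. (\<Prod>i<N. xv x ^ nat (l i - l' i)) *
      (\<Sum>p\<in>?P. of_int (sign p) * (\<Prod>i<N. hZ (B (p i)) (l' i + int (p i)))))"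
    unfolding sum_distrib_left prod.distrib by (subst sum.swap) (simp add: mult.left_commute)
  finally show ?thesis by (simp add: cdet_leibniz atLeast0LessThan)
qed

text \<open>If \<open>l' i \<le> l (Suc i)\<close>, the values at \<open>i\<close> and
  \<open>Suc i\<close> can be exchanged within the box: the power of the new variable is unchanged
  and the determinant changes sign. Applied at the least such \<open>i\<close> this is an
  involution, and the fixed range left over is the condition of a horizontal strip.\<close>

lemma cdet_hZ_horizontal:
  fixes x :: nat and l :: "nat \<Rightarrow> int"
  assumes B: "\<And>j. j < N \<Longrightarrow> finite (B j) \<and> x \<notin> B j"
    and l: "\<And>i. Suc i < N \<Longrightarrow> l (Suc i) < l i"
  shows "cdet N (\<lambda>i j. hZ (insert x (B j)) (l i + int j)) =
    (\<Sum>l'\<in>PiE {..<N} (\<lambda>i. {if Suc i < N then l (Suc i) + 1 else 1 - int N..l i}).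
       (\<Prod>i<N. xv x ^ nat (l i - l' i)) * cdet N (\<lambda>i j. hZ (B j) (l' i + int j)))"
proof -
  let ?Box = "PiE {..<N} (\<lambda>i. {1 - int N..l i})"
  let ?Good = "PiE {..<N} (\<lambda>i. {if Suc i < N then l (Suc i) + 1 else 1 - int N..l i})"
  let ?P = "\<lambda>l'. cdet N (\<lambda>i j. hZ (B j) (l' i + int j))"
  let ?f = "\<lambda>l'. (\<Prod>i<N. xv x ^ nat (l i - l' i)) * ?P l'"
  define bad where "bad l' i \<longleftrightarrow> Suc i < N \<and> l' i \<le> l (Suc i)" for l' i
  define S where "S = {l' \<in> ?Box. \<exists>i. bad l' i}"
  define g where "g l' = (let i = LEAST i. bad l' i in l' \<circ> swp i)" for l' :: "nat \<Rightarrow> int"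
  have fin: "finite ?Box" by (intro finite_PiE) auto
  have sumS: "sum ?f S = 0"
  proof (rule sum_involution_zero[where g = g])
    fix l' assume l': "l' \<in> S"
    define i where "i = (LEAST i. bad l' i)"
    have bad: "bad l' i" using l' unfolding S_def i_def by (auto intro: LeastI_ex)
    then have i: "Suc i < N" "l' i \<le> l (Suc i)" by (auto simp: bad_def)
    have box: "1 - int N \<le> l' k \<and> l' k \<le> l k" if "k < N" for k
      using l' that by (auto simp: S_def PiE_iff)
    have ext: "l' k = undefined" if "\<not> k < N" for k
      using l' that by (auto simp: S_def PiE_iff extensional_def)
    have gl: "g l' = l' \<circ> swp i" by (simp add: g_def i_def Let_def)
    have g: "g l' i = l' (Suc i)" "g l' (Suc i) = l' i" "\<And>k. k \<noteq> i \<Longrightarrow> k \<noteq> Suc i \<Longrightarrow> g l' k = l' k"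
      by (simp_all add: gl)
    have gbox: "g l' \<in> ?Box"
    proof (rule PiE_I)
      fix k assume "k \<in> {..<N}"
      then show "g l' k \<in> {1 - int N..l k}"
        using box[of k] box[of i] box[of "Suc i"] i l[of i] g by (cases "k = i"; cases "k = Suc i") auto
    next
      fix k assume "k \<notin> {..<N}"
      then show "g l' k = undefined" using ext i g(3)[of k] by auto
    qed
    have gbad: "bad (g l') i" using i box[of "Suc i"] by (simp add: bad_def g)
    have "bad l' k" if "bad (g l') k" "k < i" for k
      using that g(3)[of k] by (auto simp: bad_def)
    then have Least: "(LEAST i. bad (g l') i) = i"
      using gbad not_less_Least[of _ "bad l'", folded i_def] by (intro Least_equality) (auto simp: not_less[symmetric])
    have "g l' \<in> S" using gbox gbad by (auto simp: S_def)
    moreover have "g (g l') = l'"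
      unfolding g_def[of "g l'"] Least Let_def by (auto simp: gl fun_eq_iff)
    moreover have "?f (g l') = - ?f l'"
    proof -
      have "(\<Prod>k<N. xv x ^ nat (l k - g l' k)) = (\<Prod>k<N. xv x ^ nat (l k - l' k))"
      proof -
        let ?S = "{..<N} - {i, Suc i}"
        have split: "(\<Prod>k<N. h k) = h i * h (Suc i) * (\<Prod>k\<in>?S. h k)" for h :: "nat \<Rightarrow> laurent"
        proof -
          have "{..<N} = {i, Suc i} \<union> ?S" using i by auto
          then have "(\<Prod>k<N. h k) = (\<Prod>k\<in>{i, Suc i}. h k) * (\<Prod>k\<in>?S. h k)"
            by (metis finite.emptyI finite.insertI finite_Diff finite_lessThan prod.union_disjoint Diff_disjoint)
          then show ?thesis by simp
        qed
        \<comment> \<open>None of the four differences is negative, because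
          \<open>l' i \<le> l (Suc i)\<close>; so \<open>nat\<close> truncates nothing.\<close>
        have "nat (l i - l' (Suc i)) + nat (l (Suc i) - l' i) = nat (l i - l' i) + nat (l (Suc i) - l' (Suc i))"
          using i box[of i] box[of "Suc i"] l[of i] by auto
        then have "xv x ^ nat (l i - l' (Suc i)) * xv x ^ nat (l (Suc i) - l' i) =
            xv x ^ nat (l i - l' i) * xv x ^ nat (l (Suc i) - l' (Suc i))"
          by (simp flip: power_add)
        then show ?thesis unfolding split by (simp add: g)
      qed
      moreover have "?P (g l') = - ?P l'"
        using cdet_swap_rows[OF i(1), of "\<lambda>i j. hZ (B j) (l' i + int j)"] by (simp add: gl)
      ultimately show ?thesis by simp
    qed
    ultimately show "g l' \<in> S \<and> g (g l') = l' \<and> ?f (g l') = - ?f l'" by blast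
  qed
  have "?Box - S = ?Good"
  proof (intro equalityI subsetI)
    fix l' assume l': "l' \<in> ?Box - S"
    then have "\<not> bad l' i" for i by (auto simp: S_def)
    then have "l (Suc i) + 1 \<le> l' i" if "Suc i < N" for i
      using that unfolding bad_def by force
    with l' show "l' \<in> ?Good" by (auto simp: bad_def PiE_iff)
  next
    fix l' assume l': "l' \<in> ?Good"
    have mono: "l j \<le> l i" if "i \<le> j" "j < N" for i j
      using that
    proof (induction j rule: dec_induct)
      case (step k)
      with l[of k] show ?case by simp
    qed simp
    have lb: "1 - int N \<le> l' i" if "i < N" for i
    proof (cases "Suc i < N")
      case True
      have "1 - int N \<le> l' (N - 1)" "l' (N - 1) \<le> l (N - 1)"
        using PiE_mem[OF l', of "N - 1"] that by (auto split: if_splits)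
      moreover have "l (N - 1) \<le> l (Suc i)" using True by (intro mono) auto
      moreover have "l (Suc i) + 1 \<le> l' i"
        using PiE_mem[OF l', of i] True by (auto split: if_splits)
      ultimately show ?thesis by linarith
    next
      case False
      then show ?thesis using PiE_mem[OF l', of i] that by auto
    qed
    have "\<not> bad l' i" for i
      using PiE_mem[OF l', of i] by (auto simp: bad_def)
    moreover have "l' \<in> ?Box"
    proof (rule PiE_I)
      fix i assume "i \<in> {..<N}"
      then show "l' i \<in> {1 - int N..l i}"
        using lb[of i] PiE_mem[OF l', of i] by auto
    qed (rule PiE_arb[OF l'])
    ultimately show "l' \<in> ?Box - S" by (auto simp: S_def)
  qed
  moreover have "sum ?f ?Box = sum ?f (?Box - S) + sum ?f S"
    using fin by (intro sum.subset_diff) (auto simp: S_def)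
  ultimately show ?thesis using sumS by (simp add: cdet_hZ_insert[OF B])
qed

section \<open>Gelfand-Tsetlin patterns\<close>

definition interl :: "(nat \<Rightarrow> nat) \<Rightarrow> (nat \<Rightarrow> nat) \<Rightarrow> bool" where
  "interl a b \<longleftrightarrow> (\<forall>s. b (Suc s) \<le> a s \<and> a s \<le> b s)"

text \<open>
  Gelfand-Tsetlin patterns: \<open>K i\<close> is the shape of the letters \<open>\<le> i\<close> of a tableau; the vanishing
  condition says that the entries of row \<open>s\<close> (counted from \<open>0\<close>) are at least \<open>2 s + 1\<close>.
\<close>

definition GT :: "nat \<Rightarrow> (nat \<Rightarrow> nat) \<Rightarrow> (nat \<Rightarrow> nat \<Rightarrow> nat) set" where
  "GT L k = {K. K L = k \<and> (\<forall>i>L. K i = (\<lambda>_. 0)) \<and> (\<forall>i<L. interl (K i) (K (Suc i))) \<and>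
     (\<forall>i s. i \<le> 2 * s \<longrightarrow> K i s = 0)}"

definition lvl :: "nat \<Rightarrow> (nat \<Rightarrow> nat) \<Rightarrow> int" where
  "lvl n a = (\<Sum>s<n. int (a s))"

text \<open>The letter \<open>i\<close> corresponds to the variable \<open>2 n - i\<close>.\<close>

definition wtK :: "nat \<Rightarrow> nat \<Rightarrow> (nat \<Rightarrow> nat \<Rightarrow> nat) \<Rightarrow> weight" where
  "wtK n L K = (\<Sum>i<L. single (2 * n - Suc i) (lvl n (K (Suc i)) - lvl n (K i)))"

text \<open>The shapes left after the removal of a horizontal strip from \<open>k\<close>, with at
  most \<open>N\<close> rows.\<close>

definition strips :: "nat \<Rightarrow> (nat \<Rightarrow> nat) \<Rightarrow> (nat \<Rightarrow> nat) set" where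
  "strips N k = {k'. interl k' k \<and> (\<forall>s\<ge>N. k' s = 0)}"

text \<open>The translation between rows and the strictly decreasing indices of the determinant; the
  bound \<open>1 - int N\<close> for the last index says that the last row is nonnegative.\<close>

lemma strips_bij:
  assumes "\<And>s. N \<le> s \<Longrightarrow> k s = 0"
  shows "bij_betw (\<lambda>k'. restrict (\<lambda>i. int (k' i) - int i) {..<N}) (strips N k)
    (PiE {..<N} (\<lambda>i. {if Suc i < N then (int (k (Suc i)) - int (Suc i)) + 1 else 1 - int N..int (k i) - int i}))"
    (is "bij_betw ?f _ ?I")
proof (rule bij_betwI[where g = "\<lambda>l' s. if s < N then nat (l' s + int s) else 0"])
  show "?f \<in> strips N k \<rightarrow> ?I"
    by (auto simp: strips_def interl_def)
  show "(\<lambda>l' s. if s < N then nat (l' s + int s) else 0) \<in> ?I \<rightarrow> strips N k"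
  proof (rule funcsetI)
    fix l' assume l': "l' \<in> ?I"
    let ?k = "\<lambda>s. if s < N then nat (l' s + int s) else 0"
    have "k (Suc s) \<le> ?k s \<and> ?k s \<le> k s" for s
    proof (cases "s < N")
      case True
      then have b: "(if Suc s < N then (int (k (Suc s)) - int (Suc s)) + 1 else 1 - int N) \<le> l' s" "l' s \<le> int (k s) - int s"
        using l' by (auto simp: PiE_iff)
      show ?thesis
      proof (cases "Suc s < N")
        case True
        then show ?thesis using b by auto
      next
        case False
        then show ?thesis using b assms[of "Suc s"] True by auto
      qed
    next
      case False
      then show ?thesis using assms by simp
    qed
    then show "?k \<in> strips N k" by (simp add: strips_def interl_def)
  qed
  show "(\<lambda>s. if s < N then nat (?f k' s + int s) else 0) = k'" if "k' \<in> strips N k" for k'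
    using that by (auto simp: strips_def fun_eq_iff)
  show "?f (\<lambda>s. if s < N then nat (l' s + int s) else 0) = l'" if l': "l' \<in> ?I" for l'
  proof
    fix i
    show "?f (\<lambda>s. if s < N then nat (l' s + int s) else 0) i = l' i"
    proof (cases "i < N")
      case True
      then have "(if Suc i < N then (int (k (Suc i)) - int (Suc i)) + 1 else 1 - int N) \<le> l' i"
        using l' by (auto simp: PiE_iff)
      with True show ?thesis by (auto split: if_splits)
    next
      case False
      with l' show ?thesis by (auto simp: PiE_iff extensional_def)
    qed
  qed
qed

lemma finite_strips: "(\<And>s. N \<le> s \<Longrightarrow> k s = 0) \<Longrightarrow> finite (strips N k)"
  using bij_betw_finite[OF strips_bij[of N k]] by (simp add: finite_PiE)

lemma GT_Suc_restrict:
  assumes "K \<in> GT (Suc L) k"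
  shows "K(Suc L := (\<lambda>_. 0)) \<in> GT L (K L)" "K L \<in> strips (Suc L div 2) k"
  using assms by (auto simp: GT_def strips_def)

lemma GT_Suc_extend:
  assumes "K \<in> GT L k'" "interl k' k" "\<And>s. Suc L \<le> 2 * s \<Longrightarrow> k s = 0"
  shows "K(Suc L := k) \<in> GT (Suc L) k"
  using assms unfolding GT_def by (auto simp: less_Suc_eq)

lemma GT_0: "GT 0 k = (if k = (\<lambda>_. 0) then {\<lambda>_ _. 0} else {})"
proof -
  have 1: "K = (\<lambda>_ _. 0) \<and> k = (\<lambda>_. 0)" if "K \<in> GT 0 k" for K
  proof -
    have K: "K 0 = k" "\<And>i. 0 < i \<Longrightarrow> K i = (\<lambda>_. 0)" "\<And>i s. i \<le> 2 * s \<Longrightarrow> K i s = 0"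
      using that by (simp_all add: GT_def)
    have k: "k = (\<lambda>_. 0)"
      using K(3)[of 0] by (simp add: fun_eq_iff flip: K(1))
    moreover have "K i = (\<lambda>_. 0)" for i
      using K(1,2) k by (cases "i = 0") auto
    ultimately show ?thesis by auto
  qed
  have 2: "(\<lambda>_ _. 0) \<in> GT 0 (\<lambda>_. 0)" by (simp add: GT_def)
  show ?thesis
  proof (cases "k = (\<lambda>_. 0)")
    case True
    have "GT 0 (\<lambda>_. 0) = {\<lambda>_ _. 0}"
    proof (intro equalityI subsetI)
      fix K assume "K \<in> GT 0 (\<lambda>_. 0)"
      from 1[of K] this show "K \<in> {\<lambda>_ _. 0}" unfolding True by simp
    qed (use 2 in simp)
    then show ?thesis unfolding True by (simp only: if_True simp_thms)
  next
    case False
    then have "GT 0 k = {}" using 1 by blast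
    with False show ?thesis by (simp only: if_False)
  qed
qed

lemma finite_GT: "finite (GT L k)"
proof (induction L arbitrary: k)
  case 0
  then show ?case by (simp add: GT_0)
next
  case (Suc L)
  show ?case
  proof (cases "\<forall>s. Suc L \<le> 2 * s \<longrightarrow> k s = 0")
    case True
    have "GT (Suc L) k \<subseteq> (\<Union>k'\<in>strips (Suc (Suc L) div 2) k. (\<lambda>K. K(Suc L := k)) ` GT L k')"
    proof
      fix K assume K: "K \<in> GT (Suc L) k"
      then have "K = (K(Suc L := (\<lambda>_. 0)))(Suc L := k)" by (auto simp: GT_def)
      moreover have "K L \<in> strips (Suc (Suc L) div 2) k"
        using GT_Suc_restrict(2)[OF K] by (auto simp: strips_def)
      ultimately show "K \<in> (\<Union>k'\<in>strips (Suc (Suc L) div 2) k. (\<lambda>K. K(Suc L := k)) ` GT L k')"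
        using GT_Suc_restrict(1)[OF K] by blast
    qed
    moreover have "finite (strips (Suc (Suc L) div 2) k)"
      using True by (intro finite_strips) auto
    ultimately show ?thesis
      using Suc by (meson finite_UN_I finite_imageI finite_subset)
  next
    case False
    then have "GT (Suc L) k = {}" by (auto simp: GT_def)
    then show ?thesis by simp
  qed
qed

lemma GT_sum_Suc:
  assumes "\<And>s. Suc L \<le> 2 * s \<Longrightarrow> k s = 0"
  shows "(\<Sum>K\<in>GT (Suc L) k. f K) = (\<Sum>k'\<in>strips (Suc L div 2) k. \<Sum>K\<in>GT L k'. f (K(Suc L := k)))"
proof -
  let ?T = "strips (Suc L div 2) k"
  have "?T \<subseteq> strips (Suc (Suc L) div 2) k" by (auto simp: strips_def)
  moreover have "finite (strips (Suc (Suc L) div 2) k)"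
    using assms by (intro finite_strips) auto
  ultimately have fin: "finite ?T" by (rule finite_subset)
  have "(\<Sum>K\<in>GT (Suc L) k. f K) = (\<Sum>k'\<in>?T. \<Sum>K\<in>{K\<in>GT (Suc L) k. K L = k'}. f K)"
    by (rule sum.group[symmetric]) (use fin finite_GT GT_Suc_restrict in auto)
  also have "\<dots> = (\<Sum>k'\<in>?T. \<Sum>K\<in>GT L k'. f (K(Suc L := k)))"
  proof (rule sum.cong[OF refl])
    fix k' assume k': "k' \<in> ?T"
    show "(\<Sum>K\<in>{K\<in>GT (Suc L) k. K L = k'}. f K) = (\<Sum>K\<in>GT L k'. f (K(Suc L := k)))"
    proof (rule sum.reindex_bij_witness[of _ "\<lambda>K. K(Suc L := k)" "\<lambda>K. K(Suc L := (\<lambda>_. 0))"])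
      fix K assume K: "K \<in> {K \<in> GT (Suc L) k. K L = k'}"
      then show "(K(Suc L := (\<lambda>_. 0)))(Suc L := k) = K" by (auto simp: GT_def)
      then show "f ((K(Suc L := (\<lambda>_. 0)))(Suc L := k)) = f K" by simp
      show "K(Suc L := (\<lambda>_. 0)) \<in> GT L k'" using K GT_Suc_restrict(1) by blast
    next
      fix K assume K: "K \<in> GT L k'"
      then show "(K(Suc L := k))(Suc L := (\<lambda>_. 0)) = K" by (auto simp: GT_def)
      have "interl k' k" using k' by (simp add: strips_def)
      with K assms show "K(Suc L := k) \<in> {K \<in> GT (Suc L) k. K L = k'}"
        using GT_Suc_extend[OF K] by (auto simp: GT_def)
    qed
  qed
  finally show ?thesis .
qed

lemma wtK_Suc:
  "wtK n (Suc L) (K(Suc L := k)) = wtK n L K + single (2 * n - Suc L) (lvl n k - lvl n (K L))"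
  by (simp add: wtK_def)

text \<open>Without variables only degree 0 survives. Above the last row the degree in column
  \<open>M\<close> is positive, so the column has at most its last entry, and this is nonzero only
  if row \<open>M\<close> is empty.\<close>

lemma cdet_hZ_last_empty:
  assumes "B M = {}"
  shows "cdet (Suc M) (\<lambda>i j. hZ (B j) (int (k i) - int i + int j)) =
    (if k M = 0 then cdet M (\<lambda>i j. hZ (B j) (int (k i) - int i + int j)) else 0)"
proof -
  let ?F = "\<lambda>i j. hZ (B j) (int (k i) - int i + int j)"
  have 0: "?F i M = 0" if "i < M" for i
    using that by (simp add: assms hZ_empty)
  have 1: "?F M M = (if k M = 0 then 1 else 0)"
    by (simp add: assms hZ_empty hS_empty)
  have "cdet (Suc M) ?F = (-1) ^ (M + M) * ?F M M * cdet M (\<lambda>i' j'. ?F (skip M i') (skip M j'))"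
    unfolding cdet_expand_col[OF lessI] sum.lessThan_Suc using 0 by simp
  also have "\<dots> = (if k M = 0 then cdet M (\<lambda>i' j'. ?F (skip M i') (skip M j')) else 0)"
    unfolding 1 by simp
  also have "cdet M (\<lambda>i' j'. ?F (skip M i') (skip M j')) = cdet M ?F"
    by (rule cdet_cong) simp
  finally show ?thesis .
qed

text \<open>Each new letter enters as a further variable in all columns and removes a horizontal
  strip. The size of the determinant grows exactly at the odd letters, so row \<open>s\<close> (from
  0) opens with the letter 2 s + 1.\<close>

theorem cdet_GT:
  assumes "L \<le> 2 * n" "\<And>s. L \<le> 2 * s \<Longrightarrow> k s = 0" "\<And>s. k (Suc s) \<le> k s"
  shows "cdet (Suc L div 2) (\<lambda>i j. hZ {2 * n - L..<2 * (n - j)} (int (k i) - int i + int j)) =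
    (\<Sum>K\<in>GT L k. frag_of (wtK n L K))"
  using assms
proof (induction L arbitrary: k)
  case 0
  then have "k = (\<lambda>_. 0)" by auto
  then show ?case by (simp add: GT_0 wtK_def)
next
  case (Suc L)
  let ?N = "Suc (Suc L) div 2" and ?x = "2 * n - Suc L"
  let ?B = "\<lambda>j. {2 * n - L..<2 * (n - j)}"
  let ?h = "\<lambda>k' i j. hZ (?B j) (int (k' i) - int i + int j)"
  have k0: "k s = 0" if "?N \<le> s" for s
    using Suc.prems(2)[of s] that by auto
  have N: "?N \<le> n" using Suc.prems(1) by auto
  have x: "Suc ?x = 2 * n - L" using Suc.prems(1) by auto
  have ins: "{?x..<2 * (n - j)} = insert ?x (?B j)" if "j < ?N" for j
    using that Suc.prems(1) by auto
  have "cdet ?N (\<lambda>i j. hZ {?x..<2 * (n - j)} (int (k i) - int i + int j)) =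
      cdet ?N (\<lambda>i j. hZ (insert ?x (?B j)) ((int (k i) - int i) + int j))"
    by (rule cdet_cong) (simp only: ins)
  also have "\<dots> = (\<Sum>l'\<in>PiE {..<?N} (\<lambda>i. {if Suc i < ?N then (int (k (Suc i)) - int (Suc i)) + 1 else 1 - int ?N..int (k i) - int i}).
       (\<Prod>i<?N. xv ?x ^ nat (int (k i) - int i - l' i)) * cdet ?N (\<lambda>i j. hZ (?B j) (l' i + int j)))"
  proof (rule cdet_hZ_horizontal)
    fix i
    show "int (k (Suc i)) - int (Suc i) < int (k i) - int i"
      using Suc.prems(3)[of i] by linarith
  qed (use x in auto)
  also have "\<dots> = (\<Sum>k'\<in>strips ?N k.
       (\<Prod>i<?N. xv ?x ^ nat (int (k i) - int i - restrict (\<lambda>i. int (k' i) - int i) {..<?N} i)) *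
       cdet ?N (\<lambda>i j. hZ (?B j) (restrict (\<lambda>i. int (k' i) - int i) {..<?N} i + int j)))"
    using k0 by (intro sum.reindex_bij_betw[symmetric] strips_bij) auto
  also have "\<dots> = (\<Sum>k'\<in>strips ?N k. frag_of (single ?x (lvl n k - lvl n k')) * cdet ?N (?h k'))"
  proof (rule sum.cong[OF refl])
    fix k' assume k': "k' \<in> strips ?N k"
    have "k' i \<le> k i" for i
      using k' by (simp add: strips_def interl_def)
    then have eq: "int (\<Sum>i<?N. k i - k' i) = (\<Sum>i<?N. int (k i) - int (k' i))"
      unfolding of_nat_sum by (intro sum.cong) (simp_all add: of_nat_diff)
    have "(\<Prod>i<?N. xv ?x ^ nat (int (k i) - int i - restrict (\<lambda>i. int (k' i) - int i) {..<?N} i)) =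
        xv ?x ^ (\<Sum>i<?N. k i - k' i)"
      unfolding power_sum
      by (rule prod.cong[OF refl]) (auto simp: nat_diff_distrib')
    also have "xv ?x ^ (\<Sum>i<?N. k i - k' i) = frag_of (single ?x (\<Sum>i<?N. int (k i) - int (k' i)))"
      by (simp only: xv_power eq)
    also have "(\<Sum>i<?N. int (k i) - int (k' i)) = (\<Sum>i<n. int (k i) - int (k' i))"
      using N k0 k' by (intro sum.mono_neutral_left) (auto simp: strips_def)
    also have "\<dots> = lvl n k - lvl n k'"
      by (simp add: lvl_def sum_subtractf)
    finally have "(\<Prod>i<?N. xv ?x ^ nat (int (k i) - int i - restrict (\<lambda>i. int (k' i) - int i) {..<?N} i)) =
        frag_of (single ?x (lvl n k - lvl n k'))" .
    moreover have "cdet ?N (\<lambda>i j. hZ (?B j) (restrict (\<lambda>i. int (k' i) - int i) {..<?N} i + int j)) = cdet ?N (?h k')"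
      by (rule cdet_cong) simp
    ultimately show "(\<Prod>i<?N. xv ?x ^ nat (int (k i) - int i - restrict (\<lambda>i. int (k' i) - int i) {..<?N} i)) *
       cdet ?N (\<lambda>i j. hZ (?B j) (restrict (\<lambda>i. int (k' i) - int i) {..<?N} i + int j)) =
       frag_of (single ?x (lvl n k - lvl n k')) * cdet ?N (?h k')" by simp
  qed
  also have "\<dots> = (\<Sum>k'\<in>strips (Suc L div 2) k. frag_of (single ?x (lvl n k - lvl n k')) * cdet (Suc L div 2) (?h k'))"
  \<comment> \<open>For even \<open>L\<close> the new column has no variables before the letter
    \<open>Suc L\<close> is added, which forces the new row to be empty at level
    \<open>L\<close>.\<close>
  proof (cases "even L")
    case False
    then have "Suc L div 2 = ?N" by presburger
    then show ?thesis by simp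
  next
    case True
    then obtain M where L: "L = 2 * M" by (elim evenE)
    have BM: "?B M = {}" using L by auto
    have "(\<Sum>k'\<in>strips ?N k. frag_of (single ?x (lvl n k - lvl n k')) * cdet ?N (?h k')) =
        (\<Sum>k'\<in>strips M k. frag_of (single ?x (lvl n k - lvl n k')) * cdet M (?h k'))"
    proof (rule sum.mono_neutral_cong_right)
      show "finite (strips ?N k)" using k0 by (rule finite_strips)
      show "strips M k \<subseteq> strips ?N k" using L by (auto simp: strips_def)
      have N: "?N = Suc M" using L by simp
      have c: "cdet ?N (?h k') = (if k' M = 0 then cdet M (?h k') else 0)" for k'
        unfolding N by (rule cdet_hZ_last_empty[where B = ?B, OF BM])
      show "\<forall>k'\<in>strips ?N k - strips M k. frag_of (single ?x (lvl n k - lvl n k')) * cdet ?N (?h k') = 0"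
      proof
        fix k' assume k': "k' \<in> strips ?N k - strips M k"
        then obtain s where "M \<le> s" "k' s \<noteq> 0" by (auto simp: strips_def)
        moreover have "k' s = 0" if "Suc M \<le> s" for s
          using k' that N by (auto simp: strips_def)
        ultimately have "k' M \<noteq> 0" by (metis le_antisym not_less_eq_eq)
        then show "frag_of (single ?x (lvl n k - lvl n k')) * cdet ?N (?h k') = 0" unfolding c by simp
      qed
      fix k' assume "k' \<in> strips M k"
      then show "frag_of (single ?x (lvl n k - lvl n k')) * cdet ?N (?h k') =
          frag_of (single ?x (lvl n k - lvl n k')) * cdet M (?h k')"
        unfolding c by (simp add: strips_def)
    qed
    then show ?thesis using L by simp
  qed
  also have "\<dots> = (\<Sum>k'\<in>strips (Suc L div 2) k. \<Sum>K\<in>GT L k'. frag_of (wtK n (Suc L) (K(Suc L := k))))"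
  proof (rule sum.cong[OF refl])
    fix k' assume k': "k' \<in> strips (Suc L div 2) k"
    have "cdet (Suc L div 2) (?h k') = (\<Sum>K\<in>GT L k'. frag_of (wtK n L K))"
    proof (rule Suc.IH)
      fix s
      show "k' (Suc s) \<le> k' s"
        using k' by (auto simp: strips_def interl_def intro: order.trans)
      assume "L \<le> 2 * s"
      then have "Suc L div 2 \<le> s" by auto
      with k' show "k' s = 0" by (simp add: strips_def)
    qed (use Suc.prems in simp)
    moreover have "frag_of (single ?x (lvl n k - lvl n k')) * frag_of (wtK n L K) = frag_of (wtK n (Suc L) (K(Suc L := k)))"
      if "K \<in> GT L k'" for K
      using that by (simp add: wtK_Suc frag_of_mult GT_def add.commute)
    ultimately show "frag_of (single ?x (lvl n k - lvl n k')) * cdet (Suc L div 2) (?h k') =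
        (\<Sum>K\<in>GT L k'. frag_of (wtK n (Suc L) (K(Suc L := k))))"
      by (simp add: sum_distrib_left)
  qed
  also have "\<dots> = (\<Sum>K\<in>GT (Suc L) k. frag_of (wtK n (Suc L) K))"
    using Suc.prems(2) by (rule GT_sum_Suc[symmetric])
  finally show ?case .
qed

lemma lookup_wtK:
  "lookup (wtK n (2 * n) K) q = (if q < 2 * n then lvl n (K (2 * n - q)) - lvl n (K (2 * n - Suc q)) else 0)"
proof -
  have "lookup (wtK n (2 * n) K) q = (\<Sum>i<2 * n. if i = 2 * n - Suc q \<and> q < 2 * n then lvl n (K (Suc i)) - lvl n (K i) else 0)"
    unfolding wtK_def lookup_sum by (rule sum.cong) (auto simp: lookup_single when_def)
  also have "\<dots> = (if q < 2 * n then lvl n (K (2 * n - q)) - lvl n (K (2 * n - Suc q)) else 0)"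
  proof (cases "q < 2 * n")
    case True
    then have "Suc (2 * n - Suc q) = 2 * n - q" by simp
    with True show ?thesis by (simp add: sum.delta)
  qed simp
  finally show ?thesis .
qed

section \<open>The Bender-Knuth involution\<close>

text \<open>The number of letters \<open>i\<close> minus the number of letters \<open>i + 1\<close> in the first \<open>c\<close> columns.\<close>

definition excess :: "nat \<Rightarrow> (nat \<Rightarrow> nat \<Rightarrow> nat) \<Rightarrow> nat \<Rightarrow> nat \<Rightarrow> int" where
  "excess n K i c = (\<Sum>s<n. 2 * int (min (K i s) c) - int (min (K (i - 1) s) c) - int (min (K (i + 1) s) c))"

text \<open>The height of column \<open>c\<close> of the shape \<open>a\<close>, with columns
  counted from 1.\<close>

definition ht :: "nat \<Rightarrow> nat \<Rightarrow> (nat \<Rightarrow> nat) \<Rightarrow> nat" where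
  "ht n c a = card {s. s < n \<and> c \<le> a s}"

lemma ht_iff:
  assumes "\<And>s. a (Suc s) \<le> a s"
  shows "s < ht n c a \<longleftrightarrow> s < n \<and> c \<le> a s"
proof -
  let ?S = "{s. s < n \<and> c \<le> a s}"
  have anti: "a t \<le> a s" if "s \<le> t" for s t
    using that assms by (metis lift_Suc_antimono_le)
  have "?S = {..<card ?S}"
  proof (cases "?S = {}")
    case True
    show ?thesis unfolding True by simp
  next
    case False
    have fin: "finite ?S" by simp
    have "?S = {..Max ?S}"
    proof (intro equalityI subsetI)
      fix s assume "s \<in> {..Max ?S}"
      moreover have "Max ?S \<in> ?S" using fin False by (rule Max_in)
      ultimately show "s \<in> ?S" using anti[of s "Max ?S"] by auto
    qed (use fin in auto)
    then have "?S = {..<Suc (Max ?S)}" by (simp add: lessThan_Suc_atMost)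
    then show ?thesis by (metis card_lessThan)
  qed
  then show ?thesis unfolding ht_def by (metis (mono_tags, lifting) lessThan_iff mem_Collect_eq)
qed

lemma ht_sum: "(\<Sum>s<n. if c \<le> a s then 1 else 0 :: int) = int (ht n c a)"
proof -
  have "{s. s < n \<and> c \<le> a s} = {s \<in> {..<n}. c \<le> a s}" by auto
  then show ?thesis by (simp add: ht_def sum.If_cases Int_def)
qed

lemma ht_interl:
  assumes "interl a b"
  shows "ht n c a \<le> ht n c b" "ht n c b \<le> Suc (ht n c a)"
proof -
  have ab: "a s \<le> b s" "b (Suc s) \<le> a s" for s
    using assms by (auto simp: interl_def)
  show "ht n c a \<le> ht n c b"
    unfolding ht_def using ab by (intro card_mono) (auto intro: order.trans)
  have "{s. s < n \<and> c \<le> b s} \<subseteq> insert 0 (Suc ` {s. s < n \<and> c \<le> a s})"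
  proof
    fix s assume s: "s \<in> {s. s < n \<and> c \<le> b s}"
    show "s \<in> insert 0 (Suc ` {s. s < n \<and> c \<le> a s})"
    proof (cases s)
      case (Suc t)
      with s ab(2)[of t] show ?thesis by auto
    qed simp
  qed
  then have "card {s. s < n \<and> c \<le> b s} \<le> card (insert 0 (Suc ` {s. s < n \<and> c \<le> a s}))"
    by (intro card_mono) auto
  also have "\<dots> \<le> Suc (card {s. s < n \<and> c \<le> a s})"
    by (simp add: card_insert_if card_image)
  finally show "ht n c b \<le> Suc (ht n c a)" by (simp add: ht_def)
qed

lemma GT_interl: "K \<in> GT L k \<Longrightarrow> Suc i \<le> L \<Longrightarrow> interl (K i) (K (Suc i))"
  by (simp add: GT_def)

lemma GT_antimono:
  assumes "K \<in> GT L k" "i \<le> L"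
  shows "K i (Suc s) \<le> K i s"
proof (cases i)
  case 0
  with assms show ?thesis by (simp add: GT_def)
next
  case (Suc j)
  then show ?thesis
    using GT_interl[OF assms(1), of j] assms(2) by (auto simp: interl_def intro: order.trans)
qed

lemma excess_Suc:
  "excess n K i (Suc c) = excess n K i c + 2 * int (ht n (Suc c) (K i)) - int (ht n (Suc c) (K (i - 1))) - int (ht n (Suc c) (K (i + 1)))"
proof -
  have m: "int (min a (Suc c)) = int (min a c) + (if Suc c \<le> a then 1 else 0)" for a
    by auto
  show ?thesis
    unfolding excess_def m ht_sum[symmetric] by (simp add: sum.distrib sum_subtractf sum_distrib_left algebra_simps)
qed

text \<open>The heights of a column at two consecutive levels differ by at most 1. The excess can
  thus increase only at a column that contains \<open>i\<close> but not \<open>i + 1\<close>, and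
  then only by 1; that letter \<open>i\<close> stands in row \<open>r\<close>.\<close>

lemma first_excess:
  assumes K: "K \<in> GT L k" and i: "1 \<le> i" "i < L" and c: "c = Suc c'"
    and bad: "excess n K i c' < excess n K i c"
  defines "r \<equiv> ht n c (K (i - 1))"
  shows "excess n K i c = excess n K i c' + 1"
    and "r < n" "c \<le> K i r" "K (i - 1) r < c" "Suc r < n \<Longrightarrow> K (i + 1) (Suc r) < c"
proof -
  let ?h = "\<lambda>j. ht n c (K j)"
  have int1: "?h (i - 1) \<le> ?h i" "?h i \<le> Suc (?h (i - 1))"
    using ht_interl[OF GT_interl[OF K, of "i - 1"]] i by auto
  have int2: "?h i \<le> ?h (i + 1)"
    using ht_interl[OF GT_interl[OF K, of i]] i by auto
  have ex: "excess n K i c = excess n K i c' + 2 * int (?h i) - int (?h (i - 1)) - int (?h (i + 1))"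
    unfolding c by (rule excess_Suc)
  then have hi: "?h i = Suc r" "?h (i + 1) = Suc r"
    using bad int1 int2 by (auto simp: r_def)
  then show "excess n K i c = excess n K i c' + 1"
    using ex by (simp add: r_def)
  have iff: "s < ?h j \<longleftrightarrow> s < n \<and> c \<le> K j s" if "j \<le> L" for j s
    using GT_antimono[OF K that] by (rule ht_iff)
  show "r < n" "c \<le> K i r" using iff[of i r] hi i by auto
  moreover have "i - 1 \<le> L" using i by simp
  ultimately show "K (i - 1) r < c" using iff[of "i - 1" r] by (simp add: r_def)
  show "Suc r < n \<Longrightarrow> K (i + 1) (Suc r) < c" using iff[of "i + 1" "Suc r"] hi i by simp
qed

text \<open>
  The Bender-Knuth involution on the letters \<open>i\<close>, \<open>i + 1\<close> in the columns to the right of column \<open>c\<close>;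
  row \<open>r\<close> is the last row that reaches these columns.
\<close>

definition lo :: "(nat \<Rightarrow> nat \<Rightarrow> nat) \<Rightarrow> nat \<Rightarrow> nat \<Rightarrow> nat \<Rightarrow> nat \<Rightarrow> nat" where
  "lo K i r c s = (if s = r then c else max (K (i + 1) (Suc s)) (K (i - 1) s))"

definition up :: "(nat \<Rightarrow> nat \<Rightarrow> nat) \<Rightarrow> nat \<Rightarrow> nat \<Rightarrow> nat" where
  "up K i s = (if s = 0 then K (i + 1) 0 else min (K (i + 1) s) (K (i - 1) (s - 1)))"

definition flip :: "nat \<Rightarrow> (nat \<Rightarrow> nat \<Rightarrow> nat) \<Rightarrow> nat \<Rightarrow> nat \<Rightarrow> nat \<Rightarrow> nat \<Rightarrow> nat" where
  "flip n K i c = (let r = ht n c (K (i - 1)) in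
     K(i := (\<lambda>s. if s \<le> r then lo K i r c s + up K i s - K i s else K i s)))"

context
  fixes n :: nat and K :: "nat \<Rightarrow> nat \<Rightarrow> nat" and L :: nat and k :: "nat \<Rightarrow> nat" and i c c' r :: nat
  assumes K: "K \<in> GT L k" and L: "L \<le> 2 * n" and i: "1 \<le> i" "i < L" and c: "c = Suc c'"
    and bad: "excess n K i c' < excess n K i c"
  defines "r \<equiv> ht n c (K (i - 1))"
begin

private lemma fe: "r < n" "c \<le> K i r" "K (i - 1) r < c" "Suc r < n \<Longrightarrow> K (i + 1) (Suc r) < c"
  using first_excess[OF K i c bad] unfolding r_def by blast+

private lemma il: "K i (Suc s) \<le> K (i - 1) s" "K (i - 1) s \<le> K i s" "K (i + 1) (Suc s) \<le> K i s" "K i s \<le> K (i + 1) s"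
  using GT_interl[OF K, of "i - 1"] GT_interl[OF K, of i] i by (auto simp: interl_def)

private lemma anti: "s \<le> t \<Longrightarrow> j \<le> L \<Longrightarrow> K j t \<le> K j s"
  using GT_antimono[OF K, of j] by (metis lift_Suc_antimono_le)

private lemma zero: "n \<le> s \<Longrightarrow> K j s = 0"
proof -
  assume "n \<le> s"
  then have "j \<le> 2 * s \<or> L < j" using L by linarith
  then show "K j s = 0" using K by (auto simp: GT_def)
qed

private lemma below: "r < s \<Longrightarrow> K (i + 1) s < c"
proof -
  assume "r < s"
  then have "K (i + 1) s \<le> K (i + 1) (Suc r)" using i by (intro anti) auto
  also have "\<dots> < c" using fe(4) zero[of "Suc r" "i + 1"] c by (cases "Suc r < n") auto
  finally show ?thesis .
qed

private lemma above: "s \<le> r \<Longrightarrow> c \<le> K i s"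
  using fe(2) anti[of s r i] i by simp

private lemma above': "s < r \<Longrightarrow> c \<le> K (i - 1) s"
  using above[of "Suc s"] il(1)[of s] by simp

private lemma bounds: "s \<le> r \<Longrightarrow> lo K i r c s \<le> K i s" "K i s \<le> up K i s" "s \<le> r \<Longrightarrow> c \<le> lo K i r c s"
proof -
  show "s \<le> r \<Longrightarrow> lo K i r c s \<le> K i s"
    using above[of s] il[of s] by (auto simp: lo_def)
  show "K i s \<le> up K i s"
    using il(4)[of s] il(1)[of "s - 1"] by (auto simp: up_def)
  show "s \<le> r \<Longrightarrow> c \<le> lo K i r c s"
    using above'[of s] by (auto simp: lo_def)
qed

lemma flip_other: "j \<noteq> i \<Longrightarrow> flip n K i c j = K j"
  by (simp add: flip_def Let_def)

private lemma flip_i: "flip n K i c i s = (if s \<le> r then lo K i r c s + up K i s - K i s else K i s)"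
  by (simp add: flip_def Let_def r_def)

private lemma flip_bounds: "s \<le> r \<Longrightarrow> lo K i r c s \<le> flip n K i c i s" "s \<le> r \<Longrightarrow> flip n K i c i s \<le> up K i s"
  using bounds[of s] by (auto simp: flip_i)

lemma flip_GT: "flip n K i c \<in> GT L k"
proof -
  let ?K = "flip n K i c"
  have 1: "interl (K (i - 1)) (?K i)"
    unfolding interl_def
  proof (intro allI conjI)
    fix s
    show "?K i (Suc s) \<le> K (i - 1) s"
      using flip_bounds(2)[of "Suc s"] il(1)[of s] by (cases "Suc s \<le> r") (auto simp: up_def flip_i)
    consider "s < r" | "s = r" | "r < s" by linarith
    then show "K (i - 1) s \<le> ?K i s"
    proof cases
      case 1
      then show ?thesis using flip_bounds(1)[of s] by (simp add: lo_def)
    next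
      case 2
      then show ?thesis using flip_bounds(1)[of s] fe(3) by (simp add: lo_def)
    next
      case 3
      then show ?thesis using il(2)[of s] by (simp add: flip_i)
    qed
  qed
  have 2: "interl (?K i) (K (i + 1))"
    unfolding interl_def
  proof (intro allI conjI)
    fix s
    show "?K i s \<le> K (i + 1) s"
      using flip_bounds(2)[of s] il(4)[of s] by (cases "s \<le> r") (auto simp: up_def flip_i split: if_splits)
    consider "s < r" | "s = r" | "r < s" by linarith
    then show "K (i + 1) (Suc s) \<le> ?K i s"
    proof cases
      case 1
      then show ?thesis using flip_bounds(1)[of s] by (simp add: lo_def)
    next
      case 2
      then show ?thesis using flip_bounds(1)[of s] below[of "Suc s"] by (simp add: lo_def)
    next
      case 3
      then show ?thesis using il(3)[of s] by (simp add: flip_i)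
    qed
  qed
  have "interl (?K j) (?K (Suc j))" if "j < L" for j
    using that 1 2 i GT_interl[OF K, of j] by (cases "j = i"; cases "Suc j = i") (auto simp: flip_other)
  moreover have "?K j s = 0" if "j \<le> 2 * s" for j s
  proof (cases "j = i")
    case True
    have "K i s = 0" using that True K by (simp add: GT_def)
    then have "\<not> s \<le> r" using above[of s] c by auto
    then show ?thesis using True \<open>K i s = 0\<close> by (simp add: flip_i)
  next
    case False
    then show ?thesis using that K by (simp add: flip_other GT_def)
  qed
  ultimately show ?thesis
    using K i by (auto simp: GT_def flip_other)
qed

text \<open>The columns up to \<open>c\<close> keep their letters, so a search for the first
  violation gives the same result before and after the flip.\<close>

lemma flip_excess: "c'' \<le> c \<Longrightarrow> excess n (flip n K i c) j c'' = excess n K j c''"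
proof -
  assume c'': "c'' \<le> c"
  have "min (flip n K i c j s) c'' = min (K j s) c''" for j s
  proof (cases "j = i \<and> s \<le> r")
    case True
    then show ?thesis using above[of s] flip_bounds(1)[of s] bounds(3)[of s] c'' by simp
  next
    case False
    then show ?thesis by (cases "j = i") (auto simp: flip_i flip_other)
  qed
  then show ?thesis by (simp add: excess_def)
qed

lemma flip_flip: "flip n (flip n K i c) i c = K"
proof -
  let ?K = "flip n K i c"
  have r: "ht n c (?K (i - 1)) = r" using i by (simp add: flip_other r_def)
  have lu: "lo ?K i r c s = lo K i r c s" "up ?K i s = up K i s" for s
    using i by (simp_all add: lo_def up_def flip_other)
  have "lo ?K i r c s + up ?K i s - ?K i s = K i s" if "s \<le> r" for s
    using bounds[of s] that by (simp add: lu flip_i)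
  then show ?thesis
    unfolding flip_def[of n ?K] r Let_def by (auto simp: fun_eq_iff flip_other flip_i)
qed

text \<open>The lower end in row \<open>s\<close> and the upper end in row \<open>s + 1\<close> are
  the maximum and the minimum of the same two numbers, so their sum is known and the sum over the
  rows telescopes.\<close>

lemma flip_lvl: "lvl n (K i) + lvl n (flip n K i c i) = lvl n (K (i + 1)) + lvl n (K (i - 1)) + excess n K i c"
proof -
  define v where "v s = int (up K i s) - int (K (i + 1) s)" for s
  define T where "T s = int (K i s) + int (flip n K i c i s) - int (K (i + 1) s) - int (K (i - 1) s)
    - (2 * int (min (K i s) c) - int (min (K (i - 1) s) c) - int (min (K (i + 1) s) c))" for s
  have T1: "T s = v s - v (Suc s)" if "s < r" for s
  proof -
    have "c \<le> K i s" "c \<le> K (i - 1) s" "c \<le> K (i + 1) s"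
      using above[of s] above'[of s] il(4)[of s] that by auto
    moreover have "int (K i s) + int (flip n K i c i s) = int (lo K i r c s) + int (up K i s)"
      using that bounds[of s] by (simp add: flip_i of_nat_diff)
    moreover have "int (lo K i r c s) + int (up K i (Suc s)) = int (K (i + 1) (Suc s)) + int (K (i - 1) s)"
      using that by (auto simp: lo_def up_def)
    ultimately show ?thesis by (simp add: T_def v_def)
  qed
  have T2: "T r = v r"
  proof -
    have "c \<le> K i r" "K (i - 1) r < c" "c \<le> K (i + 1) r"
      using fe il(4)[of r] by auto
    moreover have "int (K i r) + int (flip n K i c i r) = int c + int (up K i r)"
      using bounds[of r] by (simp add: flip_i of_nat_diff lo_def)
    ultimately show ?thesis by (simp add: T_def v_def)
  qed
  have T3: "T s = 0" if "r < s" for s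
  proof -
    have "K (i + 1) s < c" "K i s < c" "K (i - 1) s < c"
      using below[OF that] il[of s] by auto
    then show ?thesis using that by (simp add: T_def flip_i)
  qed
  have "(\<Sum>s<n. T s) = (\<Sum>s<Suc r. T s)"
    using fe(1) T3 by (intro sum.mono_neutral_right) auto
  also have "\<dots> = (\<Sum>s<r. v s - v (Suc s)) + v r"
    by (simp add: T1 T2)
  also have "\<dots> = 0"
    unfolding sum_lessThan_telescope' by (simp add: v_def up_def)
  finally show ?thesis
    by (simp add: T_def sum.distrib sum_subtractf lvl_def excess_def)
qed

end

text \<open>A violating pattern is flipped at its first violating column, for the least letter
  \<open>i\<close> there. At this place the excess is exactly \<open>d i + 1\<close>, and for this
  value \<open>flip_lvl\<close> says that the new exponent is the dot reflection of the old
  one.\<close>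

theorem GT_sum_good:
  assumes D: "alternating (2 * n) D"
    and d: "\<And>i. 1 \<le> i \<Longrightarrow> i < 2 * n \<Longrightarrow> d i = lookup u (2 * n - Suc i) - lookup u (2 * n - i) \<and> 0 \<le> d i"
  shows "(\<Sum>K\<in>GT (2 * n) k. D (u + wtK n (2 * n) K)) =
    (\<Sum>K\<in>{K\<in>GT (2 * n) k. \<forall>i c. 1 \<le> i \<longrightarrow> i < 2 * n \<longrightarrow> excess n K i c \<le> d i}. D (u + wtK n (2 * n) K))"
proof -
  define viol where "viol K c i \<longleftrightarrow> 1 \<le> i \<and> i < 2 * n \<and> d i < excess n K i c" for K c i
  define cc where "cc K = (LEAST c. \<exists>i. viol K c i)" for K
  define ii where "ii K = (LEAST i. viol K (cc K) i)" for K
  define g where "g K = flip n K (ii K) (cc K)" for K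
  define S where "S = {K \<in> GT (2 * n) k. \<exists>c i. viol K c i}"
  have "(\<Sum>K\<in>S. D (u + wtK n (2 * n) K)) = 0"
  proof (rule sum_involution_zero[where g = g])
    fix K assume "K \<in> S"
    then have K: "K \<in> GT (2 * n) k" and ex: "\<exists>c i. viol K c i" by (auto simp: S_def)
    let ?c = "cc K" and ?i = "ii K"
    have "\<exists>i. viol K ?c i" unfolding cc_def by (rule LeastI_ex) (rule ex)
    then have v: "viol K ?c ?i" unfolding ii_def by (rule LeastI_ex)
    then have i: "1 \<le> ?i" "?i < 2 * n" and exc: "d ?i < excess n K ?i ?c" by (auto simp: viol_def)
    have "?c \<noteq> 0"
    proof
      assume "?c = 0"
      then show False using exc d[OF i] by (simp add: excess_def)
    qed
    then obtain c' where c: "?c = Suc c'" by (cases ?c) auto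
    have min: "\<not> viol K c j" if "c < ?c" for c j
      using not_less_Least[of c "\<lambda>c. \<exists>i. viol K c i"] that unfolding cc_def by blast
    then have le: "excess n K ?i c' \<le> d ?i" using c i unfolding viol_def by force
    then have bad: "excess n K ?i c' < excess n K ?i ?c" using exc by simp
    note fl = K order_refl i c bad
    have e1: "excess n K ?i ?c = d ?i + 1"
      using first_excess(1)[OF K i c bad] exc le by simp
    have gK: "g K = flip n K ?i ?c" by (simp add: g_def)
    have vg: "viol (g K) c j \<longleftrightarrow> viol K c j" if "c \<le> ?c" for c j
      using flip_excess[OF fl that] by (simp add: viol_def gK)
    have ccg: "cc (g K) = ?c"
      unfolding cc_def[of "g K"]
    proof (rule Least_equality)
      show "\<exists>i. viol (g K) ?c i" using v vg by blast
      fix c assume "\<exists>i. viol (g K) c i"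
      then show "?c \<le> c" using vg[of c] min[of c] by (meson not_le order.strict_implies_order)
    qed
    have iig: "ii (g K) = ?i"
    proof -
      have "viol (g K) ?c = viol K ?c" using vg[OF order_refl] by (rule ext)
      then show ?thesis unfolding ii_def[of "g K"] ccg ii_def[of K] by (rule arg_cong)
    qed
    have gS: "g K \<in> S"
      using flip_GT[OF fl] v vg[OF order_refl] by (auto simp: S_def gK)
    moreover have "g (g K) = K"
      unfolding g_def[of "g K"] ccg iig unfolding gK by (rule flip_flip[OF fl])
    moreover have "D (u + wtK n (2 * n) (g K)) = - D (u + wtK n (2 * n) K)"
    proof -
      \<comment> \<open>The order of the variables is opposite to that of the letters:
        \<open>?p\<close> belongs to the letter \<open>?i + 1\<close> and \<open>Suc ?p\<close> to
        \<open>?i\<close>.\<close>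
      let ?p = "2 * n - Suc ?i"
      have p: "Suc ?p = 2 * n - ?i" "Suc ?p < 2 * n" "2 * n - ?p = Suc ?i" "2 * n - Suc ?p = ?i" "2 * n - Suc (Suc ?p) = ?i - 1"
        using i by auto
      have other: "g K j = K j" if "j \<noteq> ?i" for j
        unfolding gK by (rule flip_other[OF fl that])
      have lv: "lvl n (K ?i) + lvl n (g K ?i) = lvl n (K (Suc ?i)) + lvl n (K (?i - 1)) + d ?i + 1"
        using flip_lvl[OF fl] e1 by (simp add: gK)
      have du: "lookup u ?p - lookup u (Suc ?p) = d ?i"
        using d[OF i] p(1) by simp
      have "u + wtK n (2 * n) (g K) = sdot ?p (u + wtK n (2 * n) K)"
      proof (rule poly_mapping_eqI)
        fix q
        consider "q = ?p" | "q = Suc ?p" | "q \<noteq> ?p" "q \<noteq> Suc ?p" by blast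
        then show "lookup (u + wtK n (2 * n) (g K)) q = lookup (sdot ?p (u + wtK n (2 * n) K)) q"
        proof cases
          case 1
          then show ?thesis
            using lv du p i other[of "Suc ?i"] other[of "?i - 1"] by (simp add: lookup_sdot lookup_add lookup_wtK)
        next
          case 2
          then show ?thesis
            using lv du p i other[of "Suc ?i"] other[of "?i - 1"] by (simp add: lookup_sdot lookup_add lookup_wtK)
        next
          case 3
          then have "2 * n - q \<noteq> ?i" "2 * n - Suc q \<noteq> ?i" if "q < 2 * n"
            using that i by auto
          with 3 show ?thesis
            using other by (simp add: lookup_sdot lookup_add lookup_wtK)
        qed
      qed
      then show ?thesis using alternatingD[OF D p(2)] by simp
    qed
    ultimately show "g K \<in> S \<and> g (g K) = K \<and> D (u + wtK n (2 * n) (g K)) = - D (u + wtK n (2 * n) K)" by blast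
  qed
  moreover have "(\<Sum>K\<in>GT (2 * n) k. D (u + wtK n (2 * n) K)) =
      (\<Sum>K\<in>GT (2 * n) k - S. D (u + wtK n (2 * n) K)) + (\<Sum>K\<in>S. D (u + wtK n (2 * n) K))"
    by (rule sum.subset_diff) (auto simp: S_def finite_GT)
  moreover have "GT (2 * n) k - S = {K\<in>GT (2 * n) k. \<forall>i c. 1 \<le> i \<longrightarrow> i < 2 * n \<longrightarrow> excess n K i c \<le> d i}"
    unfolding S_def viol_def not_le[symmetric] by blast
  ultimately show ?thesis by simp
qed

section \<open>Dominance, parity and charge\<close>

lemma lvl_0 [simp]: "lvl n (\<lambda>_. 0) = 0"
  by (simp add: lvl_def)

lemma lvl_interl: "interl a b \<Longrightarrow> lvl n a \<le> lvl n b"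
  unfolding lvl_def by (rule sum_mono) (simp add: interl_def)

lemma lookup_muw: "lookup (muw n m) q = (\<Sum>k=1..n. if q < 2 * k then int (m k) else 0)"
  unfolding muw_def lookup_sum by (rule sum.cong) (simp_all add: lookup_sum lookup_coord)

text \<open>The gap of the partition between the variables of the letters \<open>i + 1\<close> and
  \<open>i\<close>. The rows come in equal pairs, so there is none for odd \<open>i\<close>.\<close>

definition mdiff :: "nat \<Rightarrow> (nat \<Rightarrow> nat) \<Rightarrow> nat \<Rightarrow> int" where
  "mdiff n m i = (if even i then int (m (n - i div 2)) else 0)"

lemma muw_diff:
  assumes i: "1 \<le> i" "i < 2 * n"
  shows "lookup (muw n m) (2 * n - Suc i) - lookup (muw n m) (2 * n - i) = mdiff n m i"
proof -
  have "lookup (muw n m) (2 * n - Suc i) - lookup (muw n m) (2 * n - i) =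
      (\<Sum>k=1..n. if 2 * k = 2 * n - i then int (m k) else 0)"
    unfolding lookup_muw sum_subtractf[symmetric] by (rule sum.cong) (use i in auto)
  also have "\<dots> = mdiff n m i"
  proof (cases "even i")
    case True
    then obtain j where j: "i = 2 * j" by (elim evenE)
    have "2 * k = 2 * n - i \<longleftrightarrow> k = n - j" for k using i j by auto
    then show ?thesis using i j by (simp add: mdiff_def sum.delta)
  next
    case False
    then have "2 * k \<noteq> 2 * n - i" for k using i by presburger
    with False show ?thesis by (simp add: mdiff_def)
  qed
  finally show ?thesis .
qed

text \<open>For every permutation the degrees along its entries add up to the size of the shape, so
  the determinant has a single power of t.\<close>

lemma KSdet_nth:
  assumes k: "\<And>s. k (Suc s) \<le> k s" "\<And>s. n \<le> s \<Longrightarrow> k s = 0"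
  shows "fps_nth (KSdet n (\<lambda>i. int (k i) + int n - int i)) N =
    (if int N = lvl n k then \<Sum>K\<in>GT (2 * n) k. frag_of (wtK n (2 * n) K) else 0)"
proof -
  let ?e = "\<lambda>p i. int (k i) - int i + int (p i)"
  let ?B = "\<lambda>j. {2 * n - 2 * n..<2 * (n - j)}"
  have prod: "(\<Prod>i<n. hq {..<2 * (n - p i)} (?e p i)) =
      fps_const (\<Prod>i<n. hZ (?B (p i)) (?e p i)) * fps_X ^ nat (lvl n k)"
    if p: "p permutes {0..<n}" for p
  proof (cases "\<forall>i<n. 0 \<le> ?e p i")
    case True
    have "(\<Sum>i<n. int (p i)) = (\<Sum>i<n. int i)"
      using sum.permute[OF p, of int] by (simp add: atLeast0LessThan o_def)
    then have "(\<Sum>i<n. ?e p i) = lvl n k"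
      by (simp add: lvl_def sum.distrib sum_subtractf)
    then have "int (\<Sum>i<n. nat (?e p i)) = lvl n k" using True by simp
    then have "(\<Sum>i<n. nat (?e p i)) = nat (lvl n k)" by (metis nat_int)
    moreover have "(\<Prod>i<n. hq {..<2 * (n - p i)} (?e p i)) =
        (\<Prod>i<n. fps_const (hZ (?B (p i)) (?e p i))) * fps_X ^ (\<Sum>i<n. nat (?e p i))"
      by (simp add: hq_def prod.distrib power_sum atLeast0LessThan)
    moreover have "(\<Prod>i<n. fps_const (f i)) = fps_const (\<Prod>i<n. f i)" for f :: "nat \<Rightarrow> laurent"
      by (induction n) simp_all
    ultimately show ?thesis by simp
  next
    case False
    then obtain i where i: "i < n" "?e p i < 0" by auto
    then have "(\<Prod>i<n. hq {..<2 * (n - p i)} (?e p i)) = 0"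
      by (intro prod_zero) (auto intro!: bexI[of _ i])
    moreover have "(\<Prod>i<n. hZ (?B (p i)) (?e p i)) = 0"
      using i by (intro prod_zero) (auto intro!: bexI[of _ i])
    ultimately show ?thesis by (simp only: fps_const_0_eq_0 mult_zero_left)
  qed
  have "KSdet n (\<lambda>i. int (k i) + int n - int i) = cdet n (\<lambda>i j. hq {..<2 * (n - j)} (int (k i) - int i + int j))"
    unfolding KSdet_def by (rule cdet_cong) (simp add: of_nat_diff algebra_simps)
  also have "\<dots> = (\<Sum>p | p permutes {0..<n}. of_int (sign p) * (fps_const (\<Prod>i<n. hZ (?B (p i)) (?e p i)) * fps_X ^ nat (lvl n k)))"
    unfolding cdet_leibniz atLeast0LessThan[symmetric] by (rule sum.cong[OF refl]) (simp add: prod atLeast0LessThan)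
  also have "\<dots> = fps_const (cdet n (\<lambda>i j. hZ (?B j) (int (k i) - int i + int j))) * fps_X ^ nat (lvl n k)"
  proof -
    have sc: "of_int (sign p) * fps_const c = fps_const (of_int (sign p) * c)" for p :: "nat \<Rightarrow> nat" and c :: laurent
      by (cases p rule: sign_cases) (simp_all flip: fps_const_neg)
    have cs: "(\<Sum>p\<in>P. fps_const (f p)) = fps_const (\<Sum>p\<in>P. f p)" for P :: "(nat \<Rightarrow> nat) set" and f :: "_ \<Rightarrow> laurent"
      by (induction P rule: infinite_finite_induct) simp_all
    show ?thesis
      unfolding cdet_leibniz by (simp only: mult.assoc[symmetric] sc sum_distrib_right[symmetric] cs atLeast0LessThan)
  qed
  also have "cdet n (\<lambda>i j. hZ (?B j) (int (k i) - int i + int j)) = (\<Sum>K\<in>GT (2 * n) k. frag_of (wtK n (2 * n) K))"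
    using cdet_GT[of "2 * n" n k] k by simp
  finally have "KSdet n (\<lambda>i. int (k i) + int n - int i) =
      fps_const (\<Sum>K\<in>GT (2 * n) k. frag_of (wtK n (2 * n) K)) * fps_X ^ nat (lvl n k)" .
  moreover have "0 \<le> lvl n k" by (simp add: lvl_def sum_nonneg)
  ultimately show ?thesis
    by (auto simp: fps_X_power_nth)
qed

text \<open>The function \<open>excess n K i\<close> is constant beyond the columns of the top shape, so the range of the maximum loses nothing.\<close>

definition eps :: "nat \<Rightarrow> (nat \<Rightarrow> nat \<Rightarrow> nat) \<Rightarrow> nat \<Rightarrow> nat" where
  "eps n K i = nat (Max ((\<lambda>c. excess n K i c - excess n K i (K (2 * n) 0)) ` {..K (2 * n) 0}))"

text \<open>The number of letters \<open>i\<close> minus the number of letters \<open>i + 1\<close>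
  in the whole tableau.\<close>

definition tot :: "nat \<Rightarrow> (nat \<Rightarrow> nat \<Rightarrow> nat) \<Rightarrow> nat \<Rightarrow> int" where
  "tot n K i = 2 * lvl n (K i) - lvl n (K (i - 1)) - lvl n (K (i + 1))"

definition chargeK :: "nat \<Rightarrow> (nat \<Rightarrow> nat \<Rightarrow> nat) \<Rightarrow> nat" where
  "chargeK n K = (\<Sum>i=1..2 * n - 1. (2 * n - i) * ((eps n K i + 1) div 2))"

text \<open>The bound on the excess says phi_i = 0. Then eps_i = - tot_i, so the parity of eps_i can
  be stated for \<open>tot\<close>.\<close>

definition distinguished :: "nat \<Rightarrow> (nat \<Rightarrow> nat) \<Rightarrow> (nat \<Rightarrow> nat \<Rightarrow> nat) set" where
  "distinguished n k = {K \<in> GT (2 * n) k. \<forall>i. odd i \<longrightarrow> i < 2 * n \<longrightarrow> (\<forall>c. excess n K i c \<le> 0) \<and> even (tot n K i)}"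

lemma GT_le_top:
  assumes K: "K \<in> GT L k"
  shows "K j s \<le> k 0"
proof (cases "j \<le> L")
  case True
  have "K j s \<le> K L s"
    using True
  proof (induction rule: inc_induct)
    case (step i)
    then show ?case
      using GT_interl[OF K, of i] by (auto simp: interl_def intro: order.trans)
  qed simp
  moreover have "K L s \<le> K L 0"
    using GT_antimono[OF K order_refl] by (metis le0 lift_Suc_antimono_le)
  moreover have "K L = k" using K by (simp add: GT_def)
  ultimately show ?thesis by auto
next
  case False
  then show ?thesis using K by (simp add: GT_def)
qed

context
  fixes n :: nat and k :: "nat \<Rightarrow> nat" and K :: "nat \<Rightarrow> nat \<Rightarrow> nat"
  assumes n: "1 \<le> n" and k: "\<And>s. k (Suc s) \<le> k s" "\<And>s. n \<le> s \<Longrightarrow> k s = 0" and K: "K \<in> GT (2 * n) k"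
begin

lemma excess_top: "k 0 \<le> c \<Longrightarrow> excess n K i c = tot n K i"
proof -
  assume c: "k 0 \<le> c"
  have "min (K j s) c = K j s" for j s
    using GT_le_top[OF K, of j s] c by simp
  then show ?thesis
    by (simp add: excess_def tot_def lvl_def sum_subtractf sum_distrib_left)
qed

lemma K_top: "K (2 * n) = k"
  using K by (simp add: GT_def)

lemma eps_bound: "excess n K i c - tot n K i \<le> int (eps n K i)"
proof -
  have "excess n K i (min c (k 0)) - tot n K i \<in> (\<lambda>c. excess n K i c - excess n K i (k 0)) ` {..k 0}"
  proof (rule image_eqI[of _ _ "min c (k 0)"])
    show "min c (k 0) \<in> {..k 0}" unfolding atMost_iff by (rule min.cobounded2)
    show "excess n K i (min c (k 0)) - tot n K i = excess n K i (min c (k 0)) - excess n K i (k 0)"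
      unfolding excess_top[OF order_refl, of i] ..
  qed
  then have "excess n K i (min c (k 0)) - tot n K i \<le> Max ((\<lambda>c. excess n K i c - excess n K i (k 0)) ` {..k 0})"
    by (intro Max_ge) simp_all
  then have "excess n K i (min c (k 0)) - tot n K i \<le> int (eps n K i)"
    unfolding eps_def K_top by linarith
  moreover have "excess n K i (min c (k 0)) = excess n K i c"
    by (cases "c \<le> k 0") (auto simp: excess_top min_def)
  ultimately show ?thesis by simp
qed

lemma eps_attained: "\<exists>c. excess n K i c - tot n K i = int (eps n K i)"
proof -
  let ?S = "(\<lambda>c. excess n K i c - excess n K i (k 0)) ` {..k 0}"
  have "Max ?S \<in> ?S" by (rule Max_in) auto
  then obtain c where "Max ?S = excess n K i c - excess n K i (k 0)" by blast
  moreover have "0 \<le> Max ?S" by (rule Max_ge) (simp, rule image_eqI[of _ _ "k 0"], simp_all)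
  then have "int (eps n K i) = Max ?S" unfolding eps_def K_top by simp
  ultimately have "excess n K i c - tot n K i = int (eps n K i)"
    using excess_top[OF order_refl, of i] by linarith
  then show ?thesis ..
qed

text \<open>The maximum of the excess over all columns is \<open>tot + eps\<close>, the crystal
  statistic phi_i.\<close>

lemma excess_le_iff: "(\<forall>c. excess n K i c \<le> m) \<longleftrightarrow> tot n K i + int (eps n K i) \<le> m"
  using eps_bound[of i] eps_attained[of i] by (smt (verit))

lemma K_0: "K 0 = (\<lambda>_. 0)"
  using K by (auto simp: GT_def)

text \<open>A letter 1 would stand at the top of the first column, with no 2 below it because the
  entries of the second row are at least 3. Then the excess after one column would be 1.\<close>

lemma K_1_0: "(\<forall>c. excess n K 1 c \<le> 0) \<Longrightarrow> lvl n (K 1) = 0"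
proof (rule ccontr)
  assume ex: "\<forall>c. excess n K 1 c \<le> 0" and nz: "lvl n (K 1) \<noteq> 0"
  have z: "K 1 s = 0" "K 2 s = 0" if "0 < s" for s
    using K that by (auto simp: GT_def)
  have sum0: "(\<Sum>s<n. f s) = f 0" if "\<And>s. 0 < s \<Longrightarrow> f s = 0" for f :: "nat \<Rightarrow> int"
  proof -
    have "(\<Sum>s<n. f s) = (\<Sum>s\<in>{0}. f s)"
      using n that by (intro sum.mono_neutral_right) auto
    then show ?thesis by simp
  qed
  have "lvl n (K 1) = int (K 1 0)"
    unfolding lvl_def by (rule sum0) (simp add: z[unfolded One_nat_def])
  then have "0 < K 1 0" using nz by simp
  moreover have "excess n K 1 1 = 2 * int (min (K 1 0) 1) - int (min (K 0 0) 1) - int (min (K 2 0) 1)"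
    unfolding excess_def by (subst sum0) (simp_all add: z[unfolded One_nat_def numeral_2_eq_2] K_0 numeral_2_eq_2)
  ultimately show False using ex[rule_format, of 1] by (auto simp: K_0)
qed

lemma excess_bounds: "0 \<le> tot n K i + int (eps n K i)"
  using excess_le_iff[of i "tot n K i + int (eps n K i)"] by (auto simp: excess_def dest: spec[of _ 0])

text \<open>With i = 2 n - 2 j, this is the least number that is at least phi_i = tot_i + eps_i and
  has the parity of tot_i.\<close>

definition bb :: "nat \<Rightarrow> nat" where
  "bb j = (if 1 \<le> j \<and> j < n then nat (tot n K (2 * n - 2 * j) + 2 * int ((eps n K (2 * n - 2 * j) + 1) div 2)) else 0)"

lemma int_bb: "1 \<le> j \<Longrightarrow> j < n \<Longrightarrow> int (bb j) = tot n K (2 * n - 2 * j) + 2 * int ((eps n K (2 * n - 2 * j) + 1) div 2)"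
proof -
  have "0 \<le> tot n K i + 2 * int ((eps n K i + 1) div 2)" for i
    using excess_bounds[of i] by linarith
  then show "1 \<le> j \<Longrightarrow> j < n \<Longrightarrow> int (bb j) = tot n K (2 * n - 2 * j) + 2 * int ((eps n K (2 * n - 2 * j) + 1) div 2)"
    by (simp add: bb_def)
qed

lemma wt_diff:
  assumes i: "1 \<le> i" "i < 2 * n"
  shows "lookup (muw n m + wtK n (2 * n) K) (2 * n - Suc i) - lookup (muw n m + wtK n (2 * n) K) (2 * n - i) = mdiff n m i - tot n K i"
proof -
  have "2 * n - (2 * n - Suc i) = Suc i" "2 * n - (2 * n - i) = i" "2 * n - Suc (2 * n - Suc i) = i"
    "2 * n - Suc (2 * n - i) = i - 1" "2 * n - Suc i < 2 * n" "2 * n - i < 2 * n" using i by auto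
  then show ?thesis
    using muw_diff[OF i, of m] by (simp add: lookup_add lookup_wtK tot_def)
qed

lemma wt_last: "lookup (muw n m + wtK n (2 * n) K) (2 * n - 1) = int (m n) + lvl n (K 1)"
proof -
  have "lookup (muw n m) (2 * n - 1) = (\<Sum>k=1..n. if k = n then int (m k) else 0)"
    unfolding lookup_muw using n by (intro sum.cong) auto
  then have "lookup (muw n m) (2 * n - 1) = int (m n)" using n by (simp add: sum.delta)
  moreover have "2 * n - (2 * n - 1) = 1" "2 * n - Suc (2 * n - 1) = 0" "2 * n - 1 < 2 * n" using n by auto
  ultimately show ?thesis by (simp add: lookup_add lookup_wtK K_0)
qed

text \<open>All parts are even if and only if the last part and all consecutive differences are. The
  last variable belongs to the letter 1, which occurs \<open>lvl n (K 1)\<close> times.\<close>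

lemma even_partition_iff:
  "even_partition (2 * n) (muw n m + wtK n (2 * n) K) \<longleftrightarrow>
    even (int (m n) + lvl n (K 1)) \<and> (\<forall>i. 1 \<le> i \<longrightarrow> i < 2 * n \<longrightarrow> even (mdiff n m i - tot n K i))"
    (is "?E \<longleftrightarrow> ?L \<and> ?D")
proof
  let ?a = "\<lambda>q. lookup (muw n m + wtK n (2 * n) K) q"
  assume E: ?E
  then have ev: "even (?a q)" if "q < 2 * n" for q using that by (simp add: even_partition_def)
  have ?L using ev[of "2 * n - 1"] n unfolding wt_last by simp
  moreover have ?D
  proof (intro allI impI)
    fix i assume i: "1 \<le> i" "i < 2 * n"
    then show "even (mdiff n m i - tot n K i)"
      using ev[of "2 * n - Suc i"] ev[of "2 * n - i"] by (simp flip: wt_diff[OF i])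
  qed
  ultimately show "?L \<and> ?D" ..
next
  let ?a = "\<lambda>q. lookup (muw n m + wtK n (2 * n) K) q"
  assume LD: "?L \<and> ?D"
  have ev: "i < 2 * n \<Longrightarrow> even (?a (2 * n - Suc i))" for i
  proof (induction i)
    case 0
    then show ?case using LD wt_last[of m] unfolding One_nat_def by simp
  next
    case (Suc i)
    then have "even (mdiff n m (Suc i) - tot n K (Suc i))" "even (?a (2 * n - Suc i))" using LD by auto
    moreover have "?a (2 * n - Suc (Suc i)) - ?a (2 * n - Suc i) = mdiff n m (Suc i) - tot n K (Suc i)"
      using wt_diff[of "Suc i" m] Suc.prems by simp
    ultimately show ?case by presburger
  qed
  have "even (?a q)" if "q < 2 * n" for q
  proof -
    have "2 * n - Suc (2 * n - Suc q) = q" "2 * n - Suc q < 2 * n" using that by simp_all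
    then show ?thesis using ev[of "2 * n - Suc q"] by simp
  qed
  then show ?E by (simp add: even_partition_def)
qed

text \<open>At odd \<open>i\<close> there is no gap, so the conditions concern \<open>K\<close>
  alone; at i = 2 n - 2 j they concern only the multiplicity \<open>m j\<close>. Evenness of the
  last part becomes evenness of \<open>m n\<close>, since letter 1 is absent by
  \<open>K_1_0\<close>.\<close>

lemma good_even_iff:
  "(\<forall>i c. 1 \<le> i \<longrightarrow> i < 2 * n \<longrightarrow> excess n K i c \<le> mdiff n m i) \<and>
     even_partition (2 * n) (muw n m + wtK n (2 * n) K) \<longleftrightarrow>
   K \<in> distinguished n k \<and> (\<forall>j. 1 \<le> j \<longrightarrow> j \<le> n \<longrightarrow> bb j \<le> m j \<and> even (m j - bb j))"
   (is "?G \<and> ?E \<longleftrightarrow> ?K \<and> ?M")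
proof -
  let ?odd = "\<lambda>i. odd i \<and> i < 2 * n" and ?ev = "\<lambda>j. 1 \<le> j \<and> j < n"
  have K1: "lvl n (K 1) = 0" if "\<forall>i. ?odd i \<longrightarrow> (\<forall>c. excess n K i c \<le> 0)"
    using that n by (intro K_1_0) auto
  have spl: "(\<forall>i. 1 \<le> i \<longrightarrow> i < 2 * n \<longrightarrow> P i) \<longleftrightarrow> (\<forall>i. ?odd i \<longrightarrow> P i) \<and> (\<forall>j. ?ev j \<longrightarrow> P (2 * n - 2 * j))" for P
  proof (intro iffI conjI allI impI; (elim conjE)?)
    fix i assume P: "\<forall>i. ?odd i \<longrightarrow> P i" "\<forall>j. ?ev j \<longrightarrow> P (2 * n - 2 * j)" and i: "1 \<le> i" "i < 2 * n"
    show "P i"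
    proof (cases "even i")
      case True
      then obtain j where "i = 2 * j" by (elim evenE)
      with P(2)[rule_format, of "n - j"] i show ?thesis by (simp add: diff_mult_distrib2)
    qed (use P(1) i in simp)
  next
    fix i assume P: "\<forall>i. 1 \<le> i \<longrightarrow> i < 2 * n \<longrightarrow> P i" and i: "odd i" "i < 2 * n"
    show "P i" using P[rule_format, of i] i odd_pos[OF i(1)] by simp
  qed auto
  have md: "mdiff n m i = 0" if "odd i" for i using that by (simp add: mdiff_def)
  have me: "mdiff n m (2 * n - 2 * j) = int (m j)" if "?ev j" for j
    using that by (simp add: mdiff_def flip: diff_mult_distrib2)
  have e1: "?G \<and> ?E \<longleftrightarrow> (\<forall>i. ?odd i \<longrightarrow> (\<forall>c. excess n K i c \<le> 0) \<and> even (tot n K i)) \<and> even (m n) \<and>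
      (\<forall>j. ?ev j \<longrightarrow> (\<forall>c. excess n K (2 * n - 2 * j) c \<le> int (m j)) \<and> even (int (m j) - tot n K (2 * n - 2 * j)))"
  proof -
    have G: "?G \<longleftrightarrow> (\<forall>i. 1 \<le> i \<longrightarrow> i < 2 * n \<longrightarrow> (\<forall>c. excess n K i c \<le> mdiff n m i))" by blast
    show ?thesis
      unfolding G even_partition_iff spl
    proof (intro iffI; elim conjE)
      assume a: "\<forall>i. ?odd i \<longrightarrow> (\<forall>c. excess n K i c \<le> mdiff n m i)" "\<forall>j. ?ev j \<longrightarrow> (\<forall>c. excess n K (2 * n - 2 * j) c \<le> mdiff n m (2 * n - 2 * j))"
        "even (int (m n) + lvl n (K 1))" "\<forall>i. ?odd i \<longrightarrow> even (mdiff n m i - tot n K i)" "\<forall>j. ?ev j \<longrightarrow> even (mdiff n m (2 * n - 2 * j) - tot n K (2 * n - 2 * j))"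
      have "\<forall>i. ?odd i \<longrightarrow> (\<forall>c. excess n K i c \<le> 0)" using a(1) md by simp
      moreover from this have "even (m n)" using a(3) K1 by simp
      ultimately show "(\<forall>i. ?odd i \<longrightarrow> (\<forall>c. excess n K i c \<le> 0) \<and> even (tot n K i)) \<and> even (m n) \<and>
        (\<forall>j. ?ev j \<longrightarrow> (\<forall>c. excess n K (2 * n - 2 * j) c \<le> int (m j)) \<and> even (int (m j) - tot n K (2 * n - 2 * j)))"
        using a(2,4,5) md me by simp
    next
      assume a: "\<forall>i. ?odd i \<longrightarrow> (\<forall>c. excess n K i c \<le> 0) \<and> even (tot n K i)" "even (m n)"
        "\<forall>j. ?ev j \<longrightarrow> (\<forall>c. excess n K (2 * n - 2 * j) c \<le> int (m j)) \<and> even (int (m j) - tot n K (2 * n - 2 * j))"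
      have "lvl n (K 1) = 0" using a(1) by (intro K1) simp
      then show "((\<forall>i. ?odd i \<longrightarrow> (\<forall>c. excess n K i c \<le> mdiff n m i)) \<and> (\<forall>j. ?ev j \<longrightarrow> (\<forall>c. excess n K (2 * n - 2 * j) c \<le> mdiff n m (2 * n - 2 * j)))) \<and>
        even (int (m n) + lvl n (K 1)) \<and> (\<forall>i. ?odd i \<longrightarrow> even (mdiff n m i - tot n K i)) \<and> (\<forall>j. ?ev j \<longrightarrow> even (mdiff n m (2 * n - 2 * j) - tot n K (2 * n - 2 * j)))"
        using a md me by simp
    qed
  qed
  have e2: "(\<forall>i. ?odd i \<longrightarrow> (\<forall>c. excess n K i c \<le> 0) \<and> even (tot n K i)) \<longleftrightarrow> ?K"
    using K by (auto simp: distinguished_def)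
  have e3: "(\<forall>j. ?ev j \<longrightarrow> (\<forall>c. excess n K (2 * n - 2 * j) c \<le> int (m j)) \<and> even (int (m j) - tot n K (2 * n - 2 * j))) \<longleftrightarrow>
      (\<forall>j. ?ev j \<longrightarrow> bb j \<le> m j \<and> even (m j - bb j))"
  proof -
    have "(\<forall>c. excess n K (2 * n - 2 * j) c \<le> int (m j)) \<and> even (int (m j) - tot n K (2 * n - 2 * j)) \<longleftrightarrow>
        bb j \<le> m j \<and> even (m j - bb j)" if j: "?ev j" for j
    proof -
      let ?t = "tot n K (2 * n - 2 * j)" and ?e = "eps n K (2 * n - 2 * j)"
      have b: "int (bb j) = ?t + 2 * int ((?e + 1) div 2)" using int_bb j by simp
      have "?t + int ?e \<le> int (m j) \<and> even (int (m j) - ?t) \<longleftrightarrow> int (bb j) \<le> int (m j) \<and> even (int (m j) - int (bb j))"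
        unfolding b by presburger
      also have "\<dots> \<longleftrightarrow> bb j \<le> m j \<and> even (m j - bb j)"
        by (auto simp flip: of_nat_diff)
      finally show ?thesis unfolding excess_le_iff .
    qed
    then show ?thesis by (intro all_cong1 imp_cong refl)
  qed
  have "bb n = 0" by (simp add: bb_def)
  then have e4: "even (m n) \<and> (\<forall>j. ?ev j \<longrightarrow> bb j \<le> m j \<and> even (m j - bb j)) \<longleftrightarrow> ?M"
    using n by (metis diff_zero le_neq_implies_less less_imp_le_nat order_refl zero_le)
  show ?thesis unfolding e1 e2 e3 e4 ..
qed

lemma sum_second_diff: "(\<Sum>i=1..M. 2 * a i - a (i - 1) - a (i + 1)) = (a 1 - a 0 - a (Suc M) + a M :: int)"
  by (induction M) simp_all

lemma sum_weighted_second_diff: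
  "(\<Sum>i=1..M. int (Suc M - i) * (2 * a i - a (i - 1) - a (i + 1))) = (int (Suc M) * a 1 - int M * a 0 - a (Suc M) :: int)"
proof (induction M)
  case (Suc M)
  let ?b = "\<lambda>i. 2 * a i - a (i - 1) - a (i + 1)"
  have "(\<Sum>i=1..Suc M. int (Suc (Suc M) - i) * ?b i) = (\<Sum>i=1..Suc M. int (Suc M - i) * ?b i) + (\<Sum>i=1..Suc M. ?b i)"
    unfolding sum.distrib[symmetric] by (rule sum.cong) (simp_all add: Suc_diff_le algebra_simps)
  also have "(\<Sum>i=1..Suc M. int (Suc M - i) * ?b i) = (\<Sum>i=1..M. int (Suc M - i) * ?b i)" by simp
  finally show ?case unfolding Suc.IH sum_second_diff by (simp add: algebra_simps)
qed simp

text \<open>The numbers \<open>tot\<close> are second differences of the level sizes, so summing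
  them with the weights 2 n - i leaves only the boundary term - |\<lambda>|. Twice the rounded half
  of \<open>eps\<close> is \<open>- tot\<close> at odd \<open>i\<close>, and \<open>bb - tot\<close>
  at even \<open>i\<close>.\<close>

lemma charge_bb:
  assumes dist: "K \<in> distinguished n k"
  shows "2 * int (chargeK n K) = lvl n k + (\<Sum>j=1..n. 2 * int j * int (bb j))"
proof -
  have odd: "2 * int ((eps n K i + 1) div 2) = - tot n K i" if "odd i" "i < 2 * n" for i
  proof -
    have "tot n K i + int (eps n K i) \<le> 0"
      using dist that unfolding excess_le_iff[symmetric] by (simp add: distinguished_def)
    then have e: "int (eps n K i) = - tot n K i" using excess_bounds[of i] by linarith
    moreover have "even (tot n K i)" using dist that by (simp add: distinguished_def)
    ultimately show ?thesis by presburger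
  qed
  have lvl1: "lvl n (K 1) = 0"
    using dist n by (intro K_1_0) (simp add: distinguished_def)
  have S: "Suc (2 * n - 1) = 2 * n" using n by simp
  have tot_sum: "(\<Sum>i=1..2 * n - 1. int (2 * n - i) * tot n K i) = - lvl n k"
    using sum_weighted_second_diff[of "2 * n - 1" "\<lambda>i. lvl n (K i)"]
    unfolding S by (simp add: tot_def lvl1[unfolded One_nat_def] K_0 K_top)
  have h: "(2 * n - 2 * j) div 2 = n - j" for j
    by (simp flip: diff_mult_distrib2)
  define f where "f i = (if even i then int (bb ((2 * n - i) div 2)) else 0)" for i
  have "2 * int ((eps n K i + 1) div 2) = f i - tot n K i" if i: "i \<in> {1..2 * n - 1}" for i
  proof (cases "even i")
    case True
    then obtain j where j: "i = 2 * j" by (elim evenE)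
    have "1 \<le> n - j" "n - j < n" "2 * n - 2 * (n - j) = i" "(2 * n - i) div 2 = n - j" using i j by auto
    then show ?thesis using int_bb[of "n - j"] True by (simp add: f_def)
  qed (use i odd in \<open>auto simp: f_def\<close>)
  then have "2 * int (chargeK n K) = (\<Sum>i=1..2 * n - 1. int (2 * n - i) * (f i - tot n K i))"
    unfolding chargeK_def of_nat_sum sum_distrib_left of_nat_mult
    by (intro sum.cong) (simp_all add: mult.left_commute)
  also have "\<dots> = (\<Sum>i=1..2 * n - 1. int (2 * n - i) * f i) + lvl n k"
    using tot_sum by (simp add: right_diff_distrib sum_subtractf)
  also have "(\<Sum>i=1..2 * n - 1. int (2 * n - i) * f i) = (\<Sum>i\<in>{i \<in> {1..2 * n - 1}. even i}. int (2 * n - i) * int (bb ((2 * n - i) div 2)))"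
    by (rule sum.mono_neutral_cong_right) (auto simp: f_def)
  also have "\<dots> = (\<Sum>j=1..n - 1. 2 * int j * int (bb j))"
    by (rule sum.reindex_bij_witness[of _ "\<lambda>j. 2 * n - 2 * j" "\<lambda>i. (2 * n - i) div 2"])
      (auto elim!: evenE simp: of_nat_diff h)
  also have "\<dots> = (\<Sum>j=1..n. 2 * int j * int (bb j))"
    by (rule sum.mono_neutral_left) (auto simp: bb_def)
  finally show ?thesis by simp
qed

text \<open>The admissible multiplicities are \<open>bb j + 2 * m j\<close> with \<open>m\<close>
  arbitrary. By \<open>charge_bb\<close> their number depends on \<open>K\<close> only through the
  charge.\<close>

lemma card_U_good:
  assumes dist: "K \<in> distinguished n k" and w: "int w = lvl n k" "w \<le> 2 * d"
  shows "card {m \<in> U n (2 * d - w). \<forall>j. 1 \<le> j \<longrightarrow> j \<le> n \<longrightarrow> bb j \<le> m j \<and> even (m j - bb j)} =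
    (if chargeK n K \<le> d then card (U n (d - chargeK n K)) else 0)" (is "card ?M = _")
proof -
  let ?ch = "chargeK n K"
  define B where "B = (\<Sum>j=1..n. 2 * j * bb j)"
  have ch: "2 * ?ch = w + B"
  proof -
    have "int (2 * ?ch) = int (w + B)"
      using charge_bb[OF dist] w(1) by (simp add: B_def)
    then show ?thesis by (simp only: of_nat_eq_iff)
  qed
  have bb0: "bb j = 0" if "\<not> (1 \<le> j \<and> j \<le> n)" for j using that by (auto simp: bb_def)
  have half: "(\<Sum>j=1..n. 2 * j * (bb j + 2 * m j)) = B + 2 * (\<Sum>j=1..n. 2 * j * m j)" for m
    by (simp add: B_def distrib_left sum.distrib sum_distrib_left ac_simps)
  show ?thesis
  proof (cases "?ch \<le> d")
    case True
    have "bij_betw (\<lambda>m j. bb j + 2 * m j) (U n (d - ?ch)) ?M"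
    proof (rule bij_betwI[where g = "\<lambda>m j. (m j - bb j) div 2"])
      show "(\<lambda>m j. bb j + 2 * m j) \<in> U n (d - ?ch) \<rightarrow> ?M"
      proof
        fix m assume "m \<in> U n (d - ?ch)"
        then show "(\<lambda>j. bb j + 2 * m j) \<in> ?M"
          using half[of m] ch True bb0 by (auto simp: U_def)
      qed
      show "(\<lambda>m j. (m j - bb j) div 2) \<in> ?M \<rightarrow> U n (d - ?ch)"
      proof
        fix m assume m: "m \<in> ?M"
        let ?m = "\<lambda>j. (m j - bb j) div 2"
        have "m j = bb j + 2 * ?m j" if "j \<in> {1..n}" for j
          using m that by auto
        then have "(\<Sum>j=1..n. 2 * j * m j) = (\<Sum>j=1..n. 2 * j * (bb j + 2 * ?m j))"
          by (intro sum.cong) auto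
        also note half
        finally have "(\<Sum>j=1..n. 2 * j * m j) = B + 2 * (\<Sum>j=1..n. 2 * j * ?m j)" .
        moreover have "(\<Sum>j=1..n. 2 * j * m j) = 2 * d - w"
          using m unfolding U_def by blast
        ultimately have "2 * d - w = B + 2 * (\<Sum>j=1..n. 2 * j * ?m j)" by simp
        then have "(\<Sum>j=1..n. 2 * j * ?m j) = d - ?ch" using ch True w by linarith
        moreover have "?m j = 0" if "j \<notin> {1..n}" for j using m that by (auto simp: U_def)
        ultimately show "?m \<in> U n (d - ?ch)" by (simp add: U_def)
      qed
      show "(\<lambda>j. (bb j + 2 * m j - bb j) div 2) = m" for m :: "nat \<Rightarrow> nat" by simp
      show "(\<lambda>j. bb j + 2 * ((m j - bb j) div 2)) = m" if m: "m \<in> ?M" for m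
      proof
        fix j
        show "bb j + 2 * ((m j - bb j) div 2) = m j"
          using m bb0[of j] by (cases "1 \<le> j \<and> j \<le> n") (auto simp: U_def)
      qed
    qed
    with True show ?thesis by (simp add: bij_betw_same_card)
  next
    case False
    have "?M = {}"
    proof (rule equals0I)
      fix m assume m: "m \<in> ?M"
      have "B \<le> (\<Sum>j=1..n. 2 * j * m j)"
        unfolding B_def using m by (intro sum_mono mult_left_mono) auto
      then show False using m ch False w by (simp add: U_def)
    qed
    with False show ?thesis by (simp only: card.empty if_False)
  qed
qed

lemma good_partition_like:
  assumes good: "\<forall>i c. 1 \<le> i \<longrightarrow> i < 2 * n \<longrightarrow> excess n K i c \<le> mdiff n m i"
  shows "partition_like (2 * n) (muw n m + wtK n (2 * n) K)"
  unfolding partition_like_def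
proof (intro conjI allI impI)
  fix q
  show "0 \<le> lookup (muw n m + wtK n (2 * n) K) q"
  proof -
    have "lvl n (K (2 * n - Suc q)) \<le> lvl n (K (2 * n - q))" if "q < 2 * n"
    proof -
      have "Suc (2 * n - Suc q) = 2 * n - q" using that by simp
      then show ?thesis using lvl_interl[OF GT_interl[OF K, of "2 * n - Suc q"]] by simp
    qed
    then show ?thesis by (simp add: lookup_add lookup_wtK lookup_muw sum_nonneg)
  qed
  show "2 * n \<le> q \<Longrightarrow> lookup (muw n m + wtK n (2 * n) K) q = 0"
    by (simp add: lookup_add lookup_wtK lookup_muw)
  assume q: "Suc q < 2 * n"
  let ?i = "2 * n - Suc q"
  have i: "1 \<le> ?i" "?i < 2 * n" "2 * n - Suc ?i = q" "2 * n - ?i = Suc q" using q by auto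
  have "tot n K ?i \<le> mdiff n m ?i"
    using good i excess_top[OF order_refl, of ?i] by metis
  then show "lookup (muw n m + wtK n (2 * n) K) (Suc q) \<le> lookup (muw n m + wtK n (2 * n) K) q"
    using wt_diff[OF i(1,2), of m] by (simp add: i)
qed

lemma sum_lookup_wt: "m \<in> U n N \<Longrightarrow> (\<Sum>q<2 * n. lookup (muw n m + wtK n (2 * n) K) q) = int N + lvl n k"
proof -
  assume m: "m \<in> U n N"
  have "(\<Sum>q<2 * n. lookup (muw n m) q) = (\<Sum>j=1..n. \<Sum>q<2 * n. if q < 2 * j then int (m j) else 0)"
    unfolding lookup_muw by (rule sum.swap)
  also have "\<dots> = (\<Sum>j=1..n. 2 * int j * int (m j))"
  proof (rule sum.cong[OF refl])
    fix j assume "j \<in> {1..n}"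
    then have "(\<Sum>q<2 * n. if q < 2 * j then int (m j) else 0) = (\<Sum>q<2 * j. int (m j))"
      by (intro sum.mono_neutral_cong_right) auto
    then show "(\<Sum>q<2 * n. if q < 2 * j then int (m j) else 0) = 2 * int j * int (m j)" by simp
  qed
  also have "\<dots> = int (\<Sum>j=1..n. 2 * j * m j)" by simp
  also have "\<dots> = int N" using m by (simp only: U_def) simp
  finally have 1: "(\<Sum>q<2 * n. lookup (muw n m) q) = int N" .
  have "(\<Sum>q<2 * n. lookup (wtK n (2 * n) K) q) = (\<Sum>q<2 * n. lvl n (K (2 * n - q)) - lvl n (K (2 * n - Suc q)))"
    by (rule sum.cong) (auto simp: lookup_wtK)
  also have "\<dots> = lvl n (K (2 * n)) - lvl n (K 0)"
    using sum_lessThan_telescope'[of "\<lambda>q. lvl n (K (2 * n - q))" "2 * n"] by simp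
  finally have "(\<Sum>q<2 * n. lookup (wtK n (2 * n) K) q) = lvl n k" by (simp add: K_top K_0)
  with 1 show ?thesis by (simp add: lookup_add sum.distrib)
qed

end

text \<open>Each factor t of \<open>Hm\<close> comes with two variables, so the degree
  \<open>d\<close> of \<open>Hm\<close> is paired with the degree \<open>2 * d\<close> of the
  determinant.\<close>

theorem pr_DV_Mdet:
  assumes n: "1 \<le> n" and k: "\<And>s. k (Suc s) \<le> k s" "\<And>s. n \<le> s \<Longrightarrow> k s = 0"
  defines "c \<equiv> lookup (Vd (2 * n)) (rhox (2 * n))"
  shows "pr (DV (2 * n) (fps_nth (Hm (2 * n)) d)) (fps_nth (Mdet n (\<lambda>i. int (k i) + int n - int i) {..<2 * n}) (2 * d)) =
    c * (\<Sum>K\<in>distinguished n k. if chargeK n K \<le> d then int (card (U n (d - chargeK n K))) else 0)"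
proof -
  let ?l = "\<lambda>i. int (k i) + int n - int i" and ?D = "DV (2 * n) (fps_nth (Hm (2 * n)) d)"
  let ?good = "\<lambda>m K. \<forall>i c. 1 \<le> i \<longrightarrow> i < 2 * n \<longrightarrow> excess n K i c \<le> mdiff n m i"
  let ?ev = "\<lambda>m K. even_partition (2 * n) (muw n m + wtK n (2 * n) K)"
  define w where "w = nat (lvl n k)"
  have w: "int w = lvl n k" by (simp add: w_def lvl_def sum_nonneg)
  have alt: "alternating (2 * n) ?D" by (rule alternating_DV[OF symm_Hm])
  have fin: "finite (GT (2 * n) k)" by (rule finite_GT)
  have dsub: "distinguished n k \<subseteq> GT (2 * n) k" by (auto simp: distinguished_def)
  have "pr ?D (fps_nth (Mdet n ?l {..<2 * n}) (2 * d)) = pr ?D (fps_nth (KSdet n ?l * Psi n) (2 * d))"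
    using KSdet_Psi_feqv[of n ?l] unfolding feqv_def by (intro peqvD[OF peqv_sym alt]) auto
  also have "fps_nth (KSdet n ?l * Psi n) (2 * d) =
      (if w \<le> 2 * d then (\<Sum>K\<in>GT (2 * n) k. frag_of (wtK n (2 * n) K)) * fps_nth (Psi n) (2 * d - w) else 0)"
  proof -
    have kn: "fps_nth (KSdet n ?l) N = (if N = w then \<Sum>K\<in>GT (2 * n) k. frag_of (wtK n (2 * n) K) else 0)" for N
      using KSdet_nth[where k=k and n=n, OF k, of N] by (simp flip: w)
    have "fps_nth (KSdet n ?l * Psi n) (2 * d) = (\<Sum>i=0..2 * d. if i = w then
        (\<Sum>K\<in>GT (2 * n) k. frag_of (wtK n (2 * n) K)) * fps_nth (Psi n) (2 * d - w) else 0)"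
      unfolding fps_mult_nth kn by (rule sum.cong) auto
    then show ?thesis by (simp add: sum.delta)
  qed
  also have "pr ?D \<dots> = (if w \<le> 2 * d then \<Sum>m\<in>U n (2 * d - w). \<Sum>K\<in>GT (2 * n) k. ?D (muw n m + wtK n (2 * n) K) else 0)"
    by (simp add: Psi_def sum_product frag_of_mult pr_sum add.commute sum.swap[of _ "U n _"])
  also have "\<dots> = (if w \<le> 2 * d then \<Sum>m\<in>U n (2 * d - w). \<Sum>K\<in>GT (2 * n) k. if ?good m K \<and> ?ev m K then c else 0 else 0)"
  proof (rule if_cong[OF refl _ refl], rule sum.cong[OF refl])
    fix m assume wd: "w \<le> 2 * d" and m: "m \<in> U n (2 * d - w)"
    have "(\<Sum>K\<in>GT (2 * n) k. ?D (muw n m + wtK n (2 * n) K)) = (\<Sum>K\<in>{K\<in>GT (2 * n) k. ?good m K}. ?D (muw n m + wtK n (2 * n) K))"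
    proof (rule GT_sum_good[OF alt])
      fix i assume i: "1 \<le> i" "i < 2 * n"
      show "mdiff n m i = lookup (muw n m) (2 * n - Suc i) - lookup (muw n m) (2 * n - i) \<and> 0 \<le> mdiff n m i"
        unfolding muw_diff[OF i] by (simp add: mdiff_def)
    qed
    also have "\<dots> = (\<Sum>K\<in>{K\<in>GT (2 * n) k. ?good m K}. if ?ev m K then c else 0)"
    proof (rule sum.cong[OF refl])
      fix K assume "K \<in> {K\<in>GT (2 * n) k. ?good m K}"
      then have K: "K \<in> GT (2 * n) k" and g: "?good m K" by auto
      have "(\<Sum>q<2 * n. lookup (muw n m + wtK n (2 * n) K) q) = 2 * int d"
        using sum_lookup_wt[where k=k and n=n, OF n k K m] wd w by (simp add: of_nat_diff)
      then show "?D (muw n m + wtK n (2 * n) K) = (if ?ev m K then c else 0)"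
        using pr_delta_Hm[OF good_partition_like[where k=k and n=n, OF n k K g], where d=d]
        unfolding DV_eq_delta[OF symm_Hm] by (simp add: c_def)
    qed
    also have "\<dots> = (\<Sum>K\<in>GT (2 * n) k. if ?good m K \<and> ?ev m K then c else 0)"
      by (rule sum.mono_neutral_cong_left) (auto simp: fin)
    finally show "(\<Sum>K\<in>GT (2 * n) k. ?D (muw n m + wtK n (2 * n) K)) = (\<Sum>K\<in>GT (2 * n) k. if ?good m K \<and> ?ev m K then c else 0)" .
  qed
  \<comment> \<open>The cancellation was carried out for fixed \<mu>; from here \<open>K\<close> is
    fixed and the partitions \<mu> are counted.\<close>
  also have "\<dots> = (if w \<le> 2 * d then \<Sum>K\<in>GT (2 * n) k. \<Sum>m\<in>U n (2 * d - w). if ?good m K \<and> ?ev m K then c else 0 else 0)"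
    by (simp only: sum.swap[of _ "GT _ _"])
  also have "\<dots> = (\<Sum>K\<in>GT (2 * n) k. c * (if K \<in> distinguished n k \<and> chargeK n K \<le> d then int (card (U n (d - chargeK n K))) else 0))"
  proof (cases "w \<le> 2 * d")
    case True
    show ?thesis
      unfolding if_P[OF True]
    proof (rule sum.cong[OF refl])
      fix K assume K: "K \<in> GT (2 * n) k"
      let ?M = "{m \<in> U n (2 * d - w). \<forall>j. 1 \<le> j \<longrightarrow> j \<le> n \<longrightarrow> bb n K j \<le> m j \<and> even (m j - bb n K j)}"
      have ge: "?good m K \<and> ?ev m K \<longleftrightarrow>
          K \<in> distinguished n k \<and> (\<forall>j. 1 \<le> j \<longrightarrow> j \<le> n \<longrightarrow> bb n K j \<le> m j \<and> even (m j - bb n K j))" for m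
        by (rule good_even_iff[where k=k and n=n, OF n k K])
      have "(\<Sum>m\<in>U n (2 * d - w). if ?good m K \<and> ?ev m K then c else 0) =
          (\<Sum>m\<in>(if K \<in> distinguished n k then ?M else {}). c)"
      proof (cases "K \<in> distinguished n k")
        case True
        show ?thesis
          unfolding ge if_P[OF True] sum.inter_filter[OF finite_U] by (simp only: True simp_thms)
      next
        case False
        then show ?thesis unfolding ge by simp
      qed
      then show "(\<Sum>m\<in>U n (2 * d - w). if ?good m K \<and> ?ev m K then c else 0) =
          c * (if K \<in> distinguished n k \<and> chargeK n K \<le> d then int (card (U n (d - chargeK n K))) else 0)"
        using card_U_good[where k=k and n=n, OF n k K _ w True] by (cases "K \<in> distinguished n k") simp_all
    qed
  next
    case False
    have "\<not> chargeK n K \<le> d" if "K \<in> distinguished n k" for K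
    proof -
      have K: "K \<in> GT (2 * n) k" using that dsub by auto
      have "0 \<le> (\<Sum>j=1..n. 2 * int j * int (bb n K j))" by (intro sum_nonneg) simp
      then show ?thesis using charge_bb[where k=k and n=n, OF n k K that] False w by linarith
    qed
    then have "(K \<in> distinguished n k \<and> chargeK n K \<le> d) = False" for K by blast
    then show ?thesis using False by (simp only: if_False mult_zero_right sum.neutral_const)
  qed
  also have "\<dots> = c * (\<Sum>K\<in>GT (2 * n) k. if K \<in> distinguished n k \<and> chargeK n K \<le> d then int (card (U n (d - chargeK n K))) else 0)"
    by (simp only: sum_distrib_left)
  also have "(\<Sum>K\<in>GT (2 * n) k. if K \<in> distinguished n k \<and> chargeK n K \<le> d then int (card (U n (d - chargeK n K))) else 0) =
      (\<Sum>K\<in>distinguished n k. if chargeK n K \<le> d then int (card (U n (d - chargeK n K))) else 0)"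
    by (rule sum.mono_neutral_cong_right[OF fin dsub]) auto
  finally show ?thesis .
qed

section \<open>The Weyl group of type C\<close>

lemma ip_coord: "ip v (coord i) = lookup v i"
proof -
  have "ip v (coord i) = (\<Sum>k\<in>keys v. if k = i then lookup v k else 0)"
    unfolding ip_def lookup_coord by (rule sum.cong) auto
  then show ?thesis by (simp add: in_keys_iff)
qed

lemma ip_add: "ip v (a + b) = ip v a + ip v b"
  by (simp add: ip_def lookup_add distrib_left sum.distrib)

lemma ip_diff: "ip v (a - b) = ip v a - ip v b"
  by (simp add: ip_def lookup_minus right_diff_distrib sum_subtractf)

lemma ip_cmul: "ip v (frag_cmul c a) = c * ip v a"
  by (simp add: ip_def sum_distrib_left mult.left_commute)

lemma reflection_diff:
  assumes "i \<noteq> j"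
  shows "lookup (reflection (coord i - coord j) v) l =
    (if l = i then lookup v j else if l = j then lookup v i else lookup v l)"
  using assms by (simp add: reflection_def ip_diff ip_coord lookup_minus lookup_coord)

lemma reflection_add:
  assumes "i \<noteq> j"
  shows "lookup (reflection (coord i + coord j) v) l =
    (if l = i then - lookup v j else if l = j then - lookup v i else lookup v l)"
  using assms by (simp add: reflection_def ip_add ip_coord lookup_minus lookup_add lookup_coord)

lemma reflection_double:
  "lookup (reflection (frag_cmul 2 (coord i)) v) l = (if l = i then - lookup v l else lookup v l)"
  by (simp add: reflection_def ip_cmul ip_coord lookup_minus lookup_coord)

text \<open>The coordinates \<open>1, \<dots>, n\<close> of weights are indexed from \<open>0\<close> by \<open>e\<close> and \<open>p\<close>.\<close>

definition sact :: "nat \<Rightarrow> (nat \<Rightarrow> int) \<Rightarrow> (nat \<Rightarrow> nat) \<Rightarrow> weight \<Rightarrow> weight" where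
  "sact n e p v = frag_extend (\<lambda>i. frag_cmul (case_nat 1 (\<lambda>j. if j < n then e j else 1) i) (frag_of i))
     (pw (case_nat 0 (Suc \<circ> p)) v)"

lemma lookup_rescale: "lookup (frag_extend (\<lambda>i. frag_cmul (c i) (frag_of i)) v) i = c i * lookup v i"
  using subset_UNIV
  by (induction v rule: frag_induction) (auto simp: frag_extend_diff lookup_minus right_diff_distrib lookup_single when_def)

lemma inj_case_nat: "inj p \<Longrightarrow> inj (case_nat 0 (Suc \<circ> p))"
  by (rule injI) (auto split: nat.splits dest: injD)

lemma lookup_sact:
  assumes "inj p"
  shows "lookup (sact n e p v) 0 = lookup v 0"
    "lookup (sact n e p v) (Suc j) = (if j < n then e j else 1) * lookup v (Suc (p j))"
  using lookup_pw[OF inj_case_nat[OF assms], of v] by (simp_all add: sact_def lookup_rescale)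

definition signs :: "nat \<Rightarrow> (nat \<Rightarrow> int) \<Rightarrow> bool" where
  "signs n e \<longleftrightarrow> (\<forall>j<n. e j = 1 \<or> e j = -1)"

definition sgnP :: "nat \<Rightarrow> (nat \<Rightarrow> int) \<Rightarrow> (nat \<Rightarrow> nat) \<Rightarrow> int" where
  "sgnP n e p = sign p * (\<Prod>j<n. e j)"

definition signed_perms :: "nat \<Rightarrow> ((nat \<Rightarrow> int) \<times> (nat \<Rightarrow> nat)) set" where
  "signed_perms n = {(e, p). signs n e \<and> p permutes {..<n}}"

text \<open>Permutations act by precomposition on the coordinates, hence the reversed order
  \<open>q \<circ> p\<close>.\<close>

lemma sact_comp:
  assumes p: "p permutes {..<n}" and q: "q permutes {..<n}"
  shows "sact n e p \<circ> sact n f q = sact n (\<lambda>j. e j * f (p j)) (q \<circ> p)"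
proof (rule ext, rule poly_mapping_eqI)
  fix v i
  have "p j < n \<longleftrightarrow> j < n" for j
    using permutes_in_image[OF p, of j] by simp
  then show "lookup ((sact n e p \<circ> sact n f q) v) i = lookup (sact n (\<lambda>j. e j * f (p j)) (q \<circ> p) v) i"
    using permutes_inj[OF p] permutes_inj[OF q] inj_compose[OF permutes_inj[OF q] permutes_inj[OF p]]
    by (cases i) (simp_all add: lookup_sact)
qed

lemma sgnP_comp:
  assumes p: "p permutes {..<n}" and q: "q permutes {..<n}"
  shows "sgnP n (\<lambda>j. e j * f (p j)) (q \<circ> p) = sgnP n e p * sgnP n f q"
proof -
  have "(\<Prod>j<n. f (p j)) = (\<Prod>j<n. f j)"
    using prod.permute[OF p, of f] by (simp add: o_def)
  moreover have "sign (q \<circ> p) = sign q * sign p"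
    using p q by (intro sign_compose permutation_permutes[THEN iffD2]) auto
  ultimately show ?thesis by (simp add: sgnP_def prod.distrib)
qed

lemma signed_perms_comp:
  assumes "(e, p) \<in> signed_perms n" "(f, q) \<in> signed_perms n"
  shows "(\<lambda>j. e j * f (p j), q \<circ> p) \<in> signed_perms n"
proof -
  have "p permutes {..<n}" using assms(1) by (simp add: signed_perms_def)
  then have "p j < n" if "j < n" for j using that permutes_in_image[of p "{..<n}" j] by simp
  moreover have "e j * f (p j) = 1 \<or> e j * f (p j) = -1" if "e j = 1 \<or> e j = -1" "f (p j) = 1 \<or> f (p j) = -1" for j
    using that by auto
  ultimately show ?thesis
    using assms by (auto simp only: signed_perms_def signs_def mem_Collect_eq prod.case intro: permutes_compose)
qed

lemma transpose_permutes: "a < n \<Longrightarrow> b < n \<Longrightarrow> transpose a b permutes {..<n}"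
  by (rule permutes_swap_id) auto

lemma reflection_diff_sact:
  assumes "a < n" "b < n" "a \<noteq> b"
  shows "reflection (coord (Suc a) - coord (Suc b)) = sact n (\<lambda>_. 1) (transpose a b)"
proof (rule ext, rule poly_mapping_eqI)
  fix v i
  show "lookup (reflection (coord (Suc a) - coord (Suc b)) v) i = lookup (sact n (\<lambda>_. 1) (transpose a b) v) i"
    using assms by (cases i) (auto simp: reflection_diff lookup_sact inj_transpose transpose_def)
qed

lemma reflection_add_sact:
  assumes "a < n" "b < n" "a \<noteq> b"
  shows "reflection (coord (Suc a) + coord (Suc b)) =
    sact n (\<lambda>j. if j = a \<or> j = b then -1 else 1) (transpose a b)"
proof (rule ext, rule poly_mapping_eqI)
  fix v i
  show "lookup (reflection (coord (Suc a) + coord (Suc b)) v) i =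
      lookup (sact n (\<lambda>j. if j = a \<or> j = b then -1 else 1) (transpose a b) v) i"
    using assms by (cases i) (auto simp: reflection_add lookup_sact inj_transpose transpose_def)
qed

lemma reflection_double_sact:
  assumes "a < n"
  shows "reflection (frag_cmul 2 (coord (Suc a))) = sact n (\<lambda>j. if j = a then -1 else 1) (\<lambda>j. j)"
proof (rule ext, rule poly_mapping_eqI)
  fix v i
  have "inj (\<lambda>j::nat. j)" by (rule injI)
  then show "lookup (reflection (frag_cmul 2 (coord (Suc a))) v) i =
      lookup (sact n (\<lambda>j. if j = a then -1 else 1) (\<lambda>j. j) v) i"
    using assms by (cases i) (auto simp: reflection_double lookup_sact)
qed

lemma pos_rootsE:
  assumes "\<alpha> \<in> pos_roots n"
  obtains (diff) a b where "a < b" "b < n" "\<alpha> = coord (Suc a) - coord (Suc b)"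
    | (add) a b where "a < b" "b < n" "\<alpha> = coord (Suc a) + coord (Suc b)"
    | (double) a where "a < n" "\<alpha> = frag_cmul 2 (coord (Suc a))"
proof -
  consider i j where "1 \<le> i" "i < j" "j \<le> n" "\<alpha> = coord i - coord j"
    | i j where "1 \<le> i" "i < j" "j \<le> n" "\<alpha> = coord i + coord j"
    | i where "1 \<le> i" "i \<le> n" "\<alpha> = frag_cmul 2 (coord i)"
    using assms by (auto simp: pos_roots_def)
  then show thesis
  proof cases
    case (1 i j)
    then show thesis using diff[of "i - 1" "j - 1"] by simp
  next
    case (2 i j)
    then show thesis using add[of "i - 1" "j - 1"] by simp
  next
    case (3 i)
    then show thesis using double[of "i - 1"] by simp
  qed
qed

lemma pos_rootsI:
  shows pos_roots_diffI: "a < b \<Longrightarrow> b < n \<Longrightarrow> coord (Suc a) - coord (Suc b) \<in> pos_roots n"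
    and pos_roots_addI: "a < b \<Longrightarrow> b < n \<Longrightarrow> coord (Suc a) + coord (Suc b) \<in> pos_roots n"
    and pos_roots_doubleI: "a < n \<Longrightarrow> frag_cmul 2 (coord (Suc a)) \<in> pos_roots n"
  unfolding pos_roots_def
  subgoal by (intro UnI1 CollectI exI[of _ "Suc a"] exI[of _ "Suc b"]) simp
  subgoal by (rule UnI1, rule UnI2, intro CollectI exI[of _ "Suc a"] exI[of _ "Suc b"]) simp
  subgoal by (intro UnI2 CollectI exI[of _ "Suc a"]) simp
  done

lemma reflectionE:
  assumes "\<alpha> \<in> pos_roots n"
  obtains e p where "(e, p) \<in> signed_perms n" "p \<circ> p = id" "\<And>j. e (p j) = e j"
    "reflection \<alpha> = sact n e p" "sgnP n e p = -1"
  using assms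
proof (cases rule: pos_rootsE)
  case (diff a b)
  then show thesis
    by (intro that[of "\<lambda>_. 1" "transpose a b"])
      (simp_all add: reflection_diff_sact signed_perms_def signs_def transpose_permutes sgnP_def sign_swap_id)
next
  case (add a b)
  have "(\<Prod>j<n. if j = a \<or> j = b then -1 else 1 :: int) = (\<Prod>j\<in>{a, b}. -1)"
    using add by (intro prod.mono_neutral_cong_right) auto
  then have "(\<Prod>j<n. if j = a \<or> j = b then -1 else 1 :: int) = 1"
    using add by simp
  with add show thesis
    by (intro that[of "\<lambda>j. if j = a \<or> j = b then -1 else 1" "transpose a b"])
      (simp_all add: reflection_add_sact signed_perms_def signs_def transpose_permutes sgnP_def sign_swap_id
        transpose_def)
next
  case (double a)
  let ?e = "\<lambda>j. if j = a then -1 else 1 :: int"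
  have pm: "(\<lambda>j. j) permutes {..<n}" using permutes_id[of "{..<n}"] by (simp add: id_def)
  have sg: "sign (\<lambda>j::nat. j) = 1" using sign_id by (simp add: id_def)
  have pr: "(\<Prod>j<n. ?e j) = -1"
    using double by (simp add: prod.delta)
  have sn: "signs n ?e" by (simp add: signs_def)
  show thesis
  proof (rule that[of ?e "\<lambda>j. j"])
    show "(?e, \<lambda>j. j) \<in> signed_perms n" using pm sn by (simp add: signed_perms_def)
    show "(\<lambda>j. j) \<circ> (\<lambda>j. j) = (id :: nat \<Rightarrow> nat)" by (rule ext) simp
    show "reflection \<alpha> = sact n ?e (\<lambda>j. j)" unfolding double(2) by (rule reflection_double_sact[OF double(1)])
    show "sgnP n ?e (\<lambda>j. j) = -1" unfolding sgnP_def sg pr by simp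
    show "?e j = ?e j" for j ..
  qed
qed

lemma simple_subset_pos: "1 \<le> n \<Longrightarrow> simple_roots n \<subseteq> pos_roots n"
proof
  fix \<alpha> assume n: "1 \<le> n" and "\<alpha> \<in> simple_roots n"
  then consider i where "1 \<le> i" "i < n" "\<alpha> = coord i - coord (i + 1)" | "\<alpha> = frag_cmul 2 (coord n)"
    by (auto simp: simple_roots_def)
  then show "\<alpha> \<in> pos_roots n"
  proof cases
    case (1 i)
    then show ?thesis using pos_roots_diffI[of "i - 1" i n] by simp
  next
    case 2
    then show ?thesis using pos_roots_doubleI[of "n - 1" n] n by simp
  qed
qed

lemma sact_id: "sact n (\<lambda>_. 1) id = id"
proof (rule ext, rule poly_mapping_eqI)
  fix v i
  show "lookup (sact n (\<lambda>_. 1) id v) i = lookup (id v) i"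
    by (cases i) (simp_all add: lookup_sact)
qed

lemma id_signed_perms: "(\<lambda>_. 1, id) \<in> signed_perms n"
  by (simp add: signed_perms_def signs_def permutes_id)

lemma sgnP_id: "sgnP n (\<lambda>_. 1) id = 1"
  by (simp add: sgnP_def sign_id)

section \<open>Words in simple reflections and the sign of the length\<close>

definition simple_word :: "weight list \<Rightarrow> weight \<Rightarrow> weight" where
  "simple_word \<alpha>s = foldr (\<lambda>\<alpha> f. reflection \<alpha> \<circ> f) \<alpha>s id"

definition simple_words :: "nat \<Rightarrow> (weight \<Rightarrow> weight) set" where
  "simple_words n = simple_word ` {\<alpha>s. set \<alpha>s \<subseteq> simple_roots n}"

lemma simple_word_Nil: "simple_word [] = id"
  by (simp add: simple_word_def)

lemma simple_word_Cons: "simple_word (\<alpha> # \<alpha>s) = reflection \<alpha> \<circ> simple_word \<alpha>s"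
  by (simp add: simple_word_def)

lemma simple_word_append: "simple_word (\<alpha>s @ \<beta>s) = simple_word \<alpha>s \<circ> simple_word \<beta>s"
  by (induction \<alpha>s) (simp_all only: append.simps simple_word_Nil simple_word_Cons id_comp comp_assoc)

lemma simple_words_id: "id \<in> simple_words n"
  unfolding simple_words_def by (rule image_eqI[of _ _ "[]"]) (simp_all add: simple_word_Nil)

lemma simple_words_comp: "u \<in> simple_words n \<Longrightarrow> v \<in> simple_words n \<Longrightarrow> u \<circ> v \<in> simple_words n"
  unfolding simple_words_def
proof (elim imageE)
  fix \<alpha>s \<beta>s
  assume "u = simple_word \<alpha>s" "v = simple_word \<beta>s" "\<alpha>s \<in> {\<alpha>s. set \<alpha>s \<subseteq> simple_roots n}" "\<beta>s \<in> {\<alpha>s. set \<alpha>s \<subseteq> simple_roots n}"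
  then show "u \<circ> v \<in> simple_word ` {\<alpha>s. set \<alpha>s \<subseteq> simple_roots n}"
    by (intro image_eqI[of _ _ "\<alpha>s @ \<beta>s"]) (simp_all add: simple_word_append)
qed

lemma simple_words_simple: "\<alpha> \<in> simple_roots n \<Longrightarrow> reflection \<alpha> \<in> simple_words n"
  unfolding simple_words_def by (rule image_eqI[of _ _ "[\<alpha>]"]) (simp_all add: simple_word_Cons simple_word_Nil)

lemma simple_words_diff:
  assumes "1 \<le> a" "Suc a \<le> b"
  shows "b \<le> n \<Longrightarrow> reflection (coord a - coord b) \<in> simple_words n"
  using assms(2)
proof (induction b rule: dec_induct)
  case base
  then show ?case using assms(1) by (intro simple_words_simple) (auto simp: simple_roots_def)
next
  case (step b)
  let ?r = "reflection (coord b - coord (Suc b))"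
  have "?r \<in> simple_words n"
    using step by (intro simple_words_simple) (auto simp: simple_roots_def)
  moreover have "reflection (coord a - coord b) \<in> simple_words n" using step by simp
  moreover have "reflection (coord a - coord (Suc b)) = ?r \<circ> (reflection (coord a - coord b) \<circ> ?r)"
    using step(1) by (intro ext poly_mapping_eqI) (simp add: reflection_diff)
  ultimately show ?case by (simp only: simple_words_comp)
qed

lemma simple_words_double:
  assumes "1 \<le> a" "a \<le> n"
  shows "reflection (frag_cmul 2 (coord a)) \<in> simple_words n"
  using assms(2,1)
proof (induction a rule: inc_induct)
  case base
  then show ?case by (intro simple_words_simple) (simp add: simple_roots_def)
next
  case (step a)
  let ?r = "reflection (coord a - coord (Suc a))"
  have "?r \<in> simple_words n"
    using step by (intro simple_words_simple) (auto simp: simple_roots_def)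
  moreover have "reflection (frag_cmul 2 (coord (Suc a))) \<in> simple_words n" using step by simp
  moreover have "reflection (frag_cmul 2 (coord a)) = ?r \<circ> (reflection (frag_cmul 2 (coord (Suc a))) \<circ> ?r)"
    by (intro ext poly_mapping_eqI) (simp add: reflection_diff reflection_double)
  ultimately show ?case by (simp only: simple_words_comp)
qed

lemma simple_words_reflection:
  assumes "\<alpha> \<in> pos_roots n"
  shows "reflection \<alpha> \<in> simple_words n"
  using assms
proof (cases rule: pos_rootsE)
  case (diff a b)
  then show ?thesis by (simp add: simple_words_diff)
next
  case (add a b)
  have "reflection \<alpha> = reflection (frag_cmul 2 (coord (Suc a))) \<circ>
      (reflection (frag_cmul 2 (coord (Suc b))) \<circ> reflection (coord (Suc a) - coord (Suc b)))"
    unfolding add(3) using add(1)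
    by (intro ext poly_mapping_eqI) (simp add: reflection_diff reflection_add reflection_double)
  with add show ?thesis
    by (simp only: simple_words_comp simple_words_double simple_words_diff Suc_leI le_SucI less_SucI Suc_mono One_nat_def
        Suc_le_mono zero_le less_trans)
next
  case (double a)
  then show ?thesis by (simp add: simple_words_double)
qed

lemma weyl_group_word: "w \<in> weyl_group n \<Longrightarrow> w \<in> simple_words n"
  by (induction rule: weyl_group.induct) (simp_all only: simple_words_id simple_words_comp simple_words_reflection)

lemma weyl_group_signed_perm:
  assumes "w \<in> weyl_group n"
  shows "\<exists>e p. (e, p) \<in> signed_perms n \<and> w = sact n e p"
  using assms
proof induction
  case weyl_id
  then show ?case using sact_id id_signed_perms by metis
next
  case (weyl_reflection \<alpha> w)
  then obtain f q where fq: "(f, q) \<in> signed_perms n" "w = sact n f q" by blast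
  obtain e p where ep: "(e, p) \<in> signed_perms n" "reflection \<alpha> = sact n e p"
    using weyl_reflection(1) by (rule reflectionE)
  have "reflection \<alpha> \<circ> w = sact n (\<lambda>j. e j * f (p j)) (q \<circ> p)"
    unfolding ep(2) fq(2) using ep(1) fq(1) by (intro sact_comp) (simp_all add: signed_perms_def)
  with signed_perms_comp[OF ep(1) fq(1)] show ?case by blast
qed

lemma simple_word_sign:
  assumes "1 \<le> n"
  shows "set \<alpha>s \<subseteq> simple_roots n \<Longrightarrow>
    \<exists>e p. (e, p) \<in> signed_perms n \<and> simple_word \<alpha>s = sact n e p \<and> sgnP n e p = (-1) ^ length \<alpha>s"
proof (induction \<alpha>s)
  case Nil
  then show ?case using sact_id id_signed_perms sgnP_id by (metis list.size(3) power_0 simple_word_Nil)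
next
  case (Cons \<alpha> \<alpha>s)
  then obtain f q where fq: "(f, q) \<in> signed_perms n" "simple_word \<alpha>s = sact n f q" "sgnP n f q = (-1) ^ length \<alpha>s"
    by auto
  have "\<alpha> \<in> pos_roots n" using Cons.prems simple_subset_pos[OF assms] by auto
  then obtain e p where ep: "(e, p) \<in> signed_perms n" "reflection \<alpha> = sact n e p" "sgnP n e p = -1"
    by (rule reflectionE)
  have pq: "p permutes {..<n}" "q permutes {..<n}" using ep(1) fq(1) by (simp_all add: signed_perms_def)
  have "simple_word (\<alpha> # \<alpha>s) = sact n (\<lambda>j. e j * f (p j)) (q \<circ> p)"
    unfolding simple_word_Cons ep(2) fq(2) by (rule sact_comp[OF pq])
  moreover have "sgnP n (\<lambda>j. e j * f (p j)) (q \<circ> p) = (-1) ^ length (\<alpha> # \<alpha>s)"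
    unfolding sgnP_comp[OF pq] ep(3) fq(3) by simp
  ultimately show ?case using signed_perms_comp[OF ep(1) fq(1)] by blast
qed

definition rhoC :: "nat \<Rightarrow> weight" where
  "rhoC n = (\<Sum>j<n. single (Suc j) (int (n - j)))"

lemma lookup_rhoC: "lookup (rhoC n) 0 = 0" "lookup (rhoC n) (Suc j) = int (n - j)"
proof -
  show "lookup (rhoC n) 0 = 0"
    by (simp add: rhoC_def lookup_sum lookup_single)
  show "lookup (rhoC n) (Suc j) = int (n - j)"
  proof (cases "j < n")
    case True
    then show ?thesis by (simp add: rhoC_def lookup_sum lookup_single when_def sum.delta)
  next
    case False
    then show ?thesis by (simp add: rhoC_def lookup_sum lookup_single when_def)
  qed
qed

text \<open>The coordinates n, ..., 1 of \<open>rhoC n\<close> are distinct and positive, so each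
  image coordinate reveals both its sign and its source.\<close>

lemma sact_rho_inj:
  assumes ep: "(e, p) \<in> signed_perms n" and fq: "(f, q) \<in> signed_perms n"
    and eq: "sact n e p (rhoC n) = sact n f q (rhoC n)"
  shows "p = q" "j < n \<Longrightarrow> e j = f j"
proof -
  have p: "p permutes {..<n}" "signs n e" and q: "q permutes {..<n}" "signs n f"
    using ep fq by (simp_all add: signed_perms_def)
  have *: "p j = q j \<and> e j = f j" if j: "j < n" for j
  proof -
    have "p j < n" "q j < n" using j permutes_in_image[OF p(1), of j] permutes_in_image[OF q(1), of j] by simp_all
    moreover have "e j * int (n - p j) = f j * int (n - q j)"
      using arg_cong[OF eq, of "\<lambda>w. lookup w (Suc j)"] j
      by (simp add: lookup_sact permutes_inj[OF p(1)] permutes_inj[OF q(1)] lookup_rhoC)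
    moreover have "e j = 1 \<or> e j = -1" "f j = 1 \<or> f j = -1" using p(2) q(2) j by (simp_all add: signs_def)
    ultimately show ?thesis by auto
  qed
  show "p = q"
  proof
    fix j show "p j = q j" using * permutes_not_in[OF p(1), of j] permutes_not_in[OF q(1), of j] by (cases "j < n") auto
  qed
  show "j < n \<Longrightarrow> e j = f j" using * by blast
qed

lemma sgnP_cong: "(\<And>j. j < n \<Longrightarrow> e j = f j) \<Longrightarrow> sgnP n e p = sgnP n f p"
  by (simp add: sgnP_def)

lemma sact_cong: "(\<And>j. j < n \<Longrightarrow> e j = f j) \<Longrightarrow> p permutes {..<n} \<Longrightarrow> sact n e p = sact n f p"
proof (rule ext, rule poly_mapping_eqI)
  fix v i
  assume "\<And>j. j < n \<Longrightarrow> e j = f j" "p permutes {..<n}"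
  then show "lookup (sact n e p v) i = lookup (sact n f p v) i"
    by (cases i) (simp_all add: lookup_sact permutes_inj)
qed

text \<open>Every word in simple reflections for the element has the parity given by
  \<open>sgnP\<close>; it is enough that the minimal length is attained by some word, and one exists
  since all reflections are products of simple ones.\<close>

lemma weyl_sign:
  assumes "1 \<le> n" "(e, p) \<in> signed_perms n" "sact n e p \<in> weyl_group n"
  shows "(-1) ^ weyl_length n (sact n e p) = sgnP n e p"
proof -
  let ?P = "\<lambda>k. \<exists>\<alpha>s. length \<alpha>s = k \<and> set \<alpha>s \<subseteq> simple_roots n \<and> sact n e p = simple_word \<alpha>s"
  have "?P (weyl_length n (sact n e p))"
    unfolding weyl_length_def simple_word_def[symmetric]
    using weyl_group_word[OF assms(3)] by (intro LeastI_ex[of ?P]) (auto simp: simple_words_def)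
  then obtain \<alpha>s where \<alpha>s: "length \<alpha>s = weyl_length n (sact n e p)" "set \<alpha>s \<subseteq> simple_roots n"
    "sact n e p = simple_word \<alpha>s" by blast
  obtain f q where fq: "(f, q) \<in> signed_perms n" "simple_word \<alpha>s = sact n f q" "sgnP n f q = (-1) ^ length \<alpha>s"
    using simple_word_sign[OF assms(1) \<alpha>s(2)] by blast
  have "sact n e p (rhoC n) = sact n f q (rhoC n)" using \<alpha>s(3) fq(2) by simp
  note inj = sact_rho_inj[OF assms(2) fq(1) this]
  show ?thesis
    using fq(3) sgnP_cong[of n e f p] inj unfolding \<alpha>s(1) by simp
qed

lemma weyl_group_comp: "u \<in> weyl_group n \<Longrightarrow> v \<in> weyl_group n \<Longrightarrow> u \<circ> v \<in> weyl_group n"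
proof (induction rule: weyl_group.induct)
  case (weyl_reflection \<alpha> w)
  have "(reflection \<alpha> \<circ> w) \<circ> v = reflection \<alpha> \<circ> (w \<circ> v)" by (rule comp_assoc)
  with weyl_reflection show ?case by (metis weyl_group.weyl_reflection)
qed (simp only: id_comp)

lemma weyl_group_reflection: "\<alpha> \<in> pos_roots n \<Longrightarrow> reflection \<alpha> \<in> weyl_group n"
  using weyl_group.weyl_reflection[OF _ weyl_group.weyl_id, of \<alpha> n] by (simp only: comp_id)

lemma sact_perm_weyl:
  assumes "p permutes {..<n}"
  shows "sact n (\<lambda>_. 1) p \<in> weyl_group n"
  using assms finite_lessThan
proof (induction p rule: permutes_induct)
  case id
  then show ?case by (simp only: sact_id weyl_group.weyl_id)
next
  case (swap a b p)
  have "sact n (\<lambda>_. 1) (transpose a b) \<in> weyl_group n"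
  proof (cases "a < b")
    case True
    then show ?thesis using weyl_group_reflection[OF pos_roots_diffI, of a b n] swap by (simp add: reflection_diff_sact)
  next
    case False
    then have ba: "b < a" "a < n" "b < n" "b \<noteq> a" using swap by simp_all
    show ?thesis
      using weyl_group_reflection[OF pos_roots_diffI[OF ba(1,2)]]
      unfolding reflection_diff_sact[OF ba(3,2,4)] transpose_commute[of b a] .
  qed
  moreover have "sact n (\<lambda>_. 1) (transpose a b \<circ> p) = sact n (\<lambda>_. 1) p \<circ> sact n (\<lambda>_. 1) (transpose a b)"
    using swap sact_comp[of p n "transpose a b" "\<lambda>_. 1" "\<lambda>_. 1"] by (simp add: transpose_permutes)
  ultimately show ?case using swap by (simp only: weyl_group_comp)
qed

lemma sact_sign_weyl:
  assumes "finite F" "F \<subseteq> {..<n}"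
  shows "sact n (\<lambda>j. if j \<in> F then -1 else 1) id \<in> weyl_group n"
  using assms
proof (induction F rule: finite_induct)
  case empty
  then show ?case by (simp only: empty_iff if_False sact_id weyl_group.weyl_id)
next
  case (insert a F)
  let ?e = "\<lambda>j. if j = a then -1 else 1 :: int" and ?f = "\<lambda>j. if j \<in> F then -1 else 1 :: int"
  have "sact n ?e id \<circ> sact n ?f id = sact n (\<lambda>j. ?e j * ?f (id j)) (id \<circ> id)"
    by (rule sact_comp) (simp_all add: permutes_id)
  also have "(\<lambda>j. ?e j * ?f (id j)) = (\<lambda>j. if j \<in> insert a F then -1 else 1)"
    using insert(2) by (intro ext) simp
  finally have "sact n (\<lambda>j. if j \<in> insert a F then -1 else 1) id = reflection (frag_cmul 2 (coord (Suc a))) \<circ> sact n ?f id"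
    using insert reflection_double_sact[of a n] by (simp add: id_def comp_def)
  moreover have "sact n ?f id \<in> weyl_group n" using insert(3,4) by blast
  moreover have "frag_cmul 2 (coord (Suc a)) \<in> pos_roots n"
    using insert by (auto intro: pos_roots_doubleI)
  ultimately show ?case by (simp only: weyl_group.weyl_reflection)
qed

lemma sact_weyl:
  assumes "(e, p) \<in> signed_perms n"
  shows "sact n e p \<in> weyl_group n"
proof -
  have p: "p permutes {..<n}" and e: "signs n e" using assms by (simp_all add: signed_perms_def)
  let ?F = "{j. j < n \<and> e j = -1}"
  let ?f = "\<lambda>j. if j \<in> ?F then -1 else 1 :: int"
  have "sact n e p = sact n (\<lambda>j. ?f j * 1) (p \<circ> id)"
    using e by (simp only: comp_id mult_1_right, intro sact_cong[OF _ p]) (auto simp: signs_def)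
  also have "\<dots> = sact n ?f id \<circ> sact n (\<lambda>_. 1) p"
    using sact_comp[of id n p ?f "\<lambda>_. 1"] p by (simp add: permutes_id)
  finally show ?thesis
    using sact_perm_weyl[OF p] sact_sign_weyl[of ?F n] weyl_group_comp[of "sact n ?f id" n] by auto
qed

text \<open>The values of \<open>e\<close> beyond \<open>n\<close> have no effect on
  \<open>sact\<close>; taking \<open>e\<close> from \<open>PiE\<close> makes the parametrisation by
  signed permutations injective.\<close>

lemma sum_weyl_group:
  assumes "1 \<le> n"
  shows "(\<Sum>w\<in>weyl_group n. (-1) ^ weyl_length n w * F w) =
    (\<Sum>p | p permutes {..<n}. \<Sum>e\<in>PiE {..<n} (\<lambda>_. {1, -1}). of_int (sgnP n e p) * F (sact n e p) :: 'a :: comm_ring_1)"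
proof -
  let ?A = "{p. p permutes {..<n}} \<times> PiE {..<n} (\<lambda>_. {1, -1 :: int})"
  have sp: "(e, p) \<in> signed_perms n" if "(p, e) \<in> ?A" for p e
    using that by (auto simp: signed_perms_def signs_def PiE_iff)
  have bij: "bij_betw (\<lambda>(p, e). sact n e p) ?A (weyl_group n)"
    unfolding bij_betw_def
  proof
    show "inj_on (\<lambda>(p, e). sact n e p) ?A"
    proof (rule inj_onI)
      fix x y assume xy: "x \<in> ?A" "y \<in> ?A" "(\<lambda>(p, e). sact n e p) x = (\<lambda>(p, e). sact n e p) y"
      obtain p e q f where [simp]: "x = (p, e)" "y = (q, f)" by (cases x, cases y)
      have "sact n e p (rhoC n) = sact n f q (rhoC n)" using xy(3) by simp
      note inj = sact_rho_inj[OF sp sp this]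
      have "p = q" using xy by (intro inj(1)) simp_all
      moreover have "e = f" using xy by (intro PiE_ext[of e "{..<n}" "\<lambda>_. {1, -1}" f] inj(2)) simp_all
      ultimately show "x = y" by simp
    qed
    show "(\<lambda>(p, e). sact n e p) ` ?A = weyl_group n"
    proof
      show "(\<lambda>(p, e). sact n e p) ` ?A \<subseteq> weyl_group n" using sact_weyl sp by auto
      show "weyl_group n \<subseteq> (\<lambda>(p, e). sact n e p) ` ?A"
      proof
        fix w assume "w \<in> weyl_group n"
        then obtain e p where ep: "(e, p) \<in> signed_perms n" "w = sact n e p" using weyl_group_signed_perm by blast
        then have "w = sact n (restrict e {..<n}) p" "restrict e {..<n} \<in> PiE {..<n} (\<lambda>_. {1, -1})" "p permutes {..<n}"
          by (auto simp: signed_perms_def signs_def intro!: sact_cong)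
        then show "w \<in> (\<lambda>(p, e). sact n e p) ` ?A"
          by (intro image_eqI[of _ _ "(p, restrict e {..<n})"]) simp_all
      qed
    qed
  qed
  have "(\<Sum>w\<in>weyl_group n. (-1) ^ weyl_length n w * F w) =
      (\<Sum>x\<in>?A. (-1) ^ weyl_length n ((\<lambda>(p, e). sact n e p) x) * F ((\<lambda>(p, e). sact n e p) x))"
    by (rule sum.reindex_bij_betw[OF bij, symmetric])
  also have "\<dots> = (\<Sum>(p, e)\<in>?A. of_int (sgnP n e p) * F (sact n e p))"
  proof (rule sum.cong[OF refl])
    fix x assume x: "x \<in> ?A"
    obtain p e where [simp]: "x = (p, e)" by (cases x)
    have "(-1) ^ weyl_length n (sact n e p) = sgnP n e p"
      using x by (intro weyl_sign assms sp sact_weyl) simp_all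
    then have "(-1) ^ weyl_length n (sact n e p) = (of_int (sgnP n e p) :: 'a)"
      by (metis of_int_1 of_int_minus of_int_power)
    then show "(-1) ^ weyl_length n ((\<lambda>(p, e). sact n e p) x) * F ((\<lambda>(p, e). sact n e p) x) =
        (case x of (p, e) \<Rightarrow> of_int (sgnP n e p) * F (sact n e p))" by simp
  qed
  also have "\<dots> = (\<Sum>p | p permutes {..<n}. \<Sum>e\<in>PiE {..<n} (\<lambda>_. {1, -1}). of_int (sgnP n e p) * F (sact n e p))"
    by (rule sum.cartesian_product[symmetric])
  finally show ?thesis .
qed

section \<open>Reduction to an alternating sum of coefficients\<close>

lemma pos_roots_0: "pos_roots 0 = {}"
  by (auto simp: pos_roots_def)

lemma pos_roots_Suc:
  "pos_roots (Suc n) = pos_roots n \<union> ((\<lambda>i. coord (Suc i) - coord (Suc n)) ` {..<n} \<union>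
     ((\<lambda>i. coord (Suc i) + coord (Suc n)) ` {..<n} \<union> {frag_cmul 2 (coord (Suc n))}))" (is "?L = ?R")
proof
  show "?L \<subseteq> ?R"
  proof
    fix \<alpha> assume "\<alpha> \<in> ?L"
    then show "\<alpha> \<in> ?R"
    proof (cases rule: pos_rootsE)
      case (diff a b)
      then show ?thesis by (cases "b = n") (simp_all add: pos_roots_diffI)
    next
      case (add a b)
      then show ?thesis by (cases "b = n") (simp_all add: pos_roots_addI)
    next
      case (double a)
      then show ?thesis by (cases "a = n") (simp_all add: pos_roots_doubleI)
    qed
  qed
  show "?R \<subseteq> ?L"
  proof
    fix \<alpha> assume "\<alpha> \<in> ?R"
    then consider "\<alpha> \<in> pos_roots n" | i where "i < n" "\<alpha> = coord (Suc i) - coord (Suc n)"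
      | i where "i < n" "\<alpha> = coord (Suc i) + coord (Suc n)" | "\<alpha> = frag_cmul 2 (coord (Suc n))" by blast
    then show "\<alpha> \<in> ?L"
    proof cases
      case 1
      then show ?thesis
        by (cases rule: pos_rootsE) (simp_all add: pos_rootsI)
    qed (simp_all add: pos_rootsI)
  qed
qed

lemma pos_roots_lookup: "\<alpha> \<in> pos_roots n \<Longrightarrow> n < j \<Longrightarrow> lookup \<alpha> j = 0"
  by (elim pos_rootsE) (simp_all add: lookup_minus lookup_add lookup_coord)

lemma inj_coord: "coord i = coord j \<longleftrightarrow> i = j"
  using lookup_coord[of i j] lookup_coord[of j j] by (cases "i = j") auto

context
  fixes n :: nat
begin

text \<open>The coordinate \<open>Suc n\<close> tells the four families apart: it is 0, -1, 1 or
  2.\<close>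

lemma pos_roots_Suc_disjoint:
  "pos_roots n \<inter> ((\<lambda>i. coord (Suc i) - coord (Suc n)) ` {..<n} \<union>
     ((\<lambda>i. coord (Suc i) + coord (Suc n)) ` {..<n} \<union> {frag_cmul 2 (coord (Suc n))})) = {}" (is "_ \<inter> ?N = {}")
  "(\<lambda>i. coord (Suc i) - coord (Suc n)) ` {..<n} \<inter>
     ((\<lambda>i. coord (Suc i) + coord (Suc n)) ` {..<n} \<union> {frag_cmul 2 (coord (Suc n))}) = {}" (is "?A \<inter> (?B \<union> ?C) = {}")
  "(\<lambda>i. coord (Suc i) + coord (Suc n)) ` {..<n} \<inter> {frag_cmul 2 (coord (Suc n))} = {}"
proof -
  have A: "lookup a (Suc n) = -1" if "a \<in> ?A" for a
    using that by (auto simp: lookup_minus lookup_coord)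
  have B: "lookup a (Suc n) = 1" if "a \<in> ?B" for a
    using that by (auto simp: lookup_add lookup_coord)
  have C: "lookup a (Suc n) = 2" if "a \<in> ?C" for a
    using that by (auto simp: lookup_coord)
  have N: "lookup a (Suc n) \<noteq> 0" if "a \<in> ?N" for a
    using A[of a] B[of a] C[of a] that by auto
  show "pos_roots n \<inter> ?N = {}" using N pos_roots_lookup[of _ n "Suc n"] by blast
  have AB: "a \<notin> ?B" if "a \<in> ?A" for a using A[OF that] B[of a] by auto
  have AC: "a \<notin> ?C" if "a \<in> ?A" for a using A[OF that] C[of a] by auto
  have BC: "a \<notin> ?C" if "a \<in> ?B" for a using B[OF that] C[of a] by auto
  show "?A \<inter> (?B \<union> ?C) = {}" using AB AC by blast
  show "?B \<inter> ?C = {}" using BC by blast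
qed

lemma finite_pos_roots: "finite (pos_roots m)"
  by (induction m) (simp_all add: pos_roots_0 pos_roots_Suc)

lemma sum_pos_roots_Suc:
  fixes F :: "weight \<Rightarrow> 'a::comm_monoid_add"
  shows "sum F (pos_roots (Suc n)) = sum F (pos_roots n) + ((\<Sum>i<n. F (coord (Suc i) - coord (Suc n))) +
     ((\<Sum>i<n. F (coord (Suc i) + coord (Suc n))) + F (frag_cmul 2 (coord (Suc n)))))"
  unfolding pos_roots_Suc
proof -
  have fin: "finite {frag_cmul 2 (coord (Suc n))}" by simp
  have reindex: "sum F ((\<lambda>i. coord (Suc i) - coord (Suc n)) ` {..<n}) = sum (\<lambda>i. F (coord (Suc i) - coord (Suc n))) {..<n}"
    "sum F ((\<lambda>i. coord (Suc i) + coord (Suc n)) ` {..<n}) = sum (\<lambda>i. F (coord (Suc i) + coord (Suc n))) {..<n}"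
    by (rule sum.reindex_cong[OF _ refl refl]; simp add: inj_on_def inj_coord)+
  show "sum F (pos_roots n \<union> ((\<lambda>i. coord (Suc i) - coord (Suc n)) ` {..<n} \<union>
     ((\<lambda>i. coord (Suc i) + coord (Suc n)) ` {..<n} \<union> {frag_cmul 2 (coord (Suc n))}))) =
    sum F (pos_roots n) + (sum (\<lambda>i. F (coord (Suc i) - coord (Suc n))) {..<n} +
     (sum (\<lambda>i. F (coord (Suc i) + coord (Suc n))) {..<n} + F (frag_cmul 2 (coord (Suc n)))))"
    unfolding sum.union_disjoint[OF finite_pos_roots finite_UnI[OF finite_imageI[OF finite_lessThan] finite_UnI[OF finite_imageI[OF finite_lessThan] fin]] pos_roots_Suc_disjoint(1)]
      sum.union_disjoint[OF finite_imageI[OF finite_lessThan] finite_UnI[OF finite_imageI[OF finite_lessThan] fin] pos_roots_Suc_disjoint(2)]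
      sum.union_disjoint[OF finite_imageI[OF finite_lessThan] fin pos_roots_Suc_disjoint(3)] reindex
    by simp
qed

lemma prod_pos_roots_Suc:
  fixes F :: "weight \<Rightarrow> 'a::comm_monoid_mult"
  shows "prod F (pos_roots (Suc n)) = prod F (pos_roots n) * ((\<Prod>i<n. F (coord (Suc i) - coord (Suc n))) *
     ((\<Prod>i<n. F (coord (Suc i) + coord (Suc n))) * F (frag_cmul 2 (coord (Suc n)))))"
  unfolding pos_roots_Suc
proof -
  have fin: "finite {frag_cmul 2 (coord (Suc n))}" by simp
  have reindex: "prod F ((\<lambda>i. coord (Suc i) - coord (Suc n)) ` {..<n}) = prod (\<lambda>i. F (coord (Suc i) - coord (Suc n))) {..<n}"
    "prod F ((\<lambda>i. coord (Suc i) + coord (Suc n)) ` {..<n}) = prod (\<lambda>i. F (coord (Suc i) + coord (Suc n))) {..<n}"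
    by (rule prod.reindex_cong[OF _ refl refl]; simp add: inj_on_def inj_coord)+
  show "prod F (pos_roots n \<union> ((\<lambda>i. coord (Suc i) - coord (Suc n)) ` {..<n} \<union>
     ((\<lambda>i. coord (Suc i) + coord (Suc n)) ` {..<n} \<union> {frag_cmul 2 (coord (Suc n))}))) =
    prod F (pos_roots n) * (prod (\<lambda>i. F (coord (Suc i) - coord (Suc n))) {..<n} *
     (prod (\<lambda>i. F (coord (Suc i) + coord (Suc n))) {..<n} * F (frag_cmul 2 (coord (Suc n)))))"
    unfolding prod.union_disjoint[OF finite_pos_roots finite_UnI[OF finite_imageI[OF finite_lessThan] finite_UnI[OF finite_imageI[OF finite_lessThan] fin]] pos_roots_Suc_disjoint(1)]
      prod.union_disjoint[OF finite_imageI[OF finite_lessThan] finite_UnI[OF finite_imageI[OF finite_lessThan] fin] pos_roots_Suc_disjoint(2)]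
      prod.union_disjoint[OF finite_imageI[OF finite_lessThan] fin pos_roots_Suc_disjoint(3)] reindex
    by simp
qed

end

lemma rho_eq: "rho n = rhoC n"
proof (rule poly_mapping_eqI)
  have sum: "lookup (\<Sum>\<alpha>\<in>pos_roots n. \<alpha>) i = 2 * lookup (rhoC n) i" for i
  proof (induction n)
    case 0
    then show ?case by (simp add: pos_roots_0 rhoC_def)
  next
    case (Suc n)
    have "lookup (\<Sum>\<alpha>\<in>pos_roots (Suc n). \<alpha>) i = lookup (\<Sum>\<alpha>\<in>pos_roots n. \<alpha>) i +
        2 * (\<Sum>j<n. lookup (coord (Suc j)) i) + 2 * lookup (coord (Suc n)) i"
      unfolding sum_pos_roots_Suc[of "\<lambda>x. x"]
      by (simp only: lookup_add lookup_sum lookup_minus sum.distrib sum_subtractf lookup_frag_cmul)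
    also have "\<dots> = 2 * lookup (rhoC (Suc n)) i"
      unfolding Suc.IH
      by (cases i) (simp_all add: lookup_coord lookup_rhoC Suc_diff_le)
    finally show ?case .
  qed
  show "lookup (rho n) i = lookup (rhoC n) i" for i
    unfolding rho_def by (simp add: Poly_Mapping.map.rep_eq sum when_def)
qed

section \<open>Specialisation of the 2 n variables and the numerator\<close>

text \<open>Under \<open>zt\<close> the \<open>2 n\<close> variables become \<open>e\<close> to the power \<open>\<epsilon>\<^sub>1, - \<epsilon>\<^sub>1, \<dots>, \<epsilon>\<^sub>n, - \<epsilon>\<^sub>n\<close>.\<close>

definition zt :: "weight \<Rightarrow> weight" where
  "zt = frag_extend (\<lambda>i. frag_cmul (if even i then 1 else -1) (coord (Suc (i div 2))))"

lemma lattice_hom_zt: "lattice_hom zt"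
  by unfold_locales (simp add: zt_def frag_extend_add)

lemma zt_coord: "zt (coord (2 * k)) = coord (Suc k)" "zt (coord (Suc (2 * k))) = - coord (Suc k)"
  by (simp_all add: zt_def coord_def)

lemma lookup_zt: "lookup (zt a) 0 = 0" "lookup (zt a) (Suc k) = lookup a (2 * k) - lookup a (Suc (2 * k))"
proof -
  interpret lattice_hom zt by (rule lattice_hom_zt)
  show "lookup (zt a) 0 = 0"
    using subset_UNIV
    by (induction a rule: frag_induction) (simp_all add: diff lookup_minus, simp add: zt_def lookup_coord)
  show "lookup (zt a) (Suc k) = lookup a (2 * k) - lookup a (Suc (2 * k))"
    using subset_UNIV
  proof (induction a rule: frag_induction)
    case (one i)
    show ?case
    proof (cases "even i")
      case True
      then obtain j where i: "i = 2 * j" by (elim evenE)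
      have "2 * j \<noteq> Suc (2 * k)" by presburger
      then show ?thesis by (simp add: i zt_def lookup_coord lookup_single when_def)
    next
      case False
      then obtain j where i: "i = Suc (2 * j)" by (elim oddE) simp
      have "Suc (2 * j) \<noteq> 2 * k" by presburger
      then show ?thesis by (simp add: i zt_def lookup_coord lookup_single when_def)
    qed
  qed (simp_all add: diff lookup_minus)
qed

definition Zs :: "nat \<Rightarrow> laurent fps" where
  "Zs n = fmap_coeffs (pmh zt) (Hm (2 * n))"

lemma prod_lessThan_double:
  fixes f :: "nat \<Rightarrow> 'a::comm_monoid_mult"
  shows "(\<Prod>i<2 * n. f i) = (\<Prod>k<n. f (2 * k)) * (\<Prod>k<n. f (Suc (2 * k)))"
  by (induction n) (simp_all add: ac_simps)

text \<open>The two new variables have the weights \<epsilon> and - \<epsilon>. Their products with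
  the old ones give the roots that involve \<epsilon> and a second coordinate, and their products
  among themselves give 2 \<epsilon>, 0 and - 2 \<epsilon>.\<close>

lemma Zs_Suc:
  fixes n defines "\<epsilon> \<equiv> coord (Suc n)" and "c \<equiv> \<lambda>k. coord (Suc k)"
  shows "Zs (Suc n) = Zs n *
    (((\<Prod>k<n. geo (frag_of (c k + \<epsilon>))) * (\<Prod>k<n. geo (frag_of (- (c k - \<epsilon>)))) * geo (frag_of (frag_cmul 2 \<epsilon>))) *
     ((\<Prod>k<n. geo (frag_of (c k - \<epsilon>))) * (\<Prod>k<n. geo (frag_of (- (c k + \<epsilon>)))) * geo 1 * geo (frag_of (- frag_cmul 2 \<epsilon>))))"
proof -
  interpret lattice_hom zt by (rule lattice_hom_zt)
  have pz: "fmap_coeffs (pmh zt) (geo (xv i * xv j)) = geo (frag_of (zt (coord i) + zt (coord j)))" for i j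
    by (simp add: fmap_geo xv_def frag_of_mult add)
  have s: "2 * Suc n = Suc (Suc (2 * n))" by simp
  have dbl: "a + a = frag_cmul 2 a" "- a - a = - frag_cmul 2 a" for a :: weight
    by (rule poly_mapping_eqI, simp only: lookup_add lookup_frag_cmul mult_2,
        rule poly_mapping_eqI, simp only: lookup_minus lookup_uminus lookup_frag_cmul)
  have minus: "- a + b = - (a - b)" "- a - b = - (a + b)" for a b :: weight by simp_all
  have "Zs (Suc n) = Zs n * (\<Prod>i<Suc (2 * n). geo (frag_of (zt (coord i) + \<epsilon>))) *
      (\<Prod>i<Suc (Suc (2 * n)). geo (frag_of (zt (coord i) - \<epsilon>)))"
    unfolding Zs_def s Hm_Suc fmap_mult fmap_prod pz lessThan_Suc_atMost[symmetric] zt_coord \<epsilon>_def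
    by (simp only: diff_conv_add_uminus)
  also have "(\<Prod>i<Suc (2 * n). geo (frag_of (zt (coord i) + \<epsilon>))) =
      (\<Prod>k<n. geo (frag_of (c k + \<epsilon>))) * (\<Prod>k<n. geo (frag_of (- (c k - \<epsilon>)))) * geo (frag_of (frag_cmul 2 \<epsilon>))"
    unfolding prod.lessThan_Suc prod_lessThan_double zt_coord c_def \<epsilon>_def[symmetric] minus dbl ..
  also have "(\<Prod>i<Suc (Suc (2 * n)). geo (frag_of (zt (coord i) - \<epsilon>))) =
      (\<Prod>k<n. geo (frag_of (c k - \<epsilon>))) * (\<Prod>k<n. geo (frag_of (- (c k + \<epsilon>)))) * geo 1 * geo (frag_of (- frag_cmul 2 \<epsilon>))"
    unfolding prod.lessThan_Suc prod_lessThan_double zt_coord c_def \<epsilon>_def[symmetric] minus dbl diff_self frag_of_0 ..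
  finally show ?thesis by (simp only: mult.assoc)
qed

lemma geo_cancel: "(\<Prod>k<n. geo (f k)) * (\<Prod>k<n. 1 - fps_const (f k) * fps_X) = 1"
  unfolding prod.distrib[symmetric] geo_mult by simp

lemma kostant_series_geo: "kostant_series n = (\<Prod>\<alpha>\<in>pos_roots n. geo (frag_of \<alpha>))"
  by (simp add: kostant_series_def geo_left_inverse)

text \<open>The products of two variables specialise to all roots and, \<open>n\<close> times, to
  the weight 0. The product on the left cancels the negative roots.\<close>

lemma Zs_kostant:
  "Zs n * (\<Prod>\<alpha>\<in>pos_roots n. 1 - fps_const (frag_of (- \<alpha>)) * fps_X) = geo 1 ^ n * kostant_series n"
proof (induction n)
  case 0
  have "Zs 0 = 1"
    using lattice_hom.fmap_1[OF lattice_hom_zt] by (simp add: Zs_def Hm_def)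
  then show ?case by (simp add: pos_roots_0 kostant_series_geo)
next
  case (Suc n)
  define \<epsilon> where "\<epsilon> = coord (Suc n)"
  define c where "c = (\<lambda>k. coord (Suc k))"
  let ?D = "\<lambda>a. 1 - fps_const (frag_of a :: laurent) * fps_X"
  let ?G = "\<lambda>a. geo (frag_of a :: laurent)"
  let ?N = "\<Prod>\<alpha>\<in>pos_roots n. ?D (- \<alpha>)"
  define A1 A2 B1 B2 D1 D2 where "A1 = (\<Prod>k<n. ?G (c k + \<epsilon>))" and "A2 = (\<Prod>k<n. ?G (c k - \<epsilon>))"
    and "B1 = (\<Prod>k<n. ?G (- (c k - \<epsilon>)))" and "B2 = (\<Prod>k<n. ?G (- (c k + \<epsilon>)))"
    and "D1 = (\<Prod>k<n. ?D (- (c k - \<epsilon>)))" and "D2 = (\<Prod>k<n. ?D (- (c k + \<epsilon>)))"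
  have 1: "B1 * D1 = 1" "B2 * D2 = 1"
    unfolding B1_def B2_def D1_def D2_def by (rule geo_cancel)+
  have 2: "?G (- frag_cmul 2 \<epsilon>) * ?D (- frag_cmul 2 \<epsilon>) = 1" by (rule geo_mult)
  have Z: "Zs (Suc n) = Zs n * ((A1 * B1 * ?G (frag_cmul 2 \<epsilon>)) * (A2 * B2 * geo 1 * ?G (- frag_cmul 2 \<epsilon>)))"
    unfolding A1_def A2_def B1_def B2_def c_def \<epsilon>_def by (rule Zs_Suc)
  have N: "(\<Prod>\<alpha>\<in>pos_roots (Suc n). ?D (- \<alpha>)) = ?N * (D1 * (D2 * ?D (- frag_cmul 2 \<epsilon>)))"
    unfolding D1_def D2_def c_def \<epsilon>_def by (rule prod_pos_roots_Suc)
  have K: "kostant_series (Suc n) = kostant_series n * (A2 * (A1 * ?G (frag_cmul 2 \<epsilon>)))"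
    unfolding kostant_series_geo A1_def A2_def c_def \<epsilon>_def by (rule prod_pos_roots_Suc)
  have "Zs (Suc n) * (\<Prod>\<alpha>\<in>pos_roots (Suc n). ?D (- \<alpha>)) =
      (Zs n * ?N) * (geo 1 * (A2 * (A1 * ?G (frag_cmul 2 \<epsilon>)))) * ((B1 * D1) * (B2 * D2) *
        (?G (- frag_cmul 2 \<epsilon>) * ?D (- frag_cmul 2 \<epsilon>)))"
    unfolding Z N by (simp only: ac_simps)
  also have "\<dots> = geo 1 ^ Suc n * kostant_series (Suc n)"
    unfolding 1 2 Suc.IH K by (simp only: mult_1_left mult_1_right power_Suc ac_simps)
  finally show ?case .
qed

lemma involution_permutes:
  fixes \<pi> :: "nat \<Rightarrow> nat"
  assumes "\<And>i. \<pi> (\<pi> i) = i" "\<And>i. m \<le> i \<Longrightarrow> \<pi> i = i"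
  shows "\<pi> permutes {..<m}"
  unfolding permutes_def
proof (intro conjI allI impI)
  fix i :: nat
  show "\<exists>!j. \<pi> j = i" using assms(1) by (intro ex1I[of _ "\<pi> i"]) (simp, metis)
qed (use assms(2) in simp)

text \<open>A reflection permutes the weights \<plusminus> \<epsilon>_k of the variables, so it is
  induced by a permutation of the 2 n variables, under which \<open>Hm\<close> is invariant.\<close>

lemma pmh_reflection_Zs:
  assumes "\<alpha> \<in> pos_roots n"
  shows "pmh (reflection \<alpha>) (fps_nth (Zs n) m) = fps_nth (Zs n) m"
proof -
  obtain e p where ep: "(e, p) \<in> signed_perms n" "p \<circ> p = id" "\<And>j. e (p j) = e j" "reflection \<alpha> = sact n e p"
    using assms by (rule reflectionE) blast
  have p: "p permutes {..<n}" and e: "signs n e" using ep(1) by (simp_all add: signed_perms_def)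
  have pp: "p (p j) = j" for j using fun_cong[OF ep(2), of j] by simp
  have plt: "p j < n \<longleftrightarrow> j < n" for j using permutes_in_image[OF p, of j] by simp
  \<comment> \<open>The variables \<open>2 * k\<close> and \<open>2 * k + 1\<close> have opposite
    weights; a sign change exchanges the parity.\<close>
  define \<pi> where "\<pi> i = (if i < 2 * n then
      (if (e (i div 2) = 1) = even i then 2 * p (i div 2) else Suc (2 * p (i div 2))) else i)" for i
  have \<pi>e: "\<pi> (2 * k) = (if k < n then if e k = 1 then 2 * p k else Suc (2 * p k) else 2 * k)" for k
    by (simp add: \<pi>_def)
  have \<pi>o: "\<pi> (Suc (2 * k)) = (if k < n then if e k = 1 then Suc (2 * p k) else 2 * p k else Suc (2 * k))" for k
  proof -
    have "Suc (2 * k) < 2 * n \<longleftrightarrow> k < n" by presburger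
    then show ?thesis by (simp add: \<pi>_def)
  qed
  have "\<pi> (\<pi> i) = i" for i
  proof (cases "even i")
    case True
    then obtain k where "i = 2 * k" by (elim evenE)
    then show ?thesis by (auto simp: \<pi>e \<pi>o plt ep(3) pp)
  next
    case False
    then obtain k where "i = Suc (2 * k)" by (elim oddE) simp
    then show ?thesis by (auto simp: \<pi>e \<pi>o plt ep(3) pp)
  qed
  then have \<pi>: "\<pi> permutes {..<2 * n}"
    by (rule involution_permutes) (simp add: \<pi>_def)
  have "sact n e p (zt a) = zt (pw \<pi> a)" for a
  proof (rule poly_mapping_eqI)
    fix i
    note lookups = lookup_sact[OF permutes_inj[OF p]] lookup_zt lookup_pw[OF permutes_inj[OF \<pi>]] \<pi>e \<pi>o
    show "lookup (sact n e p (zt a)) i = lookup (zt (pw \<pi> a)) i"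
    proof (cases i)
      case 0
      then show ?thesis by (simp add: lookups)
    next
      case (Suc k)
      consider "\<not> k < n" | "k < n" "e k = 1" | "k < n" "e k = -1" using e by (auto simp: signs_def)
      then show ?thesis
        by cases (simp_all add: Suc lookups permutes_not_in[OF p])
    qed
  qed
  then have "pmh (reflection \<alpha>) (fps_nth (Zs n) m) = pmh zt (pmh (pw \<pi>) (fps_nth (Hm (2 * n)) m))"
    by (simp add: Zs_def pmh_pmh ep(4))
  then show ?thesis
    by (simp add: symm_perm[OF \<pi> symm_Hm] Zs_def)
qed

lemma reflection_reflection:
  assumes "\<alpha> \<in> pos_roots n"
  shows "reflection \<alpha> (reflection \<alpha> v) = v"
  using assms
  by (cases rule: pos_rootsE) (auto intro!: poly_mapping_eqI simp: reflection_diff reflection_add reflection_double)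

lemma reflection_minus:
  assumes "\<alpha> \<in> pos_roots n"
  shows "reflection \<alpha> (v - w) = reflection \<alpha> v - reflection \<alpha> w"
  using assms
  by (cases rule: pos_rootsE) (auto intro!: poly_mapping_eqI simp: reflection_diff reflection_add reflection_double lookup_minus)

lemma lookup_Zs_reflection:
  assumes "\<alpha> \<in> pos_roots n"
  shows "lookup (fps_nth (Zs n) m) (reflection \<alpha> v) = lookup (fps_nth (Zs n) m) v"
proof -
  have "inj (reflection \<alpha>)" by (rule inj_on_inverseI) (rule reflection_reflection[OF assms])
  from pmh_inj_lookup[OF this, of "fps_nth (Zs n) m" v] show ?thesis
    by (simp add: pmh_reflection_Zs[OF assms])
qed

lemma weyl_sign_reflection:
  assumes "1 \<le> n" "\<alpha> \<in> pos_roots n" "w \<in> weyl_group n"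
  shows "(-1) ^ weyl_length n (reflection \<alpha> \<circ> w) = - ((-1) ^ weyl_length n w :: int)"
proof -
  obtain e p where ep: "(e, p) \<in> signed_perms n" "reflection \<alpha> = sact n e p" "sgnP n e p = -1"
    using assms(2) by (rule reflectionE)
  obtain f q where fq: "(f, q) \<in> signed_perms n" "w = sact n f q"
    using weyl_group_signed_perm[OF assms(3)] by blast
  have pq: "p permutes {..<n}" "q permutes {..<n}" using ep(1) fq(1) by (simp_all add: signed_perms_def)
  note sc = signed_perms_comp[OF ep(1) fq(1)]
  show ?thesis
    unfolding ep(2) fq(2) sact_comp[OF pq]
    unfolding weyl_sign[OF assms(1) sc sact_weyl[OF sc]] weyl_sign[OF assms(1) fq(1) sact_weyl[OF fq(1)]]
      sgnP_comp[OF pq] ep(3) by simp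
qed

text \<open>The alternating sum for \<open>Zs\<close> in place of the Kostant series, with a free
  weight \<gamma> in place of the subtracted \<rho>. The exponents of the numerator will be absorbed
  into \<gamma>.\<close>

definition Zf :: "nat \<Rightarrow> nat \<Rightarrow> weight \<Rightarrow> weight \<Rightarrow> int" where
  "Zf n m \<mu> \<gamma> = (\<Sum>w\<in>weyl_group n. (-1) ^ weyl_length n w * lookup (fps_nth (Zs n) m) (w \<mu> - \<gamma>))"

text \<open>Invariance of \<open>Zs\<close> moves the reflection from \<gamma> to the Weyl group
  element, where it changes the sign.\<close>

lemma Zf_reflection:
  assumes "1 \<le> n" "\<alpha> \<in> pos_roots n"
  shows "Zf n m \<mu> (reflection \<alpha> \<gamma>) = - Zf n m \<mu> \<gamma>"
proof -
  let ?r = "reflection \<alpha>" and ?Z = "fps_nth (Zs n) m"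
  have rr: "?r (?r v) = v" for v by (rule reflection_reflection[OF assms(2)])
  have "Zf n m \<mu> (?r \<gamma>) = (\<Sum>w\<in>weyl_group n. (-1) ^ weyl_length n w * lookup ?Z ((?r \<circ> w) \<mu> - \<gamma>))"
    unfolding Zf_def
  proof (rule sum.cong[OF refl])
    fix w
    have "w \<mu> - ?r \<gamma> = ?r ((?r \<circ> w) \<mu> - \<gamma>)"
      by (simp add: reflection_minus[OF assms(2)] rr)
    then show "(-1) ^ weyl_length n w * lookup ?Z (w \<mu> - ?r \<gamma>) = (-1) ^ weyl_length n w * lookup ?Z ((?r \<circ> w) \<mu> - \<gamma>)"
      by (simp add: lookup_Zs_reflection[OF assms(2)])
  qed
  also have "\<dots> = (\<Sum>w\<in>weyl_group n. - ((-1) ^ weyl_length n w * lookup ?Z (w \<mu> - \<gamma>)))"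
  proof (rule sum.reindex_bij_witness[of _ "\<lambda>w. ?r \<circ> w" "\<lambda>w. ?r \<circ> w"])
    fix w assume w: "w \<in> weyl_group n"
    show "?r \<circ> (?r \<circ> w) = w" "?r \<circ> (?r \<circ> w) = w" by (simp_all add: fun_eq_iff rr)
    show "?r \<circ> w \<in> weyl_group n" "?r \<circ> w \<in> weyl_group n"
      using weyl_group.weyl_reflection[OF assms(2) w] by simp_all
    show "- ((-1) ^ weyl_length n (?r \<circ> w) * lookup ?Z ((?r \<circ> w) \<mu> - \<gamma>)) =
        (-1) ^ weyl_length n w * lookup ?Z ((?r \<circ> w) \<mu> - \<gamma>)"
      unfolding weyl_sign_reflection[OF assms w] by simp
  qed
  also have "\<dots> = - Zf n m \<mu> \<gamma>" by (simp add: Zf_def sum_negf)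
  finally show ?thesis .
qed

text \<open>The order of the quantifiers matters: \<open>s\<close> depends neither on the degree nor
  on \<mu>, and hence not on the partition.\<close>

lemma Zf_weyl:
  assumes "1 \<le> n" "w \<in> weyl_group n"
  shows "\<exists>s. \<forall>m \<mu>. Zf n m \<mu> (w \<gamma>) = s * Zf n m \<mu> \<gamma>"
  using assms(2)
proof induction
  case weyl_id
  show ?case by (rule exI[of _ 1]) simp
next
  case (weyl_reflection \<alpha> w)
  then obtain s where "\<forall>m \<mu>. Zf n m \<mu> (w \<gamma>) = s * Zf n m \<mu> \<gamma>" by blast
  then show ?case by (intro exI[of _ "-s"]) (simp add: Zf_reflection[OF assms(1) weyl_reflection(1)])
qed

text \<open>If no reflection fixes \<gamma>, its first \<open>n\<close> coordinates are nonzero with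
  distinct absolute values at most \<open>n\<close>. These are then 1, ..., n in some order, so
  \<gamma> is a signed permutation of \<rho>.\<close>

lemma Zf_rho:
  assumes n: "1 \<le> n" and supp: "lookup \<gamma> 0 = 0" "\<And>j. n \<le> j \<Longrightarrow> lookup \<gamma> (Suc j) = 0"
    and bound: "\<And>j. j < n \<Longrightarrow> \<bar>lookup \<gamma> (Suc j)\<bar> \<le> int n"
  shows "\<exists>s. \<forall>m \<mu>. Zf n m \<mu> \<gamma> = s * Zf n m \<mu> (rhoC n)"
proof (cases "\<exists>\<alpha>\<in>pos_roots n. reflection \<alpha> \<gamma> = \<gamma>")
  case True
  then obtain \<alpha> where \<alpha>: "\<alpha> \<in> pos_roots n" "reflection \<alpha> \<gamma> = \<gamma>" by blast
  have "Zf n m \<mu> \<gamma> = 0" for m \<mu>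
    using Zf_reflection[OF n \<alpha>(1), of m \<mu> \<gamma>] unfolding \<alpha>(2) by simp
  then show ?thesis by (intro exI[of _ 0]) simp
next
  case False
  let ?g = "\<lambda>j. lookup \<gamma> (Suc j)"
  have nz: "?g j \<noteq> 0" if "j < n" for j
  proof
    assume "?g j = 0"
    then have "reflection (frag_cmul 2 (coord (Suc j))) \<gamma> = \<gamma>"
      by (intro poly_mapping_eqI) (simp add: reflection_double)
    with False pos_roots_doubleI[OF that] show False by blast
  qed
  have ne: "\<bar>?g a\<bar> \<noteq> \<bar>?g b\<bar>" if ab: "a < b" "b < n" for a b
  proof
    assume "\<bar>?g a\<bar> = \<bar>?g b\<bar>"
    then consider "?g a = ?g b" | "?g a = - ?g b" by linarith
    then show False
    proof cases
      case 1
      then have "reflection (coord (Suc a) - coord (Suc b)) \<gamma> = \<gamma>"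
        using ab by (intro poly_mapping_eqI) (simp add: reflection_diff)
      with False pos_roots_diffI[OF ab] show False by blast
    next
      case 2
      then have "reflection (coord (Suc a) + coord (Suc b)) \<gamma> = \<gamma>"
        using ab by (intro poly_mapping_eqI) (simp add: reflection_add)
      with False pos_roots_addI[OF ab] show False by blast
    qed
  qed
  \<comment> \<open>The value v of \<open>rhoC n\<close> stands at position n - v, counted from
    0.\<close>
  define p where "p j = (if j < n then n - nat \<bar>?g j\<bar> else j)" for j
  define e where "e j = sgn (?g j)" for j
  have inj: "inj_on p {..<n}"
  proof (rule linorder_inj_onI')
    fix a b assume "a \<in> {..<n}" "b \<in> {..<n}" "a < b"
    then have ab: "a < b" "a < n" "b < n" by auto
    have "nat \<bar>?g a\<bar> \<noteq> nat \<bar>?g b\<bar>" using ne[OF ab(1,3)] by (metis abs_ge_zero nat_eq_iff2 nat_0_le)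
    moreover have "nat \<bar>?g a\<bar> \<le> n" "nat \<bar>?g b\<bar> \<le> n" using bound ab(2,3) by (simp_all only: nat_le_iff)
    ultimately have "n - nat \<bar>?g a\<bar> \<noteq> n - nat \<bar>?g b\<bar>" by arith
    then show "p a \<noteq> p b" using ab(2,3) by (simp only: p_def if_True not_False_eq_True)
  qed
  have "p ` {..<n} \<subseteq> {..<n}"
  proof
    fix x assume "x \<in> p ` {..<n}"
    then obtain j where "j < n" "x = n - nat \<bar>?g j\<bar>" by (auto simp: p_def)
    with nz[of j] show "x \<in> {..<n}" by simp
  qed
  then have "bij_betw p {..<n} {..<n}"
    using inj endo_inj_surj[OF finite_lessThan] by (simp add: bij_betw_def)
  then have p: "p permutes {..<n}"
    by (intro bij_imp_permutes) (simp_all add: p_def)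
  have "(e, p) \<in> signed_perms n"
    using p nz by (auto simp: signed_perms_def signs_def e_def sgn_if)
  moreover have "sact n e p (rhoC n) = \<gamma>"
  proof (rule poly_mapping_eqI)
    fix i
    show "lookup (sact n e p (rhoC n)) i = lookup \<gamma> i"
    proof (cases i)
      case 0
      then show ?thesis by (simp add: lookup_sact[OF permutes_inj[OF p]] lookup_rhoC supp)
    next
      case (Suc j)
      show ?thesis
      proof (cases "j < n")
        case True
        have "int (n - p j) = \<bar>?g j\<bar>" using bound[OF True] True by (simp add: p_def)
        then show ?thesis
          using Suc True by (simp add: lookup_sact[OF permutes_inj[OF p]] lookup_rhoC e_def sgn_mult_abs)
      next
        case False
        then show ?thesis using Suc by (simp add: lookup_sact[OF permutes_inj[OF p]] lookup_rhoC supp p_def)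
      qed
    qed
  qed
  ultimately show ?thesis using Zf_weyl[OF n sact_weyl, of e p "rhoC n"] by simp
qed

section \<open>Bounds for the exponents of the numerator\<close>

definition coord_bounds :: "nat \<Rightarrow> int \<Rightarrow> int \<Rightarrow> laurent fps \<Rightarrow> bool" where
  "coord_bounds j L B F \<longleftrightarrow> (\<forall>N. keys (fps_nth F N) \<subseteq> {a. L \<le> lookup a j \<and> lookup a j \<le> B})"

lemma coord_bounds_mult:
  assumes "coord_bounds j L B F" "coord_bounds j L' B' G"
  shows "coord_bounds j (L + L') (B + B') (F * G)"
  unfolding coord_bounds_def fps_mult_nth
proof (intro allI keys_sum_sub)
  fix N i
  show "keys (fps_nth F i * fps_nth G (N - i)) \<subseteq> {a. L + L' \<le> lookup a j \<and> lookup a j \<le> B + B'}"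
    using assms unfolding coord_bounds_def
    by (intro keys_mult_sub[of _ "{a. L \<le> lookup a j \<and> lookup a j \<le> B}" _ "{a. L' \<le> lookup a j \<and> lookup a j \<le> B'}"])
      (auto simp: lookup_add)
qed

lemma coord_bounds_1: "coord_bounds j 0 0 1"
  by (auto simp: coord_bounds_def)

lemma coord_bounds_prod:
  "(\<And>i. i \<in> I \<Longrightarrow> coord_bounds j (L i) (B i) (F i)) \<Longrightarrow> coord_bounds j (sum L I) (sum B I) (prod F I)"
  by (induction I rule: infinite_finite_induct) (simp_all add: coord_bounds_1 coord_bounds_mult)

lemma coord_bounds_linear:
  "coord_bounds j (min 0 (lookup a j)) (max 0 (lookup a j)) (1 - fps_const (frag_of a) * fps_X)"
  unfolding coord_bounds_def
proof
  fix N
  consider "N = 0" | "N = 1" | M where "N = Suc (Suc M)" by (metis One_nat_def not0_implies_Suc)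
  then show "keys (fps_nth (1 - fps_const (frag_of a) * fps_X) N) \<subseteq>
      {b. min 0 (lookup a j) \<le> lookup b j \<and> lookup b j \<le> max 0 (lookup a j)}"
    by cases auto
qed

text \<open>The first product cancels the series for the weight 0; it is written with
  \<open>frag_of 0\<close> so that \<open>coord_bounds_linear\<close> covers both products.\<close>

definition Nn :: "nat \<Rightarrow> laurent fps" where
  "Nn n = (\<Prod>i<n. 1 - fps_const (frag_of 0) * fps_X) * (\<Prod>\<alpha>\<in>pos_roots n. 1 - fps_const (frag_of (- \<alpha>)) * fps_X)"

lemma kostant_series_Zs: "kostant_series n = Nn n * Zs n"
proof -
  have "(1 - fps_const (frag_of 0) * fps_X :: laurent fps) ^ n * geo 1 ^ n = 1"
    unfolding power_mult_distrib[symmetric] using geo_mult[of "1 :: laurent"] by (simp add: mult.commute)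
  then have "kostant_series n = (1 - fps_const (frag_of 0) * fps_X) ^ n * (geo 1 ^ n * kostant_series n)"
    by (simp only: mult.assoc[symmetric] mult_1_left)
  then show ?thesis
    unfolding Zs_kostant[symmetric] by (simp only: Nn_def prod_constant card_lessThan ac_simps)
qed

lemma sum_abs_pos_roots: "(\<Sum>\<alpha>\<in>pos_roots n. \<bar>lookup \<alpha> j\<bar>) = (if 1 \<le> j \<and> j \<le> n then 2 * int n else 0)"
proof (induction n)
  case 0
  then show ?case by (simp add: pos_roots_0)
next
  case (Suc n)
  consider "j = 0 \<or> Suc n < j" | "j = Suc n" | i where "j = Suc i" "i < n"
    by (cases j) (simp, metis linorder_neqE_nat Suc_less_eq)
  then show ?case
  proof cases
    case 1
    then show ?thesis
      unfolding sum_pos_roots_Suc Suc.IH by (auto simp: lookup_add lookup_minus lookup_coord)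
  next
    case 2
    then show ?thesis
      unfolding sum_pos_roots_Suc Suc.IH by (simp add: lookup_add lookup_minus lookup_coord)
  next
    case (3 i)
    have "\<bar>lookup (coord (Suc i') - coord (Suc n)) j\<bar> = (if i' = i then 1 else 0)"
      "\<bar>lookup (coord (Suc i') + coord (Suc n)) j\<bar> = (if i' = i then 1 else 0)" for i'
      using 3 by (auto simp: lookup_add lookup_minus lookup_coord)
    then show ?thesis
      unfolding sum_pos_roots_Suc Suc.IH using 3 by (simp add: lookup_coord)
  qed
qed

lemma sum_lookup_pos_roots: "(\<Sum>\<alpha>\<in>pos_roots n. lookup \<alpha> j) = 2 * lookup (rhoC n) j"
proof (induction n)
  case 0
  then show ?case by (simp add: pos_roots_0 rhoC_def)
next
  case (Suc n)
  have "(\<Sum>\<alpha>\<in>pos_roots (Suc n). lookup \<alpha> j) = 2 * lookup (rhoC n) j +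
      2 * (\<Sum>i<n. lookup (coord (Suc i)) j) + 2 * lookup (coord (Suc n)) j"
    unfolding sum_pos_roots_Suc Suc.IH
    by (simp only: lookup_add lookup_minus sum.distrib sum_subtractf lookup_frag_cmul)
  also have "\<dots> = 2 * lookup (rhoC (Suc n)) j"
    by (cases j) (simp_all add: lookup_coord lookup_rhoC Suc_diff_le)
  finally show ?case .
qed

text \<open>Coordinate \<open>j\<close> of the exponents lies in an interval whose length is the sum
  of the absolute values in the positive roots, that is 2 n, and whose centre is minus the
  coordinate of \<rho>. Adding \<rho> centres it at 0.\<close>

lemma Nn_bounds:
  assumes "a \<in> keys (fps_nth (Nn n) N)"
  shows "\<bar>lookup (rhoC n + a) j\<bar> \<le> (if 1 \<le> j \<and> j \<le> n then int n else 0)"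
proof -
  let ?L = "\<Sum>\<alpha>\<in>pos_roots n. min 0 (lookup (- \<alpha>) j)" and ?B = "\<Sum>\<alpha>\<in>pos_roots n. max 0 (lookup (- \<alpha>) j)"
  have "coord_bounds j ((\<Sum>i<n. min 0 (lookup 0 j)) + ?L) ((\<Sum>i<n. max 0 (lookup 0 j)) + ?B) (Nn n)"
    unfolding Nn_def by (intro coord_bounds_mult coord_bounds_prod coord_bounds_linear)
  then have "coord_bounds j ?L ?B (Nn n)" by simp
  then have LB: "?L \<le> lookup a j" "lookup a j \<le> ?B" using assms by (auto simp: coord_bounds_def)
  have "?B - ?L = (\<Sum>\<alpha>\<in>pos_roots n. \<bar>lookup \<alpha> j\<bar>)"
    unfolding sum_subtractf[symmetric] by (rule sum.cong) auto
  moreover have "?B + ?L = - (\<Sum>\<alpha>\<in>pos_roots n. lookup \<alpha> j)"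
    unfolding sum.distrib[symmetric] sum_negf[symmetric] by (rule sum.cong) auto
  ultimately have "2 * ?B = (if 1 \<le> j \<and> j \<le> n then 2 * int n else 0) - 2 * lookup (rhoC n) j"
    "2 * ?L = - (if 1 \<le> j \<and> j \<le> n then 2 * int n else 0) - 2 * lookup (rhoC n) j"
    unfolding sum_abs_pos_roots sum_lookup_pos_roots by linarith+
  with LB show ?thesis
    by (simp add: lookup_add abs_le_iff split: if_splits)
qed

lemma fps_nth_sign_mult: "fps_nth ((-1) ^ k * F) d = (-1) ^ k * fps_nth (F :: int fps) d"
  by (cases "even k") simp_all

text \<open>Expanding the numerator replaces \<rho> by \<open>rhoC n + a\<close> with
  \<open>a\<close> an exponent of \<open>Nn n\<close>. By \<open>Zf_rho\<close> each such term is a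
  multiple of the one for \<rho>, and these multiples, collected in \<open>c\<close>, do not involve
  the partition.\<close>

theorem generalized_exponent_Zf:
  assumes n: "1 \<le> n"
  shows "\<exists>c. \<forall>lam. generalized_exponent n lam =
    c * Abs_fps (\<lambda>m. Zf n m (partition_weight lam + rhoC n) (rhoC n))"
proof -
  define s where "s \<gamma> = (SOME s. \<forall>m \<mu>. Zf n m \<mu> \<gamma> = s * Zf n m \<mu> (rhoC n))" for \<gamma>
  define c where "c = Abs_fps (\<lambda>k. pr (\<lambda>a. s (rhoC n + a)) (fps_nth (Nn n) k))"
  have s: "Zf n m \<mu> (rhoC n + a) = s (rhoC n + a) * Zf n m \<mu> (rhoC n)" if "a \<in> keys (fps_nth (Nn n) k)" for a k m \<mu>
  proof -
    note b = Nn_bounds[OF that]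
    have "\<exists>s. \<forall>m \<mu>. Zf n m \<mu> (rhoC n + a) = s * Zf n m \<mu> (rhoC n)"
    proof (rule Zf_rho[OF n])
      show "lookup (rhoC n + a) 0 = 0" using b[of 0] by simp
      show "lookup (rhoC n + a) (Suc j) = 0" if "n \<le> j" for j using b[of "Suc j"] that by simp
      show "\<bar>lookup (rhoC n + a) (Suc j)\<bar> \<le> int n" if "j < n" for j using b[of "Suc j"] that by simp
    qed
    from someI_ex[OF this] show ?thesis unfolding s_def by blast
  qed
  have "generalized_exponent n lam = c * Abs_fps (\<lambda>m. Zf n m (partition_weight lam + rhoC n) (rhoC n))" for lam
  proof (rule fps_ext)
    fix d
    let ?\<mu> = "partition_weight lam + rhoC n"
    have "fps_nth (generalized_exponent n lam) d =
        (\<Sum>w\<in>weyl_group n. (-1) ^ weyl_length n w * lookup (fps_nth (Nn n * Zs n) d) (w ?\<mu> - rhoC n))"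
      by (simp add: generalized_exponent_def fps_sum_nth fps_nth_sign_mult kostant_t_def kostant_series_Zs rho_eq)
    also have "\<dots> = (\<Sum>w\<in>weyl_group n. \<Sum>k=0..d.
        pr (\<lambda>a. (-1) ^ weyl_length n w * lookup (fps_nth (Zs n) (d - k)) (w ?\<mu> - (rhoC n + a))) (fps_nth (Nn n) k))"
      unfolding fps_mult_nth lookup_sum lookup_mult_pr pr_fun_cmul sum_distrib_left diff_diff_add ..
    also have "\<dots> = (\<Sum>k=0..d. pr (\<lambda>a. Zf n (d - k) ?\<mu> (rhoC n + a)) (fps_nth (Nn n) k))"
      unfolding Zf_def pr_fun_sum by (rule sum.swap)
    also have "\<dots> = (\<Sum>k=0..d. pr (\<lambda>a. Zf n (d - k) ?\<mu> (rhoC n) * s (rhoC n + a)) (fps_nth (Nn n) k))"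
      by (intro sum.cong refl pr_cong) (simp add: s)
    also have "\<dots> = fps_nth (c * Abs_fps (\<lambda>m. Zf n m ?\<mu> (rhoC n))) d"
      unfolding pr_fun_cmul fps_mult_nth c_def fps_nth_Abs_fps by (intro sum.cong refl mult.commute)
    finally show "fps_nth (generalized_exponent n lam) d = fps_nth (c * Abs_fps (\<lambda>m. Zf n m ?\<mu> (rhoC n))) d" .
  qed
  then show ?thesis by blast
qed

section \<open>The symplectic determinant paired with the symmetric algebra\<close>

lemma keys_Hm_degree:
  assumes "a \<in> keys (fps_nth (Hm m) d)"
  shows "(\<Sum>i<m. lookup a i) = 2 * int d"
proof -
  define deg where "deg F \<longleftrightarrow> (\<forall>N. keys (fps_nth F N) \<subseteq> {a. (\<Sum>i<m. lookup a i) = 2 * int N})" for F :: "laurent fps"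
  have mult: "deg (F * G)" if F: "deg F" and G: "deg G" for F G
    unfolding deg_def fps_mult_nth
  proof (intro allI keys_sum_sub)
    fix N i :: nat
    assume "i \<in> {0..N}"
    then show "keys (fps_nth F i * fps_nth G (N - i)) \<subseteq> {a. (\<Sum>i<m. lookup a i) = 2 * int N}"
      using F[unfolded deg_def, rule_format, of i] G[unfolded deg_def, rule_format, of "N - i"]
      by (intro keys_mult_sub[of _ "{a. (\<Sum>i<m. lookup a i) = 2 * int i}" _ "{a. (\<Sum>i<m. lookup a i) = 2 * int (N - i)}"])
        (auto simp: lookup_add sum.distrib of_nat_diff)
  qed
  have one: "deg 1" by (auto simp: deg_def)
  have prod: "deg (prod F I)" if "\<And>i. i \<in> I \<Longrightarrow> deg (F i)" for F :: "nat \<Rightarrow> laurent fps" and I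
    using that by (induction I rule: infinite_finite_induct) (simp_all add: one mult)
  have "deg (geo (xv i * xv j))" if "i < m" "j < m" for i j
  proof -
    have "(xv i * xv j) ^ k = frag_of (single i (int k) + single j (int k))" for k
      by (simp only: power_mult_distrib xv_power frag_of_mult)
    then show ?thesis
      using that by (simp add: deg_def lookup_add lookup_single sum.distrib when_def sum.delta)
  qed
  then have "deg (Hm m)" unfolding Hm_def by (intro prod) simp
  then show ?thesis using assms by (auto simp: deg_def)
qed

text \<open>The index set for the expansion of a product of values of \<open>gq\<close>: the entries
  \<open>2 * j\<close> and \<open>2 * j + 1\<close> are the degrees of the two complete polynomials
  from factor \<open>j\<close>.\<close>

definition pair_weights :: "(nat \<Rightarrow> int) \<Rightarrow> nat \<Rightarrow> nat \<Rightarrow> weight set" where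
  "pair_weights \<kappa> m N = {a. (\<forall>i. 0 \<le> lookup a i) \<and> (\<forall>i\<ge>2 * m. lookup a i = 0) \<and>
     (\<forall>j<m. lookup a (2 * j) - lookup a (Suc (2 * j)) = \<kappa> j) \<and> (\<Sum>i<2 * m. lookup a i) = int N}"

lemma finite_bounded_weights: "finite {a :: weight. (\<forall>i. 0 \<le> lookup a i \<and> lookup a i \<le> B) \<and> (\<forall>i\<ge>m. lookup a i = 0)}"
proof (induction m)
  case 0
  have "{a :: weight. (\<forall>i. 0 \<le> lookup a i \<and> lookup a i \<le> B) \<and> (\<forall>i\<ge>0. lookup a i = 0)} \<subseteq> {0}"
    by (auto intro: poly_mapping_eqI)
  then show ?case by (rule finite_subset) simp
next
  case (Suc m)
  let ?S = "{a :: weight. (\<forall>i. 0 \<le> lookup a i \<and> lookup a i \<le> B) \<and> (\<forall>i\<ge>m. lookup a i = 0)}"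
  have "{a :: weight. (\<forall>i. 0 \<le> lookup a i \<and> lookup a i \<le> B) \<and> (\<forall>i\<ge>Suc m. lookup a i = 0)} \<subseteq>
      (\<lambda>(a, c). a + single m c) ` (?S \<times> {0..B})"
  proof
    fix a assume a: "a \<in> {a :: weight. (\<forall>i. 0 \<le> lookup a i \<and> lookup a i \<le> B) \<and> (\<forall>i\<ge>Suc m. lookup a i = 0)}"
    have B: "0 \<le> B" using a by (auto intro: order.trans)
    have "lookup a i = 0" if "m \<le> i" "i \<noteq> m" for i using a that by (simp add: Suc_le_eq)
    then have "a - single m (lookup a m) \<in> ?S"
      using a B by (auto simp: lookup_minus lookup_single when_def)
    then show "a \<in> (\<lambda>(a, c). a + single m c) ` (?S \<times> {0..B})"
      using a by (intro image_eqI[of _ _ "(a - single m (lookup a m), lookup a m)"]) auto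
  qed
  then show ?case
    by (rule finite_subset) (intro finite_imageI finite_cartesian_product Suc.IH; simp)
qed

lemma finite_pair_weights: "finite (pair_weights \<kappa> m N)"
proof (rule finite_subset[OF _ finite_bounded_weights[of "int N" "2 * m"]])
  show "pair_weights \<kappa> m N \<subseteq> {a. (\<forall>i. 0 \<le> lookup a i \<and> lookup a i \<le> int N) \<and> (\<forall>i\<ge>2 * m. lookup a i = 0)}"
  proof (intro subsetI CollectI conjI allI)
    fix a i assume a: "a \<in> pair_weights \<kappa> m N"
    show "0 \<le> lookup a i" using a by (simp add: pair_weights_def)
    show "lookup a i \<le> int N"
    proof (cases "i < 2 * m")
      case True
      then have "lookup a i \<le> (\<Sum>i<2 * m. lookup a i)"
        using a by (intro member_le_sum) (auto simp: pair_weights_def)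
      then show ?thesis using a by (simp add: pair_weights_def)
    qed (use a in \<open>simp add: pair_weights_def\<close>)
  qed (simp add: pair_weights_def)
qed

lemma gq_prod_nth:
  "fps_nth (\<Prod>j<m. gq S (\<kappa> j)) N = (\<Sum>a\<in>pair_weights \<kappa> m N. \<Prod>i<2 * m. hZ S (lookup a i))"
proof (induction m arbitrary: N)
  case 0
  have "pair_weights \<kappa> 0 N = (if N = 0 then {0} else {})"
    by (auto simp: pair_weights_def intro: poly_mapping_eqI)
  then show ?case by simp
next
  case (Suc m)
  let ?h = "\<lambda>m a. \<Prod>i<2 * m. hZ S (lookup a i)" and ?k = "\<kappa> m"
  define u v where "u M = (int (N - M) + ?k) div 2" and "v M = (int (N - M) - ?k) div 2" for M
  let ?A = "Sigma {0..N} (\<lambda>M. pair_weights \<kappa> m M)"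
  let ?G = "\<lambda>M. even (int (N - M) - ?k) \<and> 0 \<le> u M \<and> 0 \<le> v M"
  let ?f = "\<lambda>M a. ?h m a * (if even (int (N - M) - ?k) then hZ S (v M) * hZ S (u M) else 0)"
  have "fps_nth (\<Prod>j<Suc m. gq S (\<kappa> j)) N = (\<Sum>M=0..N. \<Sum>a\<in>pair_weights \<kappa> m M. ?f M a)"
    unfolding prod.lessThan_Suc fps_mult_nth Suc.IH sum_distrib_right
    unfolding gq_def fps_nth_Abs_fps u_def v_def ..
  also have "\<dots> = (\<Sum>(M, a)\<in>?A. ?f M a)"
    by (rule sum.Sigma) (simp_all add: finite_pair_weights)
  also have "\<dots> = (\<Sum>(M, a)\<in>{(M, a) \<in> ?A. ?G M}. ?f M a)"
  proof (rule sum.mono_neutral_right)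
    show "\<forall>x\<in>?A - {(M, a) \<in> ?A. ?G M}. (case x of (M, a) \<Rightarrow> ?f M a) = 0"
    proof
      fix x assume "x \<in> ?A - {(M, a) \<in> ?A. ?G M}"
      then obtain M a where x: "x = (M, a)" and G: "\<not> ?G M" by blast
      have "?f M a = 0"
      proof (cases "even (int (N - M) - ?k)")
        case True
        with G have "u M < 0 \<or> v M < 0" by linarith
        then have "hZ S (v M) * hZ S (u M) = 0" by auto
        then show ?thesis unfolding if_P[OF True] by (simp only: mult_zero_right)
      qed (simp only: if_False mult_zero_right)
      then show "(case x of (M, a) \<Rightarrow> ?f M a) = 0" unfolding x prod.case .
    qed
  qed (auto intro: finite_pair_weights)
  also have "\<dots> = (\<Sum>a\<in>pair_weights \<kappa> (Suc m) N. ?h (Suc m) a)"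
  proof (rule sum.reindex_bij_witness[of _
        "\<lambda>b. (nat (int N - lookup b (2 * m) - lookup b (Suc (2 * m))),
              b - single (2 * m) (lookup b (2 * m)) - single (Suc (2 * m)) (lookup b (Suc (2 * m))))"
        "\<lambda>(M, a). a + single (2 * m) (u M) + single (Suc (2 * m)) (v M)"])
    fix x assume "x \<in> {(M, a) \<in> ?A. ?G M}"
    then obtain M a where x: "x = (M, a)" and M: "M \<le> N" and a: "a \<in> pair_weights \<kappa> m M" and G: "?G M" by auto
    let ?b = "a + single (2 * m) (u M) + single (Suc (2 * m)) (v M)"
    have a0: "lookup a (2 * m) = 0" "lookup a (Suc (2 * m)) = 0" using a by (simp_all add: pair_weights_def)
    then have b: "lookup ?b (2 * m) = u M" "lookup ?b (Suc (2 * m)) = v M"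
      by (simp_all add: lookup_add lookup_single)
    have blt: "lookup ?b i = lookup a i" if "i < 2 * m" for i
      using that by (simp add: lookup_add lookup_single)
    have "even (int (N - M) - ?k)" using G by blast
    then have "u M + v M = int (N - M)" "u M - v M = ?k" unfolding u_def v_def by presburger+
    then have uv: "u M + v M = int N - int M" "u M - v M = ?k" using M by (simp_all only: of_nat_diff)
    then have "nat (int N - u M - v M) = M" by simp
    then show "(\<lambda>b. (nat (int N - lookup b (2 * m) - lookup b (Suc (2 * m))),
        b - single (2 * m) (lookup b (2 * m)) - single (Suc (2 * m)) (lookup b (Suc (2 * m)))))
        ((\<lambda>(M, a). a + single (2 * m) (u M) + single (Suc (2 * m)) (v M)) x) = x"
      unfolding x prod.case b by simp
    have two: "2 * Suc m = Suc (Suc (2 * m))" by simp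
    show "(\<lambda>(M, a). a + single (2 * m) (u M) + single (Suc (2 * m)) (v M)) x \<in> pair_weights \<kappa> (Suc m) N"
      unfolding x prod.case pair_weights_def
    proof (intro CollectI conjI allI impI)
      fix i
      show "0 \<le> lookup ?b i" using a G by (simp add: pair_weights_def lookup_add lookup_single when_def)
      show "2 * Suc m \<le> i \<Longrightarrow> lookup ?b i = 0" using a by (simp add: pair_weights_def lookup_add lookup_single)
    next
      fix j assume "j < Suc m"
      show "lookup ?b (2 * j) - lookup ?b (Suc (2 * j)) = \<kappa> j"
      proof (cases "j = m")
        case True
        then show ?thesis using b uv(2) by simp
      next
        case False
        then have "j < m" using \<open>j < Suc m\<close> by simp
        moreover from this have "2 * j < 2 * m" "Suc (2 * j) < 2 * m" by simp_all
        ultimately show ?thesis unfolding blt[OF \<open>2 * j < 2 * m\<close>] blt[OF \<open>Suc (2 * j) < 2 * m\<close>]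
          using a by (simp add: pair_weights_def)
      qed
    next
      have "(\<Sum>i<2 * m. lookup ?b i) = (\<Sum>i<2 * m. lookup a i)" by (rule sum.cong) (simp_all add: blt)
      also have "\<dots> = int M" using a by (simp add: pair_weights_def)
      finally show "(\<Sum>i<2 * Suc m. lookup ?b i) = int N"
        unfolding two sum.lessThan_Suc b using uv by simp
    qed
    have "(\<Prod>i<2 * m. hZ S (lookup ?b i)) = ?h m a" by (rule prod.cong) (simp_all add: blt)
    then show "?h (Suc m) ((\<lambda>(M, a). a + single (2 * m) (u M) + single (Suc (2 * m)) (v M)) x) = (case x of (M, a) \<Rightarrow> ?f M a)"
      unfolding x prod.case two prod.lessThan_Suc b using G by (simp add: ac_simps)
  next
    fix b assume b: "b \<in> pair_weights \<kappa> (Suc m) N"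
    define M where "M = nat (int N - lookup b (2 * m) - lookup b (Suc (2 * m)))"
    define a where "a = b - single (2 * m) (lookup b (2 * m)) - single (Suc (2 * m)) (lookup b (Suc (2 * m)))"
    have alt: "lookup a i = lookup b i" if "i < 2 * m" for i
      using that by (simp add: a_def lookup_minus lookup_single)
    have two: "2 * Suc m = Suc (Suc (2 * m))" by simp
    have nn: "0 \<le> lookup b i" for i using b by (simp add: pair_weights_def)
    have "(\<Sum>i<2 * Suc m. lookup b i) = int N" using b by (simp add: pair_weights_def del: sum.lessThan_Suc)
    then have sum: "(\<Sum>i<2 * m. lookup b i) + lookup b (2 * m) + lookup b (Suc (2 * m)) = int N"
      unfolding two sum.lessThan_Suc .
    moreover have "0 \<le> (\<Sum>i<2 * m. lookup b i)" by (intro sum_nonneg nn)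
    ultimately have M: "int M = int N - lookup b (2 * m) - lookup b (Suc (2 * m))" by (simp add: M_def)
    have MN: "M \<le> N" using M nn[of "2 * m"] nn[of "Suc (2 * m)"] by linarith
    have k: "?k = lookup b (2 * m) - lookup b (Suc (2 * m))" using b by (simp add: pair_weights_def)
    have NM: "int (N - M) = lookup b (2 * m) + lookup b (Suc (2 * m))" using M MN by (simp add: of_nat_diff)
    have uv: "u M = lookup b (2 * m)" "v M = lookup b (Suc (2 * m))"
      unfolding u_def v_def NM k by simp_all
    have ev: "even (int (N - M) - ?k)" unfolding NM k by simp
    have a0: "lookup a i = 0" if "2 * m \<le> i" for i
    proof -
      consider "i = 2 * m" | "i = Suc (2 * m)" | "Suc (Suc (2 * m)) \<le> i" using \<open>2 * m \<le> i\<close> by linarith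
      then show ?thesis
        using b by cases (simp_all add: a_def lookup_minus lookup_single pair_weights_def)
    qed
    have "a \<in> pair_weights \<kappa> m M"
      unfolding pair_weights_def
    proof (intro CollectI conjI allI impI)
      show "0 \<le> lookup a i" for i using nn alt a0 by (cases "i < 2 * m") simp_all
      show "2 * m \<le> i \<Longrightarrow> lookup a i = 0" for i by (rule a0)
      have "(\<Sum>i<2 * m. lookup a i) = (\<Sum>i<2 * m. lookup b i)" by (rule sum.cong) (simp_all add: alt)
      then show "(\<Sum>i<2 * m. lookup a i) = int M" using sum M by simp
      fix j assume "j < m"
      then have "2 * j < 2 * m" "Suc (2 * j) < 2 * m" "j < Suc m" by simp_all
      then show "lookup a (2 * j) - lookup a (Suc (2 * j)) = \<kappa> j"
        using b unfolding alt[OF \<open>2 * j < 2 * m\<close>] alt[OF \<open>Suc (2 * j) < 2 * m\<close>] pair_weights_def by blast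
    qed
    then show "(nat (int N - lookup b (2 * m) - lookup b (Suc (2 * m))),
        b - single (2 * m) (lookup b (2 * m)) - single (Suc (2 * m)) (lookup b (Suc (2 * m)))) \<in> {(M, a) \<in> ?A. ?G M}"
      unfolding M_def[symmetric] a_def[symmetric] using MN ev nn uv by simp
    show "(\<lambda>(M, a). a + single (2 * m) (u M) + single (Suc (2 * m)) (v M))
        (nat (int N - lookup b (2 * m) - lookup b (Suc (2 * m))),
        b - single (2 * m) (lookup b (2 * m)) - single (Suc (2 * m)) (lookup b (Suc (2 * m)))) = b"
      unfolding prod.case M_def[symmetric] uv by simp
  qed
  finally show ?case .
qed

lemma sum_single_lookup:
  assumes "\<And>i. m \<le> i \<Longrightarrow> lookup a i = 0"
  shows "(\<Sum>i<m. single i (lookup a i)) = (a :: weight)"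
proof (rule poly_mapping_eqI)
  fix i
  show "lookup (\<Sum>i<m. single i (lookup a i)) i = lookup a i"
    using assms[of i] by (cases "i < m") (simp_all add: lookup_sum lookup_single when_def sum.delta)
qed

text \<open>Each product of complete polynomials picks one coefficient of \<open>Hm\<close>. The
  prescribed differences of exponents are the coordinates of the image under \<open>zt\<close>, and
  the total degree is automatic, so the coefficients add up to one coefficient of
  \<open>Zs\<close>.\<close>

lemma pr_DV_gq_prod:
  "pr (DV (2 * n) (fps_nth (Hm (2 * n)) d)) (fps_nth (\<Prod>j<n. gq {..<2 * n} (\<kappa> j)) (2 * d)) =
    lookup (fps_nth (Zs n) d) (\<Sum>j<n. single (Suc j) (\<kappa> j))"
proof -
  let ?G = "fps_nth (Hm (2 * n)) d" and ?B = "pair_weights \<kappa> n (2 * d)" and ?\<gamma> = "\<Sum>j<n. single (Suc j) (\<kappa> j)"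
  have "pr (DV (2 * n) ?G) (\<Prod>i<2 * n. hZ {..<2 * n} (lookup a i)) = lookup ?G a" if "a \<in> ?B" for a
  proof -
    have "pr (DV (2 * n) ?G) (\<Prod>i<2 * n. hZ {..<2 * n} (lookup a i)) = lookup ?G (\<Sum>i<2 * n. single i (lookup a i))"
      using that by (intro pr_DV_complete symm_Hm) (auto simp: pair_weights_def intro: keys_Hm(1))
    also have "(\<Sum>i<2 * n. single i (lookup a i)) = a"
      using that by (intro sum_single_lookup) (simp add: pair_weights_def)
    finally show ?thesis .
  qed
  then have "pr (DV (2 * n) ?G) (fps_nth (\<Prod>j<n. gq {..<2 * n} (\<kappa> j)) (2 * d)) = (\<Sum>a\<in>?B. lookup ?G a)"
    by (simp add: gq_prod_nth pr_sum)
  also have "\<dots> = (\<Sum>a\<in>keys ?G. lookup ?G a * (if zt a = ?\<gamma> then 1 else 0))"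
  proof (rule sum.mono_neutral_cong)
    show "finite ?B" by (rule finite_pair_weights)
    show "lookup ?G a * (if zt a = ?\<gamma> then 1 else 0) = 0" if "a \<in> keys ?G - ?B" for a
    proof -
      have a: "a \<in> keys ?G" "a \<notin> ?B" using that by auto
      have "zt a \<noteq> ?\<gamma>"
      proof
        assume eq: "zt a = ?\<gamma>"
        have "lookup a (2 * j) - lookup a (Suc (2 * j)) = \<kappa> j" if "j < n" for j
          using arg_cong[OF eq, of "\<lambda>b. lookup b (Suc j)"] that
          by (simp add: lookup_zt lookup_sum lookup_single when_def sum.delta)
        moreover have "(\<Sum>i<2 * n. lookup a i) = int (2 * d)" using keys_Hm_degree[OF a(1)] by simp
        ultimately have "a \<in> ?B" using keys_Hm[OF a(1)] by (simp add: pair_weights_def)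
        with a show False by simp
      qed
      then show ?thesis by simp
    qed
    show "lookup ?G a = lookup ?G a * (if zt a = ?\<gamma> then 1 else 0)" if "a \<in> ?B \<inter> keys ?G" for a
    proof -
      have "zt a = ?\<gamma>"
      proof (rule poly_mapping_eqI)
        fix i
        show "lookup (zt a) i = lookup ?\<gamma> i"
        proof (cases i)
          case 0
          then show ?thesis by (simp add: lookup_zt lookup_sum lookup_single)
        next
          case (Suc j)
          then show ?thesis
            using that by (cases "j < n") (simp_all add: lookup_zt lookup_sum lookup_single when_def sum.delta pair_weights_def)
        qed
      qed
      then show ?thesis by simp
    qed
  qed (auto simp: in_keys_iff)
  also have "\<dots> = lookup (fps_nth (Zs n) d) ?\<gamma>"
    by (simp add: Zs_def lookup_pmh pr_def)
  finally show ?thesis .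
qed

lemma cdet_transpose: "cdet n (\<lambda>i j. F j i) = cdet n F"
proof -
  have "mat n n (\<lambda>(i, j). F j i) = transpose_mat (mat n n (\<lambda>(i, j). F i j))"
    by (rule eq_matI) simp_all
  then show ?thesis unfolding cdet_def by (simp add: det_transpose[of _ n])
qed

lemma of_int_sign_mult:
  fixes F :: "'a::ring_1"
  assumes "c = 1 \<or> c = -1"
  shows "of_int c * F = (if c = 1 then F else - F)"
  using assms by auto

text \<open>Each entry \<open>fg\<close> is a sum over a sign, since \<open>gq\<close> is even. With
  these signs the Leibniz formula becomes the sum over signed permutations, that is over the Weyl
  group.\<close>

theorem pr_DV_Mdet_Zf:
  assumes n: "1 \<le> n" and l: "\<And>i. i < n \<Longrightarrow> l i = lookup \<mu> (Suc i)"
    and \<mu>: "lookup \<mu> 0 = 0" "\<And>j. n \<le> j \<Longrightarrow> lookup \<mu> (Suc j) = 0"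
  shows "pr (DV (2 * n) (fps_nth (Hm (2 * n)) d)) (fps_nth (Mdet n l {..<2 * n}) (2 * d)) = Zf n d \<mu> (rhoC n)"
proof -
  let ?S = "{..<2 * n}" and ?P = "{p. p permutes {..<n}}" and ?E = "PiE {..<n} (\<lambda>_. {1, -1 :: int})"
  let ?\<kappa> = "\<lambda>e p i. e i * l (p i) - int (n - i)"
  have fg: "fg ?S r k = (\<Sum>c\<in>{1, -1}. of_int c * gq ?S (c * k - int r))" for r k
  proof -
    have "gq ?S (- k - int r) = gq ?S (k + int r)" using gq_uminus[of ?S "k + int r"] by simp
    then show ?thesis by (simp add: fg_def)
  qed
  have "Mdet n l ?S = cdet n (\<lambda>i j. fg ?S (n - i) (l j))"
    unfolding Mdet_def by (rule cdet_transpose[symmetric])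
  also have "\<dots> = (\<Sum>p\<in>?P. of_int (sign p) * (\<Prod>i<n. \<Sum>c\<in>{1, -1}. of_int c * gq ?S (c * l (p i) - int (n - i))))"
    unfolding cdet_leibniz fg atLeast0LessThan ..
  also have "\<dots> = (\<Sum>p\<in>?P. \<Sum>e\<in>?E. of_int (sgnP n e p) * (\<Prod>i<n. gq ?S (?\<kappa> e p i)))"
  proof (rule sum.cong[OF refl])
    fix p
    have "(\<Prod>i<n. \<Sum>c\<in>{1, -1}. of_int c * gq ?S (c * l (p i) - int (n - i))) =
        (\<Sum>e\<in>?E. \<Prod>i<n. of_int (e i) * gq ?S (?\<kappa> e p i))"
      by (rule prod_sum_PiE) simp_all
    then show "of_int (sign p) * (\<Prod>i<n. \<Sum>c\<in>{1, -1}. of_int c * gq ?S (c * l (p i) - int (n - i))) =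
        (\<Sum>e\<in>?E. of_int (sgnP n e p) * (\<Prod>i<n. gq ?S (?\<kappa> e p i)))"
      by (simp add: sum_distrib_left prod.distrib sgnP_def mult.assoc)
  qed
  finally have M: "Mdet n l ?S = (\<Sum>p\<in>?P. \<Sum>e\<in>?E. of_int (sgnP n e p) * (\<Prod>i<n. gq ?S (?\<kappa> e p i)))" .
  have "pr (DV (2 * n) (fps_nth (Hm (2 * n)) d)) (fps_nth (Mdet n l ?S) (2 * d)) =
      (\<Sum>p\<in>?P. \<Sum>e\<in>?E. of_int (sgnP n e p) * lookup (fps_nth (Zs n) d) (sact n e p \<mu> - rhoC n))"
    unfolding M fps_sum_nth pr_sum
  proof (intro sum.cong refl)
    fix p e assume p: "p \<in> ?P" and e: "e \<in> ?E"
    have pp: "p permutes {..<n}" using p by simp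
    have "sgnP n e p = 1 \<or> sgnP n e p = -1"
    proof -
      have "\<bar>sgnP n e p\<bar> = (\<Prod>i<n. \<bar>e i\<bar>)" by (simp add: sgnP_def abs_mult abs_prod)
      also have "\<dots> = 1" using e by (intro prod.neutral) (force simp: PiE_iff)
      finally show ?thesis by linarith
    qed
    note sg = of_int_sign_mult[OF this]
    have "(\<Sum>j<n. single (Suc j) (?\<kappa> e p j)) = sact n e p \<mu> - rhoC n"
    proof (rule poly_mapping_eqI)
      fix i
      show "lookup (\<Sum>j<n. single (Suc j) (?\<kappa> e p j)) i = lookup (sact n e p \<mu> - rhoC n) i"
      proof (cases i)
        case 0
        then show ?thesis
          by (simp add: lookup_sum lookup_single lookup_minus lookup_sact[OF permutes_inj[OF pp]] lookup_rhoC \<mu>)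
      next
        case (Suc j)
        show ?thesis
        proof (cases "j < n")
          case True
          then have "p j < n" using permutes_in_image[OF pp, of j] by simp
          with True Suc show ?thesis
            by (simp add: lookup_sum lookup_single when_def sum.delta lookup_minus lookup_sact[OF permutes_inj[OF pp]] lookup_rhoC l)
        next
          case False
          then have "p j = j" using permutes_not_in[OF pp, of j] by simp
          with False Suc show ?thesis
            by (simp add: lookup_sum lookup_single when_def lookup_minus lookup_sact[OF permutes_inj[OF pp]] lookup_rhoC \<mu>)
        qed
      qed
    qed
    with pr_DV_gq_prod[of n d "?\<kappa> e p"]
    show "pr (DV (2 * n) (fps_nth (Hm (2 * n)) d)) (fps_nth (of_int (sgnP n e p) * (\<Prod>i<n. gq ?S (?\<kappa> e p i))) (2 * d)) =
        of_int (sgnP n e p) * lookup (fps_nth (Zs n) d) (sact n e p \<mu> - rhoC n)"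
      unfolding sg by (simp add: pr_uminus)
  qed
  also have "\<dots> = Zf n d \<mu> (rhoC n)"
    unfolding Zf_def by (rule sum_weyl_group[OF n, symmetric])
  finally show ?thesis .
qed

section \<open>The generalized exponent of the empty partition\<close>

lemma finite_weyl_group: "finite (weyl_group n)"
proof (rule finite_subset)
  let ?A = "{p. p permutes {..<n}} \<times> PiE {..<n} (\<lambda>_. {1, -1 :: int})"
  show "weyl_group n \<subseteq> (\<lambda>(p, e). sact n e p) ` ?A"
  proof
    fix w assume "w \<in> weyl_group n"
    then obtain e p where ep: "(e, p) \<in> signed_perms n" "w = sact n e p" using weyl_group_signed_perm by blast
    then have "w = sact n (restrict e {..<n}) p" "restrict e {..<n} \<in> PiE {..<n} (\<lambda>_. {1, -1})" "p permutes {..<n}"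
      by (auto simp: signed_perms_def signs_def intro!: sact_cong)
    then show "w \<in> (\<lambda>(p, e). sact n e p) ` ?A"
      by (intro image_eqI[of _ _ "(p, restrict e {..<n})"]) simp_all
  qed
  show "finite ((\<lambda>(p, e). sact n e p) ` ?A)"
    by (intro finite_imageI finite_cartesian_product finite_permutations finite_PiE) simp_all
qed

definition rho_height :: "nat \<Rightarrow> weight \<Rightarrow> int" where
  "rho_height n b = (\<Sum>j<n. int (n - j) * lookup b (Suc j))"

lemma rho_height_add: "rho_height n (a + b) = rho_height n a + rho_height n b"
  by (simp add: rho_height_def lookup_add distrib_left sum.distrib)

lemma rho_height_coord: "rho_height n (coord (Suc i)) = int (n - i)"
proof -
  have "rho_height n (coord (Suc i)) = (\<Sum>j<n. if j = i then int (n - i) else 0)"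
    unfolding rho_height_def by (rule sum.cong) (auto simp: lookup_coord)
  then show ?thesis by (cases "i < n") simp_all
qed

lemma rho_height_pos_root:
  assumes "\<alpha> \<in> pos_roots n"
  shows "1 \<le> rho_height n \<alpha>"
proof -
  have minus: "rho_height n (a - b) = rho_height n a - rho_height n b" for a b
    using rho_height_add[of n "a - b" b] by simp
  have dbl: "frag_cmul 2 a = a + a" for a :: weight
    by (rule poly_mapping_eqI) (simp only: lookup_add lookup_frag_cmul mult_2)
  show ?thesis
    using assms
  proof (cases rule: pos_rootsE)
    case (diff a b)
    then show ?thesis unfolding diff(3) minus rho_height_coord by linarith
  next
    case (add a b)
    then show ?thesis unfolding add(3) rho_height_add rho_height_coord by linarith
  next
    case (double a)
    then show ?thesis unfolding double(2) dbl rho_height_add rho_height_coord by linarith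
  qed
qed

text \<open>A term of degree \<open>d\<close> is a product of \<open>d\<close> positive roots, and
  each of them has height at least 1.\<close>

lemma keys_kostant_series:
  assumes "b \<in> keys (fps_nth (kostant_series n) d)"
  shows "int d \<le> rho_height n b"
proof -
  define P where "P F \<longleftrightarrow> (\<forall>N. keys (fps_nth F N) \<subseteq> {b. int N \<le> rho_height n b})" for F :: "laurent fps"
  have one: "P 1" by (auto simp: P_def rho_height_def)
  have mult: "P (F * G)" if F: "P F" and G: "P G" for F G
    unfolding P_def fps_mult_nth
  proof (intro allI keys_sum_sub)
    fix N i :: nat assume "i \<in> {0..N}"
    then show "keys (fps_nth F i * fps_nth G (N - i)) \<subseteq> {b. int N \<le> rho_height n b}"
      using F[unfolded P_def, rule_format, of i] G[unfolded P_def, rule_format, of "N - i"]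
      by (intro keys_mult_sub[of _ "{b. int i \<le> rho_height n b}" _ "{b. int (N - i) \<le> rho_height n b}"])
        (auto simp: rho_height_add of_nat_diff)
  qed
  have prod: "P (prod F I)" if "\<And>i. i \<in> I \<Longrightarrow> P (F i)" for F and I :: "weight set"
    using that by (induction I rule: infinite_finite_induct) (simp_all add: one mult)
  have geo: "P (geo (frag_of \<alpha>))" if "\<alpha> \<in> pos_roots n" for \<alpha>
  proof -
    have "\<exists>b. frag_of \<alpha> ^ k = (frag_of b :: laurent) \<and> int k \<le> rho_height n b" for k
    proof (induction k)
      case 0
      show ?case by (rule exI[of _ 0]) (simp add: rho_height_def)
    next
      case (Suc k)
      then obtain b where "frag_of \<alpha> ^ k = (frag_of b :: laurent)" "int k \<le> rho_height n b" by blast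
      then show ?case
        using rho_height_pos_root[OF that]
        by (intro exI[of _ "\<alpha> + b"]) (simp add: frag_of_mult rho_height_add)
    qed
    note ex = this
    show ?thesis
      unfolding P_def
    proof
      fix N
      obtain b where "frag_of \<alpha> ^ N = (frag_of b :: laurent)" "int N \<le> rho_height n b" using ex by blast
      then show "keys (fps_nth (geo (frag_of \<alpha>)) N) \<subseteq> {b. int N \<le> rho_height n b}" by simp
    qed
  qed
  have "P (kostant_series n)" unfolding kostant_series_geo by (intro prod geo)
  then show ?thesis using assms by (auto simp: P_def)
qed

text \<open>
  A nontrivial Weyl group element \<open>w\<close> satisfies \<open>(\<rho>, w \<rho> - \<rho>) = - |w \<rho> - \<rho>|\<^sup>2 / 2 < 0\<close>.
\<close>

lemma rho_height_weyl:
  assumes "(e, p) \<in> signed_perms n"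
  shows "2 * rho_height n (sact n e p (rhoC n) - rhoC n) =
    - (\<Sum>j<n. (lookup (sact n e p (rhoC n) - rhoC n) (Suc j))\<^sup>2)"
proof -
  have p: "p permutes {..<n}" and e: "signs n e" using assms by (simp_all add: signed_perms_def)
  let ?w = "\<lambda>j. e j * int (n - p j)"
  have l: "lookup (sact n e p (rhoC n) - rhoC n) (Suc j) = ?w j - int (n - j)" if "j < n" for j
    using that by (simp add: lookup_minus lookup_sact[OF permutes_inj[OF p]] lookup_rhoC)
  have "(\<Sum>j<n. (?w j)\<^sup>2) = (\<Sum>j<n. (int (n - p j))\<^sup>2)"
  proof (rule sum.cong[OF refl])
    fix j assume "j \<in> {..<n}"
    then have "(e j)\<^sup>2 = 1" using e by (auto simp: signs_def)
    then show "(?w j)\<^sup>2 = (int (n - p j))\<^sup>2" by (simp add: power_mult_distrib)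
  qed
  also have "\<dots> = (\<Sum>j<n. (int (n - j))\<^sup>2)"
    using sum.permute[OF p, of "\<lambda>j. (int (n - j))\<^sup>2"] by (simp add: o_def)
  finally have sq: "(\<Sum>j<n. (?w j)\<^sup>2) = (\<Sum>j<n. (int (n - j))\<^sup>2)" .
  have "(\<Sum>j<n. (lookup (sact n e p (rhoC n) - rhoC n) (Suc j))\<^sup>2) =
      (\<Sum>j<n. (?w j)\<^sup>2 - (int (n - j))\<^sup>2 - 2 * (int (n - j) * lookup (sact n e p (rhoC n) - rhoC n) (Suc j)))"
    by (rule sum.cong) (simp_all add: l power2_eq_square algebra_simps)
  also have "\<dots> = - 2 * rho_height n (sact n e p (rhoC n) - rhoC n)"
    unfolding sum_subtractf sq rho_height_def sum_distrib_left[symmetric] by simp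
  finally show ?thesis by simp
qed

text \<open>For w other than the identity, w \<rho> - \<rho> has negative height and does not occur
  in the series. For the identity the exponent is 0, which occurs in degree 0 only.\<close>

lemma generalized_exponent_Nil:
  assumes n: "1 \<le> n"
  shows "generalized_exponent n [] = 1"
proof (rule fps_ext)
  fix d
  let ?K = "fps_nth (kostant_series n) d"
  have z: "lookup ?K (w (rhoC n) - rhoC n) = 0" if w: "w \<in> weyl_group n - {id}" for w
  proof -
    obtain e p where ep: "(e, p) \<in> signed_perms n" "w = sact n e p" using w weyl_group_signed_perm by blast
    let ?b = "sact n e p (rhoC n) - rhoC n"
    have p: "p permutes {..<n}" using ep(1) by (simp add: signed_perms_def)
    have "\<exists>j<n. lookup ?b (Suc j) \<noteq> 0"
    proof (rule ccontr)
      assume "\<not> (\<exists>j<n. lookup ?b (Suc j) \<noteq> 0)"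
      then have z: "lookup ?b (Suc j) = 0" if "j < n" for j using that by blast
      have "?b = 0"
      proof (rule poly_mapping_eqI)
        fix i
        show "lookup ?b i = lookup 0 i"
        proof (cases i)
          case 0
          then show ?thesis by (simp add: lookup_minus lookup_sact[OF permutes_inj[OF p]] lookup_rhoC)
        next
          case (Suc j)
          show ?thesis
          proof (cases "j < n")
            case True
            then show ?thesis using z Suc by simp
          next
            case False
            then show ?thesis
              using Suc permutes_not_in[OF p, of j] by (simp add: lookup_minus lookup_sact[OF permutes_inj[OF p]] lookup_rhoC)
          qed
        qed
      qed
      then have "sact n e p (rhoC n) = sact n (\<lambda>_. 1) id (rhoC n)" unfolding sact_id by simp
      note inj = sact_rho_inj[OF ep(1) id_signed_perms this]
      have "sact n e p = sact n (\<lambda>_. 1) p" by (rule sact_cong[OF inj(2) p])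
      then have "w = id" unfolding ep(2) inj(1) sact_id .
      with w show False by simp
    qed
    then obtain j where j: "j < n" "lookup ?b (Suc j) \<noteq> 0" by blast
    have "0 < (lookup ?b (Suc j))\<^sup>2" using j(2) by simp
    also have "\<dots> \<le> (\<Sum>j<n. (lookup ?b (Suc j))\<^sup>2)"
      using j(1) by (intro member_le_sum) simp_all
    finally have "rho_height n ?b < 0" using rho_height_weyl[OF ep(1)] by linarith
    then have "?b \<notin> keys ?K" using keys_kostant_series[of ?b n d] by auto
    then show ?thesis unfolding ep(2) by (simp add: in_keys_iff)
  qed
  have "(-1) ^ weyl_length n id = (1 :: int)"
    using weyl_sign[OF n id_signed_perms] unfolding sact_id sgnP_id by (simp add: weyl_group.weyl_id)
  moreover have "lookup ?K 0 = (if d = 0 then 1 else 0)"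
  proof (cases "d = 0")
    case True
    have "fps_nth (\<Prod>\<alpha>\<in>I. geo (frag_of \<alpha>)) 0 = (1 :: laurent)" for I :: "weight set"
      by (induction I rule: infinite_finite_induct) simp_all
    then show ?thesis using True by (simp add: kostant_series_geo)
  next
    case False
    then have "0 \<notin> keys ?K" using keys_kostant_series[of 0 n d] by (auto simp: rho_height_def)
    then show ?thesis using False by (simp add: in_keys_iff)
  qed
  moreover have "fps_nth (generalized_exponent n []) d =
      (\<Sum>w\<in>weyl_group n. (-1) ^ weyl_length n w * lookup ?K (w (rhoC n) - rhoC n))"
    by (simp add: generalized_exponent_def fps_sum_nth fps_nth_sign_mult kostant_t_def rho_eq partition_weight_def)
  moreover have "\<dots> = (\<Sum>w\<in>{id}. (-1) ^ weyl_length n w * lookup ?K (w (rhoC n) - rhoC n))"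
    using z by (intro sum.mono_neutral_right) (simp_all add: finite_weyl_group weyl_group.weyl_id)
  ultimately show "fps_nth (generalized_exponent n []) d = fps_nth 1 d" by simp
qed

section \<open>The generalized exponent as a sum over distinguished patterns\<close>

definition part :: "nat list \<Rightarrow> nat \<Rightarrow> nat" where
  "part lam s = (if s < length lam then lam ! s else 0)"

lemma part_antimono: "is_partition lam \<Longrightarrow> part lam (Suc s) \<le> part lam s"
  by (auto simp: part_def is_partition_def sorted_wrt_iff_nth_less)

lemma lookup_partition_weight:
  "lookup (partition_weight lam) 0 = 0" "lookup (partition_weight lam) (Suc i) = int (part lam i)"
proof -
  show "lookup (partition_weight lam) 0 = 0"
    by (simp add: partition_weight_def lookup_sum lookup_coord)
  have "lookup (partition_weight lam) (Suc i) = (\<Sum>j<length lam. if j = i then int (lam ! i) else 0)"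
    unfolding partition_weight_def lookup_sum by (rule sum.cong) (auto simp: lookup_coord)
  then show "lookup (partition_weight lam) (Suc i) = int (part lam i)"
    by (simp add: part_def)
qed

lemma distinguished_0: "distinguished n (\<lambda>_. 0) = {\<lambda>_ _. 0}"
proof
  show "distinguished n (\<lambda>_. 0) \<subseteq> {\<lambda>_ _. 0}"
  proof
    fix K assume "K \<in> distinguished n (\<lambda>_. 0)"
    then have K: "K \<in> GT (2 * n) (\<lambda>_. 0)" by (simp add: distinguished_def)
    have "K j s = 0" for j s using GT_le_top[OF K, of j s] by simp
    then show "K \<in> {\<lambda>_ _. 0}" by auto
  qed
  show "{\<lambda>_ _. 0} \<subseteq> distinguished n (\<lambda>_. 0)"
    by (auto simp: distinguished_def GT_def interl_def excess_def tot_def lvl_def)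
qed

lemma chargeK_0: "chargeK n (\<lambda>_ _. 0) = 0"
proof -
  have "eps n (\<lambda>_ _. 0) i = 0" for i by (simp add: eps_def excess_def)
  then show ?thesis by (simp add: chargeK_def)
qed

text \<open>Three factors without reference to the partition are collected in the constant: that of
  \<open>generalized_exponent_Zf\<close>, the Vandermonde coefficient, and the series that counts
  \<open>U\<close>.\<close>

lemma generalized_exponent_factor:
  assumes n: "1 \<le> n"
  shows "\<exists>c. \<forall>lam. is_partition lam \<longrightarrow> length lam \<le> n \<longrightarrow>
    generalized_exponent n lam = c * (\<Sum>K\<in>distinguished n (part lam). fps_X ^ chargeK n K)"
proof -
  obtain c where c: "\<And>lam. generalized_exponent n lam =
      c * Abs_fps (\<lambda>m. Zf n m (partition_weight lam + rhoC n) (rhoC n))"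
    using generalized_exponent_Zf[OF n] by blast
  let ?v = "lookup (Vd (2 * n)) (rhox (2 * n))" and ?u = "Abs_fps (\<lambda>N. int (card (U n N)))"
  have "generalized_exponent n lam = (c * (fps_const ?v * ?u)) * (\<Sum>K\<in>distinguished n (part lam). fps_X ^ chargeK n K)"
    if lam: "is_partition lam" "length lam \<le> n" for lam
  proof -
    let ?k = "part lam" and ?\<mu> = "partition_weight lam + rhoC n"
    have k: "?k (Suc s) \<le> ?k s" "n \<le> s \<Longrightarrow> ?k s = 0" for s
      using part_antimono[OF lam(1)] lam(2) by (auto simp: part_def)
    have "Abs_fps (\<lambda>m. Zf n m ?\<mu> (rhoC n)) = fps_const ?v * (?u * (\<Sum>K\<in>distinguished n ?k. fps_X ^ chargeK n K))"
    proof (rule fps_ext)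
      fix d
      have "fps_nth (Abs_fps (\<lambda>m. Zf n m ?\<mu> (rhoC n))) d =
          pr (DV (2 * n) (fps_nth (Hm (2 * n)) d)) (fps_nth (Mdet n (\<lambda>i. int (?k i) + int n - int i) {..<2 * n}) (2 * d))"
        unfolding fps_nth_Abs_fps
        by (rule pr_DV_Mdet_Zf[OF n, symmetric])
          (simp_all add: lookup_add lookup_partition_weight lookup_rhoC of_nat_diff k(2))
      also have "\<dots> = ?v * (\<Sum>K\<in>distinguished n ?k. if chargeK n K \<le> d then int (card (U n (d - chargeK n K))) else 0)"
        by (rule pr_DV_Mdet[OF n]) (simp_all only: k)
      also have "(\<Sum>K\<in>distinguished n ?k. if chargeK n K \<le> d then int (card (U n (d - chargeK n K))) else 0) =
          fps_nth (?u * (\<Sum>K\<in>distinguished n ?k. fps_X ^ chargeK n K)) d"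
        unfolding sum_distrib_left fps_sum_nth
        by (rule sum.cong) (simp_all add: fps_X_power_mult_right_nth)
      finally show "fps_nth (Abs_fps (\<lambda>m. Zf n m ?\<mu> (rhoC n))) d =
          fps_nth (fps_const ?v * (?u * (\<Sum>K\<in>distinguished n ?k. fps_X ^ chargeK n K))) d" by simp
    qed
    then show ?thesis unfolding c by (simp only: mult.assoc)
  qed
  then show ?thesis by blast
qed

theorem generalized_exponent_distinguished:
  assumes "1 \<le> n" "is_partition lam" "length lam \<le> n"
  shows "generalized_exponent n lam = (\<Sum>K\<in>distinguished n (part lam). fps_X ^ chargeK n K)"
proof -
  obtain c where c: "\<And>lam. is_partition lam \<Longrightarrow> length lam \<le> n \<Longrightarrow>
      generalized_exponent n lam = c * (\<Sum>K\<in>distinguished n (part lam). fps_X ^ chargeK n K)"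
    using generalized_exponent_factor[OF assms(1)] by blast
  have "part [] = (\<lambda>_. 0)" by (simp add: part_def fun_eq_iff)
  then have "c = 1"
    using c[of "[]"] by (simp add: is_partition_def generalized_exponent_Nil[OF assms(1)] distinguished_0 chargeK_0)
  then show ?thesis using c[OF assms(2,3)] by simp
qed

section \<open>Reversing the record steps of a walk\<close>

text \<open>
  For a fixed letter \<open>i\<close>, \<open>p\<close>, \<open>h\<close> and \<open>q\<close> are the column heights of the shapes of the letters
  \<open>\<le> i - 1\<close>, \<open>\<le> i\<close> and \<open>\<le> i + 1\<close>. A step up of the walk is a column with an uncancelled \<open>i\<close>, and
  the record steps are those columns whose \<open>+\<close> survives.
\<close>

definition walk :: "(nat \<Rightarrow> int) \<Rightarrow> (nat \<Rightarrow> int) \<Rightarrow> (nat \<Rightarrow> int) \<Rightarrow> nat \<Rightarrow> int" where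
  "walk p q h c = (\<Sum>c'<c. 2 * h c' - p c' - q c')"

definition between :: "(nat \<Rightarrow> int) \<Rightarrow> (nat \<Rightarrow> int) \<Rightarrow> (nat \<Rightarrow> int) \<Rightarrow> bool" where
  "between p q h \<longleftrightarrow> (\<forall>c. p c \<le> h c \<and> h c \<le> p c + 1 \<and> h c \<le> q c \<and> q c \<le> h c + 1 \<and> h (Suc c) \<le> h c)"

definition rec_step :: "(nat \<Rightarrow> int) \<Rightarrow> nat \<Rightarrow> bool" where
  "rec_step S c \<longleftrightarrow> (\<forall>c'\<le>c. S c' < S (Suc c))"

definition flip_rec :: "(nat \<Rightarrow> int) \<Rightarrow> (nat \<Rightarrow> int) \<Rightarrow> (nat \<Rightarrow> int) \<Rightarrow> nat \<Rightarrow> int" where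
  "flip_rec p q h c = h c - (if rec_step (walk p q h) c then 1 else 0)"

definition recs :: "(nat \<Rightarrow> int) \<Rightarrow> nat \<Rightarrow> int" where
  "recs S c = (\<Sum>c'<c. if rec_step S c' then 1 else 0)"

lemma walk_0 [simp]: "walk p q h 0 = 0"
  by (simp add: walk_def)

lemma walk_Suc: "walk p q h (Suc c) = walk p q h c + (2 * h c - p c - q c)"
  by (simp add: walk_def)

lemma recs_Suc: "recs S (Suc c) = recs S c + (if rec_step S c then 1 else 0)"
  by (simp add: recs_def)

lemma recs_mono: "c \<le> c' \<Longrightarrow> recs S c \<le> recs S c'"
  by (rule lift_Suc_mono_le[of "recs S"]) (simp_all add: recs_Suc)

text \<open>Steps up have size at most 1, so the number of record steps equals the running
  maximum.\<close>

lemma recs_max: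
  assumes "S 0 = 0" "\<And>c. S (Suc c) \<le> S c + 1"
  shows "(\<forall>c'\<le>c. S c' \<le> recs S c) \<and> (\<exists>c'\<le>c. S c' = recs S c)"
proof (induction c)
  case 0
  then show ?case by (simp add: recs_def assms(1))
next
  case (Suc c)
  then obtain c0 where c0: "c0 \<le> c" "S c0 = recs S c" and le: "\<And>c'. c' \<le> c \<Longrightarrow> S c' \<le> recs S c" by blast
  show ?case
  proof (cases "rec_step S c")
    case True
    then have "S c0 < S (Suc c)" using c0(1) by (simp add: rec_step_def)
    then have "S (Suc c) = recs S c + 1" using c0(2) assms(2)[of c] le[of c] by simp
    then show ?thesis using True le by (fastforce simp: recs_Suc le_Suc_eq)
  next
    case False
    then obtain c1 where "c1 \<le> c" "S (Suc c) \<le> S c1" by (auto simp: rec_step_def not_less)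
    then have "S (Suc c) \<le> recs S c" using le[of c1] by simp
    then show ?thesis using False le c0 by (auto simp: recs_Suc le_Suc_eq intro: exI[of _ c0])
  qed
qed

text \<open>Reversing the record steps is Pitman's transformation: twice the running maximum is
  subtracted from the walk.\<close>

lemma walk_flip_rec: "walk p q (flip_rec p q h) c = walk p q h c - 2 * recs (walk p q h) c"
  by (induction c) (simp_all add: walk_Suc recs_Suc flip_rec_def recs_def)

context
  fixes p q :: "nat \<Rightarrow> int"
  assumes p: "\<And>c. p (Suc c) \<le> p c" and q: "\<And>c. q (Suc c) \<le> q c"
begin

lemma betweenD:
  assumes "between p q h"
  shows "p c \<le> h c" "h c \<le> p c + 1" "h c \<le> q c" "q c \<le> h c + 1" "h (Suc c) \<le> h c"
  using assms by (simp_all add: between_def)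

lemma walk_steps:
  assumes "between p q h"
  shows "walk p q h (Suc c) \<le> walk p q h c + 1" "walk p q h c - 1 \<le> walk p q h (Suc c)"
  using betweenD[OF assms, of c] by (simp_all add: walk_Suc)

lemma walk_le_recs: "between p q h \<Longrightarrow> c' \<le> c \<Longrightarrow> walk p q h c' \<le> recs (walk p q h) c"
  using recs_max[of "walk p q h" c] walk_steps by auto

lemma rec_step_walk:
  assumes h: "between p q h" and r: "rec_step (walk p q h) c"
  shows "h c = p c + 1" "q c = h c" "walk p q h c = recs (walk p q h) c"
proof -
  have lt: "walk p q h c < walk p q h (Suc c)" using r by (simp add: rec_step_def)
  then have "1 \<le> 2 * h c - p c - q c" by (simp add: walk_Suc)
  then show "h c = p c + 1" "q c = h c" using betweenD[OF h, of c] by linarith+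
  have "walk p q h (Suc c) \<le> walk p q h c + 1" by (rule walk_steps[OF h])
  moreover obtain c' where "c' \<le> c" "walk p q h c' = recs (walk p q h) c"
    using recs_max[of "walk p q h" c] walk_steps(1)[OF h] by auto
  moreover from this(1) have "walk p q h c' < walk p q h (Suc c)" using r unfolding rec_step_def by blast
  ultimately show "walk p q h c = recs (walk p q h) c" using walk_le_recs[OF h order_refl, of c] by linarith
qed

lemma between_flip_rec:
  assumes h: "between p q h"
  shows "between p q (flip_rec p q h)"
  unfolding between_def
proof (intro allI)
  fix c
  let ?S = "walk p q h"
  note b = betweenD[OF h]
  have "flip_rec p q h (Suc c) \<le> flip_rec p q h c"
  proof (cases "rec_step ?S c \<and> \<not> rec_step ?S (Suc c) \<and> h (Suc c) = h c")
    case False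
    then show ?thesis using b(5)[of c] by (auto simp: flip_rec_def)
  next
    \<comment> \<open>The critical case: a lowered column followed by an equally high one that is
      not lowered. Equal heights force a step up at \<open>Suc c\<close>, and a step up right after
      a record step is again a record.\<close>
    case True
    then have "h c = p c + 1" "q c = h c" using rec_step_walk[OF h] by auto
    then have "2 * h (Suc c) - p (Suc c) - q (Suc c) = 1"
      using True p[of c] q[of c] b[of "Suc c"] by linarith
    then have "?S (Suc (Suc c)) = ?S (Suc c) + 1" by (simp add: walk_Suc)
    then have "rec_step ?S (Suc c)" using True by (fastforce simp: rec_step_def le_Suc_eq)
    with True show ?thesis by simp
  qed
  then show "p c \<le> flip_rec p q h c \<and> flip_rec p q h c \<le> p c + 1 \<and> flip_rec p q h c \<le> q c \<and>
      q c \<le> flip_rec p q h c + 1 \<and> flip_rec p q h (Suc c) \<le> flip_rec p q h c"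
    using b[of c] rec_step_walk[OF h, of c] by (auto simp: flip_rec_def)
qed

lemma walk_flip_rec_nonpos:
  assumes h: "between p q h"
  shows "walk p q (flip_rec p q h) c \<le> - recs (walk p q h) c" "walk p q (flip_rec p q h) c \<le> 0"
proof -
  show "walk p q (flip_rec p q h) c \<le> - recs (walk p q h) c"
    using walk_le_recs[OF h order_refl, of c] by (simp add: walk_flip_rec)
  moreover have "0 \<le> recs (walk p q h) c" unfolding recs_def by (intro sum_nonneg) simp
  ultimately show "walk p q (flip_rec p q h) c \<le> 0" by simp
qed

text \<open>
  The number of record steps before \<open>c\<close> can be read off the flipped walk \<open>S'\<close> as the smallest
  value of \<open>- S'\<close> after \<open>c\<close>, capped by half of its final value.
\<close>

lemma flip_rec_inj:
  assumes h: "between p q h" "between p q g" and C: "walk p q h C = 0" "walk p q g C = 0"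
    and eq: "\<And>c. c < C \<Longrightarrow> flip_rec p q h c = flip_rec p q g c" and c: "c < C"
  shows "h c = g c"
proof -
  have walk_eq: "walk p q (flip_rec p q h) c = walk p q (flip_rec p q g) c" if "c \<le> C" for c
    unfolding walk_def using eq that by (intro sum.cong) auto
  \<comment> \<open>The witness is the next record step at or after \<open>c\<close>: the original
    walk is at its running maximum there, and that maximum has not changed since
    \<open>c\<close>.\<close>
  have attained: "\<exists>c'. c \<le> c' \<and> c' \<le> C \<and> - walk p q (flip_rec p q f) c' = recs (walk p q f) c"
    if f: "between p q f" and c: "c \<le> C" and lt: "recs (walk p q f) c < recs (walk p q f) C" for f c
  proof -
    have "\<exists>c'. c \<le> c' \<and> c' < C \<and> recs (walk p q f) c' = recs (walk p q f) c \<and> rec_step (walk p q f) c'"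
    proof (rule ccontr)
      assume no: "\<not> ?thesis"
      have "recs (walk p q f) C = recs (walk p q f) c"
        using c
      proof (induction C rule: dec_induct)
        case (step m)
        then show ?case using no lt recs_Suc[of "walk p q f" m] by (smt (verit) less_SucI)
      qed simp
      with lt show False by simp
    qed
    then obtain c' where c': "c \<le> c'" "c' < C" "recs (walk p q f) c' = recs (walk p q f) c" "rec_step (walk p q f) c'"
      by blast
    then show ?thesis
      using rec_step_walk(3)[OF f c'(4)] by (intro exI[of _ c']) (simp add: walk_flip_rec)
  qed
  have final: "2 * recs (walk p q f) C = - walk p q (flip_rec p q f) C" if "walk p q f C = 0" for f
    using that by (simp add: walk_flip_rec)
  \<comment> \<open>If \<open>f'\<close> had fewer records before \<open>c\<close> than
    \<open>f\<close>, the common flipped walk would later return to a value that the records of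
    \<open>f\<close> exclude.\<close>
  have le: "recs (walk p q f) c \<le> recs (walk p q f') c"
    if f: "between p q f" "between p q f'" "walk p q f C = 0" "walk p q f' C = 0" and c: "c \<le> C"
      and eq: "\<And>c. c \<le> C \<Longrightarrow> walk p q (flip_rec p q f) c = walk p q (flip_rec p q f') c" for f f' c
  proof (rule ccontr)
    assume "\<not> ?thesis"
    then have lt: "recs (walk p q f') c < recs (walk p q f) c" by simp
    also have "\<dots> \<le> recs (walk p q f) C" using c by (rule recs_mono)
    also have "\<dots> = recs (walk p q f') C" using final[OF f(3)] final[OF f(4)] eq[OF order_refl] by simp
    finally obtain c' where c': "c \<le> c'" "c' \<le> C" "- walk p q (flip_rec p q f') c' = recs (walk p q f') c"
      using attained[OF f(2) c] by blast
    have "recs (walk p q f) c \<le> recs (walk p q f) c'" using c'(1) by (rule recs_mono)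
    also have "\<dots> \<le> - walk p q (flip_rec p q f) c'" using walk_flip_rec_nonpos(1)[OF f(1), of c'] by simp
    finally show False using eq[OF c'(2)] c'(3) lt by simp
  qed
  have "recs (walk p q h) c = recs (walk p q g) c" if "c \<le> C" for c
    using le[OF h C that walk_eq] le[OF h(2,1) C(2,1) that walk_eq[symmetric]] by simp
  then have "walk p q h c = walk p q g c" if "c \<le> C" for c
    using walk_eq[OF that] that by (simp add: walk_flip_rec)
  from this[of c] this[of "Suc c"] c show ?thesis by (simp add: walk_Suc)
qed

text \<open>The walk is rebuilt from its prospective running maximum \<open>R\<close>: the least
  value of \<open>- ?S'\<close> from \<open>c\<close> on, capped by half of the final value. Where
  \<open>R\<close> increases, the column is raised by one; the new walk is then
  \<open>?S' + 2 * R\<close>, and its record steps are exactly the increases of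
  \<open>R\<close>.\<close>

lemma flip_rec_surj:
  assumes h: "between p q h'" and le: "\<And>c. walk p q h' c \<le> 0" and ev: "even (walk p q h' C)"
    and C: "\<And>c. C \<le> c \<Longrightarrow> q c = p c"
  shows "\<exists>h. between p q h \<and> walk p q h C = 0 \<and> flip_rec p q h = h'"
proof -
  let ?S' = "walk p q h'"
  note b = betweenD[OF h]
  define P where "P = - (?S' C div 2)"
  have P: "?S' C = - 2 * P" using ev unfolding P_def by presburger
  \<comment> \<open>The bound \<open>min c C\<close> keeps the range nonempty for \<open>c\<close>
    beyond \<open>C\<close>.\<close>
  define M where "M c = Min ((\<lambda>c'. - ?S' c') ` {min c C..C})" for c
  define R where "R c = min P (M c)" for c
  have P0: "0 \<le> P" using P le[of C] by simp
  have M_le: "M c \<le> - ?S' c'" if "min c C \<le> c'" "c' \<le> C" for c c'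
    unfolding M_def using that by (intro Min_le) auto
  have M_ge: "m \<le> M c" if "\<And>c'. min c C \<le> c' \<Longrightarrow> c' \<le> C \<Longrightarrow> m \<le> - ?S' c'" for m c
    unfolding M_def using that by (subst Min_ge_iff) auto
  have M_step: "M c = min (- ?S' c) (M (Suc c))" if c: "c < C" for c
  proof -
    have "{min c C..C} = insert c {min (Suc c) C..C}" using c by auto
    then show ?thesis unfolding M_def using c by simp
  qed
  have M_C: "M c = 2 * P" if "C \<le> c" for c
    using that P by (simp add: M_def)
  have MS: "M (Suc c) \<le> - ?S' (Suc c)" if "c < C" for c using that by (intro M_le) simp_all
  have stp: "?S' (Suc c) \<le> ?S' c + 1" "?S' c - 1 \<le> ?S' (Suc c)" for c by (rule walk_steps[OF h])+
  have inc: "R c \<le> R (Suc c) \<and> R (Suc c) \<le> R c + 1" for c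
  proof (cases "c < C")
    case True
    then show ?thesis using M_step[OF True] MS[OF True] stp[of c] unfolding R_def by linarith
  next
    case False
    then show ?thesis by (simp add: R_def M_C)
  qed
  have inc_eq: "R c = - ?S' c \<and> ?S' (Suc c) = ?S' c - 1 \<and> c < C" if "R (Suc c) \<noteq> R c" for c
  proof -
    have c: "c < C"
    proof (rule ccontr)
      assume "\<not> c < C"
      then show False using that by (simp add: R_def M_C)
    qed
    then show ?thesis using that M_step[OF c] MS[OF c] stp[of c] c unfolding R_def by linarith
  qed
  have R_le: "R c \<le> - ?S' c" for c
  proof (cases "c \<le> C")
    case True
    then show ?thesis using M_le[of c c] by (simp add: R_def)
  next
    case False
    have "?S' c = ?S' C"
      using False[unfolded not_le, THEN less_imp_le]
    proof (induction c rule: dec_induct)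
      case (step m)
      then show ?case using C[of m] b[of m] by (simp add: walk_Suc)
    qed simp
    then show ?thesis using P P0 by (simp add: R_def)
  qed
  have R_0: "R 0 = 0"
  proof -
    have "M 0 \<le> 0" using M_le[of 0 0] by simp
    moreover have "0 \<le> M 0" using le by (intro M_ge) simp
    ultimately show ?thesis using P0 by (simp add: R_def)
  qed
  define h where "h c = h' c + (R (Suc c) - R c)" for c
  have walk_h: "walk p q h c = ?S' c + 2 * R c" for c
    by (induction c) (simp_all add: walk_Suc h_def R_0)
  have net: "2 * h' c - p c - q c = - 1" if "R (Suc c) \<noteq> R c" for c
    using inc_eq[OF that] by (simp add: walk_Suc)
  have bet: "between p q h"
    unfolding between_def
  proof (intro allI)
    fix c
    have local: "p c \<le> h c \<and> h c \<le> p c + 1 \<and> h c \<le> q c \<and> q c \<le> h c + 1" for c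
    proof (cases "R (Suc c) = R c")
      case True
      then show ?thesis using b[of c] by (simp add: h_def)
    next
      case False
      then have "R (Suc c) - R c = 1" using inc[of c] by linarith
      then show ?thesis unfolding h_def using b[of c] net[OF False] by linarith
    qed
    have "h (Suc c) \<le> h c"
    proof (rule ccontr)
      assume "\<not> ?thesis"
      then have ne: "R (Suc (Suc c)) \<noteq> R (Suc c)" and same: "R (Suc c) = R c" and eq: "h' (Suc c) = h' c"
        using b(5)[of c] inc[of c] inc[of "Suc c"] by (simp_all add: h_def)
      have "2 * h' c - p c - q c = - 1"
        using net[OF ne] eq b[of c] b[of "Suc c"] p[of c] q[of c] by linarith
      then have S: "?S' (Suc c) = ?S' c - 1" by (simp add: walk_Suc)
      have "R (Suc c) = - ?S' (Suc c)" using inc_eq[OF ne] by blast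
      moreover have "R c \<le> - ?S' c" by (rule R_le)
      ultimately show False using S same by simp
    qed
    then show "p c \<le> h c \<and> h c \<le> p c + 1 \<and> h c \<le> q c \<and> q c \<le> h c + 1 \<and> h (Suc c) \<le> h c"
      using local by simp
  qed
  have S_le: "walk p q h c \<le> R c" for c
    using R_le[of c] by (simp add: walk_h)
  have R_mono: "R c \<le> R c'" if "c \<le> c'" for c c'
    using lift_Suc_mono_le[of R c c'] inc that by blast
  have R_attained: "\<exists>c'\<le>c. walk p q h c' = R c" for c
  proof (induction c)
    case 0
    show ?case by (rule exI[of _ 0]) (simp add: R_0)
  next
    case (Suc c)
    show ?case
    proof (cases "R (Suc c) = R c")
      case True
      with Suc show ?thesis by (metis le_SucI)
    next
      case False
      have "walk p q h (Suc c) = R (Suc c)"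
        using inc_eq[OF False] inc[of c] False by (simp add: walk_h)
      then show ?thesis by blast
    qed
  qed
  have rec: "rec_step (walk p q h) c \<longleftrightarrow> R (Suc c) \<noteq> R c" for c
  proof
    assume r: "rec_step (walk p q h) c"
    obtain c' where "c' \<le> c" "walk p q h c' = R c" using R_attained by blast
    then have "R c < walk p q h (Suc c)" using r by (auto simp: rec_step_def)
    with S_le[of "Suc c"] show "R (Suc c) \<noteq> R c" by simp
  next
    assume ne: "R (Suc c) \<noteq> R c"
    have "walk p q h (Suc c) = R c + 1"
      using inc_eq[OF ne] inc[of c] ne by (simp add: walk_h)
    moreover have "walk p q h c' \<le> R c" if "c' \<le> c" for c'
      using S_le[of c'] R_mono[OF that] by simp
    ultimately show "rec_step (walk p q h) c" by (fastforce simp: rec_step_def)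
  qed
  have "flip_rec p q h = h'"
  proof
    fix c
    show "flip_rec p q h c = h' c"
      using inc[of c] by (cases "R (Suc c) = R c") (simp_all add: flip_rec_def rec h_def)
  qed
  moreover have "walk p q h C = 0" using P P0 by (simp add: walk_h R_def M_C)
  ultimately show ?thesis using bet by blast
qed

end

section \<open>The map L on Gelfand-Tsetlin patterns\<close>

text \<open>Here columns are counted from 0, unlike in \<open>ht\<close>; hence
  \<open>Suc c\<close>.\<close>

definition hgt :: "nat \<Rightarrow> (nat \<Rightarrow> nat \<Rightarrow> nat) \<Rightarrow> nat \<Rightarrow> nat \<Rightarrow> int" where
  "hgt n K i c = int (ht n (Suc c) (K i))"

text \<open>The odd levels are replaced by the shapes with column heights \<open>g i\<close>. As the
  even levels stay, the odd ones can be changed independently of each other.\<close>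

definition relevel :: "nat \<Rightarrow> (nat \<Rightarrow> nat \<Rightarrow> nat) \<Rightarrow> (nat \<Rightarrow> nat \<Rightarrow> int) \<Rightarrow> nat \<Rightarrow> nat \<Rightarrow> nat" where
  "relevel n K g i s = (if odd i \<and> i < 2 * n then card {c. int s < g i c} else K i s)"

definition flips :: "nat \<Rightarrow> (nat \<Rightarrow> nat \<Rightarrow> nat) \<Rightarrow> nat \<Rightarrow> nat \<Rightarrow> int" where
  "flips n K i = flip_rec (hgt n K (i - 1)) (hgt n K (i + 1)) (hgt n K i)"

definition Lk :: "nat \<Rightarrow> (nat \<Rightarrow> nat \<Rightarrow> nat) \<Rightarrow> nat \<Rightarrow> nat \<Rightarrow> nat" where
  "Lk n K = relevel n K (flips n K)"

lemma relevel_even: "\<not> (odd i \<and> i < 2 * n) \<Longrightarrow> relevel n K g i = K i"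
  by (rule ext) (auto simp: relevel_def)

lemma hgt_eq_sum: "hgt n K i c = (\<Sum>s<n. if c < K i s then 1 else 0)"
  unfolding hgt_def ht_sum[symmetric] by (simp add: Suc_le_eq)

lemma hgt_antimono: "hgt n K i (Suc c) \<le> hgt n K i c"
  unfolding hgt_eq_sum by (rule sum_mono) simp

lemma sum_min_hgt: "(\<Sum>s<n. int (min (K i s) c)) = (\<Sum>c'<c. hgt n K i c')"
proof -
  have "int (min m c) = (\<Sum>c'<c. if c' < m then 1 else 0)" for m
    by (induction c) (auto simp: min_def)
  then show ?thesis unfolding hgt_eq_sum by (simp only: sum.swap[of _ "{..<c}"])
qed

lemma excess_walk: "excess n K i c = walk (hgt n K (i - 1)) (hgt n K (i + 1)) (hgt n K i) c"
  unfolding excess_def walk_def sum_subtractf sum_min_hgt sum_distrib_left[symmetric] ..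

lemma down_set_card:
  assumes "finite A" "\<And>c c'. c \<in> A \<Longrightarrow> c' \<le> c \<Longrightarrow> c' \<in> (A :: nat set)"
  shows "c < card A \<longleftrightarrow> c \<in> A"
proof
  assume "c \<in> A"
  then have "{..c} \<subseteq> A" using assms(2) by auto
  from card_mono[OF assms(1) this] show "c < card A" by simp
next
  assume c: "c < card A"
  show "c \<in> A"
  proof (rule ccontr)
    assume "c \<notin> A"
    then have "A \<subseteq> {..<c}" using assms(2) by (metis lessThan_iff not_less subsetI)
    from card_mono[OF _ this] c show False by simp
  qed
qed

lemma between_antimono: "between p q h \<Longrightarrow> c \<le> c' \<Longrightarrow> h c' \<le> h c"
  by (rule lift_Suc_antimono_le[of h]) (simp_all add: between_def)

context
  fixes n :: nat and k :: "nat \<Rightarrow> nat"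
  assumes n: "1 \<le> n" and k: "\<And>s. k (Suc s) \<le> k s" "\<And>s. n \<le> s \<Longrightarrow> k s = 0"
begin

context
  fixes K assumes K: "K \<in> GT (2 * n) k"
begin

lemma hgt_mem: "i \<le> 2 * n \<Longrightarrow> int s < hgt n K i c \<longleftrightarrow> c < K i s"
proof -
  assume i: "i \<le> 2 * n"
  have "s < ht n (Suc c) (K i) \<longleftrightarrow> s < n \<and> Suc c \<le> K i s"
    by (rule ht_iff) (rule GT_antimono[OF K i])
  moreover have "K i s = 0" if "n \<le> s" using K that i by (simp add: GT_def)
  ultimately show ?thesis by (cases "s < n") (auto simp: hgt_def)
qed

lemma hgt_0: "k 0 \<le> c \<Longrightarrow> hgt n K i c = 0"
  unfolding hgt_eq_sum using GT_le_top[OF K, of i] by (intro sum.neutral) (auto simp: not_less intro: order.trans)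

lemma hgt_step:
  assumes i: "i < 2 * n"
  shows "hgt n K i c \<le> hgt n K (Suc i) c" "hgt n K (Suc i) c \<le> hgt n K i c + 1"
proof -
  have il: "interl (K i) (K (Suc i))" using GT_interl[OF K, of i] i by simp
  show "hgt n K i c \<le> hgt n K (Suc i) c"
    unfolding hgt_eq_sum using il by (intro sum_mono) (auto simp: interl_def intro: less_le_trans)
  obtain a where a: "hgt n K i c = int a" by (simp add: hgt_def)
  show "hgt n K (Suc i) c \<le> hgt n K i c + 1"
  proof (rule ccontr)
    assume "\<not> ?thesis"
    then have "int (Suc a) < hgt n K (Suc i) c" unfolding a by simp
    then have "c < K (Suc i) (Suc a)" using hgt_mem[of "Suc i" "Suc a" c] i by linarith
    also have "\<dots> \<le> K i a" using il by (simp add: interl_def)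
    finally have "int a < hgt n K i c" using hgt_mem[of i a c] i by linarith
    then show False unfolding a by simp
  qed
qed

lemma hgt_between:
  assumes i: "odd i" "i < 2 * n"
  shows "between (hgt n K (i - 1)) (hgt n K (i + 1)) (hgt n K i)"
proof -
  have "i - 1 < 2 * n" "Suc (i - 1) = i" using i by (simp_all add: odd_pos)
  then show ?thesis
    unfolding between_def using hgt_step[of "i - 1"] hgt_step[of i] hgt_antimono[of n K i] i by simp
qed

lemma hgt_le_n: "hgt n K i c \<le> int n"
proof -
  have "hgt n K i c \<le> (\<Sum>s<n. 1)" unfolding hgt_eq_sum by (rule sum_mono) simp
  then show ?thesis by simp
qed

context
  fixes g assumes g: "\<And>i. odd i \<Longrightarrow> i < 2 * n \<Longrightarrow> between (hgt n K (i - 1)) (hgt n K (i + 1)) (g i)"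
begin

lemma g_bounds:
  assumes i: "odd i" "i < 2 * n"
  shows "0 \<le> g i c" "g i c \<le> int n" "k 0 \<le> c \<Longrightarrow> g i c = 0" "c \<le> c' \<Longrightarrow> g i c' \<le> g i c"
proof -
  have b: "hgt n K (i - 1) c \<le> g i c" "g i c \<le> hgt n K (i + 1) c" for c
    using g[OF i] by (simp_all add: between_def)
  have p: "0 \<le> hgt n K (i - 1) c" for c by (simp add: hgt_def)
  show "0 \<le> g i c" using b[of c] p[of c] by linarith
  show "g i c \<le> int n" using b[of c] hgt_le_n[of "i + 1" c] by linarith
  show "k 0 \<le> c \<Longrightarrow> g i c = 0" using b[of c] p[of c] hgt_0[of c "i + 1"] by simp
  show "c \<le> c' \<Longrightarrow> g i c' \<le> g i c" by (rule between_antimono[OF g[OF i]])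
qed

lemma relevel_less:
  assumes i: "odd i" "i < 2 * n"
  shows "c < relevel n K g i s \<longleftrightarrow> int s < g i c"
proof -
  have "finite {c. int s < g i c}"
  proof (rule finite_subset)
    show "{c. int s < g i c} \<subseteq> {..<k 0}"
    proof
      fix c assume "c \<in> {c. int s < g i c}"
      then show "c \<in> {..<k 0}" using g_bounds(3)[OF i, of c] by (cases "k 0 \<le> c") auto
    qed
  qed simp
  then have "c < card {c. int s < g i c} \<longleftrightarrow> c \<in> {c. int s < g i c}"
    using g_bounds(4)[OF i] by (intro down_set_card) (auto intro: less_le_trans)
  then show ?thesis using i by (simp add: relevel_def)
qed

lemma hgt_relevel: "hgt n (relevel n K g) i = (if odd i \<and> i < 2 * n then g i else hgt n K i)"
proof (cases "odd i \<and> i < 2 * n")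
  case True
  show ?thesis
  proof
    fix c
    have "{s. s < n \<and> Suc c \<le> relevel n K g i s} = {..<nat (g i c)}"
      using relevel_less[of i c] True g_bounds[of i c] by (auto simp: Suc_le_eq)
    then show "hgt n (relevel n K g) i c = (if odd i \<and> i < 2 * n then g i else hgt n K i) c"
      using True g_bounds(1)[of i c] by (simp add: hgt_def ht_def)
  qed
next
  case False
  then show ?thesis by (auto simp: hgt_def relevel_even)
qed

lemma relevel_GT: "relevel n K g \<in> GT (2 * n) k"
proof -
  have even_step: "interl (relevel n K g i) (relevel n K g (Suc i))" if i: "i < 2 * n" for i
  proof -
    have le: "a \<le> b" if "\<And>c. c < a \<Longrightarrow> c < b" for a b :: nat using that not_less by blast
    show ?thesis
    proof (cases "odd i")
      case True
      have b: "g i c \<le> hgt n K (i + 1) c" "hgt n K (i + 1) c \<le> g i c + 1" for c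
        using g[OF True i] by (simp_all add: between_def)
      have up: "relevel n K g (Suc i) = K (Suc i)" using True by (intro relevel_even) simp
      show ?thesis
        unfolding interl_def up
      proof (intro allI conjI le)
        fix s c assume "c < K (Suc i) (Suc s)"
        then have "int (Suc s) < hgt n K (Suc i) c" using hgt_mem[of "Suc i" "Suc s" c] i by simp
        then show "c < relevel n K g i s" using relevel_less[OF True i, of c s] b(2)[of c] by simp
      next
        fix s c assume "c < relevel n K g i s"
        then have "int s < hgt n K (Suc i) c" using relevel_less[OF True i, of c s] b(1)[of c] by simp
        then show "c < K (Suc i) s" using hgt_mem[of "Suc i"] i by simp
      qed
    next
      case False
      then have odd: "odd (Suc i)" "Suc i < 2 * n" using i by (simp, presburger)
      have b: "hgt n K i c \<le> g (Suc i) c" "g (Suc i) c \<le> hgt n K i c + 1" for c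
        using g[OF odd] by (simp_all add: between_def)
      have dn: "relevel n K g i = K i" using False by (intro relevel_even) simp
      show ?thesis
        unfolding interl_def dn
      proof (intro allI conjI le)
        fix s c assume "c < relevel n K g (Suc i) (Suc s)"
        then have "int s < hgt n K i c" using relevel_less[OF odd, of c "Suc s"] b(2)[of c] by simp
        then show "c < K i s" using hgt_mem[of i] i by simp
      next
        fix s c assume "c < K i s"
        then have "int s < hgt n K i c" using hgt_mem[of i] i by simp
        then show "c < relevel n K g (Suc i) s" using relevel_less[OF odd, of c s] b(1)[of c] by simp
      qed
    qed
  qed
  have zero: "relevel n K g i s = 0" if "i \<le> 2 * s" for i s
  proof (cases "odd i \<and> i < 2 * n")
    case True
    have "\<not> 0 < relevel n K g i s"
    proof
      assume "0 < relevel n K g i s"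
      then have "int s < g i 0" using relevel_less True by simp
      also have "\<dots> \<le> hgt n K (i + 1) 0" using g[of i] True by (simp add: between_def)
      finally have "0 < K (i + 1) s" using hgt_mem[of "i + 1"] True by simp
      \<comment> \<open>For odd \<open>i\<close> the vanishing condition of the even level above
        already covers row \<open>s\<close>.\<close>
      moreover have "i + 1 \<le> 2 * s" using that True by presburger
      ultimately show False using K by (simp add: GT_def)
    qed
    then show ?thesis by simp
  next
    case False
    then show ?thesis using that K by (simp add: relevel_even GT_def)
  qed
  have "relevel n K g (2 * n) = k" using K by (simp add: relevel_even GT_def)
  moreover have "relevel n K g i = (\<lambda>_. 0)" if "2 * n < i" for i
    using K that by (simp add: relevel_even GT_def)
  ultimately show ?thesis using even_step zero by (simp add: GT_def)
qed

end

lemma flips_between: "odd i \<Longrightarrow> i < 2 * n \<Longrightarrow> between (hgt n K (i - 1)) (hgt n K (i + 1)) (flips n K i)"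
  unfolding flips_def by (intro between_flip_rec hgt_between hgt_antimono) simp_all

lemma Lk_less:
  "i \<le> 2 * n \<Longrightarrow> c < Lk n K i s \<longleftrightarrow> int s < (if odd i \<and> i < 2 * n then flips n K i c else hgt n K i c)"
  unfolding Lk_def using relevel_less[OF flips_between, of i c s] relevel_even[of i n K "flips n K"] hgt_mem[of i s c] by auto

lemma hgt_Lk: "hgt n (Lk n K) i = (if odd i \<and> i < 2 * n then flips n K i else hgt n K i)"
  unfolding Lk_def by (rule hgt_relevel[OF flips_between])

lemma Lk_GT: "Lk n K \<in> GT (2 * n) k"
  unfolding Lk_def by (rule relevel_GT[OF flips_between])

lemma tot_walk: "tot n K i = walk (hgt n K (i - 1)) (hgt n K (i + 1)) (hgt n K i) (k 0)"
  using excess_top[OF n k K order_refl, of i] by (simp add: excess_walk)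

end

lemma GT_eqI:
  assumes K: "K \<in> GT (2 * n) k" and L: "L \<in> GT (2 * n) k"
    and eq: "\<And>i c. i \<le> 2 * n \<Longrightarrow> c < k 0 \<Longrightarrow> hgt n K i c = hgt n L i c"
  shows "K = L"
proof (intro ext)
  fix i s
  show "K i s = L i s"
  proof (cases "i \<le> 2 * n")
    case True
    have "c < K i s \<longleftrightarrow> c < L i s" for c
    proof (cases "c < k 0")
      case c: True
      then show ?thesis using hgt_mem[OF K True, of s c] hgt_mem[OF L True, of s c] eq[OF True c] by simp
    next
      case False
      then show ?thesis using GT_le_top[OF K, of i s] GT_le_top[OF L, of i s] by simp
    qed
    then show ?thesis by (metis linorder_neqE_nat order.irrefl)
  next
    case False
    then show ?thesis using K L by (simp add: GT_def)
  qed
qed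

text \<open>The even levels are fixed, so the claim splits into one statement for each odd
  \<open>i\<close>. The condition \<open>tot n K i = 0\<close> says that its walk returns to 0,
  which is what \<open>flip_rec_inj\<close> requires and \<open>flip_rec_surj\<close>
  provides.\<close>

theorem Lk_bij: "bij_betw (Lk n) {K \<in> GT (2 * n) k. \<forall>i. odd i \<longrightarrow> i < 2 * n \<longrightarrow> tot n K i = 0} (distinguished n k)"
  (is "bij_betw _ ?Z _")
proof (rule bij_betwI')
  fix K L assume "K \<in> ?Z" "L \<in> ?Z"
  then have K: "K \<in> GT (2 * n) k" "\<And>i. odd i \<Longrightarrow> i < 2 * n \<Longrightarrow> tot n K i = 0"
    and L: "L \<in> GT (2 * n) k" "\<And>i. odd i \<Longrightarrow> i < 2 * n \<Longrightarrow> tot n L i = 0" by auto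
  show "Lk n K = Lk n L \<longleftrightarrow> K = L"
  proof
    assume eq: "Lk n K = Lk n L"
    have ev: "hgt n K i = hgt n L i" if "\<not> (odd i \<and> i < 2 * n)" for i
      using hgt_Lk[OF K(1), of i] hgt_Lk[OF L(1), of i] that unfolding eq by simp
    show "K = L"
    proof (rule GT_eqI[OF K(1) L(1)])
      fix i c assume c: "c < k 0"
      show "hgt n K i c = hgt n L i c"
      proof (cases "odd i \<and> i < 2 * n")
        case False
        then show ?thesis using ev by simp
      next
        case True
        let ?p = "hgt n K (i - 1)" and ?q = "hgt n K (i + 1)"
        have pq: "hgt n L (i - 1) = ?p" "hgt n L (i + 1) = ?q" using ev[of "i - 1"] ev[of "i + 1"] True by simp_all
        show ?thesis
        proof (rule flip_rec_inj[of ?p ?q])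
          show "?p (Suc c) \<le> ?p c" "?q (Suc c) \<le> ?q c" for c by (rule hgt_antimono)+
          show "between ?p ?q (hgt n K i)" using hgt_between[OF K(1)] True by simp
          show "between ?p ?q (hgt n L i)" using hgt_between[OF L(1), of i] True unfolding pq by simp
          show "walk ?p ?q (hgt n K i) (k 0) = 0" using K(2)[of i] True by (simp add: tot_walk[OF K(1)])
          show "walk ?p ?q (hgt n L i) (k 0) = 0" using L(2)[of i] True unfolding tot_walk[OF L(1)] pq by simp
          show "flip_rec ?p ?q (hgt n K i) c = flip_rec ?p ?q (hgt n L i) c" for c
            using hgt_Lk[OF K(1), of i] hgt_Lk[OF L(1), of i] True unfolding eq flips_def pq by simp
        qed (rule c)
      qed
    qed
  qed simp
next
  fix K assume "K \<in> ?Z"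
  then have K: "K \<in> GT (2 * n) k" by simp
  have "(\<forall>c. excess n (Lk n K) i c \<le> 0) \<and> even (tot n (Lk n K) i)" if i: "odd i" "i < 2 * n" for i
  proof -
    let ?p = "hgt n K (i - 1)" and ?q = "hgt n K (i + 1)"
    have "hgt n (Lk n K) (i - 1) = ?p" "hgt n (Lk n K) (i + 1) = ?q" "hgt n (Lk n K) i = flip_rec ?p ?q (hgt n K i)"
      using i by (simp_all add: hgt_Lk[OF K] flips_def)
    then have ex: "excess n (Lk n K) i c = walk ?p ?q (flip_rec ?p ?q (hgt n K i)) c" for c
      by (simp add: excess_walk)
    have anti: "?p (Suc c) \<le> ?p c" "?q (Suc c) \<le> ?q c" for c by (rule hgt_antimono)+
    have b: "between ?p ?q (hgt n K i)" by (rule hgt_between[OF K i])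
    have "tot n (Lk n K) i = excess n (Lk n K) i (k 0)"
      by (rule excess_top[OF n k Lk_GT[OF K] order_refl, symmetric])
    then have "tot n (Lk n K) i = tot n K i - 2 * recs (walk ?p ?q (hgt n K i)) (k 0)"
      unfolding ex walk_flip_rec by (simp add: tot_walk[OF K])
    moreover have "tot n K i = 0" using \<open>K \<in> ?Z\<close> i by simp
    ultimately show ?thesis unfolding ex using walk_flip_rec_nonpos(2)[of ?p ?q, OF anti b] by simp
  qed
  then show "Lk n K \<in> distinguished n k" using Lk_GT[OF K] by (simp add: distinguished_def)
next
  fix K' assume K': "K' \<in> distinguished n k"
  then have K: "K' \<in> GT (2 * n) k" by (simp add: distinguished_def)
  let ?p = "\<lambda>i. hgt n K' (i - 1)" and ?q = "\<lambda>i. hgt n K' (i + 1)"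
  have "\<exists>h. between (?p i) (?q i) h \<and> walk (?p i) (?q i) h (k 0) = 0 \<and> flip_rec (?p i) (?q i) h = hgt n K' i"
    if i: "odd i" "i < 2 * n" for i
  proof (rule flip_rec_surj)
    show "?p i (Suc c) \<le> ?p i c" "?q i (Suc c) \<le> ?q i c" for c by (rule hgt_antimono)+
    show "between (?p i) (?q i) (hgt n K' i)" by (rule hgt_between[OF K i])
    show "walk (?p i) (?q i) (hgt n K' i) c \<le> 0" for c
      unfolding excess_walk[symmetric] using K' i by (simp add: distinguished_def)
    show "even (walk (?p i) (?q i) (hgt n K' i) (k 0))"
      unfolding tot_walk[OF K, symmetric] using K' i by (simp add: distinguished_def)
    show "?q i c = ?p i c" if "k 0 \<le> c" for c using that by (simp add: hgt_0[OF K])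
  qed
  then obtain g where g: "\<And>i. odd i \<Longrightarrow> i < 2 * n \<Longrightarrow> between (?p i) (?q i) (g i) \<and>
      walk (?p i) (?q i) (g i) (k 0) = 0 \<and> flip_rec (?p i) (?q i) (g i) = hgt n K' i"
    by metis
  define L where "L = relevel n K' g"
  have gb: "\<And>i. odd i \<Longrightarrow> i < 2 * n \<Longrightarrow> between (?p i) (?q i) (g i)" using g by blast
  have L: "L \<in> GT (2 * n) k" unfolding L_def by (rule relevel_GT[OF K gb])
  have hL: "hgt n L i = (if odd i \<and> i < 2 * n then g i else hgt n K' i)" for i
    unfolding L_def by (rule hgt_relevel[OF K gb])
  have pq: "hgt n L (i - 1) = ?p i" "hgt n L (i + 1) = ?q i" if "odd i" for i
    using that by (simp_all add: hL)
  have "tot n L i = 0" if "odd i" "i < 2 * n" for i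
    unfolding tot_walk[OF L] pq[OF that(1)] using g[OF that] that by (simp add: hL)
  moreover have "K' = Lk n L"
  proof (rule GT_eqI[OF K Lk_GT[OF L]])
    fix i c
    show "hgt n K' i c = hgt n (Lk n L) i c"
    proof (cases "odd i \<and> i < 2 * n")
      case True
      then show ?thesis using g[of i] pq[of i] by (simp add: hgt_Lk[OF L] flips_def hL)
    next
      case False
      then show ?thesis by (auto simp: hgt_Lk[OF L] hL)
    qed
  qed
  ultimately show "\<exists>L\<in>?Z. K' = Lk n L" using L by auto
qed

end

section \<open>Tableaux, signatures and patterns\<close>

definition Tab :: "nat \<Rightarrow> nat list \<Rightarrow> nat list list set" where
  "Tab n lam = {b. semistandard lam b \<and> (\<forall>r<length b. \<forall>x\<in>set (b ! r). 2 * r + 1 \<le> x \<and> x \<le> 2 * n)}"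

text \<open>The value 0 above level \<open>2 * n\<close> is the convention of
  \<open>GT\<close>.\<close>

definition Kb :: "nat \<Rightarrow> nat list list \<Rightarrow> nat \<Rightarrow> nat \<Rightarrow> nat" where
  "Kb n b i r = (if i \<le> 2 * n \<and> r < length b then card {c. c < length (b ! r) \<and> b ! r ! c \<le> i} else 0)"

definition tabK :: "nat list \<Rightarrow> (nat \<Rightarrow> nat \<Rightarrow> nat) \<Rightarrow> nat list list" where
  "tabK lam K = map (\<lambda>r. map (\<lambda>c. LEAST i. c < K i r) [0..<lam ! r]) [0..<length lam]"

context
  fixes n :: nat and lam :: "nat list"
  assumes n: "1 \<le> n" and lam: "is_partition lam" "length lam \<le> n"
begin

lemma part_k: "part lam (Suc s) \<le> part lam s" "n \<le> s \<Longrightarrow> part lam s = 0"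
  using part_antimono[OF lam(1)] lam(2) by (auto simp: part_def)

context
  fixes b assumes b: "b \<in> Tab n lam"
begin

lemma Tab_length: "length b = length lam" "r < length lam \<Longrightarrow> length (b ! r) = lam ! r"
proof -
  have m: "map length b = lam" using b by (simp add: Tab_def semistandard_def)
  then show "length b = length lam" by (metis length_map)
  then show "r < length lam \<Longrightarrow> length (b ! r) = lam ! r" using arg_cong[OF m, of "\<lambda>l. l ! r"] by simp
qed

lemma Tab_cell:
  assumes "r < length lam" "c < lam ! r"
  shows "2 * r + 1 \<le> b ! r ! c" "b ! r ! c \<le> 2 * n"
proof -
  have "b ! r ! c \<in> set (b ! r)" using assms Tab_length by simp
  then show "2 * r + 1 \<le> b ! r ! c" "b ! r ! c \<le> 2 * n" using b assms(1) Tab_length(1) by (simp_all add: Tab_def)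
qed

lemma Tab_row:
  assumes "r < length lam" "c' \<le> c" "c < lam ! r"
  shows "b ! r ! c' \<le> b ! r ! c"
proof -
  have "sorted (b ! r)" using b assms(1) Tab_length(1) by (simp add: Tab_def semistandard_def)
  then show ?thesis using assms Tab_length(2)[OF assms(1)] by (simp add: sorted_nth_mono)
qed

lemma Tab_col: "Suc r < length lam \<Longrightarrow> c < lam ! Suc r \<Longrightarrow> b ! r ! c < b ! Suc r ! c"
  using b Tab_length by (simp add: Tab_def semistandard_def)

lemma Kb_less:
  assumes i: "i \<le> 2 * n" and r: "r < length lam"
  shows "c < Kb n b i r \<longleftrightarrow> c < lam ! r \<and> b ! r ! c \<le> i"
proof -
  have "c < card {c. c < lam ! r \<and> b ! r ! c \<le> i} \<longleftrightarrow> c \<in> {c. c < lam ! r \<and> b ! r ! c \<le> i}"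
    using Tab_row[OF r] by (intro down_set_card) (auto intro: order.trans le_less_trans)
  then show ?thesis using i r Tab_length by (simp add: Kb_def)
qed

lemma Kb_0: "length lam \<le> r \<or> 2 * n < i \<Longrightarrow> Kb n b i r = 0"
  using Tab_length(1) by (auto simp: Kb_def)

lemma Kb_zero:
  assumes "i \<le> 2 * r"
  shows "Kb n b i r = 0"
proof (cases "r < length lam \<and> i \<le> 2 * n")
  case True
  have "\<not> 0 < Kb n b i r"
  proof
    assume "0 < Kb n b i r"
    then have "0 < lam ! r" "b ! r ! 0 \<le> i" using Kb_less[of i r 0] True by auto
    then show False using Tab_cell(1)[of r 0] True assms by simp
  qed
  then show ?thesis by simp
qed (use Kb_0 in auto)

lemma Kb_GT: "Kb n b \<in> GT (2 * n) (part lam)"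
proof -
  have le: "x \<le> y" if "\<And>c. c < x \<Longrightarrow> c < y" for x y :: nat using that not_less by blast
  have top: "Kb n b (2 * n) = part lam"
  proof
    fix r
    show "Kb n b (2 * n) r = part lam r"
    proof (cases "r < length lam")
      case True
      have "c < Kb n b (2 * n) r \<longleftrightarrow> c < lam ! r" for c
        using Kb_less[OF order_refl True, of c] Tab_cell(2)[OF True, of c] by auto
      then show ?thesis using True by (metis le le_antisym part_def)
    next
      case False
      then show ?thesis using Kb_0 by (simp add: part_def)
    qed
  qed
  have "interl (Kb n b i) (Kb n b (Suc i))" if i: "i < 2 * n" for i
    unfolding interl_def
  proof (intro allI conjI le)
    fix r c assume c: "c < Kb n b (Suc i) (Suc r)"
    then have r: "Suc r < length lam" using Kb_0[of "Suc r" "Suc i"] by (cases "Suc r < length lam") auto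
    with c i have "c < lam ! Suc r" "b ! Suc r ! c \<le> Suc i" using Kb_less[of "Suc i" "Suc r" c] by auto
    moreover from this have "c < lam ! r" using part_k(1)[of r] r by (simp add: part_def)
    ultimately show "c < Kb n b i r"
      using Tab_col[OF r, of c] Kb_less[of i r c] i r by simp
  next
    fix r c assume c: "c < Kb n b i r"
    then have r: "r < length lam" using Kb_0[of r i] by (cases "r < length lam") auto
    then show "c < Kb n b (Suc i) r" using c i Kb_less[of i r c] Kb_less[of "Suc i" r c] by simp
  qed
  then show ?thesis using top Kb_zero Kb_0 by (auto simp: GT_def fun_eq_iff)
qed

lemma tabK_Kb: "tabK lam (Kb n b) = b"
proof (rule nth_equalityI)
  show "length (tabK lam (Kb n b)) = length b" by (simp add: tabK_def Tab_length)
  fix r assume "r < length (tabK lam (Kb n b))"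
  then have r: "r < length lam" by (simp add: tabK_def)
  show "tabK lam (Kb n b) ! r = b ! r"
  proof (rule nth_equalityI)
    show "length (tabK lam (Kb n b) ! r) = length (b ! r)" using r by (simp add: tabK_def Tab_length)
    fix c assume "c < length (tabK lam (Kb n b) ! r)"
    then have c: "c < lam ! r" using r by (simp add: tabK_def)
    have "(LEAST i. c < Kb n b i r) = b ! r ! c"
    proof (rule Least_equality)
      show "c < Kb n b (b ! r ! c) r" using Kb_less[OF Tab_cell(2)[OF r c] r] c by simp
      fix i assume i: "c < Kb n b i r"
      then have "i \<le> 2 * n" using Kb_0[of r i] by (cases "i \<le> 2 * n") auto
      then show "b ! r ! c \<le> i" using Kb_less[OF _ r] i by simp
    qed
    then show "tabK lam (Kb n b) ! r ! c = b ! r ! c" using r c by (simp add: tabK_def)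
  qed
qed

end

context
  fixes K assumes K: "K \<in> GT (2 * n) (part lam)"
begin

lemma GT_top: "r < length lam \<Longrightarrow> c < lam ! r \<Longrightarrow> c < K (2 * n) r"
  using K by (simp add: GT_def part_def)

lemma GT_mono:
  assumes "i \<le> j" "j \<le> 2 * n"
  shows "K i r \<le> K j r"
  using assms
proof (induction j rule: dec_induct)
  case (step j)
  then show ?case using GT_interl[OF K, of j] by (auto simp: interl_def intro: order.trans)
qed simp

lemma tabK_length: "length (tabK lam K) = length lam" "r < length lam \<Longrightarrow> length (tabK lam K ! r) = lam ! r"
  by (simp_all add: tabK_def)

lemma tabK_le:
  assumes "r < length lam" "c < lam ! r" "i \<le> 2 * n"
  shows "tabK lam K ! r ! c \<le> i \<longleftrightarrow> c < K i r"
proof -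
  have e: "tabK lam K ! r ! c = (LEAST i. c < K i r)" using assms by (simp add: tabK_def)
  show ?thesis
  proof
    assume "tabK lam K ! r ! c \<le> i"
    then have "K (LEAST i. c < K i r) r \<le> K i r" unfolding e by (rule GT_mono[OF _ assms(3)])
    moreover have "c < K (LEAST i. c < K i r) r" by (rule LeastI[of _ "2 * n"]) (rule GT_top[OF assms(1,2)])
    ultimately show "c < K i r" by simp
  qed (simp add: e Least_le)
qed

lemma tabK_Tab: "tabK lam K \<in> Tab n lam"
proof -
  let ?b = "tabK lam K"
  note leb = tabK_le
  have bd: "2 * r + 1 \<le> ?b ! r ! c \<and> ?b ! r ! c \<le> 2 * n" if rc: "r < length lam" "c < lam ! r" for r c
  proof
    show le: "?b ! r ! c \<le> 2 * n" using leb[OF rc order_refl] GT_top[OF rc] by simp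
    then have "c < K (?b ! r ! c) r" using leb[OF rc le] by simp
    then have "\<not> ?b ! r ! c \<le> 2 * r" using K by (auto simp: GT_def)
    then show "2 * r + 1 \<le> ?b ! r ! c" by simp
  qed
  have "map length ?b = lam" by (rule nth_equalityI) (simp_all add: tabK_length)
  moreover have "sorted (?b ! r)" if r: "r < length lam" for r
    unfolding sorted_iff_nth_mono tabK_length(2)[OF r]
  proof (intro allI impI)
    fix c c' assume "c \<le> c'" "c' < lam ! r"
    moreover from this have "?b ! r ! c' \<le> 2 * n" using bd[OF r] by blast
    ultimately show "?b ! r ! c \<le> ?b ! r ! c'"
      using leb[OF r, of c "?b ! r ! c'"] leb[OF r, of c' "?b ! r ! c'"] by simp
  qed
  moreover have "?b ! r ! c < ?b ! Suc r ! c" if r: "Suc r < length lam" and c: "c < lam ! Suc r" for r c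
  proof -
    have c': "c < lam ! r" using part_k(1)[of r] r c by (simp add: part_def)
    have b2: "1 \<le> ?b ! Suc r ! c" "?b ! Suc r ! c \<le> 2 * n" using bd[OF r c] by auto
    then obtain x where x: "?b ! Suc r ! c = Suc x" by (cases "?b ! Suc r ! c") auto
    have "c < K (Suc x) (Suc r)" using leb[OF r c b2(2)] x by simp
    also have "\<dots> \<le> K x r" using GT_interl[OF K, of x] b2(2) x by (simp add: interl_def)
    finally show ?thesis using leb[of r c x] r c' b2(2) x by simp
  qed
  ultimately show ?thesis
    using bd by (auto simp: Tab_def semistandard_def tabK_length in_set_conv_nth)
qed

lemma Kb_tabK: "Kb n (tabK lam K) = K"
proof (intro ext)
  fix i r
  show "Kb n (tabK lam K) i r = K i r"
  proof (cases "i \<le> 2 * n \<and> r < length lam")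
    case True
    have "c < Kb n (tabK lam K) i r \<longleftrightarrow> c < K i r" for c
    proof (cases "c < lam ! r")
      case c: True
      then show ?thesis using Kb_less[OF tabK_Tab, of i r c] tabK_le[of r c i] True by simp
    next
      case False
      have "K i r \<le> lam ! r" using GT_mono[of i "2 * n" r] True K by (simp add: GT_def part_def)
      then show ?thesis using False Kb_less[OF tabK_Tab, of i r c] True by simp
    qed
    then show ?thesis by (metis linorder_neqE_nat order.irrefl)
  next
    case False
    have "K i r \<le> part lam r" if "i \<le> 2 * n" using GT_mono[of i "2 * n" r] that K by (simp add: GT_def)
    then have "K i r = 0" using False K by (cases "i \<le> 2 * n") (auto simp: GT_def part_def)
    then show ?thesis using False Kb_0[OF tabK_Tab, of r i] by auto
  qed
qed

end

end

section \<open>Signatures column by column\<close>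

definition sig_col :: "nat \<Rightarrow> nat list list \<Rightarrow> nat \<Rightarrow> ((nat \<times> nat) \<times> sign) list" where
  "sig_col i b c = concat (map (\<lambda>r. if c < length (b ! r) \<and> (b ! r ! c = i \<or> b ! r ! c = i + 1)
     then [((r, c), if b ! r ! c = i then Plus else Minus)] else []) [0..<length b])"

lemma concat_map_concat: "concat (map f (concat xss)) = concat (map (\<lambda>xs. concat (map f xs)) xss)"
  by (induction xss) simp_all

lemma signature_cols:
  "signature i b = concat (map (sig_col i b) (rev [0..<(if b = [] then 0 else length (hd b))]))"
proof -
  have "concat (map (\<lambda>(r, c). if b ! r ! c = i \<or> b ! r ! c = i + 1 then [((r, c), if b ! r ! c = i then Plus else Minus)] else [])
      (concat (map (\<lambda>r. if c < length (b ! r) then [(r, c)] else []) [0..<length b]))) = sig_col i b c" for c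
    unfolding sig_col_def concat_map_concat map_map comp_def
    by (intro arg_cong[of _ _ concat] map_cong refl) simp
  then show ?thesis
    unfolding signature_def reading_cells_def concat_map_concat map_map comp_def
    by (intro arg_cong[of _ _ concat] map_cong refl) simp
qed

lemma concat_map_two_segments:
  assumes "a \<le> m" "m \<le> d" "d \<le> N"
    and F: "\<And>r. r < N \<Longrightarrow> F r = (if a \<le> r \<and> r < m then [f r] else if m \<le> r \<and> r < d then [g r] else [])"
  shows "concat (map F [0..<N]) = map f [a..<m] @ map g [m..<d]"
proof -
  have e: "concat (map F [x..<y]) = map h [x..<y]" if "\<And>r. x \<le> r \<Longrightarrow> r < y \<Longrightarrow> F r = [h r]" for x y h
  proof -
    have "map F [x..<y] = map (\<lambda>r. [h r]) [x..<y]" using that by (intro map_cong) auto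
    then show ?thesis by (simp only: concat_map_singleton)
  qed
  have z: "concat (map F [x..<y]) = []" if "\<And>r. x \<le> r \<Longrightarrow> r < y \<Longrightarrow> F r = []" for x y
  proof -
    have "map F [x..<y] = map (\<lambda>r. []) [x..<y]" using that by (intro map_cong) auto
    then show ?thesis by simp
  qed
  have "[0..<N] = [0..<a] @ [a..<m] @ [m..<d] @ [d..<N]"
    using assms(1-3) by (metis upt_add_eq_append le_add_diff_inverse le_add_diff_inverse2 le0 le_trans)
  moreover have "concat (map F [0..<a]) = []" "concat (map F [d..<N]) = []" using assms by (intro z; simp add: F)+
  moreover have "concat (map F [a..<m]) = map f [a..<m]" "concat (map F [m..<d]) = map g [m..<d]"
    using assms by (intro e; simp add: F)+
  ultimately show ?thesis by (simp only: map_append concat_append append_Nil append_Nil2)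
qed

text \<open>A column contributes at most one + and, below it, one -, and is put in front of the
  word. A full pair cancels; a lone - survives; a lone + cancels against the first surviving -, and
  survives only if there is none.\<close>

lemma reduce_sig_step:
  fixes w :: "((nat \<times> nat) \<times> sign) list" and c :: nat
  assumes "m = a \<or> m = Suc a" "d = m \<or> d = Suc m"
  defines "w' \<equiv> map (\<lambda>r. ((r, c), Plus)) [a..<m] @ map (\<lambda>r. ((r, c), Minus)) [m..<d] @ w"
  shows "length (filter (\<lambda>x. snd x = Minus) (reduce w')) =
      (if d = m \<and> m = Suc a then length (filter (\<lambda>x. snd x = Minus) (reduce w)) - 1
       else if d = Suc m \<and> m = a then length (filter (\<lambda>x. snd x = Minus) (reduce w)) + 1
       else length (filter (\<lambda>x. snd x = Minus) (reduce w)))"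
    and "{x. (x, Plus) \<in> set (reduce w')} = {x. (x, Plus) \<in> set (reduce w)} \<union>
      (if d = m \<and> m = Suc a \<and> length (filter (\<lambda>x. snd x = Minus) (reduce w)) = 0 then {(a, c)} else {})"
proof -
  obtain p q where pq: "map snd (reduce w) = replicate p Minus @ replicate q Plus" using reduce_shape by blast
  have len: "length (filter (\<lambda>x. snd x = Minus) (reduce w)) = p"
  proof -
    have "length (filter (\<lambda>x. snd x = Minus) (reduce w)) = length (filter (\<lambda>x. x = Minus) (map snd (reduce w)))"
      by (simp add: filter_map comp_def)
    then show ?thesis unfolding pq by simp
  qed
  consider "m = a" "d = m" | "m = a" "d = Suc m" | "m = Suc a" "d = m" | "m = Suc a" "d = Suc m"
    using assms by blast
  then have "length (filter (\<lambda>x. snd x = Minus) (reduce w')) =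
      (if d = m \<and> m = Suc a then p - 1 else if d = Suc m \<and> m = a then p + 1 else p) \<and>
    {x. (x, Plus) \<in> set (reduce w')} = {x. (x, Plus) \<in> set (reduce w)} \<union>
      (if d = m \<and> m = Suc a \<and> p = 0 then {(a, c)} else {})"
  proof cases
    case 1
    then show ?thesis by (simp add: w'_def len)
  next
    case 2
    then have "reduce w' = ((a, c), Minus) # reduce w" by (simp add: w'_def)
    then show ?thesis using 2 by (simp add: len)
  next
    case 4
    then have "reduce w' = reduce w" by (simp add: w'_def)
    then show ?thesis using 4 by (simp add: len)
  next
    case 3
    show ?thesis
    proof (cases p)
      case 0
      have "reduce w' = ((a, c), Plus) # reduce w"
      proof (cases "reduce w")
        case (Cons x xs)
        then have "snd x = Plus" using pq 0 by (cases q) auto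
        then show ?thesis using 3 Cons by (cases x) (simp add: w'_def)
      qed (use 3 in \<open>simp add: w'_def\<close>)
      then show ?thesis using 3 0 len by auto
    next
      case (Suc p')
      then obtain x v where x: "reduce w = (x, Minus) # v" using pq by (cases "reduce w") auto
      then have "reduce w' = v" using 3 by (simp add: w'_def)
      moreover have "length (filter (\<lambda>x. snd x = Minus) v) = p'" using len Suc x by simp
      ultimately show ?thesis using 3 Suc x by simp
    qed
  qed
  then show "length (filter (\<lambda>x. snd x = Minus) (reduce w')) =
      (if d = m \<and> m = Suc a then length (filter (\<lambda>x. snd x = Minus) (reduce w)) - 1
       else if d = Suc m \<and> m = a then length (filter (\<lambda>x. snd x = Minus) (reduce w)) + 1
       else length (filter (\<lambda>x. snd x = Minus) (reduce w)))"
    "{x. (x, Plus) \<in> set (reduce w')} = {x. (x, Plus) \<in> set (reduce w)} \<union>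
      (if d = m \<and> m = Suc a \<and> length (filter (\<lambda>x. snd x = Minus) (reduce w)) = 0 then {(a, c)} else {})"
    unfolding len by blast+
qed

context
  fixes n :: nat and lam :: "nat list" and b :: "nat list list" and i :: nat
  assumes n: "1 \<le> n" and lam: "is_partition lam" "length lam \<le> n" and b: "b \<in> Tab n lam"
    and i: "1 \<le> i" "i < 2 * n"
begin

abbreviation (input) "KK \<equiv> Kb n b"
abbreviation (input) "SS \<equiv> walk (hgt n KK (i - 1)) (hgt n KK (i + 1)) (hgt n KK i)"

lemma KK_GT: "KK \<in> GT (2 * n) (part lam)"
  by (rule Kb_GT[OF n lam b])

lemma cell_hgt:
  assumes "j \<le> 2 * n" "r < length lam"
  shows "int r < hgt n KK j c \<longleftrightarrow> c < lam ! r \<and> b ! r ! c \<le> j"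
  using hgt_mem[OF n part_k[OF n lam] KK_GT assms(1), of r c] Kb_less[OF n lam b assms, of c] by simp

lemma hgt_le_rows: "j \<le> 2 * n \<Longrightarrow> hgt n KK j c \<le> int (length lam)"
proof (rule ccontr)
  assume j: "j \<le> 2 * n" and "\<not> ?thesis"
  then have "int (length lam) < hgt n KK j c" by simp
  then show False
    using hgt_mem[OF n part_k[OF n lam] KK_GT j, of "length lam" c] Kb_0[OF n lam b, of "length lam" j] by simp
qed

lemma KK_between: "between (hgt n KK (i - 1)) (hgt n KK (i + 1)) (hgt n KK i)"
  unfolding between_def
  using hgt_step[OF n part_k[OF n lam] KK_GT, of "i - 1"] hgt_step[OF n part_k[OF n lam] KK_GT, of i] i
  by (simp add: hgt_antimono)

lemma rec_step_iff:
  assumes "hgt n KK i c = hgt n KK (i - 1) c + 1" "hgt n KK (i + 1) c = hgt n KK i c"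
  shows "rec_step SS c \<longleftrightarrow> SS c = recs SS c"
proof
  assume "rec_step SS c"
  then show "SS c = recs SS c" by (intro rec_step_walk(3) KK_between hgt_antimono)
next
  assume eq: "SS c = recs SS c"
  have "SS (Suc c) = SS c + 1" using assms by (simp add: walk_Suc)
  moreover have "SS c' \<le> recs SS c" if "c' \<le> c" for c'
    by (rule walk_le_recs[OF hgt_antimono hgt_antimono KK_between that])
  ultimately show "rec_step SS c" using eq by (fastforce simp: rec_step_def)
qed

definition cols :: "nat \<Rightarrow> ((nat \<times> nat) \<times> sign) list" where
  "cols c = concat (map (sig_col i b) (rev [0..<c]))"

text \<open>The signature reads columns from right to left, so each further column goes in front.
  The surviving - signs count how far the walk is below its running maximum, and a + survives
  exactly when the walk steps up from that maximum.\<close>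

lemma reduce_cols:
  "int (length (filter (\<lambda>x. snd x = Minus) (reduce (cols c)))) = recs SS c - SS c \<and>
   {x. (x, Plus) \<in> set (reduce (cols c))} =
     {(r, c'). c' < c \<and> rec_step SS c' \<and> hgt n KK (i - 1) c' \<le> int r \<and> int r < hgt n KK i c'}"
proof (induction c)
  case 0
  show ?case by (simp add: cols_def recs_def)
next
  case (Suc c)
  define a m d where "a = nat (hgt n KK (i - 1) c)" and "m = nat (hgt n KK i c)" and "d = nat (hgt n KK (i + 1) c)"
  have nn: "0 \<le> hgt n KK j c" for j by (simp add: hgt_def)
  then have amd: "hgt n KK (i - 1) c = int a" "hgt n KK i c = int m" "hgt n KK (i + 1) c = int d"
    by (simp_all add: a_def m_def d_def)
  have "int a \<le> int m \<and> int m \<le> int a + 1 \<and> int m \<le> int d \<and> int d \<le> int m + 1"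
    using KK_between unfolding between_def amd[symmetric] by blast
  then have steps: "m = a \<or> m = Suc a" "d = m \<or> d = Suc m" by linarith+
  have len: "length b = length lam" by (rule Tab_length(1)[OF n lam b])
  have "sig_col i b c = map (\<lambda>r. ((r, c), Plus)) [a..<m] @ map (\<lambda>r. ((r, c), Minus)) [m..<d]"
    unfolding sig_col_def len
  proof (rule concat_map_two_segments)
    show "a \<le> m" "m \<le> d" using steps by auto
    show "d \<le> length lam" using hgt_le_rows[of "i + 1" c] i amd by simp
    fix r assume r: "r < length lam"
    have row: "length (b ! r) = lam ! r" by (rule Tab_length(2)[OF n lam b r])
    have c: "r < a \<longleftrightarrow> c < lam ! r \<and> b ! r ! c \<le> i - 1" "r < m \<longleftrightarrow> c < lam ! r \<and> b ! r ! c \<le> i"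
      "r < d \<longleftrightarrow> c < lam ! r \<and> b ! r ! c \<le> i + 1"
      using cell_hgt[of "i - 1" r c] cell_hgt[of i r c] cell_hgt[of "i + 1" r c] r i amd by simp_all
    have "a \<le> r \<and> r < m \<longleftrightarrow> c < lam ! r \<and> b ! r ! c = i"
      using c i unfolding not_less[symmetric, of r a] by auto
    moreover have "m \<le> r \<and> r < d \<longleftrightarrow> c < lam ! r \<and> b ! r ! c = i + 1"
      using c unfolding not_less[symmetric, of r m] by auto
    ultimately show "(if c < length (b ! r) \<and> (b ! r ! c = i \<or> b ! r ! c = i + 1)
        then [((r, c), if b ! r ! c = i then Plus else Minus)] else []) =
        (if a \<le> r \<and> r < m then [((r, c), Plus)] else if m \<le> r \<and> r < d then [((r, c), Minus)] else [])"
      unfolding row by auto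
  qed
  then have cols: "cols (Suc c) = map (\<lambda>r. ((r, c), Plus)) [a..<m] @ map (\<lambda>r. ((r, c), Minus)) [m..<d] @ cols c"
    by (simp add: cols_def)
  let ?L = "\<lambda>w. length (filter (\<lambda>x. snd x = Minus) (reduce w))" and ?P = "\<lambda>w. {x. (x, Plus) \<in> set (reduce w)}"
  note step = reduce_sig_step[OF steps, where c = c and w = "cols c", folded cols]
  have IH: "int (?L (cols c)) = recs SS c - SS c" using Suc by blast
  have S: "SS (Suc c) = SS c + (2 * int m - int a - int d)" unfolding walk_Suc amd ..
  have rec: "rec_step SS c \<longleftrightarrow> d = m \<and> m = Suc a \<and> ?L (cols c) = 0"
  proof (cases "d = m \<and> m = Suc a")
    case True
    then show ?thesis using rec_step_iff[of c] IH unfolding amd by auto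
  next
    case False
    then have "SS (Suc c) \<le> SS c" using S steps by auto
    then have "\<not> rec_step SS c" by (fastforce simp: rec_step_def)
    then show ?thesis using False by blast
  qed
  have "int (?L (cols (Suc c))) = recs SS (Suc c) - SS (Suc c)"
  proof (cases "d = m \<and> m = Suc a")
    case True
    then show ?thesis unfolding step(1) S recs_Suc rec using IH by (cases "?L (cols c)") auto
  next
    case False
    then show ?thesis unfolding step(1) S recs_Suc rec using IH steps by auto
  qed
  moreover have "?P (cols (Suc c)) =
     {(r, c'). c' < Suc c \<and> rec_step SS c' \<and> hgt n KK (i - 1) c' \<le> int r \<and> int r < hgt n KK i c'}"
  proof -
    have "{(r, c'). c' < Suc c \<and> rec_step SS c' \<and> hgt n KK (i - 1) c' \<le> int r \<and> int r < hgt n KK i c'} =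
        {(r, c'). c' < c \<and> rec_step SS c' \<and> hgt n KK (i - 1) c' \<le> int r \<and> int r < hgt n KK i c'} \<union>
        {(r, c'). c' = c \<and> rec_step SS c \<and> a \<le> r \<and> r < m}"
      using amd by (auto simp: less_Suc_eq)
    also have "{(r, c'). c' = c \<and> rec_step SS c \<and> a \<le> r \<and> r < m} =
        (if d = m \<and> m = Suc a \<and> ?L (cols c) = 0 then {(a, c)} else {})"
      unfolding rec by auto
    finally show ?thesis using step(2) Suc by simp
  qed
  ultimately show ?case by blast
qed

lemma signature_cols_part: "signature i b = cols (part lam 0)"
proof -
  have "length (hd b) = part lam 0" if "b \<noteq> []"
  proof -
    have "0 < length lam" using that Tab_length(1)[OF n lam b] by auto
    then show ?thesis using Tab_length(2)[OF n lam b, of 0] that by (simp add: hd_conv_nth part_def)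
  qed
  moreover have "part lam 0 = 0" if "b = []"
    using that Tab_length(1)[OF n lam b] by (simp add: part_def)
  ultimately show ?thesis unfolding signature_cols cols_def by auto
qed

text \<open>Both numbers are the distance of the final value of the walk from its maximum.\<close>

lemma crystal_eps_eq: "crystal_eps i b = eps n KK i"
proof -
  let ?C = "part lam 0"
  have ex: "excess n KK i c = SS c" for c by (rule excess_walk)
  have tot: "tot n KK i = SS ?C" by (rule tot_walk[OF n part_k[OF n lam] KK_GT])
  have le: "SS c' \<le> recs SS c" if "c' \<le> c" for c' c
    by (rule walk_le_recs[OF hgt_antimono hgt_antimono KK_between that])
  have "int (eps n KK i) \<le> recs SS ?C - SS ?C"
  proof -
    obtain c where c: "SS c - SS ?C = int (eps n KK i)"
      using eps_attained[OF n part_k[OF n lam] KK_GT, of i] unfolding ex tot by blast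
    have "SS c \<le> recs SS ?C"
    proof (cases "c \<le> ?C")
      case False
      then have "SS c = SS ?C" using excess_top[OF n part_k[OF n lam] KK_GT, of c i] unfolding ex tot by simp
      then show ?thesis using le[OF order_refl] by simp
    qed (rule le)
    with c show ?thesis by simp
  qed
  moreover have "recs SS ?C - SS ?C \<le> int (eps n KK i)"
  proof -
    obtain c where "SS c = recs SS ?C"
      using recs_max[of SS ?C] walk_steps(1)[OF hgt_antimono hgt_antimono KK_between] by auto
    then show ?thesis using eps_bound[OF n part_k[OF n lam] KK_GT, of i c] unfolding ex tot by simp
  qed
  ultimately show ?thesis
    unfolding crystal_eps_def signature_cols_part using reduce_cols[of ?C] by linarith
qed

lemma surviving_plus_iff:
  assumes "r < length lam" "c < lam ! r"
  shows "(r, c) \<in> surviving_plus i b \<longleftrightarrow> b ! r ! c = i \<and> rec_step SS c"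
proof -
  have "part lam r \<le> part lam 0"
    using lift_Suc_antimono_le[of "part lam" 0 r] part_k(1)[OF n lam] by blast
  then have "c < part lam 0" using assms by (simp add: part_def)
  moreover have "hgt n KK (i - 1) c \<le> int r \<and> int r < hgt n KK i c \<longleftrightarrow> b ! r ! c = i"
  proof -
    have "i - 1 \<le> 2 * n" "i \<le> 2 * n" using i by simp_all
    from cell_hgt[OF this(1) assms(1), of c] cell_hgt[OF this(2) assms(1), of c]
    have "hgt n KK (i - 1) c \<le> int r \<longleftrightarrow> \<not> b ! r ! c \<le> i - 1" "int r < hgt n KK i c \<longleftrightarrow> b ! r ! c \<le> i"
      using assms(2) by linarith+
    then show ?thesis using i by linarith
  qed
  ultimately show ?thesis
    using reduce_cols[of "part lam 0"] unfolding surviving_plus_def signature_cols_part by auto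
qed

end

section \<open>King tableaux as tableaux of numbers\<close>

definition decode :: "nat \<Rightarrow> letter" where
  "decode x = (if odd x then Plain ((x + 1) div 2) else Bar (x div 2))"

lemma code_decode: "1 \<le> x \<Longrightarrow> code (decode x) = x"
  by (auto simp: decode_def)

lemma decode_code: "1 \<le> idx l \<Longrightarrow> decode (code l) = l"
  by (cases l) (auto simp: decode_def)

lemma code_less: "1 \<le> idx x \<Longrightarrow> 1 \<le> idx y \<Longrightarrow> code x < code y \<longleftrightarrow> x < y"
  by (cases x; cases y) (auto simp: less_letter_def)

lemma code_le: "1 \<le> idx x \<Longrightarrow> 1 \<le> idx y \<Longrightarrow> code x \<le> code y \<longleftrightarrow> x \<le> y"
  by (cases x; cases y) (auto simp: less_eq_letter_def)

lemma idx_decode: "1 \<le> x \<Longrightarrow> 1 \<le> idx (decode x)" "x \<le> 2 * n \<Longrightarrow> idx (decode x) \<le> n"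
  subgoal by (auto simp: decode_def)
  subgoal by (cases "even x") (simp_all add: decode_def, presburger)
  done

lemma semistandard_map:
  assumes lam: "is_partition lam" and T: "semistandard lam T"
    and A: "\<And>row. row \<in> set T \<Longrightarrow> set row \<subseteq> A"
    and le: "\<And>x y. x \<in> A \<Longrightarrow> y \<in> A \<Longrightarrow> x \<le> y \<Longrightarrow> f x \<le> f y"
    and less: "\<And>x y. x \<in> A \<Longrightarrow> y \<in> A \<Longrightarrow> x < y \<Longrightarrow> f x < f y"
  shows "semistandard lam (map (map f) T)"
proof -
  have m: "map length T = lam" using T by (simp add: semistandard_def)
  have nthA: "T ! r ! c \<in> A" if "r < length T" "c < length (T ! r)" for r c
    using A[of "T ! r"] that by (meson nth_mem subsetD)
  have "map length (map (map f) T) = lam" using m by (simp add: comp_def)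
  moreover have "sorted (map f row)" if row: "row \<in> set T" for row
  proof -
    have "sorted row" using T row by (simp add: semistandard_def)
    moreover have "row ! c \<in> A" if "c < length row" for c using A[OF row] that by auto
    ultimately show ?thesis
      unfolding sorted_iff_nth_mono[of "map f row"] by (simp add: le sorted_nth_mono)
  qed
  moreover have "map (map f) T ! r ! c < map (map f) T ! Suc r ! c"
    if r: "Suc r < length T" and c: "c < length (T ! Suc r)" for r c
  proof -
    have l: "length (T ! s) = lam ! s" if "s < length T" for s using nth_map[OF that, of length] unfolding m by simp
    have "length lam = length T" using arg_cong[OF m, of length] by simp
    then have "part lam (Suc r) = lam ! Suc r" "part lam r = lam ! r" using r by (simp_all add: part_def)
    then have "length (T ! Suc r) \<le> length (T ! r)"
      using part_antimono[OF lam, of r] r l[of r] l[of "Suc r"] by simp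
    then have "c < length (T ! r)" using c by simp
    moreover have "T ! r ! c < T ! Suc r ! c" using T r c by (simp add: semistandard_def)
    ultimately show ?thesis using r c less nthA[of r c] nthA[of "Suc r" c] by simp
  qed
  ultimately show ?thesis by (simp add: semistandard_def cong: conj_cong)
qed

lemma count_list_nth: "count_list xs y = card {i. i < length xs \<and> xs ! i = y}"
  by (simp add: count_list_eq_length_filter length_filter_conv_card eq_commute)

lemma count_list_concat_nth: "count_list (concat b) y = (\<Sum>r<length b. count_list (b ! r) y)"
proof -
  have "count_list (concat b) y = sum_list (map (\<lambda>row. count_list row y) b)"
    by (induction b) simp_all
  then show ?thesis by (simp add: sum_list_sum_nth atLeast0LessThan)
qed

lemma nat_ceiling_half: "nat \<lceil>real e / 2\<rceil> = (e + 1) div 2"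
proof -
  have "\<lceil>real e / 2\<rceil> = int ((e + 1) div 2)"
    by (rule ceiling_unique) (cases "even e"; auto elim!: evenE oddE)+
  then show ?thesis by simp
qed


context
  fixes n :: nat and lam :: "nat list"
  assumes n: "1 \<le> n" and lam: "is_partition lam" "length lam \<le> n"
begin

lemma charge_C_eq:
  assumes b: "b \<in> Tab n lam"
  shows "charge_C n b = chargeK n (Kb n b)"
  unfolding charge_C_def chargeK_def nat_ceiling_half
proof (rule sum.cong[OF refl])
  fix i assume "i \<in> {1..2 * n - 1}"
  then have "1 \<le> i" "i < 2 * n" using n by auto
  then show "(2 * n - i) * ((crystal_eps i b + 1) div 2) = (2 * n - i) * ((eps n (Kb n b) i + 1) div 2)"
    by (simp only: crystal_eps_eq[OF n lam b])
qed

lemma count_lvl: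
  assumes b: "b \<in> Tab n lam" and j: "1 \<le> j" "j \<le> 2 * n"
  shows "int (count_list (concat b) j) = lvl n (Kb n b j) - lvl n (Kb n b (j - 1))"
proof -
  have row: "int (count_list (b ! r) j) = int (Kb n b j r) - int (Kb n b (j - 1) r)" if r: "r < length lam" for r
  proof -
    let ?E = "{c. c < length (b ! r) \<and> b ! r ! c = j}" and ?L = "\<lambda>j. {c. c < length (b ! r) \<and> b ! r ! c \<le> j}"
    have "?L j = ?L (j - 1) \<union> ?E" using j by auto
    moreover have "?L (j - 1) \<inter> ?E = {}" using j by auto
    ultimately have "card (?L j) = card (?L (j - 1)) + card ?E" by (simp add: card_Un_disjoint)
    then show ?thesis using r j Tab_length(1)[OF n lam b] by (simp add: count_list_nth Kb_def)
  qed
  have "lvl n (Kb n b j') = (\<Sum>r<length lam. int (Kb n b j' r))" for j'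
    unfolding lvl_def using lam(2) Kb_0[OF n lam b] by (intro sum.mono_neutral_right) auto
  then show ?thesis
    by (simp add: count_list_concat_nth Tab_length(1)[OF n lam b] row sum_subtractf)
qed

lemma tot_count:
  assumes "b \<in> Tab n lam" "1 \<le> i" "i < 2 * n"
  shows "tot n (Kb n b) i = int (count_list (concat b) i) - int (count_list (concat b) (i + 1))"
  using count_lvl[OF assms(1), of i] count_lvl[OF assms(1), of "i + 1"] assms(2,3) by (simp add: tot_def)

text \<open>The odd \<open>i\<close> and their successors are the codes of the letters k and k-bar,
  so the vanishing of \<open>tot\<close> there is the condition of weight 0.\<close>

lemma tot_zero_iff:
  assumes "b \<in> Tab n lam"
  shows "(\<forall>i. odd i \<longrightarrow> i < 2 * n \<longrightarrow> tot n (Kb n b) i = 0) \<longleftrightarrow>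
    (\<forall>k\<in>{1..n}. count_list (concat b) (2 * k - 1) = count_list (concat b) (2 * k))" (is "?L \<longleftrightarrow> ?R")
proof
  assume L: ?L
  show ?R
  proof
    fix k assume k: "k \<in> {1..n}"
    then have "odd (2 * k - 1)" "2 * k - 1 < 2 * n" "1 \<le> 2 * k - 1" "2 * k - 1 + 1 = 2 * k" by auto
    then show "count_list (concat b) (2 * k - 1) = count_list (concat b) (2 * k)"
      using L tot_count[OF assms, of "2 * k - 1"] by simp
  qed
next
  assume R: ?R
  show ?L
  proof (intro allI impI)
    fix i assume i: "odd i" "i < 2 * n"
    then obtain m where m: "i = 2 * m + 1" by (elim oddE)
    then have "Suc m \<in> {1..n}" "1 \<le> i" "2 * Suc m - 1 = i" "2 * Suc m = i + 1" using i by auto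
    then show "tot n (Kb n b) i = 0"
      using R[rule_format, of "Suc m"] tot_count[OF assms, of i] i(2) by simp
  qed
qed

lemma count_code:
  assumes T: "\<And>x. x \<in> set xs \<Longrightarrow> 1 \<le> idx x" and l: "1 \<le> idx l"
  shows "count_list (map code xs) (code l) = count_list xs l"
  using T
proof (induction xs)
  case (Cons x xs)
  have "1 \<le> idx x" using Cons.prems by simp
  then have "code x = code l \<longleftrightarrow> x = l" using decode_code l by metis
  then show ?case using Cons by simp
qed simp

lemma code_bij: "bij_betw (map (map code)) (king_tableaux0 n lam)
    {b \<in> Tab n lam. \<forall>i. odd i \<longrightarrow> i < 2 * n \<longrightarrow> tot n (Kb n b) i = 0}"
proof (rule bij_betwI[where g = "map (map decode)"])
  show "map (map code) \<in> king_tableaux0 n lam \<rightarrow> {b \<in> Tab n lam. \<forall>i. odd i \<longrightarrow> i < 2 * n \<longrightarrow> tot n (Kb n b) i = 0}"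
  proof
    fix T assume T: "T \<in> king_tableaux0 n lam"
    have idx: "1 \<le> idx x \<and> idx x \<le> n" if "row \<in> set T" "x \<in> set row" for row x
      using T that by (simp add: king_tableaux0_def)
    have "semistandard lam (map (map code) T)"
      using T idx by (intro semistandard_map[OF lam(1), of _ "{x. 1 \<le> idx x}"]) (auto simp: king_tableaux0_def code_less code_le)
    moreover have "2 * r + 1 \<le> x \<and> x \<le> 2 * n" if r: "r < length T" and x: "x \<in> set (map code (T ! r))" for r x
    proof -
      obtain l where l: "l \<in> set (T ! r)" "x = code l" using x by auto
      have i: "1 \<le> idx l" "idx l \<le> n" using idx[OF nth_mem[OF r] l(1)] by auto
      have "Plain (r + 1) \<le> l" using T r l(1) by (simp add: king_tableaux0_def)
      then have "code (Plain (r + 1)) \<le> code l" using i by (subst code_le) auto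
      moreover have "code l \<le> 2 * n" using i by (cases l) auto
      ultimately show ?thesis by (simp add: l(2))
    qed
    ultimately have b: "map (map code) T \<in> Tab n lam" by (simp add: Tab_def)
    have "count_list (concat (map (map code) T)) (2 * k - 1) = count_list (concat (map (map code) T)) (2 * k)"
      if k: "k \<in> {1..n}" for k
    proof -
      have c: "concat (map (map code) T) = map code (concat T)" by (simp add: map_concat)
      have idx': "1 \<le> idx x" if "x \<in> set (concat T)" for x using idx that by auto
      have "count_list (map code (concat T)) (code (Plain k)) = count_list (map code (concat T)) (code (Bar k))"
        using T k count_code[OF idx', of "concat T" "Plain k"] count_code[OF idx', of "concat T" "Bar k"]
        by (simp add: king_tableaux0_def)
      then show ?thesis unfolding c by simp
    qed
    then show "map (map code) T \<in> {b \<in> Tab n lam. \<forall>i. odd i \<longrightarrow> i < 2 * n \<longrightarrow> tot n (Kb n b) i = 0}"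
      using b tot_zero_iff[OF b] by blast
  qed
  show "map (map decode) \<in> {b \<in> Tab n lam. \<forall>i. odd i \<longrightarrow> i < 2 * n \<longrightarrow> tot n (Kb n b) i = 0} \<rightarrow> king_tableaux0 n lam"
  proof
    fix b assume "b \<in> {b \<in> Tab n lam. \<forall>i. odd i \<longrightarrow> i < 2 * n \<longrightarrow> tot n (Kb n b) i = 0}"
    then have b: "b \<in> Tab n lam" and z: "\<And>k. k \<in> {1..n} \<Longrightarrow> count_list (concat b) (2 * k - 1) = count_list (concat b) (2 * k)"
      using tot_zero_iff by auto
    let ?T = "map (map decode) b"
    have bd: "1 \<le> x \<and> x \<le> 2 * n" if row: "row \<in> set b" "x \<in> set row" for row x
    proof -
      obtain r where "r < length b" "row = b ! r" using row(1) by (metis in_set_conv_nth)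
      then have "2 * r + 1 \<le> x \<and> x \<le> 2 * n" using b row(2) by (simp add: Tab_def)
      then show ?thesis by simp
    qed
    have dec_less: "decode x < decode y" if "1 \<le> x" "1 \<le> y" "x < y" for x y
      using code_less[OF idx_decode(1)[OF that(1)] idx_decode(1)[OF that(2)]] that code_decode by metis
    have dec_le: "decode x \<le> decode y" if "1 \<le> x" "1 \<le> y" "x \<le> y" for x y
      using code_le[OF idx_decode(1)[OF that(1)] idx_decode(1)[OF that(2)]] that code_decode by metis
    have "semistandard lam ?T"
    proof (rule semistandard_map[OF lam(1), of _ "{x. 1 \<le> x}"])
      show "semistandard lam b" using b by (simp add: Tab_def)
      show "set row \<subseteq> {x. 1 \<le> x}" if "row \<in> set b" for row using bd[OF that] by auto
    qed (use dec_less dec_le in blast)+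
    moreover have idx: "1 \<le> idx x \<and> idx x \<le> n" if row: "row \<in> set ?T" "x \<in> set row" for row x
    proof -
      obtain row' y where "row' \<in> set b" "y \<in> set row'" "x = decode y" using row by auto
      then show ?thesis using bd idx_decode by metis
    qed
    moreover from idx have idx_concat: "1 \<le> idx x \<and> idx x \<le> n" if "x \<in> set (concat ?T)" for x
      using that unfolding set_concat by blast
    moreover have "Plain (r + 1) \<le> x" if r: "r < length ?T" and x: "x \<in> set (?T ! r)" for r x
    proof -
      obtain y where y: "y \<in> set (b ! r)" "x = decode y" using r x by auto
      have "2 * r + 1 \<le> y" using b r y(1) by (simp add: Tab_def)
      moreover have "decode (2 * r + 1) = Plain (r + 1)" by (simp add: decode_def)
      ultimately show ?thesis using dec_le[of "2 * r + 1" y] y(2) by simp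
    qed
    moreover have "count_list (concat ?T) (Plain k) = count_list (concat ?T) (Bar k)" for k
    proof (cases "k \<in> {1..n}")
      case True
      have "map code (concat ?T) = concat b"
      proof -
        have "map code (concat ?T) = concat (map (map (\<lambda>x. code (decode x))) b)" by (simp add: map_concat comp_def)
        also have "map (map (\<lambda>x. code (decode x))) b = b"
          using bd code_decode by (intro map_idI) simp
        finally show ?thesis .
      qed
      moreover have "1 \<le> idx x" if "x \<in> set (concat ?T)" for x
        using idx_concat[OF that] by simp
      ultimately show ?thesis
        using count_code[of "concat ?T" "Plain k"] count_code[of "concat ?T" "Bar k"] True z[OF True] by simp
    next
      case False
      have "Plain k \<notin> set (concat ?T)" "Bar k \<notin> set (concat ?T)"
        using idx_concat[of "Plain k"] idx_concat[of "Bar k"] False by auto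
      then show ?thesis by (metis count_list_0_iff)
    qed
    ultimately show "?T \<in> king_tableaux0 n lam" by (simp add: king_tableaux0_def)
  qed
  show "map (map decode) (map (map code) T) = T" if T: "T \<in> king_tableaux0 n lam" for T
  proof -
    have "1 \<le> idx x" if "row \<in> set T" "x \<in> set row" for row x
      using T that by (simp add: king_tableaux0_def)
    then show ?thesis
      unfolding map_map comp_def using decode_code by (intro map_idI) simp
  qed
  show "map (map code) (map (map decode) b) = b"
    if "b \<in> {b \<in> Tab n lam. \<forall>i. odd i \<longrightarrow> i < 2 * n \<longrightarrow> tot n (Kb n b) i = 0}" for b
  proof -
    have b: "b \<in> Tab n lam" using that by simp
    have "1 \<le> x" if row: "row \<in> set b" "x \<in> set row" for row x
    proof -
      obtain r where "r < length b" "row = b ! r" using row(1) by (metis in_set_conv_nth)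
      then have "2 * r + 1 \<le> x" using b row(2) by (simp add: Tab_def)
      then show ?thesis by simp
    qed
    then show ?thesis
      unfolding map_map comp_def using code_decode by (intro map_idI) simp
  qed
qed

text \<open>An entry is the first level that contains its cell. Raising a surviving letter x to x +
  1 is thus the same as removing the cell from level x alone, and the cells removed by
  \<open>flip_rec\<close> are those at the record steps.\<close>

lemma king_L_eq:
  assumes b: "map (map code) T \<in> Tab n lam"
  shows "king_L n T = tabK lam (Lk n (Kb n (map (map code) T)))"
proof -
  let ?b = "map (map code) T"
  let ?K = "Kb n ?b"
  note len = Tab_length[OF n lam b]
  have K: "?K \<in> GT (2 * n) (part lam)" by (rule Kb_GT[OF n lam b])
  have entry: "(LEAST j. c < Lk n ?K j r) =
      (if \<exists>k\<in>{1..n}. (r, c) \<in> surviving_plus (2 * k - 1) ?b then ?b ! r ! c + 1 else ?b ! r ! c)"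
    if r: "r < length lam" and c: "c < lam ! r" for r c
  proof -
    define x where "x = ?b ! r ! c"
    let ?S = "\<lambda>i. walk (hgt n ?K (i - 1)) (hgt n ?K (i + 1)) (hgt n ?K i)"
    have x: "1 \<le> x" "x \<le> 2 * n" using Tab_cell[OF n lam b r c] by (simp_all add: x_def)
    have hgt: "int r < hgt n ?K j c \<longleftrightarrow> x \<le> j" if "j \<le> 2 * n" for j
      using hgt_mem[OF n part_k[OF n lam] K that, of r c] Kb_less[OF n lam b that r, of c] c by (simp add: x_def)
    have Lk: "c < Lk n ?K j r \<longleftrightarrow> int r < (if odd j \<and> j < 2 * n then flips n ?K j c else hgt n ?K j c)"
      if "j \<le> 2 * n" for j
      by (rule Lk_less[OF n part_k[OF n lam] K that])
    have flips_le: "flips n ?K j c \<le> hgt n ?K j c" for j by (simp add: flips_def flip_rec_def)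
    have low: "x \<le> j" if j: "c < Lk n ?K j r" for j
    proof (cases "j \<le> 2 * n")
      case True
      then have "int r < hgt n ?K j c" using j Lk[OF True] flips_le[of j] by (auto split: if_splits)
      then show ?thesis using hgt[OF True] by simp
    qed (use x in simp)
    have surv: "(\<exists>k\<in>{1..n}. (r, c) \<in> surviving_plus (2 * k - 1) ?b) \<longleftrightarrow> odd x \<and> rec_step (?S x) c"
    proof
      assume "\<exists>k\<in>{1..n}. (r, c) \<in> surviving_plus (2 * k - 1) ?b"
      then obtain k where k: "k \<in> {1..n}" "(r, c) \<in> surviving_plus (2 * k - 1) ?b" by blast
      then have "1 \<le> 2 * k - 1" "2 * k - 1 < 2 * n" "odd (2 * k - 1)" by auto
      with k(2) show "odd x \<and> rec_step (?S x) c"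
        using surviving_plus_iff[OF n lam b _ _ r c, of "2 * k - 1"] by (auto simp: x_def)
    next
      assume o: "odd x \<and> rec_step (?S x) c"
      then have xn: "x < 2 * n" using x(2) by (cases "x = 2 * n") auto
      obtain m where m: "x = 2 * m + 1" using o by (elim conjE oddE)
      then have "Suc m \<in> {1..n}" "x = 2 * Suc m - 1" using xn by auto
      moreover have "(r, c) \<in> surviving_plus x ?b"
        using surviving_plus_iff[OF n lam b x(1) xn r c] o by (simp add: x_def)
      ultimately show "\<exists>k\<in>{1..n}. (r, c) \<in> surviving_plus (2 * k - 1) ?b" by (metis (no_types))
    qed
    show ?thesis
    proof (cases "odd x \<and> rec_step (?S x) c")
      case True
      then have xn: "x < 2 * n" using x(2) by (cases "x = 2 * n") auto
      \<comment> \<open>Since the heights at the levels \<open>x - 1\<close> and \<open>x\<close>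
        differ by at most 1, the cell in row \<open>r\<close> is the lowest of its column at level
        \<open>x\<close>, which is the one that \<open>flip_rec\<close> removes.\<close>
      have "hgt n ?K x c \<le> hgt n ?K (x - 1) c + 1"
        using hgt_step(2)[OF n part_k[OF n lam] K, of "x - 1" c] x xn by simp
      moreover have "\<not> int r < hgt n ?K (x - 1) c" using hgt[of "x - 1"] x by simp
      ultimately have "\<not> int r < flips n ?K x c" using True by (simp add: flips_def flip_rec_def)
      then have notx: "\<not> c < Lk n ?K x r" using Lk[OF x(2)] True xn by simp
      have "(LEAST j. c < Lk n ?K j r) = x + 1"
      proof (rule Least_equality)
        show "c < Lk n ?K (x + 1) r" using Lk[of "x + 1"] hgt[of "x + 1"] xn True by simp
        fix j assume j: "c < Lk n ?K j r"
        then have "j \<noteq> x" using notx by blast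
        with low[OF j] show "x + 1 \<le> j" by simp
      qed
      then show ?thesis unfolding surv using True by (simp add: x_def)
    next
      case False
      have "(LEAST j. c < Lk n ?K j r) = x"
      proof (rule Least_equality)
        show "c < Lk n ?K x r"
          using Lk[OF x(2)] hgt[OF x(2)] False by (auto simp: flips_def flip_rec_def)
      qed (rule low)
      then show ?thesis unfolding surv using False by (simp add: x_def)
    qed
  qed
  show ?thesis
    unfolding king_L_def tabK_def Let_def len(1)
    using entry len(2) by (intro map_cong refl) auto
qed

theorem sum_king_tableaux:
  "(\<Sum>T\<in>king_tableaux0 n lam. fps_X ^ charge_C n (king_L n T)) =
    (\<Sum>K\<in>distinguished n (part lam). fps_X ^ chargeK n K :: int fps)"
proof -
  let ?Z = "{b \<in> Tab n lam. \<forall>i. odd i \<longrightarrow> i < 2 * n \<longrightarrow> tot n (Kb n b) i = 0}"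
  let ?G = "{K \<in> GT (2 * n) (part lam). \<forall>i. odd i \<longrightarrow> i < 2 * n \<longrightarrow> tot n K i = 0}"
  let ?L = "\<lambda>T. Lk n (Kb n (map (map code) T))"
  have "bij_betw (Kb n) ?Z ?G"
    by (rule bij_betwI[where g = "tabK lam"])
      (auto simp: Kb_GT[OF n lam] tabK_Tab[OF n lam] tabK_Kb[OF n lam] Kb_tabK[OF n lam])
  moreover have "bij_betw (Lk n) ?G (distinguished n (part lam))"
    by (rule Lk_bij[where k = "part lam", OF n part_k[OF n lam]])
  ultimately have "bij_betw (Lk n \<circ> (Kb n \<circ> map (map code))) (king_tableaux0 n lam) (distinguished n (part lam))"
    by (intro bij_betw_trans[OF bij_betw_trans[OF code_bij]])
  then have bij: "bij_betw ?L (king_tableaux0 n lam) (distinguished n (part lam))"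
    by (simp add: comp_def)
  have "charge_C n (king_L n T) = chargeK n (?L T)" if "T \<in> king_tableaux0 n lam" for T
  proof -
    have b: "map (map code) T \<in> Tab n lam" using bij_betwE[OF code_bij] that by blast
    have L: "?L T \<in> GT (2 * n) (part lam)" by (rule Lk_GT[where k = "part lam", OF n part_k[OF n lam] Kb_GT[OF n lam b]])
    show ?thesis
      unfolding king_L_eq[OF b] charge_C_eq[OF tabK_Tab[OF n lam L]] Kb_tabK[OF n lam L] ..
  qed
  then show ?thesis
    using sum.reindex_bij_betw[OF bij, of "\<lambda>K. fps_X ^ chargeK n K"] by simp
qed

end

theorem theorem6p13:
  fixes n :: nat and lam :: "nat list"
  assumes "n \<ge> 1" and "is_partition lam" and "length lam \<le> n"
  shows "generalized_exponent n lam =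
           (\<Sum>T\<in>king_tableaux0 n lam. fps_X ^ charge_C n (king_L n T))"
  unfolding generalized_exponent_distinguished[OF assms] sum_king_tableaux[OF assms] ..

end
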